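(* Consider the Cox regression model $\mathcal P=\{P_{\theta,\eta}:\theta\in\Theta,\eta\in\mathcal H\}$ described in the context, with true law $P_0=P_{\theta_0,\eta_0}$. Suppose that: (1) $\mathbb E\,W^k\exp(\theta W)<\infty$ for $k=0,1,2,3$ and all $\theta$ in a neighbourhood of $\theta_0$, and $\mathbb E\,|W|^{2+\delta}<\infty$ for some $\delta>0$; (2) the baseline hazard $\eta_0$ is continuously differentiable and positive on $[0,1]$; (3) in a neighbourhood $U_{\theta_0}$ of $\theta_0$, $\sup_{t\in[0,1],\,\theta\in U_{\theta_0}}|S_n^{(k)}(t,\theta)-s^{(k)}_{\theta,\eta_0}(t)|=o_{P_0}(1)$ for $k=0,1,2$; (4) for a neighbourhood $U_{\eta_0}$ of $\eta_0$, the functions $(\theta,\eta)\mapsto s^{(k)}_{\theta,\eta}(t)$, $k=0,1,2,3$, are continuous on $U_{\theta_0}\times U_{\eta_0}$ uniformly in $t\in[0,1]$ and bounded on $U_{\theta_0}\times U_{\eta_0}\times[0,1]$; $s^{(0)}_{\theta,\eta}(t)$ is bounded below (away from zero) on $U_{\theta_0}\times U_{\eta_0}\times[0,1]$; and $J=\int_0^1v(t)s^{(0)}(t)\eta_0(t)\,\mathrm dt$ is positive. Then the efficient score for $\theta$ in $\mathcal P$ at $P_0$ is $\tilde\ell(X)=\int_0^1\big(W-s^{(1)}(t)/s^{(0)}(t)\big)\,\mathrm dM(t)$, with variance $J$; the maximiser $\widehat\theta_n^{\mathrm{cox}}$ of the Cox partial likelihood satisfies $$\sqrt n(\widehat\theta_n^{\mathrm{cox}}-\theta_0)=\frac1{\sqrt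 n}\sum_{i=1}^nJ^{-1}\tilde\ell(X_i)+o_{P_0^n}(1);$$ and $\widehat\theta_n^{\mathrm{cox}}$ is best regular in $\mathcal P$, i.e. regular with limiting law $\mathrm N(0,J^{-1})$.
   Context: Model. $X_1,\dots,X_n$ are i.i.d. copies of $X=(T,\Delta,W)$ observed over the time window $[0,1]$, where $T=\min(T',C)$, $\Delta=I(T'\le C)$; the lifetime $T'$ and the censoring time $C$ are independent given the real covariate $W$; and, under $P_{\theta,\eta}$, $T'$ given $W=w$ has hazard rate $\eta(t)\exp(\theta w)$, $t\in[0,1]$. Here $\theta\in\Theta\subset\mathbb R$ ($\theta_0$ interior to $\Theta$), and $\eta\in\mathcal H$, the space of continuously differentiable functions $[0,1]\to(0,\infty)$. The law of $W$ and the conditional law of $C$ given $W$ do not depend on $(\theta,\eta)$. Notation. $N(t)=\Delta I(T\le t)$, $Y(t)=I(T\ge t)$, $t\in[0,1]$; $N_i,Y_i$ are the versions for $X_i$. $M(t)=N(t)-\int_0^tY(s)\eta_0(s)\exp(\theta_0W)\,\mathrm ds$. $S_n^{(k)}(t,\theta)=n^{-1}\sum_{i=1}^nY_i(t)W_i^k\exp(\theta W_i)$; $s^{(k)}_{\theta,\eta}(t)=\mathbb E_{\theta,\eta}\,Y(t)W^k\exp(\theta W)$; $s^{(k)}=s^{(k)}_{\theta_0,\eta_0}$; $v(t)=s^{(2)}(t)/s^{(0)}(t)-\big(s^{(1)}(t)/s^{(0)}(t)\big)^2$. Neighbourhoods of $\eta_0$ are with respect to the supremum norm on bounded positive functions on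 $[0,1]$ (with $P_{\theta,\eta}$ defined for such $\eta$ in the same way). Partial likelihood. $\log L_n^{\mathrm{cox}}(\theta)=\sum_{i=1}^n\int_0^1\Big(\theta W_i-\log\big(nS_n^{(0)}(t,\theta)\big)\Big)\,\mathrm dN_i(t)$, and $\widehat\theta_n^{\mathrm{cox}}$ is its maximiser. Efficiency. Consider local paths $\theta_0+\tau/\sqrt n$, $\eta_n(b)=\eta_0+b/\sqrt n$ with $\tau\in\mathbb R$, $b\in B$, the linear space of continuously differentiable real functions on $[0,1]$. The score in direction $(\tau,b)$ is $\tau\dot\ell+Db$ with $\dot\ell(X)=WM(1)$, $Db(X)=\int_0^1(b(s)/\eta_0(s))\,\mathrm dM(s)$, and the model is differentiable in quadratic mean along these paths. The efficient score is $\tilde\ell=\dot\ell-\Pi\dot\ell$, with $\Pi$ the orthogonal projection in $L_2(P_0)$ onto the closure of $\{Db:b\in B\}$. An estimator sequence $\widehat\theta_n$ is regular if there is a law $L$ such that for every $(\tau,b)$, $\sqrt n(\widehat\theta_n-\theta_0-\tau/\sqrt n)$ converges weakly to $L$ under $P^n_{\theta_0+\tau/\sqrt n,\eta_n(b)}$; it is best regular if $L=\mathrm N(0,J^{-1})$. *)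

theory Defs
  imports "HOL-Probability.Probability"
begin

section \<open>Observations and their law\<close>

type_synonym obs = "real \<times> bool \<times> real"

text \<open>An observation is \<open>(T, \<Delta>, W)\<close>.\<close>

abbreviation obs_T :: "obs \<Rightarrow> real" where "obs_T x \<equiv> fst x"
abbreviation obs_D :: "obs \<Rightarrow> bool" where "obs_D x \<equiv> fst (snd x)"
abbreviation obs_W :: "obs \<Rightarrow> real" where "obs_W x \<equiv> snd (snd x)"

definition obs_space :: "obs measure" where
  "obs_space = borel \<Otimes>\<^sub>M (count_space UNIV \<Otimes>\<^sub>M borel)"

text \<open>Functions on \<open>[0,1]\<close> are represented by functions on the reals of which only the
  values on \<open>[0,1]\<close> are used; derivatives at the end points are one-sided.\<close>

definition C1_01 :: "(real \<Rightarrow> real) \<Rightarrow> bool" where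
  "C1_01 f \<longleftrightarrow> (\<exists>f'. (\<forall>t\<in>{0..1}. (f has_real_derivative f' t) (at t within {0..1}))
                    \<and> continuous_on {0..1} f')"

text \<open>The space \<open>\<H>\<close> of baseline hazards, and the bounded positive functions in which
  neighbourhoods are taken. Measurability is what makes the cumulative hazard meaningful.\<close>

definition smooth_hazard :: "(real \<Rightarrow> real) \<Rightarrow> bool" where
  "smooth_hazard \<eta> \<longleftrightarrow> C1_01 \<eta> \<and> (\<forall>t\<in>{0..1}. 0 < \<eta> t)"

definition bounded_hazard :: "(real \<Rightarrow> real) \<Rightarrow> bool" where
  "bounded_hazard \<eta> \<longleftrightarrow> \<eta> \<in> borel_measurable (restrict_space borel {0..1})
     \<and> (\<forall>t\<in>{0..1}. 0 < \<eta> t) \<and> (\<exists>K. \<forall>t\<in>{0..1}. \<eta> t \<le> K)"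

text \<open>On \<open>[0,1]\<close> the nonnegative lifetime has a density equal to hazard rate times
  survivor function. Nothing is prescribed beyond time 1.\<close>

definition has_hazard_rate_01 :: "real measure \<Rightarrow> (real \<Rightarrow> real) \<Rightarrow> bool" where
  "has_hazard_rate_01 \<mu> h \<longleftrightarrow> emeasure \<mu> {..<0} = 0 \<and>
     (\<forall>A\<in>sets borel. A \<subseteq> {0..1} \<longrightarrow>
        emeasure \<mu> A = (\<integral>\<^sup>+t\<in>A. ennreal (h t) * emeasure \<mu> {t..} \<partial>lborel))"

text \<open>\<open>Q\<close> is the law of \<open>W\<close>, \<open>G w\<close> the conditional law of \<open>C\<close> and \<open>F \<theta> \<eta> w\<close> the conditional
  law of \<open>T'\<close> given \<open>W = w\<close>.\<close>

definition cox_ingredients ::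
  "real set \<Rightarrow> real measure \<Rightarrow> (real \<Rightarrow> (real \<Rightarrow> real) \<Rightarrow> real \<Rightarrow> real measure)
     \<Rightarrow> (real \<Rightarrow> real measure) \<Rightarrow> bool" where
  "cox_ingredients \<Theta> Q F G \<longleftrightarrow>
     prob_space Q \<and> sets Q = sets borel \<and> G \<in> borel \<rightarrow>\<^sub>M prob_algebra borel \<and>
     (\<forall>\<theta>\<in>\<Theta>. \<forall>\<eta>. bounded_hazard \<eta> \<longrightarrow>
        F \<theta> \<eta> \<in> borel \<rightarrow>\<^sub>M prob_algebra borel \<and>
        (\<forall>w. has_hazard_rate_01 (F \<theta> \<eta> w) (\<lambda>t. \<eta> t * exp (\<theta> * w))))"

text \<open>The law of \<open>(min T' C, T' \<le> C, W)\<close> with \<open>T'\<close> and \<open>C\<close> independent given \<open>W\<close>.\<close>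

definition cox_law ::
  "real measure \<Rightarrow> (real \<Rightarrow> (real \<Rightarrow> real) \<Rightarrow> real \<Rightarrow> real measure)
     \<Rightarrow> (real \<Rightarrow> real measure) \<Rightarrow> real \<Rightarrow> (real \<Rightarrow> real) \<Rightarrow> obs measure" where
  "cox_law Q F G \<theta> \<eta> =
     Q \<bind> (\<lambda>w. F \<theta> \<eta> w \<bind> (\<lambda>t. G w \<bind> (\<lambda>c. return obs_space (min t c, t \<le> c, w))))"

definition iid :: "nat \<Rightarrow> obs measure \<Rightarrow> (nat \<Rightarrow> obs) measure" where
  "iid n P = (\<Pi>\<^sub>M i\<in>{..<n}. P)"


section \<open>Counting process, martingale and partial likelihood\<close>

definition obs_N :: "obs \<Rightarrow> real \<Rightarrow> real" where
  "obs_N x t = (if obs_D x \<and> obs_T x \<le> t then 1 else 0)"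

definition obs_Y :: "obs \<Rightarrow> real \<Rightarrow> real" where
  "obs_Y x t = (if t \<le> obs_T x then 1 else 0)"

text \<open>Lebesgue-Stieltjes integral over \<open>[0,1]\<close>.\<close>

definition int_dN :: "(real \<Rightarrow> real) \<Rightarrow> obs \<Rightarrow> real" where
  "int_dN f x = (LINT t:{0..1}|interval_measure (obs_N x). f t)"

definition cox_M :: "real \<Rightarrow> (real \<Rightarrow> real) \<Rightarrow> obs \<Rightarrow> real \<Rightarrow> real" where
  "cox_M \<theta> \<eta> x t = obs_N x t - (LBINT s:{0..t}. obs_Y x s * \<eta> s * exp (\<theta> * obs_W x))"

definition int_dM :: "real \<Rightarrow> (real \<Rightarrow> real) \<Rightarrow> (real \<Rightarrow> real) \<Rightarrow> obs \<Rightarrow> real" where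
  "int_dM \<theta> \<eta> f x = int_dN f x - (LBINT s:{0..1}. f s * (obs_Y x s * \<eta> s * exp (\<theta> * obs_W x)))"

definition S_fun :: "nat \<Rightarrow> nat \<Rightarrow> (nat \<Rightarrow> obs) \<Rightarrow> real \<Rightarrow> real \<Rightarrow> real" where
  "S_fun n k x t \<theta> = (\<Sum>i<n. obs_Y (x i) t * obs_W (x i) ^ k * exp (\<theta> * obs_W (x i))) / real n"

text \<open>Since the expectation is with respect to an arbitrary law, the paper's
  \<open>s\<^sup>(\<^sup>k\<^sup>)\<close> at \<open>(\<theta>, \<eta>)\<close> is \<open>s_fun (P \<theta> \<eta>) k \<theta>\<close>.\<close>

definition s_fun :: "obs measure \<Rightarrow> nat \<Rightarrow> real \<Rightarrow> real \<Rightarrow> real" where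
  "s_fun P k \<theta> t = (LINT x|P. obs_Y x t * obs_W x ^ k * exp (\<theta> * obs_W x))"

definition v_fun :: "obs measure \<Rightarrow> real \<Rightarrow> real \<Rightarrow> real" where
  "v_fun P \<theta> t = s_fun P 2 \<theta> t / s_fun P 0 \<theta> t - (s_fun P 1 \<theta> t / s_fun P 0 \<theta> t)\<^sup>2"

definition J_info :: "obs measure \<Rightarrow> real \<Rightarrow> (real \<Rightarrow> real) \<Rightarrow> real" where
  "J_info P \<theta> \<eta> = (LBINT t:{0..1}. v_fun P \<theta> t * s_fun P 0 \<theta> t * \<eta> t)"

definition log_cox_likelihood :: "nat \<Rightarrow> (nat \<Rightarrow> obs) \<Rightarrow> real \<Rightarrow> real" where
  "log_cox_likelihood n x \<theta> =
     (\<Sum>i<n. int_dN (\<lambda>t. \<theta> * obs_W (x i) - ln (real n * S_fun n 0 x t \<theta>)) (x i))"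

text \<open>For finite samples the concave function \<open>log_cox_likelihood n x\<close> need not attain its supremum
  (for instance if the largest covariate always fails first); the estimator is then arbitrary.\<close>

definition cox_estimator :: "real set \<Rightarrow> (nat \<Rightarrow> (nat \<Rightarrow> obs) \<Rightarrow> real) \<Rightarrow> bool" where
  "cox_estimator \<Theta> \<theta>hat \<longleftrightarrow> (\<forall>n.
     \<theta>hat n \<in> borel_measurable (iid n obs_space) \<and>
     (\<forall>x\<in>space (iid n obs_space).
        (\<exists>\<theta>. is_arg_max (log_cox_likelihood n x) (\<lambda>\<theta>. \<theta> \<in> \<Theta>) \<theta>) \<longrightarrow>
        is_arg_max (log_cox_likelihood n x) (\<lambda>\<theta>. \<theta> \<in> \<Theta>) (\<theta>hat n x)))"


section \<open>Convergence in probability\<close>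

text \<open>\<open>Z n = o(1)\<close> in probability, for nonnegative \<open>Z\<close>; the outer measure is the measure itself
  when \<open>Z n\<close> is measurable.\<close>

definition vanishes_in_prob :: "(nat \<Rightarrow> 'a measure) \<Rightarrow> (nat \<Rightarrow> 'a \<Rightarrow> ereal) \<Rightarrow> bool" where
  "vanishes_in_prob P Z \<longleftrightarrow> (\<forall>\<epsilon>>0.
     (\<lambda>n. outer_measure_of (P n) {x \<in> space (P n). Z n x > ereal \<epsilon>}) \<longlonglongrightarrow> 0)"

text \<open>The centring function \<open>c\<close> is a parameter because the condition
  \<open>sup \<bar>S\<^sub>n\<^sup>(\<^sup>k\<^sup>)(t, \<theta>) - s\<^sup>(\<^sup>k\<^sup>)(t)\<bar> = o(1)\<close> under the true law \<open>P0 = P \<theta>0 \<eta>0\<close> has two readings for \<open>\<theta> \<noteq> \<theta>0\<close>.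
  With \<open>c = s_fun (P \<theta> \<eta>0) k \<theta>\<close>, the expectation under the law at \<open>\<theta>\<close> itself, it contradicts
  \<open>J > 0\<close>, because the law of large numbers gives the limit \<open>s_fun P0 k \<theta>\<close>, the expectation
  under the law of the data. The theorem accepts either centring.\<close>

definition S_uniformly_consistent ::
  "obs measure \<Rightarrow> real set \<Rightarrow> (nat \<Rightarrow> real \<Rightarrow> real \<Rightarrow> real) \<Rightarrow> bool" where
  "S_uniformly_consistent P0 U c \<longleftrightarrow> (\<forall>k\<le>2.
     vanishes_in_prob (\<lambda>n. iid n P0)
       (\<lambda>n x. SUP (t, \<theta>) \<in> {0..1} \<times> U. ereal \<bar>S_fun n k x t \<theta> - c k \<theta> t\<bar>))"


section \<open>Efficiency\<close>

definition L2 :: "'a measure \<Rightarrow> ('a \<Rightarrow> real) \<Rightarrow> bool" where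
  "L2 P f \<longleftrightarrow> f \<in> borel_measurable P \<and> integrable P (\<lambda>x. (f x)\<^sup>2)"

definition L2_closure :: "'a measure \<Rightarrow> ('a \<Rightarrow> real) set \<Rightarrow> ('a \<Rightarrow> real) set" where
  "L2_closure P A = {g. L2 P g \<and> (\<forall>\<epsilon>>0. \<exists>a\<in>A. L2 P a \<and> (LINT x|P. (g x - a x)\<^sup>2) < \<epsilon>)}"

text \<open>\<open>g\<close> is (a version of) the orthogonal projection of \<open>f\<close> onto the closure of \<open>A\<close>.\<close>

definition L2_projection ::
  "'a measure \<Rightarrow> ('a \<Rightarrow> real) set \<Rightarrow> ('a \<Rightarrow> real) \<Rightarrow> ('a \<Rightarrow> real) \<Rightarrow> bool" where
  "L2_projection P A f g \<longleftrightarrow> L2 P f \<and> g \<in> L2_closure P A \<and>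
     (\<forall>h\<in>L2_closure P A. (LINT x|P. (f x - g x) * h x) = 0)"

definition score_\<theta> :: "real \<Rightarrow> (real \<Rightarrow> real) \<Rightarrow> obs \<Rightarrow> real" where
  "score_\<theta> \<theta> \<eta> x = obs_W x * cox_M \<theta> \<eta> x 1"

definition score_\<eta> :: "real \<Rightarrow> (real \<Rightarrow> real) \<Rightarrow> (real \<Rightarrow> real) \<Rightarrow> obs \<Rightarrow> real" where
  "score_\<eta> \<theta> \<eta> b x = int_dM \<theta> \<eta> (\<lambda>s. b s / \<eta> s) x"

definition is_efficient_score ::
  "(real \<Rightarrow> (real \<Rightarrow> real) \<Rightarrow> obs measure) \<Rightarrow> real \<Rightarrow> (real \<Rightarrow> real) \<Rightarrow> (obs \<Rightarrow> real) \<Rightarrow> bool" where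
  "is_efficient_score P \<theta> \<eta> l \<longleftrightarrow> l \<in> borel_measurable (P \<theta> \<eta>) \<and>
     (\<exists>g. L2_projection (P \<theta> \<eta>) {score_\<eta> \<theta> \<eta> b |b. C1_01 b} (score_\<theta> \<theta> \<eta>) g \<and>
          (AE x in P \<theta> \<eta>. l x = score_\<theta> \<theta> \<eta> x - g x))"

definition cox_efficient_score :: "obs measure \<Rightarrow> real \<Rightarrow> (real \<Rightarrow> real) \<Rightarrow> obs \<Rightarrow> real" where
  "cox_efficient_score P \<theta> \<eta> x =
     int_dM \<theta> \<eta> (\<lambda>t. obs_W x - s_fun P 1 \<theta> t / s_fun P 0 \<theta> t) x"

definition regular_with_limit ::
  "(real \<Rightarrow> (real \<Rightarrow> real) \<Rightarrow> obs measure) \<Rightarrow> real \<Rightarrow> (real \<Rightarrow> real)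
     \<Rightarrow> (nat \<Rightarrow> (nat \<Rightarrow> obs) \<Rightarrow> real) \<Rightarrow> real measure \<Rightarrow> bool" where
  "regular_with_limit P \<theta>\<^sub>0 \<eta>\<^sub>0 \<theta>hat L \<longleftrightarrow> real_distribution L \<and>
     (\<forall>\<tau> b. C1_01 b \<longrightarrow>
        weak_conv_m
          (\<lambda>n. distr (iid n (P (\<theta>\<^sub>0 + \<tau> / sqrt n) (\<lambda>t. \<eta>\<^sub>0 t + b t / sqrt n))) borel
                 (\<lambda>x. sqrt n * (\<theta>hat n x - \<theta>\<^sub>0 - \<tau> / sqrt n)))
          L)"

definition best_regular ::
  "(real \<Rightarrow> (real \<Rightarrow> real) \<Rightarrow> obs measure) \<Rightarrow> real \<Rightarrow> (real \<Rightarrow> real)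
     \<Rightarrow> (nat \<Rightarrow> (nat \<Rightarrow> obs) \<Rightarrow> real) \<Rightarrow> bool" where
  "best_regular P \<theta>\<^sub>0 \<eta>\<^sub>0 \<theta>hat \<longleftrightarrow> regular_with_limit P \<theta>\<^sub>0 \<eta>\<^sub>0 \<theta>hat
     (density lborel (normal_density 0 (sqrt (1 / J_info (P \<theta>\<^sub>0 \<eta>\<^sub>0) \<theta>\<^sub>0 \<eta>\<^sub>0))))"


section \<open>Conditions on the functions \<open>s\<^sup>(\<^sup>k\<^sup>)\<close>\<close>

definition hazard_neighbourhood :: "(real \<Rightarrow> real) \<Rightarrow> (real \<Rightarrow> real) set \<Rightarrow> bool" where
  "hazard_neighbourhood \<eta>\<^sub>0 U \<longleftrightarrow> (\<forall>\<eta>\<in>U. bounded_hazard \<eta>) \<and>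
     (\<exists>r>0. \<forall>\<eta>. bounded_hazard \<eta> \<and> (\<forall>t\<in>{0..1}. \<bar>\<eta> t - \<eta>\<^sub>0 t\<bar> < r) \<longrightarrow> \<eta> \<in> U)"

definition continuous_uniformly_in_t ::
  "real set \<Rightarrow> (real \<Rightarrow> real) set \<Rightarrow> (real \<Rightarrow> (real \<Rightarrow> real) \<Rightarrow> real \<Rightarrow> real) \<Rightarrow> bool" where
  "continuous_uniformly_in_t U V f \<longleftrightarrow> (\<forall>\<theta>\<in>U. \<forall>\<eta>\<in>V. \<forall>\<epsilon>>0. \<exists>d>0. \<forall>\<theta>'\<in>U. \<forall>\<eta>'\<in>V.
     \<bar>\<theta>' - \<theta>\<bar> < d \<and> (\<forall>t\<in>{0..1}. \<bar>\<eta>' t - \<eta> t\<bar> < d) \<longrightarrow>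
     (\<forall>t\<in>{0..1}. \<bar>f \<theta>' \<eta>' t - f \<theta> \<eta> t\<bar> < \<epsilon>))"

end

theory Submission
  imports Defs
begin

text \<open>
  Everything is done along an arbitrary sequence of parameters \<open>(\<theta>\<^sub>n, \<eta>\<^sub>n)\<close> converging to
  \<open>(\<theta>\<^sub>0, \<eta>\<^sub>0)\<close>, centring at \<open>\<theta>\<^sub>n\<close> and computing under \<open>P\<^bsub>\<theta>\<^sub>n,\<eta>\<^sub>n\<^esub>\<close>. Regularity along local paths then
  follows directly, without contiguity and Le Cam's third lemma.

  With \<open>e = s\<^sup>(\<^sup>1\<^sup>) / s\<^sup>(\<^sup>0\<^sup>)\<close>, the partial score at \<open>\<theta>\<^sub>n\<close> is
  \<open>\<Sum>i. \<integral> (W\<^sub>i - e) dM\<^sub>i - \<Sum>i. \<integral> (S\<^sub>n\<^sup>(\<^sup>1\<^sup>) / S\<^sub>n\<^sup>(\<^sup>0\<^sup>) - e) dM\<^sub>i\<close>. The second sum is negligible by the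
  isometry for integrals of predictable functions, for which no martingale theory is needed: the
  pathwise formula \<open>Z\<^sup>2 = \<Sum> \<integral> H\<^sup>2 dN + 2 \<Sum> \<integral> H Z\<^sub>- dM\<close> holds in the absence of ties, and the
  compensator formula, which is Fubini's theorem for the model law, gives the last term mean zero.
  The law of large numbers for \<open>S\<^sub>n\<^sup>(\<^sup>k\<^sup>)\<close> is needed only in \<open>L\<^sub>1\<close> for fixed \<open>t\<close>: by Cauchy-Schwarz
  \<open>(S\<^sub>n\<^sup>(\<^sup>1\<^sup>))\<^sup>2 \<le> S\<^sub>n\<^sup>(\<^sup>0\<^sup>) S\<^sub>n\<^sup>(\<^sup>2\<^sup>)\<close>, so \<open>(S\<^sub>n\<^sup>(\<^sup>1\<^sup>))\<^sup>2 / S\<^sub>n\<^sup>(\<^sup>0\<^sup>)\<close> is stable even where \<open>S\<^sub>n\<^sup>(\<^sup>0\<^sup>)\<close> is small.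

  The observed information is a sum of weighted variances, and these change by a factor close to 1
  when \<open>\<theta>\<close> moves by \<open>O(1 / sqrt n)\<close> and all covariates are \<open>o(sqrt n)\<close>. Concavity of the log
  partial likelihood turns this into the linear expansion of its maximiser. The limit law comes from
  characteristic functions, with the Lindeberg condition obtained by truncating \<open>W\<close>.

  For the efficient score, the isometry for a single observation makes \<open>\<integral> (W - e) dM\<close> orthogonal to
  every \<open>Db\<close>, and density of the continuously differentiable functions in \<open>L\<^sub>2\<close> puts \<open>\<integral> e dM\<close> into the
  closure of the nuisance scores.
\<close>

text \<open>The laws change with n, so every estimate concerns a triangular array and must not
  depend on the row. This is possible because the law of W is the same in all rows: integrability is
  expressed through functions of W alone, whose tails are computed under the single measure
  \<open>Q\<close>. The pathwise isometry is proved for integrands that are bounded, also after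
  multiplication by exp (\<theta> W), whereas W itself is unbounded. The cut is made on the event
  that no covariate of the sample exceeds \<gamma> sqrt n in size. Covariates are known from time 0
  on, so multiplication by the indicator of this event preserves predictability, and a finite second
  moment of W makes its probability tend to 1. For the remainder of the score the level \<gamma> is
  arbitrary; for the information it must be small, because one factor of the integrand is estimated
  by \<gamma>^2 n. Quotients by \<open>S_fun n 0\<close> at an empty risk set have the value 0, and
  the identities for risk-set means and variances are arranged to hold with this value.\<close>

section \<open>The compensator formula\<close>

text \<open>The event that a failure is observed inside the window, i.e. that \<open>N\<close> jumps.\<close>

definition ev :: "obs \<Rightarrow> bool" where
  "ev x \<longleftrightarrow> obs_D x \<and> 0 \<le> obs_T x \<and> obs_T x \<le> 1"

text \<open>Extended by 0, the hazard lets all time integrals run over the whole real line.\<close>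

definition haz01 :: "(real \<Rightarrow> real) \<Rightarrow> real \<Rightarrow> real" where
  "haz01 \<eta> t = indicator {0..1} t * \<eta> t"

text \<open>The intensity of \<open>obs_N\<close> when \<open>h\<close> is the hazard cut off to
  [0,1]; its integral is the compensator.\<close>

definition rate :: "real \<Rightarrow> (real \<Rightarrow> real) \<Rightarrow> obs \<Rightarrow> real \<Rightarrow> real" where
  "rate \<theta> h x t = obs_Y x t * h t * exp (\<theta> * obs_W x)"

lemma fst_obs_measurable [measurable]: "fst \<in> obs_space \<rightarrow>\<^sub>M borel"
  and snd_obs_measurable [measurable]: "snd \<in> obs_space \<rightarrow>\<^sub>M count_space UNIV \<Otimes>\<^sub>M borel"
  by (simp_all add: obs_space_def)

lemma sets_obs_space [measurable_cong]: "sets obs_space = sets (borel \<Otimes>\<^sub>M (count_space UNIV \<Otimes>\<^sub>M borel))"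
  by (simp add: obs_space_def)

lemma space_obs_space [simp]: "space obs_space = UNIV"
  by (simp add: obs_space_def space_pair_measure)

lemma rate_measurable [measurable (raw)]:
  assumes [measurable]: "h \<in> borel_measurable borel" "f \<in> N \<rightarrow>\<^sub>M obs_space" "g \<in> N \<rightarrow>\<^sub>M borel"
  shows "(\<lambda>z. rate \<theta> h (f z) (g z)) \<in> borel_measurable N"
  unfolding rate_def obs_Y_def by measurable

text \<open>Converts joint measurability of a function of time and sample, the form in which it is
  assumed below, into a rule that allows arbitrary measurable arguments to be substituted.\<close>

lemma measurable_apply2:
  assumes "(\<lambda>z. k (fst z) (snd z)) \<in> A \<Otimes>\<^sub>M B \<rightarrow>\<^sub>M C" "f \<in> N \<rightarrow>\<^sub>M A" "g \<in> N \<rightarrow>\<^sub>M B"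
  shows "(\<lambda>z. k (f z) (g z)) \<in> N \<rightarrow>\<^sub>M C"
  using measurable_compose[OF measurable_Pair[OF assms(2,3)] assms(1)] by simp

lemma measurable_emeasure_atLeast:
  fixes \<mu> :: "real measure"
  assumes "prob_space \<mu>" and s: "sets \<mu> = sets borel"
  shows "(\<lambda>t. emeasure \<mu> {t..}) \<in> borel_measurable borel"
proof -
  interpret prob_space \<mu> by fact
  have "{z \<in> space (borel \<Otimes>\<^sub>M borel). fst z \<le> (snd z :: real)} \<in> sets (borel \<Otimes>\<^sub>M borel)"
    by measurable
  then have "{z. fst z \<le> (snd z :: real)} \<in> sets (borel \<Otimes>\<^sub>M \<mu>)"
    by (simp add: space_pair_measure sets_pair_measure_cong[OF refl s])
  then have "(\<lambda>t. emeasure \<mu> (Pair t -` {z. fst z \<le> snd z})) \<in> borel_measurable borel"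
    by (rule measurable_emeasure_Pair)
  then show ?thesis by (simp add: vimage_def atLeast_def)
qed

text \<open>The hazard condition prescribes the mass of every Borel subset of the window. It is
  therefore an equality of two measures with densities, and integrating \<open>u\<close> against
  both passes from sets to functions.\<close>

lemma has_hazard_rate_01_nn_integral:
  assumes h: "has_hazard_rate_01 \<mu> h" and [measurable]: "haz01 h \<in> borel_measurable borel"
    and \<mu>: "prob_space \<mu>" and [measurable_cong]: "sets \<mu> = sets borel"
    and [measurable]: "u \<in> borel_measurable borel"
  shows "(\<integral>\<^sup>+t. indicator {0..1} t * u t \<partial>\<mu>) =
    (\<integral>\<^sup>+t. ennreal (haz01 h t) * u t * emeasure \<mu> {t..} \<partial>lborel)"
proof -
  interpret prob_space \<mu> by fact
  have m[measurable]: "(\<lambda>t. emeasure \<mu> {t..}) \<in> borel_measurable borel"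
    by (rule measurable_emeasure_atLeast) fact+
  have "density \<mu> (indicator {0..1}) = density lborel (\<lambda>t. ennreal (haz01 h t) * emeasure \<mu> {t..})"
  proof (rule measure_eqI)
    show "sets (density \<mu> (indicator {0..1})) = sets (density lborel (\<lambda>t. ennreal (haz01 h t) * emeasure \<mu> {t..}))"
      by (simp add: \<open>sets \<mu> = sets borel\<close>)
    fix A assume "A \<in> sets (density \<mu> (indicator {0..1}))"
    then have A[measurable]: "A \<in> sets borel" by (simp add: \<open>sets \<mu> = sets borel\<close>)
    have "emeasure (density \<mu> (indicator {0..1})) A = emeasure \<mu> (A \<inter> {0..1})"
      by (subst emeasure_density)
        (auto simp: indicator_inter_arith[symmetric] nn_integral_indicator  Int_commute)
    also have "\<dots> = (\<integral>\<^sup>+t\<in>(A \<inter> {0..1}). ennreal (h t) * emeasure \<mu> {t..} \<partial>lborel)"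
      using h A unfolding has_hazard_rate_01_def by auto
    also have "\<dots> = emeasure (density lborel (\<lambda>t. ennreal (haz01 h t) * emeasure \<mu> {t..})) A"
      by (subst emeasure_density, measurable)
        (auto simp: haz01_def intro!: nn_integral_cong split: split_indicator)
    finally show "emeasure (density \<mu> (indicator {0..1})) A = emeasure (density lborel (\<lambda>t. ennreal (haz01 h t) * emeasure \<mu> {t..})) A" .
  qed
  then have "(\<integral>\<^sup>+t. u t \<partial>density \<mu> (indicator {0..1})) = (\<integral>\<^sup>+t. u t \<partial>density lborel (\<lambda>t. ennreal (haz01 h t) * emeasure \<mu> {t..}))"
    by simp
  then show ?thesis
    by (subst (asm) (1 2) nn_integral_density) (auto simp: ac_simps)
qed

text \<open>What the asymptotic arguments use of the law of one observation. The test function in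
  \<open>compensator\<close> may depend on time and covariate, which for a single observation still
  at risk is all that a predictable integrand can see. \<open>K\<close> bounds the hazard and can be
  kept fixed while the law varies.\<close>

locale counting_law = prob_space R for R :: "obs measure" +
  fixes \<theta> :: real and h :: "real \<Rightarrow> real" and K :: real
  assumes sets_R: "sets R = sets obs_space"
    and h_measurable [measurable]: "h \<in> borel_measurable borel"
    and h_nonneg: "0 \<le> h t" and h_le: "h t \<le> K" and h_outside: "t \<notin> {0..1} \<Longrightarrow> h t = 0"
    and compensator: "\<And>g :: real \<Rightarrow> real \<Rightarrow> ennreal. case_prod g \<in> borel_measurable (borel \<Otimes>\<^sub>M borel) \<Longrightarrow>
      (\<integral>\<^sup>+x. (if ev x then g (obs_T x) (obs_W x) else 0) \<partial>R) =
      (\<integral>\<^sup>+x. (\<integral>\<^sup>+t. ennreal (rate \<theta> h x t) * g t (obs_W x) \<partial>lborel) \<partial>R)"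

section \<open>The Cox law satisfies the compensator formula\<close>

context
  fixes \<Theta> Q F G \<theta> \<eta>
  assumes model: "cox_ingredients \<Theta> Q F G" and \<theta>: "\<theta> \<in> \<Theta>" and \<eta>: "bounded_hazard \<eta>"
begin

lemma cox_kernels:
  shows "prob_space Q" "sets Q = sets borel" "G \<in> borel \<rightarrow>\<^sub>M prob_algebra borel"
    "F \<theta> \<eta> \<in> borel \<rightarrow>\<^sub>M prob_algebra borel" "has_hazard_rate_01 (F \<theta> \<eta> w) (\<lambda>t. \<eta> t * exp (\<theta> * w))"
  using model \<theta> \<eta> by (auto simp: cox_ingredients_def)

lemma cox_kernel_spaces:
  shows "prob_space (G w)" "sets (G w) = sets borel" "prob_space (F \<theta> \<eta> w)" "sets (F \<theta> \<eta> w) = sets borel"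
  using measurable_space[OF cox_kernels(3), of w] measurable_space[OF cox_kernels(4), of w]
  by (auto simp: space_prob_algebra)

lemma haz01_measurable: "haz01 \<eta> \<in> borel_measurable borel"
  using \<eta> unfolding bounded_hazard_def haz01_def
  by (subst (asm) borel_measurable_restrict_space_iff) (auto simp: mult.commute scaleR_conv_of_real)

lemma cox_law_kernel:
  "(\<lambda>w. F \<theta> \<eta> w \<bind> (\<lambda>t. G w \<bind> (\<lambda>c. return obs_space (min t c, t \<le> c, w)))) \<in> borel \<rightarrow>\<^sub>M prob_algebra obs_space"
proof -
  note [measurable] = cox_kernels(3,4)
  have 1: "(\<lambda>z. return obs_space (min (snd (fst z)) (snd z), snd (fst z) \<le> snd z, fst (fst z))) \<in> (borel \<Otimes>\<^sub>M borel) \<Otimes>\<^sub>M borel \<rightarrow>\<^sub>M prob_algebra obs_space"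
    by (rule measurable_compose[OF _ measurable_return_prob_space]) (unfold obs_space_def, measurable)
  have 2: "(\<lambda>z. G (fst z) \<bind> (\<lambda>c. return obs_space (min (snd z) c, snd z \<le> c, fst z))) \<in> borel \<Otimes>\<^sub>M borel \<rightarrow>\<^sub>M prob_algebra obs_space"
    by (rule measurable_bind_prob_space2[where N=borel]) (use 1 in \<open>auto simp: case_prod_beta'\<close>)
  show ?thesis
    by (rule measurable_bind_prob_space2[where N=borel]) (use 2 in \<open>auto simp: case_prod_beta' cox_kernels\<close>)
qed

lemma
  shows prob_space_cox_law: "prob_space (cox_law Q F G \<theta> \<eta>)"
    and sets_cox_law: "sets (cox_law Q F G \<theta> \<eta>) = sets obs_space"
proof -
  have Q: "Q \<in> space (prob_algebra borel)" using cox_kernels by (auto simp: space_prob_algebra)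
  have "cox_law Q F G \<theta> \<eta> \<in> space (prob_algebra obs_space)"
    unfolding cox_law_def
    \<comment> \<open>A kernel that ignores its argument: measurability of the bind, read at an
      arbitrary point of a dummy discrete space, says that the bind is a probability
      measure.\<close>
    using measurable_space[OF measurable_bind_prob_space[OF measurable_const[OF Q] cox_law_kernel], of undefined "count_space UNIV"]
    by simp
  then show "prob_space (cox_law Q F G \<theta> \<eta>)" "sets (cox_law Q F G \<theta> \<eta>) = sets obs_space"
    by (auto simp: space_prob_algebra)
qed

lemma nn_integral_cox_law:
  assumes [measurable]: "f \<in> borel_measurable obs_space"
  shows "(\<integral>\<^sup>+x. f x \<partial>cox_law Q F G \<theta> \<eta>) =
    (\<integral>\<^sup>+w. \<integral>\<^sup>+t. \<integral>\<^sup>+c. f (min t c, t \<le> c, w) \<partial>G w \<partial>F \<theta> \<eta> w \<partial>Q)"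
proof -
  note [measurable] = cox_kernels(3,4)
  have 1: "(\<lambda>z. return obs_space (min (fst z) (snd z), fst z \<le> snd z, w)) \<in> borel \<Otimes>\<^sub>M borel \<rightarrow>\<^sub>M prob_algebra obs_space" for w
    by (rule measurable_compose[OF _ measurable_return_prob_space]) (unfold obs_space_def, measurable)
  have 2: "(\<lambda>t. G w \<bind> (\<lambda>c. return obs_space (min t c, t \<le> c, w))) \<in> borel \<rightarrow>\<^sub>M prob_algebra obs_space" for w
  proof (rule measurable_bind_prob_space2[where N=borel])
    show "(\<lambda>x. G w) \<in> borel \<rightarrow>\<^sub>M prob_algebra borel" by measurable
  qed (use 1 in \<open>auto simp: case_prod_beta'\<close>)
  have 3: "(\<lambda>c. return obs_space (min t c, t \<le> c, w)) \<in> borel \<rightarrow>\<^sub>M prob_algebra obs_space" for t w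
    by (rule measurable_compose[OF _ measurable_return_prob_space]) (unfold obs_space_def, measurable)
  have k: "(\<lambda>w. F \<theta> \<eta> w \<bind> (\<lambda>t. G w \<bind> (\<lambda>c. return obs_space (min t c, t \<le> c, w)))) \<in> Q \<rightarrow>\<^sub>M subprob_algebra obs_space"
    using cox_law_kernel[THEN measurable_prob_algebraD] cox_kernels(2) by (simp cong: measurable_cong_sets)
  show ?thesis
    unfolding cox_law_def
    apply (subst nn_integral_bind[OF assms k])
    apply (intro nn_integral_cong)
    apply (subst nn_integral_bind[OF assms])
     apply (subst measurable_cong_sets[OF cox_kernel_spaces(4) refl])
     apply (rule 2[THEN measurable_prob_algebraD])
    apply (intro nn_integral_cong)
    apply (subst nn_integral_bind[OF assms])
     apply (subst measurable_cong_sets[OF cox_kernel_spaces(2) refl])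
     apply (rule 3[THEN measurable_prob_algebraD])
    apply (intro nn_integral_cong)
    apply (subst nn_integral_return)
    apply auto
    done
qed

lemma distr_cox_law_W: "distr (cox_law Q F G \<theta> \<eta>) borel obs_W = Q"
proof (rule measure_eqI)
  show "sets (distr (cox_law Q F G \<theta> \<eta>) borel obs_W) = sets Q" using cox_kernels by simp
  fix A assume "A \<in> sets (distr (cox_law Q F G \<theta> \<eta>) borel obs_W)"
  then have A[measurable]: "A \<in> sets borel" by simp
  have m: "obs_W \<in> cox_law Q F G \<theta> \<eta> \<rightarrow>\<^sub>M borel"
    by (subst measurable_cong_sets[OF sets_cox_law refl]) measurable
  have "emeasure (distr (cox_law Q F G \<theta> \<eta>) borel obs_W) A = (\<integral>\<^sup>+x. indicator A (obs_W x) \<partial>cox_law Q F G \<theta> \<eta>)"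
    by (subst nn_integral_distr[symmetric, OF m]) auto
  also have "\<dots> = emeasure Q A"
    apply (subst nn_integral_cox_law)
     apply measurable
    apply (simp add: prob_space.emeasure_space_1[OF cox_kernel_spaces(1)] prob_space.emeasure_space_1[OF cox_kernel_spaces(3)])
    apply (use cox_kernels(2) in simp)
    done
  finally show "emeasure (distr (cox_law Q F G \<theta> \<eta>) borel obs_W) A = emeasure Q A" .
qed

text \<open>At an uncensored event the observed time is the lifetime, which has no mass below 0. The
  restriction to uncensored events matters, since C may be negative.\<close>

lemma AE_cox_law_nonneg: "AE x in cox_law Q F G \<theta> \<eta>. obs_D x \<longrightarrow> 0 \<le> obs_T x"
proof -
  let ?f = "\<lambda>x. indicator {x. obs_D x \<and> obs_T x < 0} x :: ennreal"
  have "{x \<in> space obs_space. obs_D x \<and> obs_T x < 0} \<in> sets obs_space"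
    by measurable
  then have m[measurable]: "{x. obs_D x \<and> obs_T x < 0} \<in> sets obs_space" by simp
  have "emeasure (cox_law Q F G \<theta> \<eta>) {x. obs_D x \<and> obs_T x < 0} = (\<integral>\<^sup>+x. ?f x \<partial>cox_law Q F G \<theta> \<eta>)"
    using m by (simp add: sets_cox_law)
  also have "\<dots> = (\<integral>\<^sup>+w. \<integral>\<^sup>+t. \<integral>\<^sup>+c. ?f (min t c, t \<le> c, w) \<partial>G w \<partial>F \<theta> \<eta> w \<partial>Q)"
    by (rule nn_integral_cox_law) measurable
  also have "\<dots> \<le> (\<integral>\<^sup>+w. \<integral>\<^sup>+t. \<integral>\<^sup>+c. indicator {..<0} t \<partial>G w \<partial>F \<theta> \<eta> w \<partial>Q)"
    by (intro nn_integral_mono) (auto split: split_indicator)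
  also have "\<dots> = (\<integral>\<^sup>+w. emeasure (F \<theta> \<eta> w) {..<0} \<partial>Q)"
    by (simp add: prob_space.emeasure_space_1[OF cox_kernel_spaces(1)] cox_kernel_spaces)
  also have "\<dots> = 0"
    using cox_kernels(5) by (simp add: has_hazard_rate_01_def)
  finally have "emeasure (cox_law Q F G \<theta> \<eta>) {x. obs_D x \<and> obs_T x < 0} = 0" by simp
  then show ?thesis
    by (intro AE_I[where N="{x. obs_D x \<and> obs_T x < 0}"]) (auto simp: sets_cox_law)
qed

text \<open>The two sides agree already given W = w: a failure at t has density hazard(t) P(T' >=
  t), it is uncensored with probability P(C >= t), and by conditional independence the product of
  the two tail probabilities is the probability of being at risk at t.\<close>

lemma counting_law_cox_law:
  assumes K: "\<And>t. t \<in> {0..1} \<Longrightarrow> \<eta> t \<le> K"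
  shows "counting_law (cox_law Q F G \<theta> \<eta>) \<theta> (haz01 \<eta>) K"
proof -
  interpret prob_space "cox_law Q F G \<theta> \<eta>" by (rule prob_space_cox_law)
  have pos: "\<And>t. t \<in> {0..1} \<Longrightarrow> 0 < \<eta> t" using \<eta> by (auto simp: bounded_hazard_def)
  have "0 < \<eta> 0" "\<eta> 0 \<le> K" using pos K by auto
  then have K0: "0 \<le> K" by linarith
  note [measurable] = haz01_measurable
  show ?thesis
  proof
    show "sets (cox_law Q F G \<theta> \<eta>) = sets obs_space" by (rule sets_cox_law)
    show "haz01 \<eta> \<in> borel_measurable borel" by measurable
    show "0 \<le> haz01 \<eta> t" "haz01 \<eta> t \<le> K" for t
      using pos[of t] K[of t] K0 by (auto simp: haz01_def split: split_indicator)
    show "haz01 \<eta> t = 0" if "t \<notin> {0..1}" for t using that by (auto simp: haz01_def)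
    fix g :: "real \<Rightarrow> real \<Rightarrow> ennreal"
    assume g: "case_prod g \<in> borel_measurable (borel \<Otimes>\<^sub>M borel)"
    then have "(\<lambda>z. g (fst z) (snd z)) \<in> borel_measurable (borel \<Otimes>\<^sub>M borel)" by (simp add: case_prod_beta')
    note [measurable (raw)] = measurable_apply2[OF this]
    note [measurable_cong] = cox_kernel_spaces(2,4)
    have evm[measurable]: "Measurable.pred obs_space ev" unfolding ev_def by measurable
    have [measurable]: "(\<lambda>x. if ev x then g (obs_T x) (obs_W x) else 0) \<in> borel_measurable obs_space"
      by measurable
    have inner: "(\<integral>\<^sup>+t. \<integral>\<^sup>+c. (if ev (min t c, t \<le> c, w) then g (min t c) w else 0) \<partial>G w \<partial>F \<theta> \<eta> w) =
        (\<integral>\<^sup>+t. \<integral>\<^sup>+c. (\<integral>\<^sup>+s. ennreal (rate \<theta> (haz01 \<eta>) (min t c, t \<le> c, w) s) * g s w \<partial>lborel) \<partial>G w \<partial>F \<theta> \<eta> w)" for w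
    proof -
      interpret FW: prob_space "F \<theta> \<eta> w" by (rule cox_kernel_spaces)
      interpret GW: prob_space "G w" by (rule cox_kernel_spaces)
      interpret FL: pair_sigma_finite "F \<theta> \<eta> w" lborel by standard
      interpret GL: pair_sigma_finite "G w" lborel by standard
      have gm[measurable]: "(\<lambda>t. g t w) \<in> borel_measurable borel" by measurable
      have Gm[measurable]: "(\<lambda>t. emeasure (G w) {t..}) \<in> borel_measurable borel"
        by (rule measurable_emeasure_atLeast[OF cox_kernel_spaces(1,2)])
      have "(\<integral>\<^sup>+t. \<integral>\<^sup>+c. (if ev (min t c, t \<le> c, w) then g (min t c) w else 0) \<partial>G w \<partial>F \<theta> \<eta> w) =
         (\<integral>\<^sup>+t. \<integral>\<^sup>+c. (indicator {0..1} t * g t w) * indicator {t..} c \<partial>G w \<partial>F \<theta> \<eta> w)"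
        by (intro nn_integral_cong) (auto simp: ev_def min_def split: split_indicator)
      also have "\<dots> = (\<integral>\<^sup>+t. indicator {0..1} t * (g t w * emeasure (G w) {t..}) \<partial>F \<theta> \<eta> w)"
        by (subst nn_integral_cmult) (auto simp: cox_kernel_spaces mult.assoc)
      also have "\<dots> = (\<integral>\<^sup>+t. ennreal (haz01 (\<lambda>t. \<eta> t * exp (\<theta> * w)) t) * (g t w * emeasure (G w) {t..}) * emeasure (F \<theta> \<eta> w) {t..} \<partial>lborel)"
      proof (rule has_hazard_rate_01_nn_integral[OF cox_kernels(5)])
        have "haz01 (\<lambda>t. \<eta> t * exp (\<theta> * w)) = (\<lambda>t. haz01 \<eta> t * exp (\<theta> * w))"
          by (auto simp: haz01_def)
        then show "haz01 (\<lambda>t. \<eta> t * exp (\<theta> * w)) \<in> borel_measurable borel" by simp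
      qed (auto simp: cox_kernel_spaces)
      \<comment> \<open>The product of the tail probabilities is written as a double integral of
        indicators, so that Fubini can move the time integral inside the averages over T' and
        C.\<close>
      also have "\<dots> = (\<integral>\<^sup>+s. \<integral>\<^sup>+t. \<integral>\<^sup>+c. ennreal (haz01 \<eta> s * exp (\<theta> * w)) * g s w * indicator {s..} c * indicator {s..} t \<partial>G w \<partial>F \<theta> \<eta> w \<partial>lborel)"
      proof (intro nn_integral_cong)
        fix s :: real
        let ?k = "ennreal (haz01 \<eta> s * exp (\<theta> * w)) * g s w"
        have "(\<integral>\<^sup>+t. \<integral>\<^sup>+c. ?k * indicator {s..} c * indicator {s..} t \<partial>G w \<partial>F \<theta> \<eta> w)
          = (\<integral>\<^sup>+t. ?k * emeasure (G w) {s..} * indicator {s..} t \<partial>F \<theta> \<eta> w)"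
          by (subst nn_integral_multc, simp, subst nn_integral_cmult) (auto simp: cox_kernel_spaces)
        also have "\<dots> = ?k * emeasure (G w) {s..} * emeasure (F \<theta> \<eta> w) {s..}"
          by (subst nn_integral_cmult) (auto simp: cox_kernel_spaces)
        finally show "ennreal (haz01 (\<lambda>t. \<eta> t * exp (\<theta> * w)) s) * (g s w * emeasure (G w) {s..}) * emeasure (F \<theta> \<eta> w) {s..} =
          (\<integral>\<^sup>+t. \<integral>\<^sup>+c. ?k * indicator {s..} c * indicator {s..} t \<partial>G w \<partial>F \<theta> \<eta> w)"
          by (simp add: haz01_def mult_ac)
      qed
      also have "\<dots> = (\<integral>\<^sup>+t. \<integral>\<^sup>+s. \<integral>\<^sup>+c. ennreal (haz01 \<eta> s * exp (\<theta> * w)) * g s w * indicator {s..} c * indicator {s..} t \<partial>G w \<partial>lborel \<partial>F \<theta> \<eta> w)"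
        unfolding indicator_def atLeast_iff by (rule FL.Fubini') measurable
      also have "\<dots> = (\<integral>\<^sup>+t. \<integral>\<^sup>+c. \<integral>\<^sup>+s. ennreal (haz01 \<eta> s * exp (\<theta> * w)) * g s w * indicator {s..} c * indicator {s..} t \<partial>lborel \<partial>G w \<partial>F \<theta> \<eta> w)"
        unfolding indicator_def atLeast_iff by (intro nn_integral_cong GL.Fubini') measurable
      also have "\<dots> = (\<integral>\<^sup>+t. \<integral>\<^sup>+c. (\<integral>\<^sup>+s. ennreal (rate \<theta> (haz01 \<eta>) (min t c, t \<le> c, w) s) * g s w \<partial>lborel) \<partial>G w \<partial>F \<theta> \<eta> w)"
        by (intro nn_integral_cong) (auto simp: rate_def obs_Y_def split: split_indicator)
      finally show ?thesis .
    qed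
    have "(\<integral>\<^sup>+x. (if ev x then g (obs_T x) (obs_W x) else 0) \<partial>cox_law Q F G \<theta> \<eta>) =
        (\<integral>\<^sup>+w. \<integral>\<^sup>+t. \<integral>\<^sup>+c. (if ev (min t c, t \<le> c, w) then g (min t c) w else 0) \<partial>G w \<partial>F \<theta> \<eta> w \<partial>Q)"
      by (subst nn_integral_cox_law, measurable) (intro nn_integral_cong if_cong refl, simp)
    also have "\<dots> = (\<integral>\<^sup>+w. \<integral>\<^sup>+t. \<integral>\<^sup>+c. (\<integral>\<^sup>+s. ennreal (rate \<theta> (haz01 \<eta>) (min t c, t \<le> c, w) s) * g s w \<partial>lborel) \<partial>G w \<partial>F \<theta> \<eta> w \<partial>Q)"
      by (simp only: inner)
    also have "\<dots> = (\<integral>\<^sup>+x. (\<integral>\<^sup>+t. ennreal (rate \<theta> (haz01 \<eta>) x t) * g t (obs_W x) \<partial>lborel) \<partial>cox_law Q F G \<theta> \<eta>)"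
    proof (subst nn_integral_cox_law)
      show "(\<lambda>x. \<integral>\<^sup>+t. ennreal (rate \<theta> (haz01 \<eta>) x t) * g t (obs_W x) \<partial>lborel) \<in> borel_measurable obs_space"
        by (rule lborel.borel_measurable_nn_integral) measurable
    qed (simp only: fst_conv snd_conv)
    finally show "(\<integral>\<^sup>+x. (if ev x then g (obs_T x) (obs_W x) else 0) \<partial>cox_law Q F G \<theta> \<eta>) =
      (\<integral>\<^sup>+x. (\<integral>\<^sup>+t. ennreal (rate \<theta> (haz01 \<eta>) x t) * g t (obs_W x) \<partial>lborel) \<partial>cox_law Q F G \<theta> \<eta>)" .
  qed
qed

end

section \<open>Isometry for predictable integrals\<close>

text \<open>The square of the integral is a double integral over the plane. The half planes on both
  sides of the diagonal contribute equally by symmetry, and the diagonal is a null set.\<close>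

lemma integral_triangle_half_square:
  fixes a :: "real \<Rightarrow> real"
  assumes a: "integrable lborel a"
  shows "(LBINT t. a t * (LBINT s. indicator {..<t} s * a s)) = (LBINT t. a t)\<^sup>2 / 2"
proof -
  have [measurable]: "a \<in> borel_measurable borel" using borel_measurable_integrable[OF a] by simp
  let ?f = "\<lambda>t s. a t * a s"
  have i2: "integrable (lborel \<Otimes>\<^sub>M lborel) (\<lambda>(t, s). ?f t s)"
  proof (rule lborel_pair.Fubini_integrable)
    show "(\<lambda>(t, s). ?f t s) \<in> borel_measurable (lborel \<Otimes>\<^sub>M lborel)" by measurable
    have "integrable lborel (\<lambda>x. norm (a x) * (LBINT y. norm (a y)))"
      using a by auto
    then show "integrable lborel (\<lambda>x. LBINT y. norm (case (x, y) of (t, s) \<Rightarrow> ?f t s))"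
      by (simp add: abs_mult)
    show "AE x in lborel. integrable lborel (\<lambda>y. case (x, y) of (t, s) \<Rightarrow> ?f t s)"
      using a by simp
  qed
  have l: "integrable (lborel \<Otimes>\<^sub>M lborel) (\<lambda>(t, s). of_bool (s < t) * ?f t s)"
    and g: "integrable (lborel \<Otimes>\<^sub>M lborel) (\<lambda>(t, s). of_bool (t < s) * ?f t s)"
    by (rule Bochner_Integration.integrable_bound[OF i2]; measurable; auto)+
  have ia: "integrable lborel (\<lambda>s. of_bool (P s) * a s)" if "Measurable.pred borel P" for P
    using that by (intro Bochner_Integration.integrable_bound[OF a]) auto
  have "(LBINT t. a t)\<^sup>2 = (LBINT t. LBINT s. ?f t s)"
    by (simp add: power2_eq_square)
  also have "\<dots> = (LBINT t. (LBINT s. of_bool (s < t) * ?f t s) + (LBINT s. of_bool (t < s) * ?f t s))"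
  proof (intro Bochner_Integration.integral_cong refl)
    fix t
    have 1: "integrable lborel (\<lambda>s. of_bool (s < t) * ?f t s)" "integrable lborel (\<lambda>s. of_bool (t < s) * ?f t s)"
      using integrable_mult_right[of "a t", OF ia[of "\<lambda>s. s < t"]] integrable_mult_right[of "a t", OF ia[of "\<lambda>s. t < s"]]
      by (auto simp: mult_ac)
    have "AE s in lborel. s \<noteq> t" by (rule AE_lborel_singleton)
    then have "(LBINT s. ?f t s) = (LBINT s. of_bool (s < t) * ?f t s + of_bool (t < s) * ?f t s)"
      by (intro integral_cong_AE) (auto simp: neq_iff)
    then show "(LBINT s. ?f t s) = (LBINT s. of_bool (s < t) * ?f t s) + (LBINT s. of_bool (t < s) * ?f t s)"
      using 1 by simp
  qed
  also have "\<dots> = (LBINT t. LBINT s. of_bool (s < t) * ?f t s) + (LBINT t. LBINT s. of_bool (t < s) * ?f t s)"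
    using lborel_pair.integrable_fst'[OF l] lborel_pair.integrable_fst'[OF g] by simp
  also have "(LBINT t. LBINT s. of_bool (t < s) * ?f t s) = (LBINT s. LBINT t. of_bool (t < s) * ?f t s)"
    using lborel_pair.Fubini_integral[OF g] by simp
  also have "\<dots> = (LBINT t. LBINT s. of_bool (s < t) * ?f t s)" by (simp add: mult_ac)
  also have "\<dots> = (LBINT t. a t * (LBINT s. indicator {..<t} s * a s))"
    by (intro Bochner_Integration.integral_cong refl, subst integral_mult_right_zero[symmetric],
        intro Bochner_Integration.integral_cong refl) (simp split: split_indicator)
  finally show ?thesis by simp
qed

text \<open>Discrete counterpart of the preceding identity: injectivity confines equal times to the
  diagonal, and the two ordered halves are exchanged by swapping the indices.\<close>

lemma square_sum_ordered:
  fixes c T :: "'a \<Rightarrow> real"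
  assumes "finite C" "inj_on T C"
  shows "(\<Sum>i\<in>C. c i)\<^sup>2 = (\<Sum>i\<in>C. (c i)\<^sup>2) + 2 * (\<Sum>i\<in>C. \<Sum>j\<in>C. if T j < T i then c i * c j else 0)"
proof -
  have "(\<Sum>i\<in>C. c i)\<^sup>2 = (\<Sum>i\<in>C. \<Sum>j\<in>C. c i * c j)"
    by (simp add: power2_eq_square sum_product)
  also have "\<dots> = (\<Sum>i\<in>C. \<Sum>j\<in>C. (if j = i then (c i)\<^sup>2 else 0) + (if T j < T i then c i * c j else 0)
       + (if T i < T j then c i * c j else 0))"
    using assms(2) by (intro sum.cong refl) (auto simp: power2_eq_square inj_on_def not_less order.order_iff_strict)
  also have "\<dots> = (\<Sum>i\<in>C. (c i)\<^sup>2) + (\<Sum>i\<in>C. \<Sum>j\<in>C. if T j < T i then c i * c j else 0)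
       + (\<Sum>i\<in>C. \<Sum>j\<in>C. if T i < T j then c i * c j else 0)"
    using assms(1) by (simp add: sum.distrib)
  also have "(\<Sum>i\<in>C. \<Sum>j\<in>C. if T i < T j then c i * c j else 0) = (\<Sum>i\<in>C. \<Sum>j\<in>C. if T j < T i then c i * c j else 0)"
    by (subst sum.swap) (intro sum.cong refl if_cong mult.commute)
  finally show ?thesis by simp
qed

lemma measurable_iid_component [measurable (raw)]:
  "i < n \<Longrightarrow> f \<in> N \<rightarrow>\<^sub>M iid n obs_space \<Longrightarrow> (\<lambda>z. f z i) \<in> N \<rightarrow>\<^sub>M obs_space"
  unfolding iid_def by (auto intro: measurable_component_singleton[THEN measurable_compose[rotated]])

lemma
  fixes f g :: "'a \<Rightarrow> real"
  assumes "f \<in> borel_measurable M" "g \<in> borel_measurable M"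
  shows pred_le_real [measurable (raw)]: "Measurable.pred M (\<lambda>w. f w \<le> g w)"
    and pred_eq_real [measurable (raw)]: "Measurable.pred M (\<lambda>w. f w = g w)"
  using borel_measurable_le[OF assms] borel_measurable_eq[OF assms] by (simp_all add: pred_def)

lemma ev_measurable [measurable]: "Measurable.pred obs_space ev"
  unfolding ev_def by measurable

text \<open>Two samples agree before \<open>t\<close> if every observation is the same, or is still at risk at \<open>t\<close> in both.
  A function is predictable if it depends on the sample only through this information.\<close>

definition agree :: "real \<Rightarrow> (nat \<Rightarrow> obs) \<Rightarrow> (nat \<Rightarrow> obs) \<Rightarrow> bool" where
  "agree t x y \<longleftrightarrow> (\<forall>j. obs_W (x j) = obs_W (y j) \<and>
     (x j = y j \<or> t \<le> obs_T (x j) \<and> t \<le> obs_T (y j)))"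

definition predictable :: "(real \<Rightarrow> (nat \<Rightarrow> obs) \<Rightarrow> 'b) \<Rightarrow> bool" where
  "predictable K \<longleftrightarrow> (\<forall>t x y. agree t x y \<longrightarrow> K t x = K t y)"

text \<open>The weaker property under which the compensator formula holds for observation i: only
  this observation varies, and it is at risk at t before and after. Dependence on the other
  observations is unrestricted and may include their future, as in the proof that ties do not
  occur.\<close>

definition predictable_at :: "nat \<Rightarrow> (real \<Rightarrow> (nat \<Rightarrow> obs) \<Rightarrow> 'b) \<Rightarrow> bool" where
  "predictable_at i K \<longleftrightarrow> (\<forall>t x y. obs_W y = obs_W (x i) \<longrightarrow> t \<le> obs_T y \<longrightarrow> t \<le> obs_T (x i) \<longrightarrow>
     K t (x(i := y)) = K t x)"

lemma predictable_at: "predictable K \<Longrightarrow> predictable_at i K"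
  unfolding predictable_def predictable_at_def agree_def by auto

lemma agree_mono: "agree t x y \<Longrightarrow> s \<le> t \<Longrightarrow> agree s x y"
  unfolding agree_def by (meson order_trans)

section \<open>The compensator formula for samples\<close>

context counting_law
begin

lemma prob_space_R: "prob_space R"
  by (rule prob_space_axioms)

sublocale PP: product_prob_space "\<lambda>_::nat. R" by standard

lemma prob_space_iid: "prob_space (iid n R)"
  unfolding iid_def by (intro prob_space_PiM prob_space_R)

lemmas sets_R_cong [measurable_cong] = sets_R

lemma sets_iid [measurable_cong]: "sets (iid n R) = sets (iid n obs_space)"
  unfolding iid_def by (intro sets_PiM_cong refl sets_R)

lemma space_iid: "space (iid n R) = space (iid n obs_space)"
  by (rule sets_eq_imp_space_eq) (rule sets_iid)

lemma rate_nonneg: "0 \<le> rate \<theta>' h x t"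
  using h_nonneg[of t] by (simp add: rate_def obs_Y_def)

lemma K_nonneg: "0 \<le> K" using h_nonneg h_le order_trans by blast

lemma rate_le: "rate \<theta>' h x t \<le> indicator {0..1} t * (K * exp (\<theta>' * obs_W x))"
  using h_nonneg[of t] h_le[of t] h_outside[of t] K_nonneg
  by (auto simp: rate_def obs_Y_def split: split_indicator)

text \<open>Fubini isolates observation i. With the others fixed, the integrand depends on this
  observation only through time and covariate, so the formula for one observation applies.\<close>

lemma nn_integral_predictable:
  fixes k :: "real \<Rightarrow> (nat \<Rightarrow> obs) \<Rightarrow> ennreal"
  assumes i: "i < n" and pr: "predictable_at i k"
    and m [measurable]: "(\<lambda>z. k (fst z) (snd z)) \<in> borel_measurable (borel \<Otimes>\<^sub>M iid n obs_space)"
  shows "(\<integral>\<^sup>+x. (if ev (x i) then k (obs_T (x i)) x else 0) \<partial>iid n R) =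
    (\<integral>\<^sup>+x. (\<integral>\<^sup>+t. ennreal (rate \<theta> h (x i) t) * k t x \<partial>lborel) \<partial>iid n R)"
proof -
  let ?I = "{..<n} - {i}"
  have I: "{..<n} = insert i ?I" "finite ?I" "i \<notin> ?I" using i by auto
  note [measurable (raw)] = measurable_apply2[OF m]
  have iid: "iid n R = PiM (insert i ?I) (\<lambda>_. R)" using I(1) by (simp add: iid_def)
  have seq: "sets (PiM (insert i ?I) (\<lambda>_. R)) = sets (iid n obs_space)"
    using sets_iid[of n] iid by (simp only:)
  have split: "(\<integral>\<^sup>+x. f x \<partial>iid n R) = (\<integral>\<^sup>+x. (\<integral>\<^sup>+y. f (x(i := y)) \<partial>R) \<partial>PiM ?I (\<lambda>_. R))"
    if "f \<in> borel_measurable (iid n obs_space)" for f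
    unfolding iid
  proof (rule PP.product_nn_integral_insert[OF I(2,3)])
    show "f \<in> borel_measurable (PiM (insert i ?I) (\<lambda>_. R))"
      using that measurable_cong_sets[OF seq refl] by blast
  qed
  have "(\<integral>\<^sup>+x. (if ev (x i) then k (obs_T (x i)) x else 0) \<partial>iid n R) =
      (\<integral>\<^sup>+x. (\<integral>\<^sup>+y. (if ev y then k (obs_T y) (x(i := y)) else 0) \<partial>R) \<partial>PiM ?I (\<lambda>_. R))"
    using i by (subst split) (measurable, simp cong: if_cong)
  also have "\<dots> = (\<integral>\<^sup>+x. (\<integral>\<^sup>+y. (\<integral>\<^sup>+t. ennreal (rate \<theta> h y t) * k t (x(i := y)) \<partial>lborel) \<partial>R) \<partial>PiM ?I (\<lambda>_. R))"
  proof (rule nn_integral_cong)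
    fix x assume x: "x \<in> space (PiM ?I (\<lambda>_. R))"
    \<comment> \<open>A representative observation with covariate w that is still at risk at t. By
      \<open>predictable_at\<close> every other such observation gives the same value of
      \<open>k\<close>, both at the jump time and wherever the intensity is nonzero.\<close>
    let ?g = "\<lambda>t w. k t (x(i := (t, False, w)))"
    have upd: "(\<lambda>y. x(i := y)) \<in> obs_space \<rightarrow>\<^sub>M iid n obs_space"
      using measurable_component_update[OF x I(3)]
      using measurable_cong_sets[OF sets_R seq] by (simp only:)
    have "(\<lambda>z. (fst z, False, snd z)) \<in> borel \<Otimes>\<^sub>M borel \<rightarrow>\<^sub>M obs_space"
      unfolding obs_space_def by measurable
    from measurable_compose[OF this upd]
    have upd': "(\<lambda>z. x(i := (fst z, False, snd z))) \<in> borel \<Otimes>\<^sub>M borel \<rightarrow>\<^sub>M iid n obs_space" .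
    have "(\<integral>\<^sup>+y. (if ev y then k (obs_T y) (x(i := y)) else 0) \<partial>R) = (\<integral>\<^sup>+y. (if ev y then ?g (obs_T y) (obs_W y) else 0) \<partial>R)"
    proof (intro nn_integral_cong)
      fix y :: obs
      show "(if ev y then k (obs_T y) (x(i := y)) else 0) = (if ev y then ?g (obs_T y) (obs_W y) else 0)"
        using pr[unfolded predictable_at_def, rule_format, of y "x(i := (obs_T y, False, obs_W y))" "obs_T y"] by simp
    qed
    also have "\<dots> = (\<integral>\<^sup>+y. (\<integral>\<^sup>+t. ennreal (rate \<theta> h y t) * ?g t (obs_W y) \<partial>lborel) \<partial>R)"
      by (rule compensator) (use measurable_apply2[OF m measurable_fst upd'] in \<open>simp add: case_prod_beta'\<close>)
    also have "\<dots> = (\<integral>\<^sup>+y. (\<integral>\<^sup>+t. ennreal (rate \<theta> h y t) * k t (x(i := y)) \<partial>lborel) \<partial>R)"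
    proof (intro nn_integral_cong)
      fix y :: obs and t :: real
      show "ennreal (rate \<theta> h y t) * ?g t (obs_W y) = ennreal (rate \<theta> h y t) * k t (x(i := y))"
        using pr[unfolded predictable_at_def, rule_format, of y "x(i := (t, False, obs_W y))" t]
        by (cases "t \<le> obs_T y") (simp_all add: rate_def obs_Y_def)
    qed
    finally show "(\<integral>\<^sup>+y. (if ev y then k (obs_T y) (x(i := y)) else 0) \<partial>R) =
      (\<integral>\<^sup>+y. (\<integral>\<^sup>+t. ennreal (rate \<theta> h y t) * k t (x(i := y)) \<partial>lborel) \<partial>R)" by simp
  qed
  also have "\<dots> = (\<integral>\<^sup>+x. (\<integral>\<^sup>+t. ennreal (rate \<theta> h (x i) t) * k t x \<partial>lborel) \<partial>iid n R)"
  proof (subst split)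
    show "(\<lambda>x. \<integral>\<^sup>+t. ennreal (rate \<theta> h (x i) t) * k t x \<partial>lborel) \<in> borel_measurable (iid n obs_space)"
      using i by (intro lborel.borel_measurable_nn_integral) measurable
  qed simp
  finally show ?thesis .
qed

lemma
  fixes k :: "real \<Rightarrow> (nat \<Rightarrow> obs) \<Rightarrow> real"
  assumes i: "i < n" and pr: "predictable_at i k"
    and m [measurable]: "(\<lambda>z. k (fst z) (snd z)) \<in> borel_measurable (borel \<Otimes>\<^sub>M iid n obs_space)"
    and int: "integrable (iid n R) (\<lambda>x. if ev (x i) then k (obs_T (x i)) x else 0)"
  shows integrable_predictable: "integrable (iid n R) (\<lambda>x. LBINT t. k t x * rate \<theta> h (x i) t)"
    and integral_predictable: "(LINT x|iid n R. (if ev (x i) then k (obs_T (x i)) x else 0)) =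
      (LINT x|iid n R. (LBINT t. k t x * rate \<theta> h (x i) t))"
proof -
  interpret N: prob_space "iid n R" by (rule prob_space_iid)
  interpret NL: pair_sigma_finite "iid n R" lborel by standard
  note [measurable (raw)] = measurable_apply2[OF m]
  let ?G = "\<lambda>z. k (snd z) (fst z) * rate \<theta> h (fst z i) (snd z)"
  let ?f = "\<lambda>x. if ev (x i) then k (obs_T (x i)) x else 0"
  note [measurable] = i
  have Gm[measurable]: "?G \<in> borel_measurable (iid n R \<Otimes>\<^sub>M lborel)" by measurable
  \<comment> \<open>One identity for three choices of \<phi>: the absolute value gives
    integrability, the identity and the negation give the positive and the negative part, since
    \<open>ennreal\<close> cuts off at 0. Homogeneity in a nonnegative factor lets \<phi> pass the
    intensity.\<close>
  have key: "(\<integral>\<^sup>+z. ennreal (\<phi> (?G z)) \<partial>(iid n R \<Otimes>\<^sub>M lborel)) = (\<integral>\<^sup>+x. ennreal (\<phi> (?f x)) \<partial>iid n R)"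
    if \<phi>: "\<And>a b. 0 \<le> b \<Longrightarrow> \<phi> (a * b) = \<phi> a * b" "\<phi> 0 = 0" and [measurable]: "\<phi> \<in> borel_measurable borel" for \<phi> :: "real \<Rightarrow> real"
  proof -
    have "(\<integral>\<^sup>+z. ennreal (\<phi> (?G z)) \<partial>(iid n R \<Otimes>\<^sub>M lborel)) = (\<integral>\<^sup>+x. \<integral>\<^sup>+t. ennreal (\<phi> (?G (x, t))) \<partial>lborel \<partial>iid n R)"
      by (rule lborel.nn_integral_fst[symmetric]) measurable
    also have "\<dots> = (\<integral>\<^sup>+x. \<integral>\<^sup>+t. ennreal (rate \<theta> h (x i) t) * ennreal (\<phi> (k t x)) \<partial>lborel \<partial>iid n R)"
      using rate_nonneg by (intro nn_integral_cong) (simp add: \<phi> ennreal_mult'' mult.commute)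
    also have "\<dots> = (\<integral>\<^sup>+x. (if ev (x i) then ennreal (\<phi> (k (obs_T (x i)) x)) else 0) \<partial>iid n R)"
      using pr by (subst nn_integral_predictable[OF i]) (auto simp: predictable_at_def)
    also have "\<dots> = (\<integral>\<^sup>+x. ennreal (\<phi> (?f x)) \<partial>iid n R)"
      by (intro nn_integral_cong) (auto simp: \<phi>)
    finally show ?thesis .
  qed
  have "(\<integral>\<^sup>+z. ennreal \<bar>?G z\<bar> \<partial>(iid n R \<Otimes>\<^sub>M lborel)) = (\<integral>\<^sup>+x. ennreal \<bar>?f x\<bar> \<partial>iid n R)"
    by (rule key) (auto simp: abs_mult)
  also have "\<dots> < \<infinity>" using int by (simp add: integrable_iff_bounded)
  finally have G: "integrable (iid n R \<Otimes>\<^sub>M lborel) ?G" by (intro integrableI_bounded) auto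
  have fm: "?f \<in> borel_measurable (iid n R)" using int by (rule borel_measurable_integrable)
  have "(LINT x|iid n R. ?f x) = (LINT z|(iid n R \<Otimes>\<^sub>M lborel). ?G z)"
    using key[of "\<lambda>x. x"] key[of "\<lambda>x. - x"] by (simp add: real_lebesgue_integral_def G int)
  then show "(LINT x|iid n R. ?f x) = (LINT x|iid n R. (LBINT t. k t x * rate \<theta> h (x i) t))"
    using NL.integral_fst'[OF G] by simp
  show "integrable (iid n R) (\<lambda>x. LBINT t. k t x * rate \<theta> h (x i) t)"
    using NL.integrable_fst'[OF G] by simp
qed

end

text \<open>Here \<open>c i = H (T i)\<close>, and \<open>a\<close> is the density of the total drift of \<open>Z = \<Sum> \<integral> H dM\<close>, with primitive
  \<open>A\<close>; injectivity of \<open>T\<close> is the absence of ties.\<close>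

lemma integral_pathwise_ito:
  fixes c T :: "'i \<Rightarrow> real" and a :: "real \<Rightarrow> real"
  assumes C: "finite C" "inj_on T C" and a: "integrable lborel a"
    and A: "\<And>t. A t = (LBINT s. indicator {..<t} s * a s)"
  shows "((\<Sum>i\<in>C. c i) - (LBINT t. a t))\<^sup>2 = (\<Sum>i\<in>C. (c i)\<^sup>2)
    + 2 * (\<Sum>i\<in>C. c i * ((\<Sum>j\<in>C. if T j < T i then c j else 0) - A (T i)))
    - 2 * (LBINT t. a t * ((\<Sum>j\<in>C. if T j < t then c j else 0) - A t))"
proof -
  have [measurable]: "a \<in> borel_measurable borel" using borel_measurable_integrable[OF a] by simp
  have ia: "integrable lborel (\<lambda>s. indicator S s * a s)" if "S \<in> sets borel" for S
    using that by (intro Bochner_Integration.integrable_bound[OF a]) (auto split: split_indicator)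
  have Ab: "\<bar>A t\<bar> \<le> (LBINT s. \<bar>a s\<bar>)" for t
  proof -
    have "\<bar>A t\<bar> \<le> (LBINT s. \<bar>indicator {..<t} s * a s\<bar>)"
      unfolding A by (rule integral_abs_bound)
    also have "\<dots> \<le> (LBINT s. \<bar>a s\<bar>)"
      using a ia[of "{..<t}"] by (intro integral_mono) (auto split: split_indicator)
    finally show ?thesis .
  qed
  have Am[measurable]: "A \<in> borel_measurable borel"
  proof -
    have "(\<lambda>t. LBINT s. (if s < t then 1 else 0) * a s) \<in> borel_measurable borel" by measurable
    then show ?thesis by (subst A[THEN ext]) (simp add: indicator_def)
  qed
  have aA: "integrable lborel (\<lambda>t. a t * A t)"
    by (rule Bochner_Integration.integrable_bound[where f="\<lambda>t. a t * (LBINT s. \<bar>a s\<bar>)"])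
      (use a Ab in \<open>auto simp: abs_mult intro!: mult_left_mono AE_I2 order_trans[OF Ab abs_ge_self]\<close>)
  have tail: "(LBINT t. a t * (if T j < t then c j else 0)) = c j * ((LBINT t. a t) - A (T j))" for j
  proof -
    have "(LBINT t. a t) = (LBINT t. indicator {..<T j} t * a t + indicator {T j<..} t * a t)"
      by (intro integral_cong_AE) (auto intro: eventually_mono[OF AE_lborel_singleton[of "T j"]] split: split_indicator)
    also have "\<dots> = A (T j) + (LBINT t. indicator {T j<..} t * a t)"
      using ia by (simp add: A)
    finally have "(LBINT t. indicator {T j<..} t * a t) = (LBINT t. a t) - A (T j)" by simp
    moreover have "(LBINT t. a t * (if T j < t then c j else 0)) = (LBINT t. c j * (indicator {T j<..} t * a t))"
      by (intro Bochner_Integration.integral_cong) (auto split: split_indicator)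
    ultimately show ?thesis by simp
  qed
  have iT: "integrable lborel (\<lambda>t. a t * (if T j < t then c j else 0))" for j
    by (rule Bochner_Integration.integrable_bound[where f="\<lambda>t. a t * c j"]) (use a in auto)
  have "(LBINT t. a t * ((\<Sum>j\<in>C. if T j < t then c j else 0) - A t)) =
     (LBINT t. (\<Sum>j\<in>C. a t * (if T j < t then c j else 0)) - a t * A t)"
    by (simp add: sum_distrib_left right_diff_distrib)
  also have "\<dots> = (\<Sum>j\<in>C. c j * ((LBINT t. a t) - A (T j))) - (LBINT t. a t * A t)"
    using iT aA by (simp add: tail)
  also have "(LBINT t. a t * A t) = (LBINT t. a t)\<^sup>2 / 2"
    using integral_triangle_half_square[OF a] by (simp add: A)
  finally have 1: "(LBINT t. a t * ((\<Sum>j\<in>C. if T j < t then c j else 0) - A t)) =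
     (\<Sum>j\<in>C. c j) * (LBINT t. a t) - (\<Sum>j\<in>C. c j * A (T j)) - (LBINT t. a t)\<^sup>2 / 2"
    by (simp add: sum_subtractf right_diff_distrib sum_distrib_right)
  have 2: "(\<Sum>i\<in>C. c i * ((\<Sum>j\<in>C. if T j < T i then c j else 0) - A (T i))) =
     (\<Sum>i\<in>C. \<Sum>j\<in>C. if T j < T i then c i * c j else 0) - (\<Sum>j\<in>C. c j * A (T j))"
    by (simp add: right_diff_distrib sum_subtractf sum_distrib_left if_distrib cong: if_cong)
  \<comment> \<open>The terms \<open>c j * A (T j)\<close> occur in both sums with opposite signs
    and cancel; the rest is the expanded square, with the square of the total drift coming from the
    triangle identity.\<close>
  show ?thesis
    unfolding 1 2 power2_diff square_sum_ordered[OF C] by (simp add: algebra_simps)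
qed

lemma integrable_indicator_01 [simp]: "integrable lborel (indicator {0..1::real} :: real \<Rightarrow> real)"
  by (rule integrable_real_indicator) auto

text \<open>The integral of \<open>k\<close> over the window against the counting process of
  observation i; \<open>drift\<close> below is its compensator.\<close>

definition jump :: "(real \<Rightarrow> (nat \<Rightarrow> obs) \<Rightarrow> real) \<Rightarrow> nat \<Rightarrow> (nat \<Rightarrow> obs) \<Rightarrow> real" where
  "jump k i x = (if ev (x i) then k (obs_T (x i)) x else 0)"

section \<open>Absence of ties and the isometry\<close>

context counting_law
begin

definition drift :: "(real \<Rightarrow> (nat \<Rightarrow> obs) \<Rightarrow> real) \<Rightarrow> nat \<Rightarrow> (nat \<Rightarrow> obs) \<Rightarrow> real" where
  "drift k i x = (LBINT t. k t x * rate \<theta> h (x i) t)"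

text \<open>With the indicator that j fails at t as integrand for i, the compensator formula turns
  the probability of a tie into a time integral concentrated on the single point
  \<open>obs_T (x j)\<close>.\<close>

lemma AE_no_ties:
  assumes "i < n" "j < n" "i \<noteq> j"
  shows "AE x in iid n R. ev (x i) \<longrightarrow> ev (x j) \<longrightarrow> obs_T (x i) \<noteq> obs_T (x j)"
proof -
  let ?k = "\<lambda>t x. if ev (x j) \<and> obs_T (x j) = t then 1 else 0 :: ennreal"
  note [measurable] = assms(1,2)
  have m: "(\<lambda>z. ?k (fst z) (snd z)) \<in> borel_measurable (borel \<Otimes>\<^sub>M iid n obs_space)"
    by measurable
  have p: "predictable_at i ?k"
    unfolding predictable_at_def using assms by auto
  have "(\<integral>\<^sup>+x. (if ev (x i) then ?k (obs_T (x i)) x else 0) \<partial>iid n R) =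
    (\<integral>\<^sup>+x. (\<integral>\<^sup>+t. ennreal (rate \<theta> h (x i) t) * ?k t x \<partial>lborel) \<partial>iid n R)"
    by (rule nn_integral_predictable[OF assms(1) p m])
  also have "\<dots> = (\<integral>\<^sup>+x. 0 \<partial>iid n R)"
  proof (intro nn_integral_cong)
    fix x
    have "(\<integral>\<^sup>+t. ennreal (rate \<theta> h (x i) t) * ?k t x \<partial>lborel) = (\<integral>\<^sup>+t. 0 \<partial>(lborel::real measure))"
      by (intro nn_integral_cong_AE eventually_mono[OF AE_lborel_singleton[of "obs_T (x j)"]]) auto
    then show "(\<integral>\<^sup>+t. ennreal (rate \<theta> h (x i) t) * ?k t x \<partial>lborel) = 0" by simp
  qed
  finally have "(\<integral>\<^sup>+x. (if ev (x i) then ?k (obs_T (x i)) x else 0) \<partial>iid n R) = 0" by simp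
  moreover have "(\<lambda>x. if ev (x i) then ?k (obs_T (x i)) x else 0) \<in> borel_measurable (iid n R)"
    by measurable
  ultimately have "AE x in iid n R. (if ev (x i) then ?k (obs_T (x i)) x else 0) = 0"
    by (simp add: nn_integral_0_iff_AE)
  then show ?thesis by eventually_elim (auto split: if_splits)
qed

lemma rate_integrable:
  assumes [measurable]: "f \<in> borel_measurable borel" and b: "\<And>t. \<bar>f t\<bar> \<le> B"
  shows "integrable lborel (\<lambda>t. f t * rate \<theta>' h x t)"
proof (rule Bochner_Integration.integrable_bound[where f="\<lambda>t. indicator {0..1} t * (B * (K * exp (\<theta>' * obs_W x)))"])
  show "integrable lborel (\<lambda>t::real. indicator {0..1} t * (B * (K * exp (\<theta>' * obs_W x))) :: real)"
    by (intro integrable_mult_left integrable_indicator_01)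
  show "(\<lambda>t. f t * rate \<theta>' h x t) \<in> borel_measurable lborel" by measurable
  have "0 \<le> B" using b[of 0] by linarith
  have "\<bar>f t * rate \<theta>' h x t\<bar> \<le> B * (indicator {0..1} t * (K * exp (\<theta>' * obs_W x)))" for t
    using b[of t] rate_le[of \<theta>' x t] rate_nonneg[of \<theta>' x t] \<open>0 \<le> B\<close>
    by (auto simp: abs_mult intro!: mult_mono)
  then show "AE t in lborel. norm (f t * rate \<theta>' h x t) \<le> norm (indicator {0..1} t * (B * (K * exp (\<theta>' * obs_W x))))"
    using \<open>0 \<le> B\<close> K_nonneg by (auto intro!: AE_I2 simp: mult_ac abs_mult)
qed

text \<open>Expectations are taken in the pathwise formula. The left limit of the martingale is
  predictable, so its product with \<open>H\<close> is a legitimate integrand whose jumps and drift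
  have the same mean and cancel; the jumps of the squared integrand are exchanged for their drift.
  The second bound is there because the drift carries the factor exp (\<theta> W), which need not be
  bounded where \<open>H\<close> is.\<close>

lemma
  fixes H :: "nat \<Rightarrow> real \<Rightarrow> (nat \<Rightarrow> obs) \<Rightarrow> real"
  assumes m: "\<And>i. i < n \<Longrightarrow> (\<lambda>z. H i (fst z) (snd z)) \<in> borel_measurable (borel \<Otimes>\<^sub>M iid n obs_space)"
    and pr: "\<And>i. i < n \<Longrightarrow> predictable (H i)"
    and bd: "\<And>i t x. i < n \<Longrightarrow> \<bar>H i t x\<bar> \<le> B"
    and bd': "\<And>i t x. i < n \<Longrightarrow> \<bar>H i t x\<bar> * exp (\<theta> * obs_W (x i)) \<le> B"
  shows integrable_martingale_square: "integrable (iid n R) (\<lambda>x. (\<Sum>i<n. jump (H i) i x - drift (H i) i x)\<^sup>2)"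
    and martingale_isometry: "(LINT x|iid n R. (\<Sum>i<n. jump (H i) i x - drift (H i) i x)\<^sup>2) =
       (\<Sum>i<n. LINT x|iid n R. drift (\<lambda>t x. (H i t x)\<^sup>2) i x)"
    and integrable_drift_square: "\<And>i. i < n \<Longrightarrow> integrable (iid n R) (drift (\<lambda>t x. (H i t x)\<^sup>2) i)"
proof -
  interpret N: prob_space "iid n R" by (rule prob_space_iid)
  note Hm [measurable (raw)] = measurable_apply2[OF m]
  define a where "a t x = (\<Sum>i<n. H i t x * rate \<theta> h (x i) t)" for t x
  define A where "A t x = (LBINT s. (if s < t then 1 else 0) * a s x)" for t x
  \<comment> \<open>The strict inequality makes \<open>Z t\<close> the left limit of the martingale
    at t; with events at t included it would not be predictable.\<close>
  define Z where "Z t x = (\<Sum>j<n. if ev (x j) \<and> obs_T (x j) < t then H j (obs_T (x j)) x else 0) - A t x" for t x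
  define k where "k i t x = H i t x * Z t x" for i t x
  have am [measurable]: "(\<lambda>z. a (fst z) (snd z)) \<in> borel_measurable (borel \<Otimes>\<^sub>M iid n obs_space)"
    unfolding a_def by measurable
  note [measurable (raw)] = measurable_apply2[OF am]
  have Am [measurable]: "(\<lambda>z. A (fst z) (snd z)) \<in> borel_measurable (borel \<Otimes>\<^sub>M iid n obs_space)"
    unfolding A_def by measurable
  note [measurable (raw)] = measurable_apply2[OF Am]
  have Zm [measurable]: "(\<lambda>z. Z (fst z) (snd z)) \<in> borel_measurable (borel \<Otimes>\<^sub>M iid n obs_space)"
    unfolding Z_def by measurable
  note [measurable (raw)] = measurable_apply2[OF Zm]
  have km [measurable]: "(\<lambda>z. k i (fst z) (snd z)) \<in> borel_measurable (borel \<Otimes>\<^sub>M iid n obs_space)" if [measurable]: "i < n" for i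
    unfolding k_def by measurable
  note [measurable (raw)] = measurable_apply2[OF km]
  have H2m [measurable]: "(\<lambda>z. (H i (fst z) (snd z))\<^sup>2) \<in> borel_measurable (borel \<Otimes>\<^sub>M iid n obs_space)" if [measurable]: "i < n" for i
    by measurable
  have B0: "0 \<le> B" if "n > 0" using bd[OF that, of 0 undefined] by linarith
  have ab: "\<bar>a t x\<bar> \<le> indicator {0..1} t * (real n * (B * K))" for t x
  proof -
    have "\<bar>a t x\<bar> \<le> (\<Sum>i<n. \<bar>H i t x * rate \<theta> h (x i) t\<bar>)" unfolding a_def by (rule sum_abs)
    also have "\<dots> \<le> (\<Sum>i<n. indicator {0..1} t * (B * K))"
    proof (rule sum_mono)
      fix i assume "i \<in> {..<n}" then have i: "i < n" by simp
      have "\<bar>H i t x * rate \<theta> h (x i) t\<bar> \<le> \<bar>H i t x\<bar> * (indicator {0..1} t * (K * exp (\<theta> * obs_W (x i))))"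
        using rate_le[of \<theta> "x i" t] rate_nonneg[of \<theta> "x i" t] by (auto simp: abs_mult intro!: mult_left_mono)
      also have "\<dots> = indicator {0..1} t * ((\<bar>H i t x\<bar> * exp (\<theta> * obs_W (x i))) * K)" by simp
      also have "\<dots> \<le> indicator {0..1} t * (B * K)"
        using bd'[OF i, of t x] K_nonneg by (intro mult_left_mono mult_right_mono) auto
      finally show "\<bar>H i t x * rate \<theta> h (x i) t\<bar> \<le> indicator {0..1} t * (B * K)" .
    qed
    also have "\<dots> = indicator {0..1} t * (real n * (B * K))" by simp
    finally show ?thesis .
  qed
  have nBK: "0 \<le> real n * (B * K)" using B0 K_nonneg by (cases n) auto
  have ai: "integrable lborel (\<lambda>t. a t x)" if "x \<in> space (iid n obs_space)" for x
    by (rule Bochner_Integration.integrable_bound[where f="\<lambda>t. indicator {0..1} t * (real n * (B * K))"])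
      (use that nBK ab in \<open>auto intro!: AE_I2 order_trans[OF ab] integrable_mult_left integrable_indicator_01 simp del: mult_nonneg_nonneg\<close>)
  have Ab: "\<bar>A t x\<bar> \<le> real n * (B * K)" if "x \<in> space (iid n obs_space)" for t x
  proof -
    have "\<bar>A t x\<bar> \<le> (LBINT s. \<bar>(if s < t then 1 else 0) * a s x\<bar>)"
      unfolding A_def by (rule integral_abs_bound)
    also have "\<dots> \<le> (LBINT s. indicator {0..1::real} s * (real n * (B * K)))"
    proof (rule integral_mono')
      show "integrable lborel (\<lambda>s::real. indicator {0..1} s * (real n * (B * K)))"
        by (intro integrable_mult_left integrable_indicator_01)
      show "\<bar>(if s < t then 1 else 0) * a s x\<bar> \<le> indicator {0..1} s * (real n * (B * K))" for s
        using ab[of s x] nBK by auto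
    qed (use nBK in \<open>simp split: split_indicator\<close>)
    also have "\<dots> = real n * (B * K)" by simp
    finally show ?thesis .
  qed
  define B' where "B' = real n * B + real n * (B * K)"
  have Zb: "\<bar>Z t x\<bar> \<le> B'" if "x \<in> space (iid n obs_space)" for t x
  proof -
    have "\<bar>\<Sum>j<n. if ev (x j) \<and> obs_T (x j) < t then H j (obs_T (x j)) x else 0\<bar> \<le> (\<Sum>j<n. B)"
      by (intro order_trans[OF sum_abs] sum_mono) (use bd B0 in auto)
    then show ?thesis using Ab[OF that, of t] unfolding Z_def B'_def by simp
  qed
  have kb: "\<bar>k i t x\<bar> \<le> B * B'" if "i < n" "x \<in> space (iid n obs_space)" for i t x
    unfolding k_def abs_mult using bd[OF that(1)] Zb[OF that(2)] B0 that by (intro mult_mono) auto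
  have A_pr: "A t x = A t y" if "agree t x y" for t x y
    unfolding A_def
  proof (intro Bochner_Integration.integral_cong refl)
    fix s
    show "(if s < t then 1 else 0) * a s x = (if s < t then 1 else 0) * a s y"
    proof (cases "s < t")
      case True
      have ag: "agree s x y" using agree_mono[OF that] True by simp
      have "H i s x * rate \<theta> h (x i) s = H i s y * rate \<theta> h (y i) s" if "i < n" for i
      proof -
        have 1: "H i s x = H i s y" using pr[OF that] ag unfolding predictable_def by blast
        have "obs_W (x i) = obs_W (y i) \<and> (x i = y i \<or> s \<le> obs_T (x i) \<and> s \<le> obs_T (y i))"
          using ag unfolding agree_def by blast
        then have "rate \<theta> h (x i) s = rate \<theta> h (y i) s" by (auto simp: rate_def obs_Y_def)
        with 1 show ?thesis by simp
      qed
      then show ?thesis unfolding a_def by simp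
    qed simp
  qed
  have Z_pr: "Z t x = Z t y" if ag: "agree t x y" for t x y
  proof -
    have "(if ev (x j) \<and> obs_T (x j) < t then H j (obs_T (x j)) x else 0) =
      (if ev (y j) \<and> obs_T (y j) < t then H j (obs_T (y j)) y else 0)" if j: "j < n" for j
    proof (cases "x j = y j")
      case True
      then show ?thesis
        using pr[OF j] agree_mono[OF ag, of "obs_T (x j)"] by (auto simp: predictable_def)
    next
      case False
      then have "t \<le> obs_T (x j)" "t \<le> obs_T (y j)" using ag by (auto simp: agree_def)
      then show ?thesis by auto
    qed
    then show ?thesis unfolding Z_def using A_pr[OF ag] by simp
  qed
  have k_pr: "predictable_at i (k i)" if "i < n" for i
    using pr[OF that] Z_pr by (intro predictable_at) (auto simp: predictable_def k_def)
  have jm: "jump (k i) i \<in> borel_measurable (iid n R)" if [measurable]: "i < n" for i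
    unfolding jump_def[abs_def] k_def by measurable
  have jb: "\<bar>jump (k i) i x\<bar> \<le> B * B'" if "i < n" "x \<in> space (iid n obs_space)" for i x
    using kb[OF that] order_trans[OF abs_ge_zero kb[OF that]] by (auto simp: jump_def)
  have ji: "integrable (iid n R) (jump (k i) i)" if "i < n" for i
  proof (rule N.integrable_const_bound[where B="B * B'"])
    show "AE x in iid n R. norm (jump (k i) i x) \<le> B * B'"
      using jb[OF that] by (intro AE_I2) (simp add: space_iid)
  qed (rule jm[OF that])
  have H2_pr: "predictable_at i (\<lambda>t x. (H i t x)\<^sup>2)" if "i < n" for i
    using pr[OF that] by (intro predictable_at) (auto simp: predictable_def)
  have jm2: "jump (\<lambda>t x. (H i t x)\<^sup>2) i \<in> borel_measurable (iid n R)" if [measurable]: "i < n" for i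
    unfolding jump_def[abs_def] by measurable
  have ji2: "integrable (iid n R) (jump (\<lambda>t x. (H i t x)\<^sup>2) i)" if "i < n" for i
    by (rule N.integrable_const_bound[where B="B\<^sup>2"])
      (use jm2[OF that] power_mono[OF bd[OF that] abs_ge_zero, of _ _ 2] in \<open>simp_all add: jump_def\<close>)
  have di: "integrable (iid n R) (drift (k i) i)" and de: "(LINT x|iid n R. jump (k i) i x) = (LINT x|iid n R. drift (k i) i x)" if "i < n" for i
    using integrable_predictable[OF that k_pr[OF that] km[OF that]] integral_predictable[OF that k_pr[OF that] km[OF that]] ji[OF that]
    unfolding jump_def[abs_def] drift_def[abs_def] by auto
  have di2: "integrable (iid n R) (drift (\<lambda>t x. (H i t x)\<^sup>2) i)"
    and de2: "(LINT x|iid n R. jump (\<lambda>t x. (H i t x)\<^sup>2) i x) = (LINT x|iid n R. drift (\<lambda>t x. (H i t x)\<^sup>2) i x)" if "i < n" for i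
    using integrable_predictable[OF that H2_pr[OF that] H2m[OF that]] integral_predictable[OF that H2_pr[OF that] H2m[OF that]] ji2[OF that]
    unfolding jump_def[abs_def] drift_def[abs_def] by auto
  show "\<And>i. i < n \<Longrightarrow> integrable (iid n R) (drift (\<lambda>t x. (H i t x)\<^sup>2) i)" by (rule di2)
  let ?S = "\<lambda>x. (\<Sum>i<n. jump (\<lambda>t x. (H i t x)\<^sup>2) i x) + 2 * (\<Sum>i<n. jump (k i) i x) - 2 * (\<Sum>i<n. drift (k i) i x)"
  have path: "(\<Sum>i<n. jump (H i) i x - drift (H i) i x)\<^sup>2 = ?S x"
    if x: "x \<in> space (iid n obs_space)" and nt: "\<forall>i<n. \<forall>j<n. i \<noteq> j \<longrightarrow> ev (x i) \<longrightarrow> ev (x j) \<longrightarrow> obs_T (x i) \<noteq> obs_T (x j)" for x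
  proof -
    let ?C = "{i. i < n \<and> ev (x i)}"
    have C: "finite ?C" "inj_on (\<lambda>i. obs_T (x i)) ?C" using nt by (auto simp: inj_on_def)
    have C_sum: "(\<Sum>i<n. if ev (x i) \<and> P i then f i else 0) = (\<Sum>i\<in>?C. if P i then f i else 0)" for P and f :: "nat \<Rightarrow> real"
      by (intro sum.mono_neutral_cong_right) auto
    have j_sum: "(\<Sum>i<n. jump (K i) i x) = (\<Sum>i\<in>?C. K i (obs_T (x i)) x)" for K
      using C_sum[of "\<lambda>_. True"] by (simp add: jump_def)
    have hi: "integrable lborel (\<lambda>t. H i t x * rate \<theta> h (x i) t)" if "i < n" for i
      using that x by (intro rate_integrable[where B=B] bd) auto
    have drift_sum: "(\<Sum>i<n. drift (H i) i x) = (LBINT t. a t x)"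
      unfolding drift_def a_def using hi by simp
    have kdrift: "(\<Sum>i<n. drift (k i) i x) = (LBINT t. a t x * Z t x)"
    proof -
      have "(\<Sum>i<n. drift (k i) i x) = (LBINT t. (\<Sum>i<n. k i t x * rate \<theta> h (x i) t))"
        unfolding drift_def using x
        by (subst Bochner_Integration.integral_sum) (auto intro!: rate_integrable[where B="B * B'"] kb)
      then show ?thesis by (simp add: a_def k_def sum_distrib_right sum_distrib_left mult_ac)
    qed
    have Zx: "Z t x = (\<Sum>j\<in>?C. if obs_T (x j) < t then H j (obs_T (x j)) x else 0) - A t x" for t
      unfolding Z_def by (simp add: C_sum)
    have "(\<Sum>i<n. jump (H i) i x - drift (H i) i x)\<^sup>2 =
      ((\<Sum>i\<in>?C. H i (obs_T (x i)) x) - (LBINT t. a t x))\<^sup>2"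
      by (simp add: sum_subtractf drift_sum j_sum)
    also have "\<dots> = ?S x"
      unfolding j_sum kdrift k_def Zx
      by (rule integral_pathwise_ito[OF C ai[OF x], where A="\<lambda>t. A t x"]) (simp add: A_def indicator_def of_bool_def)
    finally show ?thesis .
  qed
  have ae: "AE x in iid n R. (\<Sum>i<n. jump (H i) i x - drift (H i) i x)\<^sup>2 = ?S x"
  proof -
    have "AE x in iid n R. \<forall>i<n. \<forall>j<n. i \<noteq> j \<longrightarrow> ev (x i) \<longrightarrow> ev (x j) \<longrightarrow> obs_T (x i) \<noteq> obs_T (x j)"
    proof -
      have "AE x in iid n R. \<forall>p\<in>{..<n} \<times> {..<n}. fst p \<noteq> snd p \<longrightarrow> ev (x (fst p)) \<longrightarrow> ev (x (snd p)) \<longrightarrow> obs_T (x (fst p)) \<noteq> obs_T (x (snd p))"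
        by (rule AE_finite_allI) (auto intro: AE_no_ties)
      then show ?thesis by eventually_elim auto
    qed
    then show ?thesis using AE_space by eventually_elim (use path space_iid in auto)
  qed
  have s1: "integrable (iid n R) (\<lambda>x. \<Sum>i<n. jump (\<lambda>t x. (H i t x)\<^sup>2) i x)"
    and s2: "integrable (iid n R) (\<lambda>x. \<Sum>i<n. jump (k i) i x)"
    and s3: "integrable (iid n R) (\<lambda>x. \<Sum>i<n. drift (k i) i x)"
    by (rule Bochner_Integration.integrable_sum, simp add: ji ji2 di)+
  have Si: "integrable (iid n R) ?S"
    using s1 s2 s3 by simp
  have Sm: "(\<lambda>x. (\<Sum>i<n. jump (H i) i x - drift (H i) i x)\<^sup>2) \<in> borel_measurable (iid n R)"
    unfolding jump_def drift_def by measurable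
  show "integrable (iid n R) (\<lambda>x. (\<Sum>i<n. jump (H i) i x - drift (H i) i x)\<^sup>2)"
    by (rule integrable_cong_AE_imp[OF Si Sm]) (use ae in \<open>auto elim: eventually_mono\<close>)
  have "(LINT x|iid n R. (\<Sum>i<n. jump (H i) i x - drift (H i) i x)\<^sup>2) = (LINT x|iid n R. ?S x)"
    by (rule integral_cong_AE[OF Sm _ ae]) (use Si in auto)
  also have "\<dots> = (\<Sum>i<n. LINT x|iid n R. jump (\<lambda>t x. (H i t x)\<^sup>2) i x) + 2 * (\<Sum>i<n. LINT x|iid n R. jump (k i) i x)
      - 2 * (\<Sum>i<n. LINT x|iid n R. drift (k i) i x)"
    using s1 s2 s3 by (simp add: Bochner_Integration.integral_sum ji ji2 di)
  also have "\<dots> = (\<Sum>i<n. LINT x|iid n R. drift (\<lambda>t x. (H i t x)\<^sup>2) i x)"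
    using de de2 by simp
  finally show "(LINT x|iid n R. (\<Sum>i<n. jump (H i) i x - drift (H i) i x)\<^sup>2) =
       (\<Sum>i<n. LINT x|iid n R. drift (\<lambda>t x. (H i t x)\<^sup>2) i x)" .
qed

subsection \<open>Nonnegative form of the isometry and single-observation integrals\<close>

lemma measurable_RI: "f \<in> obs_space \<rightarrow>\<^sub>M N \<Longrightarrow> f \<in> R \<rightarrow>\<^sub>M N"
  using measurable_cong_sets[OF sets_R refl] by blast

text \<open>With nonnegative integrals and the time integral kept inside, pointwise estimates and
  monotone convergence can be applied to both sides without integrability side conditions.\<close>

lemma nn_martingale_isometry:
  fixes H :: "nat \<Rightarrow> real \<Rightarrow> (nat \<Rightarrow> obs) \<Rightarrow> real"
  assumes m: "\<And>i. i < n \<Longrightarrow> (\<lambda>z. H i (fst z) (snd z)) \<in> borel_measurable (borel \<Otimes>\<^sub>M iid n obs_space)"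
    and pr: "\<And>i. i < n \<Longrightarrow> predictable (H i)"
    and bd: "\<And>i t x. i < n \<Longrightarrow> \<bar>H i t x\<bar> \<le> B"
    and bd': "\<And>i t x. i < n \<Longrightarrow> \<bar>H i t x\<bar> * exp (\<theta> * obs_W (x i)) \<le> B"
  shows "(\<integral>\<^sup>+x. ennreal ((\<Sum>i<n. jump (H i) i x - drift (H i) i x)\<^sup>2) \<partial>iid n R) =
       (\<integral>\<^sup>+x. (\<integral>\<^sup>+t. ennreal (\<Sum>i<n. (H i t x)\<^sup>2 * rate \<theta> h (x i) t) \<partial>lborel) \<partial>iid n R)"
proof -
  note [measurable (raw)] = measurable_apply2[OF m]
  have d0: "0 \<le> drift (\<lambda>t x. (H i t x)\<^sup>2) i x" for i x
    unfolding drift_def using rate_nonneg by (auto intro!: Bochner_Integration.integral_nonneg)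
  have sq: "\<bar>(H i t x)\<^sup>2\<bar> \<le> B\<^sup>2" if "i < n" for i t x
    using power_mono[OF bd[OF that] abs_ge_zero, of _ _ 2] by simp
  have hi: "integrable lborel (\<lambda>t. (H i t x)\<^sup>2 * rate \<theta> h (x i) t)" if "i < n" "x \<in> space (iid n R)" for i x
    using that by (intro rate_integrable[where B="B\<^sup>2"] sq) (auto simp: space_iid)
  have "(\<integral>\<^sup>+x. ennreal ((\<Sum>i<n. jump (H i) i x - drift (H i) i x)\<^sup>2) \<partial>iid n R) =
    ennreal (LINT x|iid n R. (\<Sum>i<n. jump (H i) i x - drift (H i) i x)\<^sup>2)"
    by (rule nn_integral_eq_integral[OF integrable_martingale_square[OF assms]]) auto
  also have "\<dots> = ennreal (LINT x|iid n R. (\<Sum>i<n. drift (\<lambda>t x. (H i t x)\<^sup>2) i x))"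
    using integrable_drift_square[OF assms]
    by (subst martingale_isometry[OF assms]) (auto simp: Bochner_Integration.integral_sum)
  also have "\<dots> = (\<integral>\<^sup>+x. ennreal (\<Sum>i<n. drift (\<lambda>t x. (H i t x)\<^sup>2) i x) \<partial>iid n R)"
    using integrable_drift_square[OF assms] d0
    by (intro nn_integral_eq_integral[symmetric]) (auto intro!: AE_I2 sum_nonneg)
  also have "\<dots> = (\<integral>\<^sup>+x. (\<integral>\<^sup>+t. ennreal (\<Sum>i<n. (H i t x)\<^sup>2 * rate \<theta> h (x i) t) \<partial>lborel) \<partial>iid n R)"
  proof (rule nn_integral_cong)
    fix x assume x: "x \<in> space (iid n R)"
    have "(\<Sum>i<n. drift (\<lambda>t x. (H i t x)\<^sup>2) i x) = (LBINT t. \<Sum>i<n. (H i t x)\<^sup>2 * rate \<theta> h (x i) t)"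
      unfolding drift_def using hi x by (subst Bochner_Integration.integral_sum) auto
    then show "ennreal (\<Sum>i<n. drift (\<lambda>t x. (H i t x)\<^sup>2) i x) = (\<integral>\<^sup>+t. ennreal (\<Sum>i<n. (H i t x)\<^sup>2 * rate \<theta> h (x i) t) \<partial>lborel)"
      using hi x by (subst nn_integral_eq_integral)
        (auto intro!: AE_I2 sum_nonneg mult_nonneg_nonneg rate_nonneg)
  qed
  finally show ?thesis .
qed

lemma distr_iid_component: "i < n \<Longrightarrow> distr (iid n R) R (\<lambda>x. x i) = R"
  unfolding iid_def by (rule distr_PiM_component) (auto intro: prob_space_R)

lemma component_measurable: "i < n \<Longrightarrow> (\<lambda>x. x i) \<in> iid n R \<rightarrow>\<^sub>M R"
  unfolding iid_def by (rule measurable_component_singleton) auto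

lemma nn_integral_iid_component:
  "i < n \<Longrightarrow> f \<in> borel_measurable R \<Longrightarrow> (\<integral>\<^sup>+x. f (x i) \<partial>iid n R) = (\<integral>\<^sup>+x. f x \<partial>R)"
  using nn_integral_distr[OF component_measurable, of i n f] distr_iid_component[of i n] by simp

lemma integral_iid_component:
  "i < n \<Longrightarrow> f \<in> borel_measurable R \<Longrightarrow> (LINT x|iid n R. f (x i)) = (LINT x|R. f x :: real)"
  using integral_distr[OF component_measurable, of i n f] distr_iid_component[of i n] by simp

lemma integrable_iid_component:
  "i < n \<Longrightarrow> integrable R (f :: obs \<Rightarrow> real) \<Longrightarrow> integrable (iid n R) (\<lambda>x. f (x i))"
  using integrable_distr[OF component_measurable, of i n f] distr_iid_component[of i n] by simp

text \<open>The integral of \<open>f t W\<close> against the martingale of one observation. The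
  nuisance scores and the efficient score are of this form, the score for \<theta> almost
  everywhere.\<close>

definition mart :: "(real \<Rightarrow> real \<Rightarrow> real) \<Rightarrow> obs \<Rightarrow> real" where
  "mart f x = (if ev x then f (obs_T x) (obs_W x) else 0) - (LBINT t. f t (obs_W x) * rate \<theta> h x t)"

lemma mart_measurable [measurable]:
  assumes m: "(\<lambda>z. f (fst z) (snd z)) \<in> borel_measurable (borel \<Otimes>\<^sub>M borel)"
  shows "mart f \<in> borel_measurable obs_space"
proof -
  note [measurable (raw)] = measurable_apply2[OF m]
  show ?thesis unfolding mart_def[abs_def] by measurable
qed

text \<open>A sample of size one brings the formula for samples back to \<open>R\<close>; an
  integrand that depends on time and covariate only is predictable.\<close>

lemma
  assumes m: "(\<lambda>z. f (fst z) (snd z)) \<in> borel_measurable (borel \<Otimes>\<^sub>M borel)"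
    and b: "\<And>t w. \<bar>f t w\<bar> \<le> q w" and q: "integrable R (\<lambda>x. q (obs_W x))"
  shows integrable_mart: "integrable R (mart f)" and integral_mart: "(LINT x|R. mart f x) = 0"
proof -
  note [measurable (raw)] = measurable_apply2[OF m]
  have lt: "(0::nat) < 1" by simp
  let ?k = "\<lambda>t (x :: nat \<Rightarrow> obs). f t (obs_W (x 0))"
  have km: "(\<lambda>z. ?k (fst z) (snd z)) \<in> borel_measurable (borel \<Otimes>\<^sub>M iid 1 obs_space)"
    using lt by measurable
  have kp: "predictable_at 0 ?k" by (auto simp: predictable_at_def)
  have i0: "integrable R (\<lambda>x. if ev x then f (obs_T x) (obs_W x) else 0)"
  proof (rule Bochner_Integration.integrable_bound[OF q])
    show "AE x in R. norm (if ev x then f (obs_T x) (obs_W x) else 0) \<le> norm (q (obs_W x))"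
    proof (rule AE_I2)
      fix x :: obs show "norm (if ev x then f (obs_T x) (obs_W x) else 0) \<le> norm (q (obs_W x))"
        using b[of "obs_T x" "obs_W x"] by auto
    qed
  qed (rule measurable_RI, measurable)
  have i1: "integrable (iid 1 R) (\<lambda>x. if ev (x 0) then ?k (obs_T (x 0)) x else 0)"
    using integrable_iid_component[OF _ i0, of 0 1] by simp
  have dm: "(\<lambda>x. LBINT t. f t (obs_W x) * rate \<theta> h x t) \<in> borel_measurable R" by (rule measurable_RI) measurable
  have "integrable (iid 1 R) (\<lambda>x. LBINT t. ?k t x * rate \<theta> h (x 0) t)"
    by (rule integrable_predictable[OF _ kp km i1]) simp
  then have "integrable (distr (iid 1 R) R (\<lambda>x. x 0)) (\<lambda>x. LBINT t. f t (obs_W x) * rate \<theta> h x t)"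
    by (subst integrable_distr_eq[OF component_measurable dm]) auto
  then have i2: "integrable R (\<lambda>x. LBINT t. f t (obs_W x) * rate \<theta> h x t)"
    by (simp add: distr_iid_component)
  have "(LINT x|iid 1 R. (if ev (x 0) then ?k (obs_T (x 0)) x else 0)) = (LINT x|iid 1 R. (LBINT t. ?k t x * rate \<theta> h (x 0) t))"
    by (rule integral_predictable[OF _ kp km i1]) simp
  then have "(LINT x|R. (if ev x then f (obs_T x) (obs_W x) else 0)) = (LINT x|R. (LBINT t. f t (obs_W x) * rate \<theta> h x t))"
    using integral_iid_component[OF _ borel_measurable_integrable[OF i0], of 0 1] integral_iid_component[OF _ dm, of 0 1] by simp
  then show "(LINT x|R. mart f x) = 0" unfolding mart_def using i0 i2 by simp
  show "integrable R (mart f)" unfolding mart_def[abs_def] using i0 i2 by simp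
qed

text \<open>The isometry is applied on the event that W and its bound \<open>q W\<close> are at most
  m. This event concerns the covariate only, so its indicator factors out of \<open>mart\<close>,
  and monotone convergence in m removes it.\<close>

lemma nn_integral_mart_square:
  assumes m: "(\<lambda>z. f (fst z) (snd z)) \<in> borel_measurable (borel \<Otimes>\<^sub>M borel)"
    and b: "\<And>t w. \<bar>f t w\<bar> \<le> q w" and q: "q \<in> borel_measurable borel"
  shows "(\<integral>\<^sup>+x. ennreal ((mart f x)\<^sup>2) \<partial>R) =
    (\<integral>\<^sup>+x. (\<integral>\<^sup>+t. ennreal ((f t (obs_W x))\<^sup>2 * rate \<theta> h x t) \<partial>lborel) \<partial>R)"
proof -
  note [measurable (raw)] = measurable_apply2[OF m]
  note [measurable] = q
  define S where "S m w \<longleftrightarrow> \<bar>w\<bar> \<le> real m \<and> q w \<le> real m" for m :: nat and w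
  have Sm [measurable]: "Measurable.pred borel (S m)" for m unfolding S_def[abs_def] by measurable
  have S_inc: "S m w \<Longrightarrow> m \<le> m' \<Longrightarrow> S m' w" for m m' w by (auto simp: S_def)
  have S_ex: "\<exists>m. S m w" for w
    using real_arch_simple[of "max \<bar>w\<bar> (q w)"] by (auto simp: S_def)
  have dm [measurable]: "(\<lambda>x. \<integral>\<^sup>+t. ennreal ((f t (obs_W x))\<^sup>2 * rate \<theta> h x t) \<partial>lborel) \<in> borel_measurable R"
    by (rule lborel.borel_measurable_nn_integral) measurable
  have mm [measurable]: "mart f \<in> borel_measurable R"
    using mart_measurable[OF m] measurable_cong_sets[OF sets_R refl] by blast
  have eq: "(\<integral>\<^sup>+x. (if S m (obs_W x) then ennreal ((mart f x)\<^sup>2) else 0) \<partial>R) =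
     (\<integral>\<^sup>+x. (if S m (obs_W x) then (\<integral>\<^sup>+t. ennreal ((f t (obs_W x))\<^sup>2 * rate \<theta> h x t) \<partial>lborel) else 0) \<partial>R)" for m
  proof -
    have lt: "(0::nat) < 1" by simp
    let ?H = "\<lambda>(i::nat) t (x :: nat \<Rightarrow> obs). if S m (obs_W (x 0)) then f t (obs_W (x 0)) else 0"
    \<comment> \<open>Dominates the truncated integrand both alone and multiplied by exp (\<theta>
      W).\<close>
    let ?B = "real m * exp (\<bar>\<theta>\<bar> * real m)"
    have bd: "\<bar>?H i t x\<bar> \<le> real m" for i t x using b[of t "obs_W (x 0)"] by (auto simp: S_def)
    have e1: "exp (\<bar>\<theta>\<bar> * real m) \<ge> 1" by simp
    have iso: "(\<integral>\<^sup>+x. ennreal ((\<Sum>i<1. jump (?H i) i x - drift (?H i) i x)\<^sup>2) \<partial>iid 1 R) =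
       (\<integral>\<^sup>+x. (\<integral>\<^sup>+t. ennreal (\<Sum>i<1. (?H i t x)\<^sup>2 * rate \<theta> h (x i) t) \<partial>lborel) \<partial>iid 1 R)"
    proof (rule nn_martingale_isometry[where B="?B"])
      show "predictable (?H i)" for i :: nat by (auto simp: predictable_def agree_def)
      show "(\<lambda>z. ?H i (fst z) (snd z)) \<in> borel_measurable (borel \<Otimes>\<^sub>M iid 1 obs_space)" for i :: nat
        using lt by measurable
      show "\<bar>?H i t x\<bar> \<le> ?B" for i :: nat and t x
      proof (rule order_trans)
        show "\<bar>?H i t x\<bar> \<le> real m" by (rule bd)
        show "real m \<le> ?B" using mult_left_mono[OF e1, of "real m"] by simp
      qed
      show "\<bar>?H i t x\<bar> * exp (\<theta> * obs_W (x i)) \<le> ?B" if "i < 1" for i :: nat and t x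
      proof (cases "S m (obs_W (x 0))")
        case True
        then have "\<theta> * obs_W (x 0) \<le> \<bar>\<theta>\<bar> * real m"
          using mult_left_mono[of "\<bar>obs_W (x 0)\<bar>" "real m" "\<bar>\<theta>\<bar>"] abs_ge_self[of "\<theta> * obs_W (x 0)"]
          by (simp add: abs_mult S_def)
        then have "exp (\<theta> * obs_W (x i)) \<le> exp (\<bar>\<theta>\<bar> * real m)" using that by simp
        then show ?thesis by (rule mult_mono[OF bd]) simp_all
      qed simp
    qed
    have c2: "(\<Sum>i<1. jump (?H i) i x - drift (?H i) i x) = (if S m (obs_W (x 0)) then mart f (x 0) else 0)" for x
      using lessThan_Suc[of 0] by (simp add: jump_def drift_def mart_def)
    have c3: "(\<integral>\<^sup>+t. ennreal (\<Sum>i<1. (?H i t x)\<^sup>2 * rate \<theta> h (x i) t) \<partial>lborel) =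
        (if S m (obs_W (x 0)) then (\<integral>\<^sup>+t. ennreal ((f t (obs_W (x 0)))\<^sup>2 * rate \<theta> h (x 0) t) \<partial>lborel) else 0)" for x
      by simp
    have "(\<integral>\<^sup>+x. (if S m (obs_W (x 0)) then ennreal ((mart f (x 0))\<^sup>2) else 0) \<partial>iid 1 R) =
      (\<integral>\<^sup>+x. (if S m (obs_W (x 0)) then (\<integral>\<^sup>+t. ennreal ((f t (obs_W (x 0)))\<^sup>2 * rate \<theta> h (x 0) t) \<partial>lborel) else 0) \<partial>iid 1 R)"
    proof -
      have 1: "ennreal ((if P then a else 0)\<^sup>2) = (if P then ennreal (a\<^sup>2) else 0)" for P and a :: real by simp
      show ?thesis
        using iso unfolding c2 c3 1 .
    qed
    moreover have "(\<lambda>x. if S m (obs_W x) then ennreal ((mart f x)\<^sup>2) else 0) \<in> borel_measurable R"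
      "(\<lambda>x. if S m (obs_W x) then (\<integral>\<^sup>+t. ennreal ((f t (obs_W x))\<^sup>2 * rate \<theta> h x t) \<partial>lborel) else 0) \<in> borel_measurable R"
      by measurable
    ultimately show ?thesis
      using nn_integral_iid_component[OF lt, of "\<lambda>x. if S m (obs_W x) then ennreal ((mart f x)\<^sup>2) else 0"]
        nn_integral_iid_component[OF lt, of "\<lambda>x. if S m (obs_W x) then (\<integral>\<^sup>+t. ennreal ((f t (obs_W x))\<^sup>2 * rate \<theta> h x t) \<partial>lborel) else 0"]
      by (simp only:)
  qed
  have lim: "(\<lambda>m. \<integral>\<^sup>+x. (if S m (obs_W x) then g x else 0) \<partial>R) \<longlonglongrightarrow> (\<integral>\<^sup>+x. g x \<partial>R)"
    if [measurable]: "g \<in> borel_measurable R" for g :: "obs \<Rightarrow> ennreal"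
  proof (rule nn_integral_LIMSEQ)
    show "incseq (\<lambda>m x. if S m (obs_W x) then g x else 0)"
      using S_inc by (auto simp: incseq_def le_fun_def)
    show "(\<lambda>m. if S m (obs_W x) then g x else 0) \<longlonglongrightarrow> g x" for x
    proof -
      obtain m where "S m (obs_W x)" using S_ex by auto
      then have "\<forall>\<^sub>F k in sequentially. (if S k (obs_W x) then g x else 0) = g x"
        using S_inc by (auto simp: eventually_sequentially)
      then show ?thesis by (rule tendsto_eventually)
    qed
  qed measurable
  have mm2: "(\<lambda>x. ennreal ((mart f x)\<^sup>2)) \<in> borel_measurable R" by measurable
  show ?thesis
    using lim[OF mm2, unfolded eq] lim[OF dm] by (rule LIMSEQ_unique)
qed

section \<open>Sums of independent observations\<close>

lemma iid_sum_square:
  fixes u :: "obs \<Rightarrow> real"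
  assumes u: "integrable R u" and u2: "integrable R (\<lambda>x. (u x)\<^sup>2)" and mean: "(LINT x|R. u x) = 0"
  shows "integrable (iid n R) (\<lambda>x. (\<Sum>i<n. u (x i))\<^sup>2)"
    and "(LINT x|iid n R. (\<Sum>i<n. u (x i))\<^sup>2) = real n * (LINT x|R. (u x)\<^sup>2)"
proof -
  have um: "u \<in> borel_measurable R" using u by (rule borel_measurable_integrable)
  have off: "integrable (iid n R) (\<lambda>x. u (x i) * u (x j))"
    "(LINT x|iid n R. u (x i) * u (x j)) = (if i = j then (LINT x|R. (u x)\<^sup>2) else 0)" if "i < n" "j < n" for i j
  proof -
    have "integrable (iid n R) (\<lambda>x. u (x i) * u (x j)) \<and>
      (LINT x|iid n R. u (x i) * u (x j)) = (if i = j then (LINT x|R. (u x)\<^sup>2) else 0)"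
    proof (cases "i = j")
      case True
      then show ?thesis
        using that integrable_iid_component[OF _ u2, of i n] integral_iid_component[OF that(1) borel_measurable_integrable[OF u2]]
        by (simp add: power2_eq_square)
    next
      case False
      \<comment> \<open>The factor 1 in all coordinates but i and j makes the product of two terms a
        product over the whole sample, to which the integral formula for product measures
        applies.\<close>
      let ?F = "\<lambda>k. if k = i \<or> k = j then u else (\<lambda>_. 1)"
      have prod: "(\<Prod>k<n. ?F k (x k)) = u (x i) * u (x j)" for x
      proof -
        have "(\<Prod>k<n. ?F k (x k)) = (\<Prod>k\<in>{i, j}. ?F k (x k))"
          using that by (intro prod.mono_neutral_right) auto
        then show ?thesis using False by simp
      qed
      have "(LINT x|PiM {..<n} (\<lambda>_. R). (\<Prod>k<n. ?F k (x k))) = (\<Prod>k<n. LINT x|R. ?F k x)"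
        by (rule PP.product_integral_prod) (auto intro: u)
      also have "\<dots> = 0" using that mean by (intro prod_zero) auto
      finally have 1: "(LINT x|iid n R. u (x i) * u (x j)) = 0" by (simp add: prod iid_def)
      have "integrable (PiM {..<n} (\<lambda>_. R)) (\<lambda>x. \<Prod>k<n. ?F k (x k))"
        by (rule PP.product_integrable_prod) (auto intro: u)
      then have "integrable (iid n R) (\<lambda>x. u (x i) * u (x j))" by (simp add: prod iid_def)
      with 1 False show ?thesis by simp
    qed
    then show "integrable (iid n R) (\<lambda>x. u (x i) * u (x j))"
      "(LINT x|iid n R. u (x i) * u (x j)) = (if i = j then (LINT x|R. (u x)\<^sup>2) else 0)" by auto
  qed
  have eq: "(\<Sum>i<n. u (x i))\<^sup>2 = (\<Sum>i<n. \<Sum>j<n. u (x i) * u (x j))" for x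
    by (simp add: power2_eq_square sum_product)
  show "integrable (iid n R) (\<lambda>x. (\<Sum>i<n. u (x i))\<^sup>2)"
    unfolding eq using off by (intro Bochner_Integration.integrable_sum) auto
  have "(LINT x|iid n R. (\<Sum>i<n. u (x i))\<^sup>2) = (\<Sum>i<n. \<Sum>j<n. LINT x|iid n R. u (x i) * u (x j))"
  proof -
    have "(LINT x|iid n R. (\<Sum>i<n. u (x i))\<^sup>2) = (\<Sum>i<n. LINT x|iid n R. (\<Sum>j<n. u (x i) * u (x j)))"
      unfolding eq using off by (intro Bochner_Integration.integral_sum Bochner_Integration.integrable_sum) auto
    also have "\<dots> = (\<Sum>i<n. \<Sum>j<n. LINT x|iid n R. u (x i) * u (x j))"
      using off by (intro sum.cong refl Bochner_Integration.integral_sum) auto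
    finally show ?thesis .
  qed
  also have "\<dots> = real n * (LINT x|R. (u x)\<^sup>2)"
    using off by (simp add: sum.delta)
  finally show "(LINT x|iid n R. (\<Sum>i<n. u (x i))\<^sup>2) = real n * (LINT x|R. (u x)\<^sup>2)" .
qed

text \<open>The part of \<open>f\<close> where \<open>g\<close> is at most A has variance at most
  A^2, hence contributes A / sqrt n. The rest is dominated by the tail of \<open>g\<close>, once for
  the sample mean and once for the expectation. The bound is explicit because the law will vary with
  n.\<close>

lemma L1_law_of_large_numbers:
  fixes f g :: "obs \<Rightarrow> real"
  assumes fm: "f \<in> borel_measurable R" and g: "integrable R g" and fg: "\<And>x. \<bar>f x\<bar> \<le> g x"
    and A: "0 < A" and n: "0 < n"
  shows "(\<integral>\<^sup>+x. ennreal \<bar>(\<Sum>i<n. f (x i)) / n - (LINT x|R. f x)\<bar> \<partial>iid n R) \<le>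
    ennreal (A / sqrt n + 2 * (LINT x|R. (if g x \<le> A then 0 else g x)))"
proof -
  interpret N: prob_space "iid n R" by (rule prob_space_iid)
  note [measurable] = fm borel_measurable_integrable[OF g]
  define fa where "fa x = (if g x \<le> A then f x else 0)" for x
  define v where "v x = f x - fa x" for x
  define u where "u x = fa x - (LINT y|R. fa y)" for x
  define \<gamma> where "\<gamma> x = (if g x \<le> A then 0 else g x)" for x
  have g0: "0 \<le> g x" for x using fg[of x] by linarith
  have [measurable]: "fa \<in> borel_measurable R" "v \<in> borel_measurable R" "u \<in> borel_measurable R" "\<gamma> \<in> borel_measurable R"
    unfolding fa_def[abs_def] v_def[abs_def] u_def[abs_def] \<gamma>_def[abs_def] by measurable
  have fab: "\<bar>fa x\<bar> \<le> A" for x using fg[of x] A by (auto simp: fa_def)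
  have fai: "integrable R fa" by (rule integrable_const_bound[where B=A]) (auto simp: fab)
  have fi: "integrable R f" by (rule Bochner_Integration.integrable_bound[OF g]) (auto intro!: AE_I2 order_trans[OF fg])
  have vi: "integrable R v" unfolding v_def[abs_def] using fi fai by simp
  have \<gamma>i: "integrable R \<gamma>" by (rule Bochner_Integration.integrable_bound[OF g]) (auto simp: \<gamma>_def g0)
  have v\<gamma>: "\<bar>v x\<bar> \<le> \<gamma> x" for x using fg[of x] by (auto simp: v_def fa_def \<gamma>_def)
  have fa2: "integrable R (\<lambda>x. (fa x)\<^sup>2)"
    by (rule integrable_const_bound[where B="A\<^sup>2"]) (use power_mono[OF fab abs_ge_zero, of _ 2] in auto)
  have ui: "integrable R u" unfolding u_def[abs_def] using fai by simp
  have u0: "(LINT x|R. u x) = 0" unfolding u_def using fai prob_space by simp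
  have u2i: "integrable R (\<lambda>x. (u x)\<^sup>2)"
    unfolding u_def power2_diff using fa2 fai by simp
  have u2: "(LINT x|R. (u x)\<^sup>2) \<le> A\<^sup>2"
  proof -
    have "(LINT x|R. (u x)\<^sup>2) = (LINT x|R. (fa x)\<^sup>2) - (LINT x|R. fa x)\<^sup>2"
      unfolding u_def by (rule variance_eq[OF fai fa2])
    also have "\<dots> \<le> (LINT x|R. (fa x)\<^sup>2)" by simp
    also have "\<dots> \<le> (LINT x|R. A\<^sup>2)"
      using fa2 power_mono[OF fab abs_ge_zero, of _ 2] by (intro integral_mono) auto
    finally show ?thesis using prob_space by simp
  qed
  note su = iid_sum_square[OF ui u2i u0, of n]
  \<comment> \<open>For this value the inequality |z| <= (\<epsilon> + z^2 / \<epsilon>) / 2 turns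
    the bound A^2 / n on the second moment into A / sqrt n.\<close>
  define \<epsilon> where "\<epsilon> = A / sqrt n"
  have e: "\<epsilon> > 0" using A n by (simp add: \<epsilon>_def)
  have ptw: "\<bar>(\<Sum>i<n. f (x i)) / n - (LINT x|R. f x)\<bar> \<le>
     (\<epsilon> + ((\<Sum>i<n. u (x i)) / n)\<^sup>2 / \<epsilon>) / 2 + ((\<Sum>i<n. \<gamma> (x i)) / n + (LINT x|R. \<gamma> x))" for x
  proof -
    have "(\<Sum>i<n. f (x i)) / n - (LINT x|R. f x) = (\<Sum>i<n. u (x i)) / n + ((\<Sum>i<n. v (x i)) / n - (LINT x|R. v x))"
    proof -
      have "(LINT x|R. f x) = (LINT x|R. v x) + (LINT x|R. fa x)" using fi fai by (simp add: v_def)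
      moreover have "(\<Sum>i<n. f (x i)) = (\<Sum>i<n. u (x i)) + (\<Sum>i<n. v (x i)) + n * (LINT x|R. fa x)"
        by (simp add: u_def v_def sum_subtractf)
      ultimately show ?thesis using n by (simp add: field_simps)
    qed
    moreover have "\<bar>(\<Sum>i<n. v (x i)) / n\<bar> \<le> (\<Sum>i<n. \<gamma> (x i)) / n"
      using order_trans[OF sum_abs sum_mono[of "{..<n}" "\<lambda>i. \<bar>v (x i)\<bar>" "\<lambda>i. \<gamma> (x i)"]] v\<gamma>
      by (simp add: divide_right_mono)
    moreover have "\<bar>LINT x|R. v x\<bar> \<le> (LINT x|R. \<gamma> x)"
      by (rule order_trans[OF integral_abs_bound]) (use vi \<gamma>i v\<gamma> in \<open>auto intro!: integral_mono\<close>)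
    moreover have "\<bar>z\<bar> \<le> (\<epsilon> + z\<^sup>2 / \<epsilon>) / 2" for z
    proof -
      have "0 \<le> (\<bar>z\<bar> - \<epsilon>)\<^sup>2" by simp
      then have "2 * \<bar>z\<bar> * \<epsilon> \<le> \<epsilon>\<^sup>2 + z\<^sup>2" by (simp add: power2_diff)
      then show ?thesis using e by (simp add: field_simps power2_eq_square)
    qed
    ultimately show ?thesis by (smt (verit, best))
  qed
  let ?r = "\<lambda>x. (\<epsilon> + ((\<Sum>i<n. u (x i)) / n)\<^sup>2 / \<epsilon>) / 2 + ((\<Sum>i<n. \<gamma> (x i)) / n + (LINT x|R. \<gamma> x))"
  have \<gamma>s: "integrable (iid n R) (\<lambda>x. \<Sum>i<n. \<gamma> (x i))"
    using integrable_iid_component[OF _ \<gamma>i] by (intro Bochner_Integration.integrable_sum) auto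
  have ri: "integrable (iid n R) ?r" using su(1) \<gamma>s by (simp add: power_divide)
  have "(LINT x|iid n R. ?r x) = (\<epsilon> + (LINT x|R. (u x)\<^sup>2) / n / \<epsilon>) / 2 + 2 * (LINT x|R. \<gamma> x)"
  proof -
    have "(LINT x|iid n R. (\<Sum>i<n. \<gamma> (x i))) = n * (LINT x|R. \<gamma> x)"
      using integrable_iid_component[OF _ \<gamma>i] integral_iid_component[OF _ borel_measurable_integrable[OF \<gamma>i]]
      by (simp add: Bochner_Integration.integral_sum)
    then show ?thesis
      using su \<gamma>s n N.prob_space by (simp add: power_divide power2_eq_square)
  qed
  also have "\<dots> \<le> (\<epsilon> + A\<^sup>2 / n / \<epsilon>) / 2 + 2 * (LINT x|R. \<gamma> x)"
    using u2 e by (simp add: divide_right_mono)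
  also have "A\<^sup>2 / n / \<epsilon> = \<epsilon>" using A n by (simp add: \<epsilon>_def field_simps power2_eq_square)
  finally have r: "(LINT x|iid n R. ?r x) \<le> A / sqrt n + 2 * (LINT x|R. \<gamma> x)" by (simp add: \<epsilon>_def)
  have \<gamma>0: "0 \<le> \<gamma> x" for x by (simp add: \<gamma>_def g0)
  have "(\<integral>\<^sup>+x. ennreal \<bar>(\<Sum>i<n. f (x i)) / n - (LINT x|R. f x)\<bar> \<partial>iid n R) \<le> (\<integral>\<^sup>+x. ennreal (?r x) \<partial>iid n R)"
    by (intro nn_integral_mono ennreal_leI ptw)
  also have "\<dots> = ennreal (LINT x|iid n R. ?r x)"
    using ri by (rule nn_integral_eq_integral)
      (use e in \<open>auto intro!: AE_I2 add_nonneg_nonneg divide_nonneg_nonneg sum_nonneg Bochner_Integration.integral_nonneg \<gamma>0\<close>)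
  also have "\<dots> \<le> ennreal (A / sqrt n + 2 * (LINT x|R. \<gamma> x))" using r by (rule ennreal_leI)
  finally show ?thesis by (simp add: \<gamma>_def)
qed

end

section \<open>Deterministic properties of the partial likelihood\<close>

text \<open>If the total deviation is below \<open>m\<close>, then S0 stays above c / 2 and the
  quotient is Lipschitz, with constant \<open>C2\<close>. Otherwise S1^2 / S0 <= S2 bounds the error
  by the deviation plus K + K^2 / c, and a deviation of at least \<open>m\<close> absorbs this
  constant, which gives \<open>C1\<close>.\<close>

lemma square_ratio_stability:
  fixes c K :: real
  assumes "0 < c" "0 \<le> K"
  obtains C where "0 \<le> C"
    "\<And>S0 S1 S2 s0 s1 s2. \<lbrakk>0 \<le> S0; S1\<^sup>2 \<le> S0 * S2; 0 \<le> S2; c \<le> s0; \<bar>s1\<bar> \<le> K; \<bar>s2\<bar> \<le> K\<rbrakk> \<Longrightarrow>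
      \<bar>S1\<^sup>2 / S0 - s1\<^sup>2 / s0\<bar> \<le> C * (\<bar>S0 - s0\<bar> + \<bar>S1 - s1\<bar> + \<bar>S2 - s2\<bar>)"
proof -
  define m where "m = min (c / 2) 1"
  define C1 where "C1 = 1 + (K + K\<^sup>2 / c) / m"
  define C2 where "C2 = (2 * K + 1) * (2 / c) + K\<^sup>2 * (2 / c\<^sup>2)"
  have m: "0 < m" using assms by (simp add: m_def)
  have C2: "D * (2 * K + 1) / (c / 2) + K\<^sup>2 * D / (c / 2 * c) = C2 * D" for D
    using assms by (simp add: C2_def field_simps power2_eq_square)
  have C10: "0 \<le> C1" "0 \<le> C2" using assms m by (auto simp: C1_def C2_def)
  show thesis
  proof (rule that[of "C1 + C2"])
    show "0 \<le> C1 + C2" using C10 by simp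
    fix S0 S1 S2 s0 s1 s2 :: real
    assume h: "0 \<le> S0" "S1\<^sup>2 \<le> S0 * S2" "0 \<le> S2" "c \<le> s0" "\<bar>s1\<bar> \<le> K" "\<bar>s2\<bar> \<le> K"
    let ?D = "\<bar>S0 - s0\<bar> + \<bar>S1 - s1\<bar> + \<bar>S2 - s2\<bar>"
    have s0: "0 < s0" using h assms by linarith
    have s1: "s1\<^sup>2 \<le> K\<^sup>2" using power_mono[OF h(5), of 2] by simp
    have D0: "0 \<le> ?D" by simp
    have split: "(C1 + C2) * ?D = C1 * ?D + C2 * ?D" by (rule distrib_right)
    show "\<bar>S1\<^sup>2 / S0 - s1\<^sup>2 / s0\<bar> \<le> (C1 + C2) * ?D"
    proof (cases "?D < m")
      case True
      then have "?D < c / 2" "?D < 1" unfolding m_def by simp_all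
      then have "\<bar>S0 - s0\<bar> < c / 2" "\<bar>S1 - s1\<bar> < 1" by linarith+
      then have S0: "c / 2 \<le> S0" and S1: "\<bar>S1 + s1\<bar> \<le> 2 * K + 1" using h by linarith+
      have S0p: "0 < S0" using S0 assms by linarith
      have "S1\<^sup>2 / S0 - s1\<^sup>2 / s0 = (S1 - s1) * (S1 + s1) / S0 + s1\<^sup>2 * (s0 - S0) / (S0 * s0)"
        using S0p s0 by (simp add: field_simps power2_eq_square)
      also have "\<bar>\<dots>\<bar> \<le> \<bar>(S1 - s1) * (S1 + s1) / S0\<bar> + \<bar>s1\<^sup>2 * (s0 - S0) / (S0 * s0)\<bar>"
        by (rule abs_triangle_ineq)
      finally have b0: "\<bar>S1\<^sup>2 / S0 - s1\<^sup>2 / s0\<bar> \<le> \<bar>(S1 - s1) * (S1 + s1) / S0\<bar> + \<bar>s1\<^sup>2 * (s0 - S0) / (S0 * s0)\<bar>" .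
      have b1: "\<bar>(S1 - s1) * (S1 + s1) / S0\<bar> \<le> ?D * (2 * K + 1) / (c / 2)"
        unfolding abs_mult abs_divide using S0 S1 S0p assms h
        by (intro frac_le mult_mono) auto
      have b2: "\<bar>s1\<^sup>2 * (s0 - S0) / (S0 * s0)\<bar> \<le> K\<^sup>2 * ?D / (c / 2 * c)"
      proof -
        have "\<bar>s0 - S0\<bar> \<le> ?D" by linarith
        then show ?thesis
          unfolding abs_mult abs_divide using S0 S0p s0 assms h s1
          by (intro frac_le mult_mono) (auto intro!: mult_mono mult_nonneg_nonneg add_nonneg_nonneg)
      qed
      have "\<bar>S1\<^sup>2 / S0 - s1\<^sup>2 / s0\<bar> \<le> C2 * ?D"
        using order_trans[OF b0 add_mono[OF b1 b2]] unfolding C2 .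
      then show ?thesis using mult_nonneg_nonneg[OF C10(1) D0] split by linarith
    next
      case False
      have R: "S1\<^sup>2 / S0 \<le> S2" "0 \<le> S1\<^sup>2 / S0"
        using h by (cases "S0 = 0"; simp add: divide_le_eq mult.commute)+
      have r: "s1\<^sup>2 / s0 \<le> K\<^sup>2 / c" "0 \<le> s1\<^sup>2 / s0"
        using s1 h s0 assms by (auto intro!: frac_le)
      have "\<bar>S1\<^sup>2 / S0 - s1\<^sup>2 / s0\<bar> \<le> ?D + (K + K\<^sup>2 / c)" using R r h by linarith
      also have "(K + K\<^sup>2 / c) \<le> (K + K\<^sup>2 / c) / m * ?D"
      proof -
        have "(K + K\<^sup>2 / c) / m * m \<le> (K + K\<^sup>2 / c) / m * ?D"
          using False assms m by (intro mult_left_mono) auto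
        then show ?thesis using m by simp
      qed
      finally have "\<bar>S1\<^sup>2 / S0 - s1\<^sup>2 / s0\<bar> \<le> C1 * ?D" by (simp add: C1_def distrib_right)
      then show ?thesis using mult_nonneg_nonneg[OF C10(2) D0] split by linarith
    qed
  qed
qed

text \<open>One Newton step from \<open>\<theta>1\<close> nearly reaches the maximiser. The existence of a maximiser on \<open>S\<close> comes for
  free from the sign of \<open>f'\<close> at \<open>\<theta>1 - r\<close> and \<open>\<theta>1 + r\<close>.\<close>

lemma concave_maximiser_near:
  fixes f f' V :: "real \<Rightarrow> real"
  assumes f: "\<And>\<theta>. (f has_real_derivative f' \<theta>) (at \<theta>)"
    and f': "\<And>\<theta>. (f' has_real_derivative - V \<theta>) (at \<theta>)"
    and V: "\<And>\<theta>. 0 \<le> V \<theta>" and V0: "0 < V \<theta>1" and r: "0 < r" and \<kappa>: "1 \<le> \<kappa>"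
    and near: "\<And>\<theta>. \<bar>\<theta> - \<theta>1\<bar> \<le> r \<Longrightarrow> V \<theta> \<le> \<kappa> * V \<theta>1 \<and> V \<theta>1 \<le> \<kappa> * V \<theta>"
    and small: "\<kappa> * \<bar>f' \<theta>1\<bar> < r * V \<theta>1"
    and S: "{\<theta>1 - r..\<theta>1 + r} \<subseteq> S"
    and arg: "(\<exists>\<theta>. is_arg_max f (\<lambda>\<theta>. \<theta> \<in> S) \<theta>) \<Longrightarrow> is_arg_max f (\<lambda>\<theta>. \<theta> \<in> S) \<theta>h"
  shows "\<bar>(\<theta>h - \<theta>1) - f' \<theta>1 / V \<theta>1\<bar> \<le> (\<kappa> - 1) * \<bar>f' \<theta>1\<bar> / V \<theta>1"
proof -
  have mvt: "\<exists>z. a \<le> z \<and> z \<le> b \<and> f' b - f' a = (b - a) * - V z" if "a \<le> b" for a b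
  proof (cases "a < b")
    case True
    then show ?thesis using MVT2[OF True, of f' "\<lambda>\<theta>. - V \<theta>"] f' by (meson less_le)
  qed (use that in auto)
  have mono: "f' b \<le> f' a" if "a \<le> b" for a b
  proof -
    obtain z where "f' b - f' a = (b - a) * - V z" using mvt[OF \<open>a \<le> b\<close>] by blast
    moreover have "0 \<le> (b - a) * V z" using that V by (intro mult_nonneg_nonneg) auto
    ultimately show ?thesis by (simp only: mult_minus_right)
  qed
  have lin: "\<exists>z. \<bar>z - \<theta>1\<bar> \<le> r \<and> f' \<theta> - f' \<theta>1 = - (\<theta> - \<theta>1) * V z" if "\<bar>\<theta> - \<theta>1\<bar> \<le> r" for \<theta>
  proof (cases "\<theta>1 \<le> \<theta>")
    case True
    then obtain z where "\<theta>1 \<le> z" "z \<le> \<theta>" "f' \<theta> - f' \<theta>1 = (\<theta> - \<theta>1) * - V z" using mvt by blast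
    then show ?thesis using that by (intro exI[of _ z]) (auto simp: algebra_simps)
  next
    case False
    then obtain z where "\<theta> \<le> z" "z \<le> \<theta>1" "f' \<theta>1 - f' \<theta> = (\<theta>1 - \<theta>) * - V z" using mvt[of \<theta> \<theta>1] by auto
    then show ?thesis using that by (intro exI[of _ z]) (auto simp: algebra_simps)
  qed
  \<comment> \<open>Over a distance r the derivative drops by r times some value of V. This exceeds
    its size at \<theta>1 and forces a change of sign inside the interval.\<close>
  have big: "\<bar>f' \<theta>1\<bar> < r * V z" if "\<bar>z - \<theta>1\<bar> \<le> r" for z
  proof -
    have "\<kappa> * \<bar>f' \<theta>1\<bar> < r * (\<kappa> * V z)"
      using near[OF that] r small mult_left_mono[of "V \<theta>1" "\<kappa> * V z" r] by linarith
    then show ?thesis using \<kappa> by (simp add: mult.left_commute)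
  qed
  have right: "f' (\<theta>1 + r) < 0"
  proof -
    obtain z where z: "\<bar>z - \<theta>1\<bar> \<le> r" "f' (\<theta>1 + r) - f' \<theta>1 = - r * V z" using lin[of "\<theta>1 + r"] r by auto
    then show ?thesis using big[OF z(1)] by (simp add: abs_less_iff)
  qed
  have left: "0 < f' (\<theta>1 - r)"
  proof -
    obtain z where z: "\<bar>z - \<theta>1\<bar> \<le> r" "f' (\<theta>1 - r) - f' \<theta>1 = r * V z" using lin[of "\<theta>1 - r"] r by auto
    then show ?thesis using big[OF z(1)] by (simp add: abs_less_iff)
  qed
  have "\<exists>z\<ge>\<theta>1 - r. z \<le> \<theta>1 + r \<and> f' z = 0"
    by (rule IVT2) (use left right r DERIV_isCont[OF f'] in auto)
  then obtain z where z: "\<theta>1 - r \<le> z" "z \<le> \<theta>1 + r" "f' z = 0" by blast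
  have zr: "\<bar>z - \<theta>1\<bar> \<le> r" using z by auto
  have Vpos: "0 < V \<theta>" if "\<bar>\<theta> - \<theta>1\<bar> \<le> r" for \<theta>
    using near[OF that] V0 \<kappa> V[of \<theta>] by (metis less_le mult_zero_right not_le)
  have zs: "\<theta>1 - r < z" "z < \<theta>1 + r" using z left right by (auto simp: less_le)
  have strict: "f \<theta> < f z" if "\<theta> \<noteq> z" for \<theta>
  proof (cases "\<theta> < z")
    case True
    \<comment> \<open>V is known to be positive only within distance r of \<theta>1, so strict
      increase is available only from \<open>a\<close> to z; from \<theta> to \<open>a\<close>
      monotonicity is enough.\<close>
    define a where "a = max \<theta> (\<theta>1 - r)"
    have a: "\<theta> \<le> a" "a < z" "\<bar>a - \<theta>1\<bar> \<le> r" using True zs r by (auto simp: a_def)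
    have pos: "0 < f' w" if "a \<le> w" "w < z" for w
    proof -
      have "\<exists>u>w. u < z \<and> f' z - f' w = (z - w) * - V u"
        using MVT2[OF that(2), of f' "\<lambda>\<theta>. - V \<theta>"] f' by blast
      then obtain u where u: "w < u" "u < z" "f' z - f' w = (z - w) * - V u" by blast
      have "\<bar>u - \<theta>1\<bar> \<le> r" using u that a zs by auto
      then have "0 < (z - w) * V u" using Vpos that by (intro mult_pos_pos) auto
      then show ?thesis using u z by simp
    qed
    have "f a < f z"
      using MVT2[OF a(2), of f f'] f pos a by (smt (verit, del_insts) mult_pos_pos)
    moreover have "f \<theta> \<le> f a"
    proof (rule DERIV_nonneg_imp_nondecreasing[OF a(1)])
      fix w assume "\<theta> \<le> w" "w \<le> a"
      then have "0 \<le> f' w" using mono[of w z] a z by auto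
      then show "\<exists>y. (f has_real_derivative y) (at w) \<and> 0 \<le> y" using f by blast
    qed
    ultimately show ?thesis by simp
  next
    case False
    then have zt: "z < \<theta>" using that by simp
    define a where "a = min \<theta> (\<theta>1 + r)"
    have a: "a \<le> \<theta>" "z < a" "\<bar>a - \<theta>1\<bar> \<le> r" using zt zs r by (auto simp: a_def)
    have neg: "f' w < 0" if "w \<le> a" "z < w" for w
    proof -
      have "\<exists>u>z. u < w \<and> f' w - f' z = (w - z) * - V u"
        using MVT2[OF that(2), of f' "\<lambda>\<theta>. - V \<theta>"] f' by blast
      then obtain u where u: "z < u" "u < w" "f' w - f' z = (w - z) * - V u" by blast
      have "\<bar>u - \<theta>1\<bar> \<le> r" using u that a zs by auto
      then have "0 < (w - z) * V u" using Vpos that by (intro mult_pos_pos) auto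
      then show ?thesis using u z by simp
    qed
    have "f a < f z"
      using MVT2[OF a(2), of f f'] f neg a by (smt (verit, del_insts) mult_pos_neg)
    moreover have "f \<theta> \<le> f a"
    proof (rule DERIV_nonpos_imp_nonincreasing[OF a(1)])
      fix w assume "a \<le> w" "w \<le> \<theta>"
      then have "f' w \<le> 0" using mono[of z w] a z by auto
      then show "\<exists>y. (f has_real_derivative y) (at w) \<and> y \<le> 0" using f by blast
    qed
    ultimately show ?thesis by simp
  qed
  have zS: "z \<in> S" using S z by auto
  have "is_arg_max f (\<lambda>\<theta>. \<theta> \<in> S) z"
    unfolding is_arg_max_def using zS strict by (metis less_asym)
  then have "is_arg_max f (\<lambda>\<theta>. \<theta> \<in> S) \<theta>h" using arg by blast
  then have zh: "\<theta>h = z"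
    unfolding is_arg_max_def using zS strict by metis
  obtain u where u: "\<bar>u - \<theta>1\<bar> \<le> r" "f' z - f' \<theta>1 = - (z - \<theta>1) * V u" using lin[OF zr] by blast
  have Vu: "0 < V u" using Vpos u by blast
  have d: "z - \<theta>1 = f' \<theta>1 / V u" using u z Vu by (simp add: field_simps)
  \<comment> \<open>The two reciprocals differ by a factor between 1 / \<kappa> and \<kappa>, and 1
    - 1 / \<kappa> <= \<kappa> - 1.\<close>
  have "\<bar>1 / V u - 1 / V \<theta>1\<bar> \<le> (\<kappa> - 1) / V \<theta>1"
  proof -
    have 1: "1 / V u \<le> \<kappa> / V \<theta>1" using near[OF u(1)] Vu V0 by (simp add: field_simps)
    have 2: "1 / V \<theta>1 \<le> \<kappa> / V u" using near[OF u(1)] Vu V0 by (simp add: field_simps)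
    have 3: "1 / V \<theta>1 - 1 / V u \<le> (\<kappa> - 1) / V \<theta>1"
    proof -
      have "1 / \<kappa> * (1 / V \<theta>1) \<le> 1 / V u" using 2 \<kappa> V0 Vu by (simp add: field_simps)
      moreover have "1 - 1 / \<kappa> \<le> \<kappa> - 1"
      proof -
        have "0 \<le> (\<kappa> - 1) * (\<kappa> - 1)" by simp
        then have "2 * \<kappa> \<le> \<kappa> * \<kappa> + 1" by (simp add: algebra_simps)
        then have "2 \<le> \<kappa> + 1 / \<kappa>" using \<kappa> by (simp add: field_simps)
        then show ?thesis by linarith
      qed
      then have "(1 - 1 / \<kappa>) * (1 / V \<theta>1) \<le> (\<kappa> - 1) * (1 / V \<theta>1)"
        using V0 by (intro mult_right_mono) auto
      ultimately show ?thesis by (simp add: algebra_simps)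
    qed
    show ?thesis using 1 3 by (simp add: diff_divide_distrib abs_le_iff)
  qed
  then have "\<bar>f' \<theta>1\<bar> * \<bar>1 / V u - 1 / V \<theta>1\<bar> \<le> \<bar>f' \<theta>1\<bar> * ((\<kappa> - 1) / V \<theta>1)"
    by (intro mult_left_mono) auto
  moreover have "(\<theta>h - \<theta>1) - f' \<theta>1 / V \<theta>1 = f' \<theta>1 * (1 / V u - 1 / V \<theta>1)"
    unfolding zh d by (simp add: algebra_simps)
  ultimately show ?thesis by (simp add: abs_mult mult.commute)
qed

section \<open>Weighted means and variances over the risk set\<close>

lemma
  shows S_fun_nonneg: "0 \<le> S_fun n 0 x t \<theta>" "0 \<le> S_fun n 2 x t \<theta>"
    and S_fun_Cauchy_Schwarz: "(S_fun n 1 x t \<theta>)\<^sup>2 \<le> S_fun n 0 x t \<theta> * S_fun n 2 x t \<theta>"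
proof -
  show "0 \<le> S_fun n 0 x t \<theta>" "0 \<le> S_fun n 2 x t \<theta>"
    by (auto simp: S_fun_def obs_Y_def intro!: divide_nonneg_nonneg sum_nonneg)
  \<comment> \<open>The square root of the weight; \<open>obs_Y\<close> takes the values 0 and 1 and
    is its own square.\<close>
  let ?a = "\<lambda>i. obs_Y (x i) t * exp (\<theta> * obs_W (x i) / 2)"
  have a2: "(?a i)\<^sup>2 = obs_Y (x i) t * exp (\<theta> * obs_W (x i))" for i
    by (simp add: obs_Y_def power2_eq_square exp_add[symmetric])
  have aa: "?a i * (?a i * w) = obs_Y (x i) t * exp (\<theta> * obs_W (x i)) * w" for i w
    by (simp only: mult.assoc[symmetric] power2_eq_square[symmetric] a2)
  have ab: "(?a i * w)\<^sup>2 = obs_Y (x i) t * exp (\<theta> * obs_W (x i)) * w\<^sup>2" for i w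
    by (simp only: power_mult_distrib[of "?a i" w] a2)
  have "(\<Sum>i<n. ?a i * (?a i * obs_W (x i)))\<^sup>2 \<le> (\<Sum>i<n. (?a i)\<^sup>2) * (\<Sum>i<n. (?a i * obs_W (x i))\<^sup>2)"
    by (rule Cauchy_Schwarz_ineq_sum)
  then have "(\<Sum>i<n. obs_Y (x i) t * obs_W (x i) * exp (\<theta> * obs_W (x i)))\<^sup>2 \<le>
     (\<Sum>i<n. obs_Y (x i) t * exp (\<theta> * obs_W (x i))) * (\<Sum>i<n. obs_Y (x i) t * (obs_W (x i))\<^sup>2 * exp (\<theta> * obs_W (x i)))"
    unfolding aa a2 ab by (simp add: mult_ac)
  then show "(S_fun n 1 x t \<theta>)\<^sup>2 \<le> S_fun n 0 x t \<theta> * S_fun n 2 x t \<theta>"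
    unfolding S_fun_def by (cases "n = 0") (auto simp: power_divide field_simps power2_eq_square)
qed

text \<open>Mean and, below, variance of the covariates in the risk set, with weights proportional
  to exp (\<theta> W). Both are 0 for an empty risk set, by division by 0.\<close>

definition Sbar :: "nat \<Rightarrow> (nat \<Rightarrow> obs) \<Rightarrow> real \<Rightarrow> real \<Rightarrow> real" where
  "Sbar n x t \<theta> = S_fun n 1 x t \<theta> / S_fun n 0 x t \<theta>"

definition Svar :: "nat \<Rightarrow> (nat \<Rightarrow> obs) \<Rightarrow> real \<Rightarrow> real \<Rightarrow> real" where
  "Svar n x t \<theta> = S_fun n 2 x t \<theta> / S_fun n 0 x t \<theta> - (Sbar n x t \<theta>)\<^sup>2"

lemma S_fun_0_pos: "i < n \<Longrightarrow> t \<le> obs_T (x i) \<Longrightarrow> 0 < S_fun n 0 x t \<theta>"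
  unfolding S_fun_def obs_Y_def
  by (auto intro!: divide_pos_pos sum_pos2[where i=i])

text \<open>All weights are positive, so a vanishing sum means an empty risk set, a property that
  depends neither on k nor on \<theta>. This covers the degenerate case of the identities
  below.\<close>

lemma S_fun_eq_0:
  assumes "S_fun n 0 x t \<theta> = 0" shows "S_fun n k x t \<theta>' = 0"
proof (cases "n = 0")
  case False
  have "\<not> t \<le> obs_T (x i)" if "i < n" for i
    using S_fun_0_pos[OF that, of t x \<theta>] assms by auto
  then show ?thesis by (simp add: S_fun_def obs_Y_def)
qed (simp add: S_fun_def)

text \<open>The weighted variance is always met together with the factor \<open>S_fun n 0\<close>,
  and in this form the only quotient left is the one treated by
  \<open>square_ratio_stability\<close>.\<close>

lemma Svar_S0: "Svar n x t \<theta> * S_fun n 0 x t \<theta> = S_fun n 2 x t \<theta> - (S_fun n 1 x t \<theta>)\<^sup>2 / S_fun n 0 x t \<theta>"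
  using S_fun_eq_0[of n x t \<theta> 2 \<theta>]
  by (cases "S_fun n 0 x t \<theta> = 0") (auto simp: Svar_def Sbar_def field_simps power2_eq_square)

lemma Svar_nonneg: "0 \<le> Svar n x t \<theta>"
proof (cases "S_fun n 0 x t \<theta> = 0")
  case True
  then show ?thesis by (simp add: Svar_def Sbar_def)
next
  case False
  then have "0 < S_fun n 0 x t \<theta>" using S_fun_nonneg(1)[of n x t \<theta>] by linarith
  then show ?thesis using S_fun_Cauchy_Schwarz[of n x t \<theta>]
    by (simp add: Svar_def Sbar_def power_divide field_simps power2_eq_square)
qed

text \<open>Variance plus squared bias. The centre \<open>m\<close> is free because the tilting
  argument takes deviations from the mean that belongs to another parameter.\<close>

lemma weighted_square_deviation:
  assumes "0 < S_fun n 0 x t \<theta>"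
  shows "(\<Sum>i<n. obs_Y (x i) t * exp (\<theta> * obs_W (x i)) * (obs_W (x i) - m)\<^sup>2) / real n =
    S_fun n 0 x t \<theta> * (Svar n x t \<theta> + (Sbar n x t \<theta> - m)\<^sup>2)"
proof -
  have "(\<Sum>i<n. obs_Y (x i) t * exp (\<theta> * obs_W (x i)) * (obs_W (x i) - m)\<^sup>2) / real n =
    S_fun n 2 x t \<theta> - 2 * m * S_fun n 1 x t \<theta> + m\<^sup>2 * S_fun n 0 x t \<theta>"
  proof -
    have "obs_Y (x i) t * exp (\<theta> * obs_W (x i)) * (obs_W (x i) - m)\<^sup>2 =
       obs_Y (x i) t * obs_W (x i) ^ 2 * exp (\<theta> * obs_W (x i)) - 2 * m * (obs_Y (x i) t * obs_W (x i) ^ 1 * exp (\<theta> * obs_W (x i)))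
       + m\<^sup>2 * (obs_Y (x i) t * obs_W (x i) ^ 0 * exp (\<theta> * obs_W (x i)))" for i
      by (simp add: power2_diff algebra_simps)
    then have "(\<Sum>i<n. obs_Y (x i) t * exp (\<theta> * obs_W (x i)) * (obs_W (x i) - m)\<^sup>2) =
      (\<Sum>i<n. obs_Y (x i) t * obs_W (x i) ^ 2 * exp (\<theta> * obs_W (x i))) - 2 * m * (\<Sum>i<n. obs_Y (x i) t * obs_W (x i) ^ 1 * exp (\<theta> * obs_W (x i)))
       + m\<^sup>2 * (\<Sum>i<n. obs_Y (x i) t * obs_W (x i) ^ 0 * exp (\<theta> * obs_W (x i)))"
      by (simp only: sum.distrib sum_subtractf sum_distrib_left)
    then show ?thesis by (simp only: S_fun_def diff_divide_distrib add_divide_distrib times_divide_eq_right)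
  qed
  also have "\<dots> = S_fun n 0 x t \<theta> * (Svar n x t \<theta> + (Sbar n x t \<theta> - m)\<^sup>2)"
    using assms by (simp add: Svar_def Sbar_def field_simps power2_eq_square)
  finally show ?thesis .
qed

text \<open>A weighted variance is the least weighted mean square deviation, so tilting the weights by
  factors in \<open>[exp (-d), exp d]\<close> changes it at most by a factor \<open>exp (2 d)\<close>.\<close>

lemma Svar_tilt:
  assumes W: "\<And>j. j < n \<Longrightarrow> \<bar>(\<theta>' - \<theta>) * obs_W (x j)\<bar> \<le> d" and pos: "0 < S_fun n 0 x t \<theta>"
  shows "Svar n x t \<theta>' \<le> exp (2 * d) * Svar n x t \<theta>"
proof -
  have n: "0 < n" using pos by (cases n) (auto simp: S_fun_def)
  have "S_fun n 0 x t \<theta>' \<noteq> 0" using S_fun_eq_0[of n x t \<theta>' 0 \<theta>] pos by auto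
  then have pos': "0 < S_fun n 0 x t \<theta>'" using S_fun_nonneg(1)[of n x t \<theta>'] by linarith
  have up: "exp (\<theta>' * obs_W (x j)) \<le> exp d * exp (\<theta> * obs_W (x j))"
    and lo: "exp (\<theta> * obs_W (x j)) \<le> exp d * exp (\<theta>' * obs_W (x j))" if "j < n" for j
    using W[OF that] by (auto simp: exp_add[symmetric] algebra_simps abs_le_iff)
  have Y: "0 \<le> obs_Y y t" for y by (simp add: obs_Y_def)
  \<comment> \<open>Deviations from the mean at \<theta> overestimate the variance at \<theta>'. One
    factor exp d is then spent on the weights in the sum, the other on their total
    \<open>S_fun n 0\<close>.\<close>
  let ?m = "Sbar n x t \<theta>"
  have "S_fun n 0 x t \<theta>' * Svar n x t \<theta>' \<le> S_fun n 0 x t \<theta>' * (Svar n x t \<theta>' + (Sbar n x t \<theta>' - ?m)\<^sup>2)"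
    using pos' by (intro mult_left_mono) auto
  also have "\<dots> = (\<Sum>i<n. obs_Y (x i) t * exp (\<theta>' * obs_W (x i)) * (obs_W (x i) - ?m)\<^sup>2) / real n"
    by (rule weighted_square_deviation[OF pos', symmetric])
  also have "\<dots> \<le> (\<Sum>i<n. exp d * (obs_Y (x i) t * exp (\<theta> * obs_W (x i)) * (obs_W (x i) - ?m)\<^sup>2)) / real n"
  proof (intro divide_right_mono sum_mono)
    fix i assume "i \<in> {..<n}"
    then have "obs_Y (x i) t * (obs_W (x i) - ?m)\<^sup>2 * exp (\<theta>' * obs_W (x i)) \<le>
       obs_Y (x i) t * (obs_W (x i) - ?m)\<^sup>2 * (exp d * exp (\<theta> * obs_W (x i)))"
      using up Y by (intro mult_left_mono) auto
    then show "obs_Y (x i) t * exp (\<theta>' * obs_W (x i)) * (obs_W (x i) - ?m)\<^sup>2 \<le>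
       exp d * (obs_Y (x i) t * exp (\<theta> * obs_W (x i)) * (obs_W (x i) - ?m)\<^sup>2)" by (simp add: mult_ac)
  qed simp
  also have "\<dots> = exp d * (S_fun n 0 x t \<theta> * Svar n x t \<theta>)"
    using weighted_square_deviation[OF pos, of ?m] by (simp add: sum_distrib_left[symmetric] times_divide_eq_right[symmetric] del: times_divide_eq_right)
  also have "\<dots> \<le> exp d * ((exp d * S_fun n 0 x t \<theta>') * Svar n x t \<theta>)"
  proof -
    have "S_fun n 0 x t \<theta> \<le> exp d * S_fun n 0 x t \<theta>'"
    proof -
      have "(\<Sum>i<n. obs_Y (x i) t * exp (\<theta> * obs_W (x i))) \<le> (\<Sum>i<n. obs_Y (x i) t * (exp d * exp (\<theta>' * obs_W (x i))))"
        using lo Y by (intro sum_mono mult_left_mono) auto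
      also have "\<dots> = exp d * (\<Sum>i<n. obs_Y (x i) t * exp (\<theta>' * obs_W (x i)))"
        by (simp add: sum_distrib_left mult_ac)
      finally show ?thesis using n by (simp add: S_fun_def divide_right_mono)
    qed
    then show ?thesis using Svar_nonneg by (intro mult_left_mono mult_right_mono) auto
  qed
  also have "\<dots> = S_fun n 0 x t \<theta>' * (exp (2 * d) * Svar n x t \<theta>)"
    using exp_double[of d] by (simp add: power2_eq_square mult_ac)
  finally show ?thesis using pos' by simp
qed

lemma S_fun_deriv: "((\<lambda>\<theta>. S_fun n k x t \<theta>) has_real_derivative S_fun n (Suc k) x t \<theta>) (at \<theta>)"
  unfolding S_fun_def
  by (intro DERIV_cdivide DERIV_sum) (auto intro!: derivative_eq_intros simp: mult_ac)

lemma Sbar_deriv: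
  assumes "0 < S_fun n 0 x t \<theta>"
  shows "((\<lambda>\<theta>. Sbar n x t \<theta>) has_real_derivative Svar n x t \<theta>) (at \<theta>)"
proof -
  have "((\<lambda>\<theta>. S_fun n 1 x t \<theta> / S_fun n 0 x t \<theta>) has_real_derivative
    (S_fun n 2 x t \<theta> * S_fun n 0 x t \<theta> - S_fun n 1 x t \<theta> * S_fun n 1 x t \<theta>) / (S_fun n 0 x t \<theta> * S_fun n 0 x t \<theta>)) (at \<theta>)"
    using S_fun_deriv[of n 1 x t \<theta>] S_fun_deriv[of n 0 x t \<theta>] assms
    by (intro DERIV_divide) (auto simp: numeral_2_eq_2)
  moreover have "(S_fun n 2 x t \<theta> * S_fun n 0 x t \<theta> - S_fun n 1 x t \<theta> * S_fun n 1 x t \<theta>) / (S_fun n 0 x t \<theta> * S_fun n 0 x t \<theta>) = Svar n x t \<theta>"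
    using assms by (simp add: Svar_def Sbar_def field_simps power2_eq_square)
  ultimately show ?thesis unfolding Sbar_def by simp
qed

section \<open>The partial likelihood as a finite sum over events\<close>

lemma interval_measure_obs_N_event:
  assumes "obs_D x" shows "interval_measure (obs_N x) = return borel (obs_T x)"
proof -
  interpret r: real_distribution "return borel (obs_T x)"
    by (intro real_distribution.intro prob_space_return real_distribution_axioms.intro) auto
  \<comment> \<open>\<open>obs_N x\<close> is the distribution function of the unit mass at the
    event time, and a distribution function determines its measure.\<close>
  have N: "cdf (return borel (obs_T x)) = obs_N x"
    using assms by (auto simp: cdf_def measure_return fun_eq_iff obs_N_def split: split_indicator)
  have N1: "obs_N x s \<le> obs_N x t" if "s \<le> t" for s t
    using that by (auto simp: obs_N_def)
  have N2: "continuous (at_right a) (obs_N x)" for a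
    using r.cdf_is_right_cont unfolding N .
  have N3: "(obs_N x \<longlongrightarrow> 0) at_bot" "(obs_N x \<longlongrightarrow> 1) at_top"
    using r.cdf_lim_at_bot r.cdf_lim_at_top_prob unfolding N by simp_all
  show ?thesis
    by (rule cdf_unique[OF real_distribution_interval_measure[OF N1 N2 N3] r.real_distribution_axioms])
      (use cdf_interval_measure[OF N1 N2 N3(1)] N in auto)
qed

text \<open>Without an event \<open>obs_N\<close> is constant, so bounded half-open intervals, and
  hence the whole line, have measure 0.\<close>

lemma interval_measure_obs_N_no_event:
  assumes "\<not> obs_D x" shows "AE t in interval_measure (obs_N x). False"
proof -
  have 0: "emeasure (interval_measure (obs_N x)) {- real k<..real k} = 0" for k
  proof -
    have "obs_N x = (\<lambda>_. 0)" using assms by (simp add: fun_eq_iff obs_N_def)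
    then show ?thesis using emeasure_interval_measure_Ioc[of "- real k" "real k" "obs_N x"] by simp
  qed
  have "(\<Union>k. {- real k<..real k}) = (UNIV :: real set)"
  proof (intro equalityI subsetI)
    fix t :: real
    obtain k where "\<bar>t\<bar> < real k" using reals_Archimedean2 by blast
    then show "t \<in> (\<Union>k. {- real k<..real k})" by (auto intro!: exI[of _ k])
  qed simp
  moreover have "emeasure (interval_measure (obs_N x)) (\<Union>k. {- real k<..real k}) = 0"
    by (rule emeasure_UN_eq_0) (use 0 in auto)
  ultimately show ?thesis
    by (intro AE_I[where N=UNIV]) auto
qed

text \<open>The integral sees only the values on [0,1], so measurability is asked of the integrand
  after it has been cut off there.\<close>

lemma int_dN_eq:
  assumes "(\<lambda>t. indicator {0..1} t * f t) \<in> borel_measurable borel"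
  shows "int_dN f x = (if ev x then f (obs_T x) else 0)"
proof (cases "obs_D x")
  case True
  have "int_dN f x = (LINT t|return borel (obs_T x). indicator {0..1} t * f t)"
    by (simp add: int_dN_def set_lebesgue_integral_def interval_measure_obs_N_event[OF True])
  also have "\<dots> = indicator {0..1} (obs_T x) * f (obs_T x)"
    by (rule integral_return) (use assms in auto)
  finally show ?thesis using True by (auto simp: ev_def)
next
  case False
  have "int_dN f x = (LINT t|interval_measure (obs_N x). 0)"
    unfolding int_dN_def set_lebesgue_integral_def
    using assms interval_measure_obs_N_no_event[OF False] by (intro integral_cong_AE) auto
  then show ?thesis using False by (simp add: ev_def)
qed

lemma S_fun_measurable [measurable (raw)]:
  assumes [measurable]: "f \<in> N \<rightarrow>\<^sub>M iid n obs_space" "g \<in> borel_measurable N" "u \<in> borel_measurable N"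
  shows "(\<lambda>z. S_fun n k (f z) (g z) (u z)) \<in> borel_measurable N"
proof -
  have "(\<lambda>z. obs_Y (f z i) (g z) * obs_W (f z i) ^ k * exp (u z * obs_W (f z i))) \<in> borel_measurable N" if "i < n" for i
    unfolding obs_Y_def using that by measurable
  then show ?thesis unfolding S_fun_def by (intro borel_measurable_divide borel_measurable_sum) auto
qed

lemma S_fun_measurable_time [measurable]: "(\<lambda>t. S_fun n k x t \<theta>) \<in> borel_measurable borel"
  unfolding S_fun_def obs_Y_def by measurable

lemma log_cox_likelihood_eq:
  "log_cox_likelihood n x \<theta> =
    (\<Sum>i<n. if ev (x i) then \<theta> * obs_W (x i) - ln (real n * S_fun n 0 x (obs_T (x i)) \<theta>) else 0)"
  unfolding log_cox_likelihood_def by (intro sum.cong refl int_dN_eq) measurable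

definition cox_score :: "nat \<Rightarrow> (nat \<Rightarrow> obs) \<Rightarrow> real \<Rightarrow> real" where
  "cox_score n x \<theta> = (\<Sum>i<n. if ev (x i) then obs_W (x i) - Sbar n x (obs_T (x i)) \<theta> else 0)"

definition cox_information :: "nat \<Rightarrow> (nat \<Rightarrow> obs) \<Rightarrow> real \<Rightarrow> real" where
  "cox_information n x \<theta> = (\<Sum>i<n. if ev (x i) then Svar n x (obs_T (x i)) \<theta> else 0)"

lemma log_cox_likelihood_deriv:
  "((\<lambda>\<theta>. log_cox_likelihood n x \<theta>) has_real_derivative cox_score n x \<theta>) (at \<theta>)"
  unfolding log_cox_likelihood_eq cox_score_def
proof (intro DERIV_sum)
  fix i assume "i \<in> {..<n}"
  then have i: "i < n" by simp
  have pos: "0 < S_fun n 0 x (obs_T (x i)) \<theta>" using S_fun_0_pos[OF i] by simp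
  have "((\<lambda>\<theta>. \<theta> * obs_W (x i) - ln (real n * S_fun n 0 x (obs_T (x i)) \<theta>)) has_real_derivative
     obs_W (x i) - Sbar n x (obs_T (x i)) \<theta>) (at \<theta>)"
    using pos i S_fun_deriv[of n 0 x "obs_T (x i)" \<theta>]
    by (auto intro!: derivative_eq_intros simp: Sbar_def)
  then show "((\<lambda>\<theta>. if ev (x i) then \<theta> * obs_W (x i) - ln (real n * S_fun n 0 x (obs_T (x i)) \<theta>) else 0) has_real_derivative
      (if ev (x i) then obs_W (x i) - Sbar n x (obs_T (x i)) \<theta> else 0)) (at \<theta>)"
    by simp
qed

lemma cox_score_deriv:
  "((\<lambda>\<theta>. cox_score n x \<theta>) has_real_derivative - cox_information n x \<theta>) (at \<theta>)"
proof -
  have "((\<lambda>\<theta>. \<Sum>i<n. if ev (x i) then obs_W (x i) - Sbar n x (obs_T (x i)) \<theta> else 0) has_real_derivative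
    (\<Sum>i<n. if ev (x i) then - Svar n x (obs_T (x i)) \<theta> else 0)) (at \<theta>)"
  proof (intro DERIV_sum)
    fix i assume "i \<in> {..<n}"
    then have pos: "0 < S_fun n 0 x (obs_T (x i)) \<theta>" using S_fun_0_pos by simp
    have "((\<lambda>\<theta>. obs_W (x i) - Sbar n x (obs_T (x i)) \<theta>) has_real_derivative - Svar n x (obs_T (x i)) \<theta>) (at \<theta>)"
      using Sbar_deriv[OF pos] by (auto intro!: derivative_eq_intros)
    then show "((\<lambda>\<theta>. if ev (x i) then obs_W (x i) - Sbar n x (obs_T (x i)) \<theta> else 0) has_real_derivative
      (if ev (x i) then - Svar n x (obs_T (x i)) \<theta> else 0)) (at \<theta>)" by simp
  qed
  moreover have "(\<Sum>i<n. if ev (x i) then - Svar n x (obs_T (x i)) \<theta> else 0) = - cox_information n x \<theta>"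
    unfolding cox_information_def sum_negf[symmetric] by (intro sum.cong) auto
  ultimately show ?thesis unfolding cox_score_def by simp
qed

lemma cox_information_nonneg: "0 \<le> cox_information n x \<theta>"
  unfolding cox_information_def using Svar_nonneg by (auto intro!: sum_nonneg)

lemma cox_information_tilt:
  assumes W: "\<And>j. j < n \<Longrightarrow> \<bar>(\<theta>' - \<theta>) * obs_W (x j)\<bar> \<le> d"
  shows "cox_information n x \<theta>' \<le> exp (2 * d) * cox_information n x \<theta>"
  unfolding cox_information_def sum_distrib_left
  by (intro sum_mono) (auto intro!: Svar_tilt[OF W] S_fun_0_pos)

section \<open>Limits along a convergent sequence of parameters\<close>

text \<open>For |\<theta> - \<theta>0| <= d the function exp (\<theta> w) lies below the sum of the
  exponentials at the two end points, and 1 + w^2 dominates the powers up to the second. One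
  function of the covariate thus dominates the summands of \<open>S_fun\<close> at all times and all
  nearby parameters.\<close>

definition envelope :: "real \<Rightarrow> real \<Rightarrow> real \<Rightarrow> real" where
  "envelope \<theta>0 d w = (1 + w\<^sup>2) * (exp ((\<theta>0 + d) * w) + exp ((\<theta>0 - d) * w))"

lemma envelope_nonneg: "0 \<le> envelope \<theta>0 d w"
  by (simp add: envelope_def add_nonneg_nonneg)

lemma envelope_measurable [measurable]: "envelope \<theta>0 d \<in> borel_measurable borel"
  unfolding envelope_def[abs_def] by measurable

lemma power_exp_le_envelope:
  assumes k: "k \<le> 2" and \<theta>: "\<bar>\<theta> - \<theta>0\<bar> \<le> d"
  shows "\<bar>w ^ k * exp (\<theta> * w)\<bar> \<le> envelope \<theta>0 d w"
proof -
  have "\<bar>w ^ k\<bar> \<le> 1 + w\<^sup>2"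
  proof -
    have "2 * \<bar>w\<bar> \<le> 1 + w\<^sup>2" using sum_squares_bound[of 1 "\<bar>w\<bar>"] by simp
    moreover have "k = 0 \<or> k = 1 \<or> k = 2" using k by auto
    ultimately show ?thesis by (auto simp: power_abs)
  qed
  moreover have "exp (\<theta> * w) \<le> exp ((\<theta>0 + d) * w) + exp ((\<theta>0 - d) * w)"
  proof (cases "0 \<le> w")
    case True
    then have "exp (\<theta> * w) \<le> exp ((\<theta>0 + d) * w)" using \<theta> by (auto intro!: mult_right_mono)
    then show ?thesis by (smt (verit) exp_gt_zero)
  next
    case False
    then have "exp (\<theta> * w) \<le> exp ((\<theta>0 - d) * w)" using \<theta> by (auto intro!: mult_right_mono_neg)
    then show ?thesis by (smt (verit) exp_gt_zero)
  qed
  ultimately show ?thesis unfolding envelope_def abs_mult by (intro mult_mono) auto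
qed

lemma agree_S_fun: "agree t x y \<Longrightarrow> S_fun n k x t \<theta> = S_fun n k y t \<theta>"
proof -
  assume ag: "agree t x y"
  have "obs_W (x i) = obs_W (y i) \<and> obs_Y (x i) t = obs_Y (y i) t" for i
    using ag unfolding agree_def obs_Y_def by (metis (full_types))
  then show ?thesis by (simp add: S_fun_def)
qed

lemma agree_Sbar: "agree t x y \<Longrightarrow> Sbar n x t \<theta> = Sbar n y t \<theta>"
  and agree_Svar: "agree t x y \<Longrightarrow> Svar n x t \<theta> = Svar n y t \<theta>"
  using agree_S_fun[of t x y n] by (simp_all add: Sbar_def Svar_def)

lemma
  assumes W: "\<And>j. j < n \<Longrightarrow> \<bar>obs_W (x j)\<bar> \<le> B" and B: "0 \<le> B"
  shows Sbar_le: "\<bar>Sbar n x t \<theta>\<bar> \<le> B" and Svar_le: "Svar n x t \<theta> \<le> B\<^sup>2"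
proof -
  have S1: "\<bar>S_fun n 1 x t \<theta>\<bar> \<le> B * S_fun n 0 x t \<theta>"
  proof -
    have "\<bar>\<Sum>i<n. obs_Y (x i) t * obs_W (x i) ^ 1 * exp (\<theta> * obs_W (x i))\<bar> \<le> (\<Sum>i<n. B * (obs_Y (x i) t * obs_W (x i) ^ 0 * exp (\<theta> * obs_W (x i))))"
      by (intro order_trans[OF sum_abs] sum_mono) (use W in \<open>auto simp: abs_mult obs_Y_def\<close>)
    then have "\<bar>S_fun n 1 x t \<theta>\<bar> \<le> (\<Sum>i<n. B * (obs_Y (x i) t * obs_W (x i) ^ 0 * exp (\<theta> * obs_W (x i)))) / real n"
      unfolding S_fun_def abs_divide by (simp add: divide_right_mono)
    then show ?thesis by (simp add: S_fun_def sum_distrib_left)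
  qed
  have S2: "S_fun n 2 x t \<theta> \<le> B\<^sup>2 * S_fun n 0 x t \<theta>"
  proof -
    have "(\<Sum>i<n. obs_Y (x i) t * obs_W (x i) ^ 2 * exp (\<theta> * obs_W (x i))) \<le> (\<Sum>i<n. B\<^sup>2 * (obs_Y (x i) t * obs_W (x i) ^ 0 * exp (\<theta> * obs_W (x i))))"
      using power_mono[OF W abs_ge_zero, of _ 2] by (intro sum_mono) (auto simp: obs_Y_def)
    then have "S_fun n 2 x t \<theta> \<le> (\<Sum>i<n. B\<^sup>2 * (obs_Y (x i) t * obs_W (x i) ^ 0 * exp (\<theta> * obs_W (x i)))) / real n"
      unfolding S_fun_def by (simp add: divide_right_mono)
    then show ?thesis by (simp add: S_fun_def sum_distrib_left)
  qed
  show "\<bar>Sbar n x t \<theta>\<bar> \<le> B" "Svar n x t \<theta> \<le> B\<^sup>2"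
  proof -
    show "\<bar>Sbar n x t \<theta>\<bar> \<le> B"
    proof (cases "S_fun n 0 x t \<theta> = 0")
      case False
      then have "0 < S_fun n 0 x t \<theta>" using S_fun_nonneg(1)[of n x t \<theta>] by linarith
      then show ?thesis using S1 by (simp add: Sbar_def abs_divide divide_le_eq)
    qed (simp add: Sbar_def B)
    show "Svar n x t \<theta> \<le> B\<^sup>2"
    proof (cases "S_fun n 0 x t \<theta> = 0")
      case False
      then have "0 < S_fun n 0 x t \<theta>" using S_fun_nonneg(1)[of n x t \<theta>] by linarith
      then have "S_fun n 2 x t \<theta> / S_fun n 0 x t \<theta> \<le> B\<^sup>2" using S2 by (simp add: divide_le_eq)
      then show ?thesis unfolding Svar_def by (smt (verit) zero_le_power2)
    qed (simp add: Svar_def Sbar_def)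
  qed
qed

lemma Sbar_measurable [measurable (raw)]:
  assumes [measurable]: "f \<in> N \<rightarrow>\<^sub>M iid n obs_space" "g \<in> borel_measurable N" "u \<in> borel_measurable N"
  shows "(\<lambda>z. Sbar n (f z) (g z) (u z)) \<in> borel_measurable N"
  unfolding Sbar_def by measurable

lemma Svar_measurable [measurable (raw)]:
  assumes [measurable]: "f \<in> N \<rightarrow>\<^sub>M iid n obs_space" "g \<in> borel_measurable N" "u \<in> borel_measurable N"
  shows "(\<lambda>z. Svar n (f z) (g z) (u z)) \<in> borel_measurable N"
  unfolding Svar_def by measurable

lemma sum_rate: "(\<Sum>i<n. rate \<theta> h (x i) t) = real n * S_fun n 0 x t \<theta> * h t"
  by (cases "n = 0") (simp, simp add: rate_def S_fun_def, simp add: sum_distrib_left sum_distrib_right mult_ac)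

lemma sum_W_rate: "(\<Sum>i<n. obs_W (x i) * rate \<theta> h (x i) t) = real n * S_fun n 1 x t \<theta> * h t"
  by (cases "n = 0") (simp, simp add: rate_def S_fun_def, simp add: sum_distrib_left sum_distrib_right mult_ac)

text \<open>Row n of the array consists of n observations with law \<open>R n\<close> and parameters
  \<open>th n\<close>, \<open>hz n\<close>. The covariate law \<open>Q\<close> and the hazard bound
  \<open>K\<close> are common to all rows. The constants \<open>c\<close> and \<open>B\<close>
  restrict only the limits \<open>s\<close>; the random sums themselves may come arbitrarily close
  to 0.\<close>

locale cox_sequence =
  fixes Q :: "real measure" and R :: "nat \<Rightarrow> obs measure" and th :: "nat \<Rightarrow> real"
    and hz :: "nat \<Rightarrow> real \<Rightarrow> real" and K :: real and \<theta>0 d :: real and h0 :: "real \<Rightarrow> real"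
    and s :: "nat \<Rightarrow> real \<Rightarrow> real" and c B :: real
  assumes law: "counting_law (R n) (th n) (hz n) K"
    and distr_W: "distr (R n) borel obs_W = Q"
    and th_near: "\<bar>th n - \<theta>0\<bar> \<le> d"
    and envelope_integrable: "integrable Q (envelope \<theta>0 d)"
    and square_integrable: "integrable Q (\<lambda>w. w\<^sup>2)"
    and h0_measurable [measurable]: "h0 \<in> borel_measurable borel"
    and h0_nonneg: "0 \<le> h0 t" and h0_le: "h0 t \<le> K" and h0_outside: "t \<notin> {0..1} \<Longrightarrow> h0 t = 0"
    and hz_conv: "0 < \<epsilon> \<Longrightarrow> \<forall>\<^sub>F n in sequentially. \<forall>t. \<bar>hz n t - h0 t\<bar> \<le> \<epsilon>"
    and s_measurable [measurable]: "s k \<in> borel_measurable borel"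
    and s_conv: "k \<le> 2 \<Longrightarrow> 0 < \<epsilon> \<Longrightarrow> \<forall>\<^sub>F n in sequentially. \<forall>t\<in>{0..1}. \<bar>s_fun (R n) k (th n) t - s k t\<bar> \<le> \<epsilon>"
    and s_le: "k \<le> 2 \<Longrightarrow> t \<in> {0..1} \<Longrightarrow> \<bar>s k t\<bar> \<le> B"
    and c_pos: "0 < c" and s0_ge: "t \<in> {0..1} \<Longrightarrow> c \<le> s 0 t"
begin

sublocale L: counting_law "R n" "th n" "hz n" K for n by (rule law)

abbreviation "N n \<equiv> iid n (R n)"

lemma prob_space_N: "prob_space (N n)" by (rule L.prob_space_iid)

lemma B_nonneg: "0 \<le> B" using s_le[of 0 0] by auto

lemma obs_W_measurable: "obs_W \<in> R n \<rightarrow>\<^sub>M borel"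
  by (rule L.measurable_RI) measurable

lemma prob_space_Q: "prob_space Q"
  using prob_space.prob_space_distr[OF L.prob_space_R obs_W_measurable] distr_W by metis

lemma sets_Q: "sets Q = sets borel"
  using distr_W[of 0] by (metis sets_distr)

lemma integral_W: "f \<in> borel_measurable borel \<Longrightarrow> (LINT x|R n. f (obs_W x)) = (LINT w|Q. f w :: real)"
  using integral_distr[OF obs_W_measurable, of f n] distr_W[of n] by simp

lemma integrable_W: "integrable Q f \<Longrightarrow> integrable (R n) (\<lambda>x. f (obs_W x) :: real)"
  using integrable_distr[OF obs_W_measurable, of n f] distr_W[of n] by simp

text \<open>The total deviation that appears in \<open>square_ratio_stability\<close>.\<close>

definition D :: "nat \<Rightarrow> (nat \<Rightarrow> obs) \<Rightarrow> real \<Rightarrow> real" where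
  "D n x t = \<bar>S_fun n 0 x t (th n) - s 0 t\<bar> + \<bar>S_fun n 1 x t (th n) - s 1 t\<bar> + \<bar>S_fun n 2 x t (th n) - s 2 t\<bar>"

lemma D_nonneg: "0 \<le> D n x t" by (simp add: D_def)

lemma D_measurable [measurable (raw)]:
  assumes [measurable]: "f \<in> M \<rightarrow>\<^sub>M iid n obs_space" "g \<in> borel_measurable M"
  shows "(\<lambda>z. D n (f z) (g z)) \<in> borel_measurable M"
  unfolding D_def by measurable

text \<open>The summands are dominated by the same envelope at every t and in every row, so a single
  truncation level gives a bound that is uniform in t. The bias is covered by
  \<open>s_conv\<close>.\<close>

lemma S_fun_small:
  assumes k: "k \<le> 2" and \<epsilon>: "0 < \<epsilon>"
  shows "\<forall>\<^sub>F n in sequentially. \<forall>t\<in>{0..1}. (\<integral>\<^sup>+x. ennreal \<bar>S_fun n k x t (th n) - s k t\<bar> \<partial>N n) \<le> ennreal \<epsilon>"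
proof -
  interpret Q: prob_space Q by (rule prob_space_Q)
  have em: "envelope \<theta>0 d \<in> borel_measurable Q" using envelope_integrable by (rule borel_measurable_integrable)
  let ?tail = "\<lambda>A. LINT w|Q. (if envelope \<theta>0 d w \<le> A then 0 else envelope \<theta>0 d w)"
  have "(\<lambda>m. ?tail (real m)) \<longlonglongrightarrow> (LINT w|Q. 0)"
  proof (rule integral_dominated_convergence[where w="envelope \<theta>0 d"])
    show "AE w in Q. (\<lambda>m. if envelope \<theta>0 d w \<le> real m then 0 else envelope \<theta>0 d w) \<longlonglongrightarrow> 0"
    proof (rule AE_I2)
      fix w
      obtain m0 :: nat where "envelope \<theta>0 d w \<le> real m0" using real_arch_simple by blast
      then have "\<forall>\<^sub>F m in sequentially. (if envelope \<theta>0 d w \<le> real m then 0 else envelope \<theta>0 d w) = 0"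
        by (auto simp: eventually_sequentially intro!: exI[of _ m0])
      then show "(\<lambda>m. if envelope \<theta>0 d w \<le> real m then 0 else envelope \<theta>0 d w) \<longlonglongrightarrow> 0"
        by (rule tendsto_eventually)
    qed
    show "AE w in Q. norm (if envelope \<theta>0 d w \<le> real m then 0 else envelope \<theta>0 d w) \<le> envelope \<theta>0 d w" for m
      using envelope_nonneg by (auto intro!: AE_I2)
  qed (use em envelope_integrable in auto)
  \<comment> \<open>The tail enters the law of large numbers twice, hence \<epsilon> / 8; with
    \<epsilon> / 4 for the term m / sqrt n this makes \<epsilon> / 2.\<close>
  then have "\<forall>\<^sub>F m in sequentially. ?tail (real m) < \<epsilon> / 8"
    using \<epsilon> by (intro order_tendstoD) auto
  then have "\<forall>\<^sub>F m in sequentially. ?tail (real m) < \<epsilon> / 8 \<and> 0 < m"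
    using eventually_gt_at_top[of 0] by (rule eventually_conj)
  then obtain m where m: "?tail (real m) < \<epsilon> / 8" "0 < m" using eventually_happens'[OF sequentially_bot] by blast
  have "(\<lambda>n. real m / sqrt (real n)) \<longlonglongrightarrow> 0"
    by (rule real_tendsto_divide_at_top[OF tendsto_const filterlim_compose[OF sqrt_at_top filterlim_real_sequentially]])
  then have "\<forall>\<^sub>F n in sequentially. real m / sqrt (real n) < \<epsilon> / 4"
    using \<epsilon> by (intro order_tendstoD) auto
  moreover have "\<forall>\<^sub>F n in sequentially. \<forall>t\<in>{0..1}. \<bar>s_fun (R n) k (th n) t - s k t\<bar> \<le> \<epsilon> / 4"
    using s_conv[OF k, of "\<epsilon> / 4"] \<epsilon> by simp
  moreover have "\<forall>\<^sub>F n :: nat in sequentially. 0 < n" by (rule eventually_gt_at_top)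
  ultimately show ?thesis
  proof eventually_elim
    case (elim n)
    show ?case
    proof
      fix t :: real assume t: "t \<in> {0..1}"
      interpret N: prob_space "N n" by (rule prob_space_N)
      let ?f = "\<lambda>x. obs_Y x t * obs_W x ^ k * exp (th n * obs_W x)"
      let ?g = "\<lambda>x. envelope \<theta>0 d (obs_W x)"
      have fm: "?f \<in> borel_measurable (R n)"
        unfolding obs_Y_def by (rule L.measurable_RI) measurable
      have fg: "\<bar>?f x\<bar> \<le> ?g x" for x
        using power_exp_le_envelope[OF k th_near[of n], of "obs_W x"] envelope_nonneg[of \<theta>0 d "obs_W x"]
        by (auto simp: obs_Y_def abs_mult)
      have L1: "(\<integral>\<^sup>+x. ennreal \<bar>(\<Sum>i<n. ?f (x i)) / n - (LINT x|R n. ?f x)\<bar> \<partial>N n) \<le>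
         ennreal (real m / sqrt n + 2 * (LINT x|R n. (if ?g x \<le> real m then 0 else ?g x)))"
        using m(2) elim(3) by (intro L.L1_law_of_large_numbers[OF fm integrable_W[OF envelope_integrable] fg]) auto
      have "(LINT x|R n. (if ?g x \<le> real m then 0 else ?g x)) = ?tail (real m)"
        by (rule integral_W[of "\<lambda>w. if envelope \<theta>0 d w \<le> real m then 0 else envelope \<theta>0 d w"]) measurable
      then have "real m / sqrt n + 2 * (LINT x|R n. (if ?g x \<le> real m then 0 else ?g x)) \<le> \<epsilon> / 2"
        using elim(1) m(1) by linarith
      then have L2: "(\<integral>\<^sup>+x. ennreal \<bar>S_fun n k x t (th n) - s_fun (R n) k (th n) t\<bar> \<partial>N n) \<le> ennreal (\<epsilon> / 2)"
        using order_trans[OF L1 ennreal_leI] by (simp add: S_fun_def s_fun_def)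
      have Sm: "(\<lambda>x. S_fun n k x t (th n)) \<in> borel_measurable (N n)" by measurable
      have "(\<integral>\<^sup>+x. ennreal \<bar>S_fun n k x t (th n) - s k t\<bar> \<partial>N n) \<le>
         (\<integral>\<^sup>+x. ennreal \<bar>S_fun n k x t (th n) - s_fun (R n) k (th n) t\<bar> + ennreal (\<epsilon> / 2) \<partial>N n)"
      proof (rule nn_integral_mono)
        fix x
        have "\<bar>s_fun (R n) k (th n) t - s k t\<bar> \<le> \<epsilon> / 2" 
        proof -
          have "\<bar>s_fun (R n) k (th n) t - s k t\<bar> \<le> \<epsilon> / 4" using elim(2) t by blast
          then show ?thesis using \<epsilon> by linarith
        qed
        then have "\<bar>S_fun n k x t (th n) - s k t\<bar> \<le> \<bar>S_fun n k x t (th n) - s_fun (R n) k (th n) t\<bar> + \<epsilon> / 2" by linarith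
        then show "ennreal \<bar>S_fun n k x t (th n) - s k t\<bar> \<le> ennreal \<bar>S_fun n k x t (th n) - s_fun (R n) k (th n) t\<bar> + ennreal (\<epsilon> / 2)"
          using \<epsilon> by (simp add: ennreal_plus[symmetric] del: ennreal_plus)
      qed
      also have "\<dots> = (\<integral>\<^sup>+x. ennreal \<bar>S_fun n k x t (th n) - s_fun (R n) k (th n) t\<bar> \<partial>N n) + ennreal (\<epsilon> / 2)"
        using Sm by (subst nn_integral_add) (auto simp: N.emeasure_space_1)
      also have "\<dots> \<le> ennreal (\<epsilon> / 2) + ennreal (\<epsilon> / 2)" using L2 by (rule add_right_mono)
      also have "\<dots> = ennreal \<epsilon>" using \<epsilon> by (simp add: ennreal_plus[symmetric] del: ennreal_plus)
      finally show "(\<integral>\<^sup>+x. ennreal \<bar>S_fun n k x t (th n) - s k t\<bar> \<partial>N n) \<le> ennreal \<epsilon>" .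
    qed
  qed
qed

text \<open>After exchanging expectation and time integral, the bounds at fixed times are integrated
  over a window of length 1.\<close>

lemma D_small:
  assumes \<epsilon>: "0 < \<epsilon>"
  shows "\<forall>\<^sub>F n in sequentially. (\<integral>\<^sup>+x. (\<integral>\<^sup>+t. ennreal (indicator {0..1} t * D n x t) \<partial>lborel) \<partial>N n) \<le> ennreal \<epsilon>"
proof -
  have e3: "0 < \<epsilon> / 3" and le: "(0::nat) \<le> 2" "(1::nat) \<le> 2" "(2::nat) \<le> 2" using \<epsilon> by auto
  show ?thesis
    using S_fun_small[OF le(1) e3] S_fun_small[OF le(2) e3] S_fun_small[OF le(3) e3]
  proof eventually_elim
    case (elim n)
    interpret N: prob_space "N n" by (rule prob_space_N)
    interpret NL: pair_sigma_finite "N n" lborel by standard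
    have [measurable]: "(\<lambda>x. S_fun n k x t (th n)) \<in> borel_measurable (N n)" for k t by measurable
    have "(\<integral>\<^sup>+x. (\<integral>\<^sup>+t. ennreal (indicator {0..1} t * D n x t) \<partial>lborel) \<partial>N n) =
       (\<integral>\<^sup>+t. (\<integral>\<^sup>+x. ennreal (indicator {0..1} t * D n x t) \<partial>N n) \<partial>lborel)"
      by (rule NL.Fubini'[symmetric]) measurable
    also have "\<dots> \<le> (\<integral>\<^sup>+t. ennreal \<epsilon> * indicator {0..1::real} t \<partial>lborel)"
    proof (rule nn_integral_mono)
      fix t :: real
      show "(\<integral>\<^sup>+x. ennreal (indicator {0..1} t * D n x t) \<partial>N n) \<le> ennreal \<epsilon> * indicator {0..1} t"
      proof (cases "t \<in> {0..1}")
        case True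
        have "(\<integral>\<^sup>+x. ennreal (indicator {0..1} t * D n x t) \<partial>N n) =
          (\<integral>\<^sup>+x. ennreal \<bar>S_fun n 0 x t (th n) - s 0 t\<bar> \<partial>N n) + (\<integral>\<^sup>+x. ennreal \<bar>S_fun n 1 x t (th n) - s 1 t\<bar> \<partial>N n)
           + (\<integral>\<^sup>+x. ennreal \<bar>S_fun n 2 x t (th n) - s 2 t\<bar> \<partial>N n)"
          using True by (simp add: D_def nn_integral_add)
        also have "\<dots> \<le> ennreal (\<epsilon> / 3) + ennreal (\<epsilon> / 3) + ennreal (\<epsilon> / 3)"
          using elim True by (intro add_mono) auto
        also have "\<dots> = ennreal \<epsilon>" using \<epsilon> by (simp add: ennreal_plus[symmetric] del: ennreal_plus)
        finally show ?thesis using True by simp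
      qed simp
    qed
    also have "\<dots> = ennreal \<epsilon>" by (simp add: nn_integral_cmult)
    finally show ?case .
  qed
qed

section \<open>The truncation event and negligible sequences\<close>

definition bounded_W :: "real \<Rightarrow> nat \<Rightarrow> (nat \<Rightarrow> obs) \<Rightarrow> bool" where
  "bounded_W \<epsilon> n x \<longleftrightarrow> (\<forall>j<n. \<bar>obs_W (x j)\<bar> \<le> \<epsilon> * sqrt n)"

lemma bounded_W_measurable [measurable (raw)]:
  assumes [measurable]: "f \<in> M \<rightarrow>\<^sub>M iid n obs_space"
  shows "Measurable.pred M (\<lambda>z. bounded_W \<epsilon> n (f z))"
proof -
  have "Measurable.pred M (\<lambda>z. \<bar>obs_W (f z j)\<bar> \<le> \<epsilon> * sqrt n)" if [measurable]: "j < n" for j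
    by measurable
  then have "Measurable.pred M (\<lambda>z. \<forall>j\<in>{..<n}. \<bar>obs_W (f z j)\<bar> \<le> \<epsilon> * sqrt n)"
    by (intro pred_intros_finite) auto
  then show ?thesis unfolding bounded_W_def by (simp add: Ball_def)
qed

text \<open>Convergence to 0 in probability along the row laws. Measurability refers to the common
  sigma-algebra, so that it is the same condition in every row.\<close>

definition small :: "(nat \<Rightarrow> (nat \<Rightarrow> obs) \<Rightarrow> real) \<Rightarrow> bool" where
  "small Z \<longleftrightarrow> (\<forall>n. Z n \<in> borel_measurable (iid n obs_space)) \<and>
     (\<forall>\<epsilon>>0. \<forall>\<delta>>0. \<forall>\<^sub>F n in sequentially. measure (N n) {x \<in> space (N n). \<epsilon> < \<bar>Z n x\<bar>} \<le> \<delta>)"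

lemma measurable_NI: "f \<in> iid n obs_space \<rightarrow>\<^sub>M M \<Longrightarrow> f \<in> N n \<rightarrow>\<^sub>M M"
  using measurable_cong_sets[OF L.sets_iid refl] by blast

lemma smallD:
  "small Z \<Longrightarrow> 0 < \<epsilon> \<Longrightarrow> 0 < \<delta> \<Longrightarrow> \<forall>\<^sub>F n in sequentially. measure (N n) {x \<in> space (N n). \<epsilon> < \<bar>Z n x\<bar>} \<le> \<delta>"
  "small Z \<Longrightarrow> Z n \<in> borel_measurable (iid n obs_space)"
  by (auto simp: small_def)

lemma markov_N:
  assumes "Z \<in> borel_measurable (iid n obs_space)" "0 < \<epsilon>" "0 \<le> a" "(\<integral>\<^sup>+x. ennreal \<bar>Z x\<bar> \<partial>N n) \<le> ennreal a"
  shows "measure (N n) {x \<in> space (N n). \<epsilon> < \<bar>Z x\<bar>} \<le> a / \<epsilon>"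
proof -
  interpret N: prob_space "N n" by (rule prob_space_N)
  have Zm[measurable]: "Z \<in> borel_measurable (N n)" by (rule measurable_NI) fact
  have "emeasure (N n) {x \<in> space (N n). \<epsilon> < \<bar>Z x\<bar>} \<le> emeasure (N n) {x \<in> space (N n). 1 \<le> ennreal (1 / \<epsilon>) * ennreal \<bar>Z x\<bar>}"
  proof (rule emeasure_mono)
    show "{x \<in> space (N n). \<epsilon> < \<bar>Z x\<bar>} \<subseteq> {x \<in> space (N n). 1 \<le> ennreal (1 / \<epsilon>) * ennreal \<bar>Z x\<bar>}"
      using assms(2) by (auto simp: ennreal_mult'[symmetric] field_simps simp flip: ennreal_1 intro!: ennreal_leI)
  qed measurable
  also have "\<dots> \<le> ennreal (1 / \<epsilon>) * (\<integral>\<^sup>+x. ennreal \<bar>Z x\<bar> * indicator (space (N n)) x \<partial>N n)"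
    by (rule nn_integral_Markov_inequality) auto
  also have "(\<integral>\<^sup>+x. ennreal \<bar>Z x\<bar> * indicator (space (N n)) x \<partial>N n) = (\<integral>\<^sup>+x. ennreal \<bar>Z x\<bar> \<partial>N n)"
    by (intro nn_integral_cong) auto
  also have "ennreal (1 / \<epsilon>) * (\<integral>\<^sup>+x. ennreal \<bar>Z x\<bar> \<partial>N n) \<le> ennreal (1 / \<epsilon>) * ennreal a"
    by (rule mult_left_mono[OF assms(4)]) simp
  also have "\<dots> = ennreal (a / \<epsilon>)" using assms by (simp add: ennreal_mult'[symmetric])
  finally show ?thesis using assms by (simp add: N.emeasure_eq_measure)
qed

text \<open>By the union bound the probability is at most n times a tail probability of one
  covariate, hence at most the integral of W^2 over |W| > \<epsilon> sqrt n, divided by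
  \<epsilon>^2. This integral tends to 0 by dominated convergence.\<close>

lemma bounded_W_likely:
  assumes \<epsilon>: "0 < \<epsilon>" and \<delta>: "0 < \<delta>"
  shows "\<forall>\<^sub>F n in sequentially. measure (N n) {x \<in> space (N n). \<not> bounded_W \<epsilon> n x} \<le> \<delta>"
proof -
  interpret Q: prob_space Q by (rule prob_space_Q)
  note [measurable_cong] = sets_Q
  let ?q = "\<lambda>n w. if \<bar>w\<bar> \<le> \<epsilon> * sqrt (real n) then 0 else w\<^sup>2"
  have qm: "?q n \<in> borel_measurable borel" for n
  proof -
    have "?q n = (\<lambda>w. indicator (- {- (\<epsilon> * sqrt n)..\<epsilon> * sqrt n}) w * w\<^sup>2)"
      by (auto simp: fun_eq_iff abs_le_iff split: split_indicator)
    then show ?thesis by (simp only:) measurable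
  qed
  have "(\<lambda>n. LINT w|Q. ?q n w) \<longlonglongrightarrow> (LINT w|Q. 0)"
  proof (rule integral_dominated_convergence[where w="\<lambda>w. w\<^sup>2"])
    show "AE w in Q. (\<lambda>n. ?q n w) \<longlonglongrightarrow> 0"
    proof (rule AE_I2)
      fix w
      have "filterlim (\<lambda>n. \<epsilon> * sqrt (real n)) at_top sequentially"
        using \<epsilon> by (intro filterlim_tendsto_pos_mult_at_top[OF tendsto_const] filterlim_compose[OF sqrt_at_top filterlim_real_sequentially])
      then have "\<forall>\<^sub>F n in sequentially. \<bar>w\<bar> \<le> \<epsilon> * sqrt (real n)" by (simp add: filterlim_at_top)
      then have "\<forall>\<^sub>F n in sequentially. ?q n w = 0" by eventually_elim simp
      then show "(\<lambda>n. ?q n w) \<longlonglongrightarrow> 0" by (rule tendsto_eventually)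
    qed
    show "AE w in Q. norm (?q n w) \<le> w\<^sup>2" for n by (auto intro!: AE_I2)
  qed (use square_integrable qm in \<open>auto simp: measurable_cong_sets[OF sets_Q refl]\<close>)
  then have "\<forall>\<^sub>F n in sequentially. (LINT w|Q. ?q n w) < \<delta> * \<epsilon>\<^sup>2"
    using \<epsilon> \<delta> by (intro order_tendstoD(2)) auto
  moreover have "\<forall>\<^sub>F n :: nat in sequentially. 0 < n" by (rule eventually_gt_at_top)
  ultimately show ?thesis
  proof eventually_elim
    case (elim n)
    interpret N: prob_space "N n" by (rule prob_space_N)
    let ?b = "\<lambda>w. \<not> \<bar>w\<bar> \<le> \<epsilon> * sqrt (real n)"
    have Aj: "{x \<in> space (N n). ?b (obs_W (x j))} \<in> sets (N n)" if "j < n" for j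
    proof -
      have [measurable]: "(\<lambda>x. obs_W (x j)) \<in> borel_measurable (N n)" by (rule measurable_NI) (use that in measurable)
      show ?thesis unfolding not_le by measurable
    qed
    have m: "measure (N n) {x \<in> space (N n). ?b (obs_W (x j))} \<le> \<delta> / n" if "j < n" for j
    proof -
      have W: "(\<lambda>x. obs_W (x j)) \<in> borel_measurable (N n)" by (rule measurable_NI) (use that in measurable)
      have qi: "integrable Q (?q n)"
        by (rule Bochner_Integration.integrable_bound[OF square_integrable])
          (use qm[of n] in \<open>auto simp: measurable_cong_sets[OF sets_Q refl]\<close>)
      have "\<epsilon>\<^sup>2 * real n * measure (N n) {x \<in> space (N n). ?b (obs_W (x j))} =
         (LINT x|N n. (if ?b (obs_W (x j)) then \<epsilon>\<^sup>2 * real n else 0))"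
      proof -
        have "(LINT x|N n. (if ?b (obs_W (x j)) then \<epsilon>\<^sup>2 * real n else 0)) =
          (LINT x|N n. (\<epsilon>\<^sup>2 * real n) * indicator {x \<in> space (N n). ?b (obs_W (x j))} x)"
          by (intro Bochner_Integration.integral_cong) (auto split: split_indicator)
        then show ?thesis using Aj[OF that] by simp
      qed
      also have "\<dots> \<le> (LINT x|N n. ?q n (obs_W (x j)))"
      proof (rule integral_mono)
        show "integrable (N n) (\<lambda>x. if ?b (obs_W (x j)) then \<epsilon>\<^sup>2 * real n else 0)"
          using W by (intro N.integrable_const_bound[where B="\<epsilon>\<^sup>2 * real n"]) auto
        show "integrable (N n) (\<lambda>x. ?q n (obs_W (x j)))"
          using L.integrable_iid_component[OF that integrable_W[OF qi, of n]] .
        fix x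
        have "\<epsilon>\<^sup>2 * real n \<le> (obs_W (x j))\<^sup>2" if "\<epsilon> * sqrt (real n) < \<bar>obs_W (x j)\<bar>"
          using power_mono[OF less_imp_le[OF that], of 2] \<epsilon> by (simp add: power_mult_distrib)
        then show "(if ?b (obs_W (x j)) then \<epsilon>\<^sup>2 * real n else 0) \<le> ?q n (obs_W (x j))" by auto
      qed
      also have "\<dots> = (LINT x|R n. ?q n (obs_W x))"
        by (rule L.integral_iid_component[OF that]) (rule borel_measurable_integrable[OF integrable_W[OF qi]])
      also have "\<dots> = (LINT w|Q. ?q n w)" by (rule integral_W[of "?q n"]) (rule qm)
      finally have "\<epsilon>\<^sup>2 * real n * measure (N n) {x \<in> space (N n). ?b (obs_W (x j))} \<le> \<delta> * \<epsilon>\<^sup>2"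
        using elim(1) by linarith
      then have "\<epsilon>\<^sup>2 * (real n * measure (N n) {x \<in> space (N n). ?b (obs_W (x j))}) \<le> \<epsilon>\<^sup>2 * \<delta>"
        by (simp add: mult_ac)
      then have "real n * measure (N n) {x \<in> space (N n). ?b (obs_W (x j))} \<le> \<delta>"
        by (rule mult_left_le_imp_le) (use \<epsilon> in simp)
      then show ?thesis using elim(2) by (simp add: field_simps)
    qed
    have "{x \<in> space (N n). \<not> bounded_W \<epsilon> n x} = (\<Union>j<n. {x \<in> space (N n). ?b (obs_W (x j))})"
      by (auto simp: bounded_W_def)
    then have "measure (N n) {x \<in> space (N n). \<not> bounded_W \<epsilon> n x} \<le> (\<Sum>j<n. measure (N n) {x \<in> space (N n). ?b (obs_W (x j))})"
      using Aj by (simp only:) (intro N.finite_measure_subadditive_finite; auto)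
    also have "\<dots> \<le> (\<Sum>j<n. \<delta> / n)" using m by (intro sum_mono) auto
    also have "\<dots> = \<delta>" using elim(2) by simp
    finally show ?case .
  qed
qed

text \<open>Second moments only need to be small on the likely event that all covariates are of smaller
  order than \<open>sqrt n\<close>.\<close>

lemma small_truncated:
  assumes m: "\<And>n. Z n \<in> borel_measurable (iid n obs_space)"
    and b: "\<And>\<epsilon>. 0 < \<epsilon> \<Longrightarrow> \<exists>\<gamma>>0. \<forall>\<^sub>F n in sequentially.
      (\<integral>\<^sup>+x. ennreal (if bounded_W \<gamma> n x then (Z n x)\<^sup>2 else 0) \<partial>N n) \<le> ennreal \<epsilon>"
  shows "small Z"
  unfolding small_def
proof (intro conjI allI impI)
  fix \<epsilon> \<delta> :: real assume e: "0 < \<epsilon>" and \<delta>: "0 < \<delta>"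
  obtain \<gamma> where \<gamma>: "0 < \<gamma>" and g: "\<forall>\<^sub>F n in sequentially.
      (\<integral>\<^sup>+x. ennreal (if bounded_W \<gamma> n x then (Z n x)\<^sup>2 else 0) \<partial>N n) \<le> ennreal (\<delta> / 2 * \<epsilon>\<^sup>2)"
    using b[of "\<delta> / 2 * \<epsilon>\<^sup>2"] e \<delta> by auto
  have d2: "0 < \<delta> / 2" using \<delta> by simp
  show "\<forall>\<^sub>F n in sequentially. measure (N n) {x \<in> space (N n). \<epsilon> < \<bar>Z n x\<bar>} \<le> \<delta>"
    using g bounded_W_likely[OF \<gamma> d2]
  proof eventually_elim
    case (elim n)
    interpret N: prob_space "N n" by (rule prob_space_N)
    note [measurable] = m
    have Zm[measurable]: "Z n \<in> borel_measurable (N n)" by (rule measurable_NI) (rule m)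
    let ?Z = "\<lambda>x. if bounded_W \<gamma> n x then (Z n x)\<^sup>2 else 0"
    have "measure (N n) {x \<in> space (N n). \<epsilon>\<^sup>2 < \<bar>?Z x\<bar>} \<le> (\<delta> / 2 * \<epsilon>\<^sup>2) / \<epsilon>\<^sup>2"
    proof (rule markov_N)
      have "(\<integral>\<^sup>+x. ennreal \<bar>?Z x\<bar> \<partial>N n) = (\<integral>\<^sup>+x. ennreal (?Z x) \<partial>N n)"
        by (intro nn_integral_cong) auto
      then show "(\<integral>\<^sup>+x. ennreal \<bar>?Z x\<bar> \<partial>N n) \<le> ennreal (\<delta> / 2 * \<epsilon>\<^sup>2)" using elim(1) by simp
    qed (use e \<delta> in \<open>auto intro!: mult_nonneg_nonneg\<close>)
    then have 1: "measure (N n) {x \<in> space (N n). \<epsilon>\<^sup>2 < \<bar>?Z x\<bar>} \<le> \<delta> / 2" using e by simp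
    have s1: "{x \<in> space (N n). \<epsilon>\<^sup>2 < \<bar>?Z x\<bar>} \<in> sets (N n)" "{x \<in> space (N n). \<not> bounded_W \<gamma> n x} \<in> sets (N n)"
      by measurable
    have "{x \<in> space (N n). \<epsilon> < \<bar>Z n x\<bar>} \<subseteq> {x \<in> space (N n). \<epsilon>\<^sup>2 < \<bar>?Z x\<bar>} \<union> {x \<in> space (N n). \<not> bounded_W \<gamma> n x}"
      using power_strict_mono[of \<epsilon> "\<bar>Z n _\<bar>" 2] e by auto
    then have "measure (N n) {x \<in> space (N n). \<epsilon> < \<bar>Z n x\<bar>} \<le>
       measure (N n) ({x \<in> space (N n). \<epsilon>\<^sup>2 < \<bar>?Z x\<bar>} \<union> {x \<in> space (N n). \<not> bounded_W \<gamma> n x})"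
      using s1 by (intro N.finite_measure_mono) auto
    also have "\<dots> \<le> measure (N n) {x \<in> space (N n). \<epsilon>\<^sup>2 < \<bar>?Z x\<bar>} + measure (N n) {x \<in> space (N n). \<not> bounded_W \<gamma> n x}"
      using s1 by (intro measure_Un_le) auto
    finally show ?case using 1 elim(2) by linarith
  qed
qed (rule m)

lemma small_L1:
  assumes m: "\<And>n. Z n \<in> borel_measurable (iid n obs_space)"
    and b: "\<And>\<epsilon>. 0 < \<epsilon> \<Longrightarrow> \<forall>\<^sub>F n in sequentially. (\<integral>\<^sup>+x. ennreal \<bar>Z n x\<bar> \<partial>N n) \<le> ennreal \<epsilon>"
  shows "small Z"
  unfolding small_def
proof (intro conjI allI impI)
  fix \<epsilon> \<delta> :: real assume e: "0 < \<epsilon>" and \<delta>: "0 < \<delta>"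
  have "\<forall>\<^sub>F n in sequentially. (\<integral>\<^sup>+x. ennreal \<bar>Z n x\<bar> \<partial>N n) \<le> ennreal (\<delta> * \<epsilon>)"
    using b[of "\<delta> * \<epsilon>"] e \<delta> by simp
  then show "\<forall>\<^sub>F n in sequentially. measure (N n) {x \<in> space (N n). \<epsilon> < \<bar>Z n x\<bar>} \<le> \<delta>"
  proof eventually_elim
    case (elim n)
    then show ?case using markov_N[OF m e _ elim] e \<delta> by simp
  qed
qed (rule m)

lemma small_add:
  assumes "small Y" "small Z" shows "small (\<lambda>n x. Y n x + Z n x)"
  unfolding small_def
proof (intro conjI allI impI)
  show "(\<lambda>x. Y n x + Z n x) \<in> borel_measurable (iid n obs_space)" for n
    using smallD(2)[OF assms(1)] smallD(2)[OF assms(2)] by measurable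
  fix \<epsilon> \<delta> :: real assume "0 < \<epsilon>" "0 < \<delta>"
  then have h: "0 < \<epsilon> / 2" "0 < \<delta> / 2" by auto
  show "\<forall>\<^sub>F n in sequentially. measure (N n) {x \<in> space (N n). \<epsilon> < \<bar>Y n x + Z n x\<bar>} \<le> \<delta>"
    using smallD(1)[OF assms(1) h] smallD(1)[OF assms(2) h]
  proof eventually_elim
    case (elim n)
    interpret N: prob_space "N n" by (rule prob_space_N)
    have [measurable]: "Y n \<in> borel_measurable (N n)" "Z n \<in> borel_measurable (N n)"
      using assms by (auto intro: measurable_NI smallD(2))
    have "measure (N n) {x \<in> space (N n). \<epsilon> < \<bar>Y n x + Z n x\<bar>} \<le>
      measure (N n) ({x \<in> space (N n). \<epsilon> / 2 < \<bar>Y n x\<bar>} \<union> {x \<in> space (N n). \<epsilon> / 2 < \<bar>Z n x\<bar>})"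
      by (intro N.finite_measure_mono subsetI) (auto simp: field_simps)
    also have "\<dots> \<le> measure (N n) {x \<in> space (N n). \<epsilon> / 2 < \<bar>Y n x\<bar>} + measure (N n) {x \<in> space (N n). \<epsilon> / 2 < \<bar>Z n x\<bar>}"
      by (intro measure_Un_le) measurable
    finally show ?case using elim by linarith
  qed
qed

section \<open>Stability of the risk-set ratios\<close>

definition e :: "real \<Rightarrow> real" where "e t = indicator {0..1} t * (s 1 t / s 0 t)"

lemma e_measurable [measurable]: "e \<in> borel_measurable borel" unfolding e_def[abs_def] by measurable

definition E :: real where "E = B / c"

lemma E_nonneg: "0 \<le> E" using B_nonneg c_pos by (simp add: E_def)

lemma e_le: "\<bar>e t\<bar> \<le> E"
proof (cases "t \<in> {0..1}")
  case True
  then have "\<bar>s 1 t\<bar> / \<bar>s 0 t\<bar> \<le> B / c"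
    using s_le[of 1 t] s0_ge[of t] c_pos B_nonneg by (intro frac_le) auto
  then show ?thesis using True by (simp add: e_def E_def)
qed (simp add: e_def E_nonneg)

text \<open>The first expression is the integrand that the isometry yields for the remainder, the
  second the drift of the information. Expanding the first gives S1^2 / S0 - 2 e S1 + e^2 S0, whose
  limit s1^2 / s0 - 2 e s1 + e^2 s0 is 0; apart from the quotient S1^2 / S0 everything is linear in
  the sums.\<close>

lemma ratio_constant:
  obtains C where "0 \<le> C"
    "\<And>n x t. t \<in> {0..1} \<Longrightarrow> (Sbar n x t (th n) - e t)\<^sup>2 * S_fun n 0 x t (th n) \<le> C * D n x t"
    "\<And>n x t. t \<in> {0..1} \<Longrightarrow> \<bar>Svar n x t (th n) * S_fun n 0 x t (th n) - (s 2 t - (s 1 t)\<^sup>2 / s 0 t)\<bar> \<le> C * D n x t"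
proof -
  obtain C where C: "0 \<le> C" and CC: "\<And>S0 S1 S2 s0 s1 s2. \<lbrakk>0 \<le> S0; S1\<^sup>2 \<le> S0 * S2; 0 \<le> S2; c \<le> s0; \<bar>s1\<bar> \<le> B; \<bar>s2\<bar> \<le> B\<rbrakk> \<Longrightarrow>
      \<bar>S1\<^sup>2 / S0 - s1\<^sup>2 / s0\<bar> \<le> C * (\<bar>S0 - s0\<bar> + \<bar>S1 - s1\<bar> + \<bar>S2 - s2\<bar>)"
    using square_ratio_stability[OF c_pos B_nonneg] by blast
  have R: "\<bar>(S_fun n 1 x t (th n))\<^sup>2 / S_fun n 0 x t (th n) - (s 1 t)\<^sup>2 / s 0 t\<bar> \<le> C * D n x t" if "t \<in> {0..1}" for n x t
    unfolding D_def using that s0_ge s_le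
    by (intro CC S_fun_nonneg S_fun_Cauchy_Schwarz) auto
  show thesis
  \<comment> \<open>One constant for both estimates: the first costs C + 2 E + E^2, the second C +
    1.\<close>
  proof (rule that[of "C + 1 + 2 * E + E\<^sup>2"])
    show "0 \<le> C + 1 + 2 * E + E\<^sup>2" using C E_nonneg by simp
    fix n x and t :: real assume t: "t \<in> {0..1}"
    let ?S = "\<lambda>k. S_fun n k x t (th n)"
    have s0: "s 0 t > 0" using s0_ge[OF t] c_pos by linarith
    have et: "e t = s 1 t / s 0 t" using t by (simp add: e_def)
    have D0: "0 \<le> D n x t" by (rule D_nonneg)
    have D1: "\<bar>?S 0 - s 0 t\<bar> \<le> D n x t" "\<bar>?S 1 - s 1 t\<bar> \<le> D n x t" "\<bar>?S 2 - s 2 t\<bar> \<le> D n x t"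
      by (simp_all add: D_def)
    have "(Sbar n x t (th n) - e t)\<^sup>2 * ?S 0 = (?S 1)\<^sup>2 / ?S 0 - 2 * e t * ?S 1 + (e t)\<^sup>2 * ?S 0"
      using S_fun_eq_0[of n x t "th n" 1 "th n"]
      by (cases "?S 0 = 0") (auto simp: Sbar_def field_simps power2_eq_square)
    also have "\<dots> = ((?S 1)\<^sup>2 / ?S 0 - (s 1 t)\<^sup>2 / s 0 t) - 2 * e t * (?S 1 - s 1 t) + (e t)\<^sup>2 * (?S 0 - s 0 t)"
      using s0 by (simp add: et field_simps power2_eq_square)
    also have "\<dots> \<le> C * D n x t + 2 * E * D n x t + E\<^sup>2 * D n x t"
    proof -
      have "- 2 * e t * (?S 1 - s 1 t) \<le> \<bar>2 * e t * (?S 1 - s 1 t)\<bar>" by (simp add: abs_le_iff)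
      also have "\<dots> \<le> 2 * E * D n x t"
        unfolding abs_mult using e_le[of t] D1 E_nonneg by (intro mult_mono) auto
      finally have 1: "- 2 * e t * (?S 1 - s 1 t) \<le> 2 * E * D n x t" .
      have "(e t)\<^sup>2 * (?S 0 - s 0 t) \<le> (e t)\<^sup>2 * D n x t" using D1 by (intro mult_left_mono) auto
      also have "\<dots> \<le> E\<^sup>2 * D n x t" using D0 power_mono[OF e_le[of t] abs_ge_zero, of 2] by (intro mult_right_mono) auto
      finally have 2: "(e t)\<^sup>2 * (?S 0 - s 0 t) \<le> E\<^sup>2 * D n x t" .
      show ?thesis using 1 2 R[OF t, of n x] by linarith
    qed
    also have "\<dots> \<le> (C + 1 + 2 * E + E\<^sup>2) * D n x t" using D0 by (simp add: algebra_simps)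
    finally show "(Sbar n x t (th n) - e t)\<^sup>2 * ?S 0 \<le> (C + 1 + 2 * E + E\<^sup>2) * D n x t" .
    have "\<bar>Svar n x t (th n) * ?S 0 - (s 2 t - (s 1 t)\<^sup>2 / s 0 t)\<bar> \<le> D n x t + C * D n x t"
      using R[OF t, of n x] D1(3) unfolding Svar_S0 by linarith
    also have "\<dots> \<le> (C + 1 + 2 * E + E\<^sup>2) * D n x t"
      using mult_nonneg_nonneg[OF E_nonneg D0] mult_nonneg_nonneg[of "E\<^sup>2", OF _ D0] by (simp add: algebra_simps)
    finally show "\<bar>Svar n x t (th n) * ?S 0 - (s 2 t - (s 1 t)\<^sup>2 / s 0 t)\<bar> \<le> (C + 1 + 2 * E + E\<^sup>2) * D n x t" .
  qed
qed

lemma nn_integral_D_scale: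
  assumes "0 \<le> C" "0 < \<epsilon>"
  shows "\<forall>\<^sub>F n in sequentially. (\<integral>\<^sup>+x. (\<integral>\<^sup>+t. ennreal (C * (indicator {0..1} t * D n x t)) \<partial>lborel) \<partial>N n) \<le> ennreal \<epsilon>"
proof -
  \<comment> \<open>The summand 1 allows for C = 0.\<close>
  have "0 < \<epsilon> / (C + 1)" using assms by simp
  from D_small[OF this] show ?thesis
  proof eventually_elim
    case (elim n)
    have m: "(\<lambda>x. \<integral>\<^sup>+t. ennreal (indicator {0..1} t * D n x t) \<partial>lborel) \<in> borel_measurable (N n)"
      by (rule measurable_NI, rule lborel.borel_measurable_nn_integral) measurable
    have m2: "(\<lambda>t. ennreal (indicator {0..1} t * D n x t)) \<in> borel_measurable lborel" for x
      unfolding D_def by measurable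
    have "(\<integral>\<^sup>+x. (\<integral>\<^sup>+t. ennreal (C * (indicator {0..1} t * D n x t)) \<partial>lborel) \<partial>N n) =
      ennreal C * (\<integral>\<^sup>+x. (\<integral>\<^sup>+t. ennreal (indicator {0..1} t * D n x t) \<partial>lborel) \<partial>N n)"
      using assms m m2 by (simp add: ennreal_mult' nn_integral_cmult)
    also have "\<dots> \<le> ennreal C * ennreal (\<epsilon> / (C + 1))" by (rule mult_left_mono[OF elim]) simp
    also have "\<dots> \<le> ennreal \<epsilon>"
    proof -
      have "C * (\<epsilon> / (C + 1)) \<le> \<epsilon>" using assms by (simp add: field_simps)
      then show ?thesis using assms by (simp add: ennreal_mult'[symmetric] ennreal_leI)
    qed
    finally show ?case .
  qed
qed

end

lemma jump_measurable:
  assumes m: "(\<lambda>z. k (fst z) (snd z)) \<in> borel_measurable (borel \<Otimes>\<^sub>M iid n obs_space)" and i: "i < n"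
  shows "jump k i \<in> borel_measurable (iid n obs_space)"
proof -
  note [measurable (raw)] = measurable_apply2[OF m]
  note [measurable] = i
  show ?thesis unfolding jump_def[abs_def] by measurable
qed

lemma (in counting_law) drift_measurable:
  assumes m: "(\<lambda>z. k (fst z) (snd z)) \<in> borel_measurable (borel \<Otimes>\<^sub>M iid n obs_space)" and i: "i < n"
  shows "drift k i \<in> borel_measurable (iid n obs_space)"
proof -
  note [measurable (raw)] = measurable_apply2[OF m]
  note [measurable] = i
  show ?thesis unfolding drift_def[abs_def] by measurable
qed

section \<open>The remainder of the partial score\<close>

context cox_sequence
begin

text \<open>For an integrand shared by all observations the intensities add up to n
  \<open>S_fun n 0\<close> times the hazard. The integrand has to be bounded only on the truncation
  event, by a number that may depend on n.\<close>

lemma truncated_martingale_square: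
  fixes k :: "real \<Rightarrow> (nat \<Rightarrow> obs) \<Rightarrow> real"
  assumes m: "(\<lambda>z. k (fst z) (snd z)) \<in> borel_measurable (borel \<Otimes>\<^sub>M iid n obs_space)"
    and pr: "predictable k" and \<gamma>: "0 < \<gamma>" and a: "0 < a"
    and bd: "\<And>t x. bounded_W \<gamma> n x \<Longrightarrow> \<bar>k t x\<bar> \<le> M"
  shows "(\<integral>\<^sup>+x. ennreal (if bounded_W \<gamma> n x then ((\<Sum>i<n. jump k i x - L.drift n k i x) / a)\<^sup>2 else 0) \<partial>N n) =
    (\<integral>\<^sup>+x. (\<integral>\<^sup>+t. ennreal (if bounded_W \<gamma> n x then (k t x)\<^sup>2 * (n * S_fun n 0 x t (th n) * hz n t) / a\<^sup>2 else 0) \<partial>lborel) \<partial>N n)"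
proof -
  note [measurable (raw)] = measurable_apply2[OF m]
  let ?H = "\<lambda>(i::nat) t x. if bounded_W \<gamma> n x then k t x else 0"
  define M' where "M' = \<bar>M\<bar> * exp (\<bar>th n\<bar> * (\<gamma> * sqrt n))"
  have Hm: "(\<lambda>z. ?H i (fst z) (snd z)) \<in> borel_measurable (borel \<Otimes>\<^sub>M iid n obs_space)" for i :: nat by measurable
  have Hp: "predictable (?H i)" for i :: nat
    using pr unfolding predictable_def bounded_W_def agree_def by metis
  have ge1: "1 \<le> exp (\<bar>th n\<bar> * (\<gamma> * sqrt n))" using \<gamma> by simp
  have Hb: "\<bar>?H i t x\<bar> \<le> M'" for i :: nat and t x
  proof (cases "bounded_W \<gamma> n x")
    case True
    have "\<bar>k t x\<bar> \<le> \<bar>M\<bar>" using bd[OF True, of t] by linarith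
    also have "\<dots> \<le> M'" unfolding M'_def using mult_left_mono[OF ge1, of "\<bar>M\<bar>"] by simp
    finally show ?thesis using True by simp
  qed (simp add: M'_def)
  have Hb': "\<bar>?H i t x\<bar> * exp (th n * obs_W (x i)) \<le> M'" if "i < n" for i t x
  proof (cases "bounded_W \<gamma> n x")
    case True
    have "\<bar>k t x\<bar> \<le> \<bar>M\<bar>" using bd[OF True, of t] by linarith
    moreover have "th n * obs_W (x i) \<le> \<bar>th n\<bar> * (\<gamma> * sqrt n)"
      using mult_left_mono[of "\<bar>obs_W (x i)\<bar>" "\<gamma> * sqrt n" "\<bar>th n\<bar>"] True that abs_ge_self[of "th n * obs_W (x i)"]
      by (simp add: bounded_W_def abs_mult)
    ultimately show ?thesis using True unfolding M'_def by (auto intro!: mult_mono)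
  qed (simp add: M'_def)
  have iso: "(\<integral>\<^sup>+x. ennreal ((\<Sum>i<n. jump (?H i) i x - L.drift n (?H i) i x)\<^sup>2) \<partial>N n) =
       (\<integral>\<^sup>+x. (\<integral>\<^sup>+t. ennreal (\<Sum>i<n. (?H i t x)\<^sup>2 * rate (th n) (hz n) (x i) t) \<partial>lborel) \<partial>N n)"
    by (rule L.nn_martingale_isometry[OF Hm Hp Hb Hb'])
  have jH: "jump (?H i) i x - L.drift n (?H i) i x = (if bounded_W \<gamma> n x then jump k i x - L.drift n k i x else 0)" for i x
    by (simp add: jump_def L.drift_def)
  have sm: "(\<lambda>x. (\<Sum>i<n. jump (?H i) i x - L.drift n (?H i) i x)\<^sup>2) \<in> borel_measurable (N n)"
    using jump_measurable[OF Hm] L.drift_measurable[OF Hm]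
    by (intro measurable_NI borel_measurable_power borel_measurable_sum borel_measurable_diff) auto
  have "(\<integral>\<^sup>+x. ennreal (if bounded_W \<gamma> n x then ((\<Sum>i<n. jump k i x - L.drift n k i x) / a)\<^sup>2 else 0) \<partial>N n) =
     (\<integral>\<^sup>+x. ennreal (1 / a\<^sup>2) * ennreal ((\<Sum>i<n. jump (?H i) i x - L.drift n (?H i) i x)\<^sup>2) \<partial>N n)"
    unfolding jH using a by (intro nn_integral_cong) (auto simp: ennreal_mult'[symmetric] power_divide)
  also have "\<dots> = ennreal (1 / a\<^sup>2) * (\<integral>\<^sup>+x. (\<integral>\<^sup>+t. ennreal (\<Sum>i<n. (?H i t x)\<^sup>2 * rate (th n) (hz n) (x i) t) \<partial>lborel) \<partial>N n)"
    unfolding iso[symmetric] by (rule nn_integral_cmult) (rule measurable_compose[OF sm measurable_ennreal])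
  also have "\<dots> = (\<integral>\<^sup>+x. (\<integral>\<^sup>+t. ennreal (1 / a\<^sup>2) * ennreal (\<Sum>i<n. (?H i t x)\<^sup>2 * rate (th n) (hz n) (x i) t) \<partial>lborel) \<partial>N n)"
  proof -
    have r: "(\<lambda>z. (?H i (snd z) (fst z))\<^sup>2 * rate (th n) (hz n) (fst z i) (snd z)) \<in> borel_measurable (iid n obs_space \<Otimes>\<^sub>M lborel)" if [measurable]: "i < n" for i
      by measurable
    have r2: "(\<lambda>z. ennreal (\<Sum>i<n. (?H i (snd z) (fst z))\<^sup>2 * rate (th n) (hz n) (fst z i) (snd z))) \<in> borel_measurable (iid n obs_space \<Otimes>\<^sub>M lborel)"
      using r by (intro measurable_compose[OF _ measurable_ennreal] borel_measurable_sum) auto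
    have 1: "(\<lambda>x. \<integral>\<^sup>+t. ennreal (\<Sum>i<n. (?H i t x)\<^sup>2 * rate (th n) (hz n) (x i) t) \<partial>lborel) \<in> borel_measurable (N n)"
      by (rule measurable_NI, rule lborel.borel_measurable_nn_integral) (use r2 in \<open>simp add: case_prod_beta'\<close>)
    have 2: "(\<lambda>t. ennreal (\<Sum>i<n. (?H i t x)\<^sup>2 * rate (th n) (hz n) (x i) t)) \<in> borel_measurable lborel" if "x \<in> space (iid n obs_space)" for x
      using measurable_compose[OF measurable_Pair1'[OF that] r2] by (simp cong: if_cong)
    show ?thesis
      using 1 2 by (subst nn_integral_cmult[symmetric]) (auto intro!: nn_integral_cong nn_integral_cmult[symmetric] simp: L.space_iid)
  qed
  also have "\<dots> = (\<integral>\<^sup>+x. (\<integral>\<^sup>+t. ennreal (if bounded_W \<gamma> n x then (k t x)\<^sup>2 * (n * S_fun n 0 x t (th n) * hz n t) / a\<^sup>2 else 0) \<partial>lborel) \<partial>N n)"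
    by (intro nn_integral_cong)
      (auto simp: ennreal_mult'[symmetric] sum_rate sum_distrib_left[symmetric])
  finally show ?thesis .
qed

lemma predictable_Sbar: "predictable (\<lambda>t x. Sbar n x t \<theta> - e t)"
  and predictable_Svar: "predictable (\<lambda>t x. Svar n x t \<theta>)"
  unfolding predictable_def
  by (intro allI impI, drule agree_Sbar[where n=n and \<theta>=\<theta>], simp)
    (intro allI impI, drule agree_Svar[where n=n and \<theta>=\<theta>], simp)

lemma hz_le: "hz n t \<le> indicator {0..1} t * K"
  using L.h_le[of n t] L.h_outside[of t n] by (auto split: split_indicator)

definition remainder :: "nat \<Rightarrow> (nat \<Rightarrow> obs) \<Rightarrow> real" where
  "remainder n x = (\<Sum>i<n. jump (\<lambda>t x. Sbar n x t (th n) - e t) i x - L.drift n (\<lambda>t x. Sbar n x t (th n) - e t) i x) / sqrt n"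

lemma Sbar_e_measurable: "(\<lambda>z. Sbar n (snd z) (fst z) (th n) - e (fst z)) \<in> borel_measurable (borel \<Otimes>\<^sub>M iid n obs_space)"
  by measurable

lemma Svar_th_measurable: "(\<lambda>z. Svar n (snd z) (fst z) (th n)) \<in> borel_measurable (borel \<Otimes>\<^sub>M iid n obs_space)"
  by measurable

text \<open>The truncated second moment is the expectation of the time integral of (Sbar - e)^2 S0
  times the hazard, which is at most a multiple of that of \<open>D\<close>. The truncation level 1
  serves only to make the integrand bounded for each n, by sqrt n + E.\<close>

lemma remainder_small: "small remainder"
proof (rule small_truncated)
  show "remainder n \<in> borel_measurable (iid n obs_space)" for n
    unfolding remainder_def[abs_def]
    using jump_measurable[OF Sbar_e_measurable] L.drift_measurable[OF Sbar_e_measurable]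
    by (intro borel_measurable_divide borel_measurable_sum borel_measurable_diff) auto
  fix \<epsilon> :: real assume \<epsilon>: "0 < \<epsilon>"
  obtain C where C: "0 \<le> C"
    "\<And>n x t. t \<in> {0..1} \<Longrightarrow> (Sbar n x t (th n) - e t)\<^sup>2 * S_fun n 0 x t (th n) \<le> C * D n x t"
    "\<And>n x t. t \<in> {0..1} \<Longrightarrow> \<bar>Svar n x t (th n) * S_fun n 0 x t (th n) - (s 2 t - (s 1 t)\<^sup>2 / s 0 t)\<bar> \<le> C * D n x t"
    by (rule ratio_constant) (rule that)
  have K0: "0 \<le> K" by (rule L.K_nonneg)
  have CK: "0 \<le> C * K" using C K0 by simp
  have "\<forall>\<^sub>F n in sequentially. (\<integral>\<^sup>+x. ennreal (if bounded_W 1 n x then (remainder n x)\<^sup>2 else 0) \<partial>N n) \<le> ennreal \<epsilon>"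
    using nn_integral_D_scale[OF CK \<epsilon>] eventually_gt_at_top[of 0]
  proof eventually_elim
    case (elim n)
    let ?k = "\<lambda>t x. Sbar n x t (th n) - e t"
    have "(\<integral>\<^sup>+x. ennreal (if bounded_W 1 n x then (remainder n x)\<^sup>2 else 0) \<partial>N n) =
      (\<integral>\<^sup>+x. (\<integral>\<^sup>+t. ennreal (if bounded_W 1 n x then (?k t x)\<^sup>2 * (n * S_fun n 0 x t (th n) * hz n t) / (sqrt n)\<^sup>2 else 0) \<partial>lborel) \<partial>N n)"
      unfolding remainder_def
    proof (rule truncated_martingale_square[where M="sqrt n + E"])
      show "\<bar>Sbar n x t (th n) - e t\<bar> \<le> sqrt n + E" if "bounded_W 1 n x" for t x
      proof -
        have "\<bar>Sbar n x t (th n)\<bar> \<le> sqrt n"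
          by (rule Sbar_le) (use that in \<open>auto simp: bounded_W_def\<close>)
        then show ?thesis using e_le[of t] by linarith
      qed
      show "0 < sqrt n" using elim(2) by simp
    qed (rule Sbar_e_measurable predictable_Sbar zero_less_one)+
    also have "\<dots> \<le> (\<integral>\<^sup>+x. (\<integral>\<^sup>+t. ennreal (C * K * (indicator {0..1} t * D n x t)) \<partial>lborel) \<partial>N n)"
    proof (intro nn_integral_mono ennreal_leI)
      fix x and t :: real
      have "(?k t x)\<^sup>2 * (n * S_fun n 0 x t (th n) * hz n t) / (sqrt n)\<^sup>2 = ((?k t x)\<^sup>2 * S_fun n 0 x t (th n)) * hz n t"
        using elim(2) by simp
      also have "\<dots> \<le> C * K * (indicator {0..1} t * D n x t)"
      proof (cases "t \<in> {0..1}")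
        case True
        then have hk: "hz n t \<le> K" using hz_le[of n t] by simp
        have "((?k t x)\<^sup>2 * S_fun n 0 x t (th n)) * hz n t \<le> (C * D n x t) * K"
          by (rule mult_mono[OF C(2)[OF True] hk mult_nonneg_nonneg[OF C(1) D_nonneg] L.h_nonneg])
        then show ?thesis using True by (simp add: mult_ac)
      next
        case False
        then show ?thesis using L.h_outside[of t n] by simp
      qed
      finally show "(if bounded_W 1 n x then (?k t x)\<^sup>2 * (n * S_fun n 0 x t (th n) * hz n t) / (sqrt n)\<^sup>2 else 0) \<le> C * K * (indicator {0..1} t * D n x t)"
        using CK D_nonneg[of n x t] by simp
    qed
    finally show ?case using elim(1) by (rule order_trans)
  qed
  then show "\<exists>\<gamma>>0. \<forall>\<^sub>F n in sequentially. (\<integral>\<^sup>+x. ennreal (if bounded_W \<gamma> n x then (remainder n x)\<^sup>2 else 0) \<partial>N n) \<le> ennreal \<epsilon>"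
    by (intro exI[of _ 1] conjI zero_less_one)
qed

section \<open>Convergence of the observed information\<close>

definition vs :: "real \<Rightarrow> real" where "vs t = s 2 t - (s 1 t)\<^sup>2 / s 0 t"

text \<open>This is \<open>J_info\<close> in the limit: \<open>vs\<close> is the product of
  \<open>v_fun\<close> and \<open>s 0\<close>, multiplied out so that it matches
  \<open>Svar_S0\<close>.\<close>

definition J :: real where "J = (LBINT t. vs t * h0 t)"

lemma vs_measurable [measurable]: "vs \<in> borel_measurable borel" unfolding vs_def[abs_def] by measurable

lemma vs_le: "t \<in> {0..1} \<Longrightarrow> \<bar>vs t\<bar> \<le> B + B\<^sup>2 / c"
proof -
  assume t: "t \<in> {0..1}"
  have "\<bar>(s 1 t)\<^sup>2 / s 0 t\<bar> \<le> B\<^sup>2 / c"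
    unfolding abs_divide using power_mono[OF s_le[of 1 t] abs_ge_zero, of 2] t s0_ge[OF t] c_pos by (intro frac_le) auto
  then show ?thesis using s_le[of 2 t] t unfolding vs_def by linarith
qed

lemma integrable_01:
  fixes f :: "real \<Rightarrow> real"
  assumes [measurable]: "f \<in> borel_measurable borel" and b: "\<And>t. \<bar>f t\<bar> \<le> indicator {0..1} t * b"
  shows "integrable lborel f"
proof (rule Bochner_Integration.integrable_bound[where f="\<lambda>t. indicator {0..1} t * b"])
  show "integrable lborel (\<lambda>t::real. indicator {0..1} t * b)"
    by (intro integrable_mult_left integrable_indicator_01)
  show "AE t in lborel. norm (f t) \<le> norm (indicator {0..1} t * b)"
    using b by (intro AE_I2) (auto intro: order_trans[OF _ abs_ge_self])
qed measurable

lemma vs_h_integrable: "integrable lborel (\<lambda>t. vs t * h0 t)"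
proof (rule integrable_01)
  fix t show "\<bar>vs t * h0 t\<bar> \<le> indicator {0..1} t * ((B + B\<^sup>2 / c) * K)"
    using vs_le[of t] h0_nonneg[of t] h0_le[of t] h0_outside[of t]
    by (auto simp: abs_mult intro!: mult_mono split: split_indicator)
qed measurable

text \<open>For a fixed sample any bound on the covariates yields integrability, and the sum of
  their absolute values is one. The intensities then add up to the factor \<open>S_fun n 0\<close>
  times the hazard.\<close>

lemma Svar_drift:
  assumes n: "0 < n" and x: "x \<in> space (iid n obs_space)"
  shows "(\<Sum>i<n. L.drift n (\<lambda>t x. Svar n x t (th n)) i x) / n = (LBINT t. Svar n x t (th n) * S_fun n 0 x t (th n) * hz n t)"
    and "integrable lborel (\<lambda>t. Svar n x t (th n) * S_fun n 0 x t (th n) * hz n t)"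
proof -
  let ?M = "\<Sum>j<n. \<bar>obs_W (x j)\<bar>"
  have M: "\<bar>obs_W (x j)\<bar> \<le> ?M" if "j < n" for j using that by (intro member_le_sum) auto
  have Vm: "(\<lambda>t. Svar n x t (th n)) \<in> borel_measurable borel"
    using x by measurable
  have Vb: "\<bar>Svar n x t (th n)\<bar> \<le> ?M\<^sup>2" for t
    using Svar_le[OF M, of n] Svar_nonneg[of n x t "th n"] by (simp add: sum_nonneg)
  have i: "integrable lborel (\<lambda>t. Svar n x t (th n) * rate (th n) (hz n) (x i) t)" for i
    by (rule L.rate_integrable[OF Vm Vb])
  have eq: "(\<Sum>i<n. Svar n x t (th n) * rate (th n) (hz n) (x i) t) / n = Svar n x t (th n) * S_fun n 0 x t (th n) * hz n t" for t
    using n by (simp add: sum_distrib_left[symmetric] sum_rate)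
  have i2: "integrable lborel (\<lambda>t. (\<Sum>i<n. Svar n x t (th n) * rate (th n) (hz n) (x i) t) / n)"
    using i by (intro integrable_divide_zero Bochner_Integration.integrable_sum) auto
  then show "integrable lborel (\<lambda>t. Svar n x t (th n) * S_fun n 0 x t (th n) * hz n t)" unfolding eq .
  have "(\<Sum>i<n. L.drift n (\<lambda>t x. Svar n x t (th n)) i x) = (LBINT t. (\<Sum>i<n. Svar n x t (th n) * rate (th n) (hz n) (x i) t))"
    unfolding L.drift_def using i by (intro Bochner_Integration.integral_sum[symmetric]) auto
  then show "(\<Sum>i<n. L.drift n (\<lambda>t x. Svar n x t (th n)) i x) / n = (LBINT t. Svar n x t (th n) * S_fun n 0 x t (th n) * hz n t)"
    unfolding eq[symmetric] by simp
qed

text \<open>The second moment is 1 / n times the expected integral of Svar^2 S0 times the hazard. On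
  the truncation event one factor Svar is at most \<gamma>^2 n and uses up the 1 / n, while Svar S0
  <= B + D stays bounded in mean. Smallness thus comes from the truncation level, not from
  n.\<close>

lemma information_martingale_small:
  "small (\<lambda>n x. (\<Sum>i<n. jump (\<lambda>t x. Svar n x t (th n)) i x - L.drift n (\<lambda>t x. Svar n x t (th n)) i x) / n)"
proof (rule small_truncated)
  show "(\<lambda>x. (\<Sum>i<n. jump (\<lambda>t x. Svar n x t (th n)) i x - L.drift n (\<lambda>t x. Svar n x t (th n)) i x) / n) \<in> borel_measurable (iid n obs_space)" for n
    using jump_measurable[OF Svar_th_measurable] L.drift_measurable[OF Svar_th_measurable]
    by (intro borel_measurable_divide borel_measurable_sum borel_measurable_diff) auto
  fix \<epsilon> :: real assume \<epsilon>: "0 < \<epsilon>"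
  have K0: "0 \<le> K" by (rule L.K_nonneg)
  \<comment> \<open>The two terms of the estimate amount to \<gamma>^2 (1 + K B), which this choice
    keeps below \<epsilon>.\<close>
  define \<gamma> where "\<gamma> = sqrt (\<epsilon> / (K * B + K + 1))"
  have kb: "0 < K * B + K + 1" using K0 mult_nonneg_nonneg[OF K0 B_nonneg] by linarith
  have \<gamma>: "0 < \<gamma>" "\<gamma>\<^sup>2 = \<epsilon> / (K * B + K + 1)" using \<epsilon> kb by (auto simp: \<gamma>_def less_imp_le)
  have gK: "0 \<le> \<gamma>\<^sup>2 * K" using K0 by simp
  have e1: "0 < \<gamma>\<^sup>2" using \<gamma>(1) by (rule zero_less_power)
  have "\<forall>\<^sub>F n in sequentially. (\<integral>\<^sup>+x. ennreal (if bounded_W \<gamma> n x then ((\<Sum>i<n. jump (\<lambda>t x. Svar n x t (th n)) i x - L.drift n (\<lambda>t x. Svar n x t (th n)) i x) / n)\<^sup>2 else 0) \<partial>N n) \<le> ennreal \<epsilon>"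
    using nn_integral_D_scale[OF gK e1] eventually_gt_at_top[of 0]
  proof eventually_elim
    case (elim n)
    interpret N: prob_space "N n" by (rule prob_space_N)
    let ?k = "\<lambda>t x. Svar n x t (th n)"
    have "(\<integral>\<^sup>+x. ennreal (if bounded_W \<gamma> n x then ((\<Sum>i<n. jump ?k i x - L.drift n ?k i x) / n)\<^sup>2 else 0) \<partial>N n) =
      (\<integral>\<^sup>+x. (\<integral>\<^sup>+t. ennreal (if bounded_W \<gamma> n x then (?k t x)\<^sup>2 * (n * S_fun n 0 x t (th n) * hz n t) / (real n)\<^sup>2 else 0) \<partial>lborel) \<partial>N n)"
    proof (rule truncated_martingale_square[where M="(\<gamma> * sqrt n)\<^sup>2"])
      show "\<bar>Svar n x t (th n)\<bar> \<le> (\<gamma> * sqrt n)\<^sup>2" if "bounded_W \<gamma> n x" for t x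
      proof -
        have "Svar n x t (th n) \<le> (\<gamma> * sqrt n)\<^sup>2"
          by (rule Svar_le) (use that \<gamma>(1) in \<open>auto simp: bounded_W_def\<close>)
        then show ?thesis using Svar_nonneg[of n x t "th n"] by linarith
      qed
      show "0 < real n" using elim(2) by simp
    qed (rule Svar_th_measurable predictable_Svar \<gamma>(1))+
    also have "\<dots> \<le> (\<integral>\<^sup>+x. (\<integral>\<^sup>+t. ennreal (\<gamma>\<^sup>2 * K * (indicator {0..1} t * D n x t)) + ennreal (\<gamma>\<^sup>2 * K * B) * indicator {0..1} t \<partial>lborel) \<partial>N n)"
    proof (intro nn_integral_mono)
      fix x and t :: real
      have D0: "0 \<le> D n x t" by (rule D_nonneg)
      show "ennreal (if bounded_W \<gamma> n x then (?k t x)\<^sup>2 * (n * S_fun n 0 x t (th n) * hz n t) / (real n)\<^sup>2 else 0) \<le>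
         ennreal (\<gamma>\<^sup>2 * K * (indicator {0..1} t * D n x t)) + ennreal (\<gamma>\<^sup>2 * K * B) * indicator {0..1} t"
      proof (cases "bounded_W \<gamma> n x \<and> t \<in> {0..1}")
        case True
        then have t: "t \<in> {0..1}" by simp
        have V: "?k t x \<le> \<gamma>\<^sup>2 * n"
        proof -
          have "Svar n x t (th n) \<le> (\<gamma> * sqrt n)\<^sup>2"
            by (rule Svar_le) (use True \<gamma>(1) in \<open>auto simp: bounded_W_def\<close>)
          then show ?thesis by (simp add: power_mult_distrib)
        qed
        have VS: "?k t x * S_fun n 0 x t (th n) \<le> B + D n x t"
        proof -
          have "0 \<le> (S_fun n 1 x t (th n))\<^sup>2 / S_fun n 0 x t (th n)" using S_fun_nonneg(1) by simp
          then have "?k t x * S_fun n 0 x t (th n) \<le> S_fun n 2 x t (th n)" unfolding Svar_S0 by linarith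
          also have "\<dots> \<le> B + D n x t" using s_le[of 2 t] t unfolding D_def by linarith
          finally show ?thesis .
        qed
        have VS0: "0 \<le> ?k t x * S_fun n 0 x t (th n)" by (intro mult_nonneg_nonneg Svar_nonneg S_fun_nonneg)
        have "(?k t x)\<^sup>2 * (n * S_fun n 0 x t (th n) * hz n t) / (real n)\<^sup>2 = ?k t x * ((?k t x * S_fun n 0 x t (th n)) * hz n t) / n"
          using elim(2) by (simp add: power2_eq_square)
        also have "\<dots> \<le> (\<gamma>\<^sup>2 * n) * ((B + D n x t) * K) / n"
          using V VS VS0 hz_le[of n t] L.h_nonneg[of n t] t K0 Svar_nonneg[of n x t "th n"] D0 B_nonneg
          by (intro divide_right_mono mult_mono mult_nonneg_nonneg S_fun_nonneg) auto
        also have "\<dots> = \<gamma>\<^sup>2 * K * D n x t + \<gamma>\<^sup>2 * K * B" using elim(2) by (simp add: field_simps)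
        finally have kk: "(?k t x)\<^sup>2 * (n * S_fun n 0 x t (th n) * hz n t) / (real n)\<^sup>2 \<le> \<gamma>\<^sup>2 * K * D n x t + \<gamma>\<^sup>2 * K * B" .
        have "0 \<le> \<gamma>\<^sup>2 * K * D n x t" "0 \<le> \<gamma>\<^sup>2 * K * B" using K0 D0 B_nonneg by simp_all
        then have "ennreal (\<gamma>\<^sup>2 * K * D n x t + \<gamma>\<^sup>2 * K * B) = ennreal (\<gamma>\<^sup>2 * K * D n x t) + ennreal (\<gamma>\<^sup>2 * K * B)"
          by (rule ennreal_plus)
        then show ?thesis using True ennreal_leI[OF kk] by simp
      next
        case False
        then show ?thesis using L.h_outside[of t n] by auto
      qed
    qed
    also have "\<dots> = (\<integral>\<^sup>+x. (\<integral>\<^sup>+t. ennreal (\<gamma>\<^sup>2 * K * (indicator {0..1} t * D n x t)) \<partial>lborel) \<partial>N n) + ennreal (\<gamma>\<^sup>2 * K * B)"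
    proof -
      have m: "(\<lambda>x. \<integral>\<^sup>+t. ennreal (\<gamma>\<^sup>2 * K * (indicator {0..1} t * D n x t)) \<partial>lborel) \<in> borel_measurable (N n)"
        by (rule measurable_NI, rule lborel.borel_measurable_nn_integral) measurable
      have m2: "(\<lambda>t. ennreal (\<gamma>\<^sup>2 * K * (indicator {0..1} t * D n x t))) \<in> borel_measurable lborel" for x
        unfolding D_def by measurable
      show ?thesis
        using m m2 by (simp add: nn_integral_add nn_integral_cmult N.emeasure_space_1)
    qed
    also have "\<dots> \<le> ennreal (\<gamma>\<^sup>2) + ennreal (\<gamma>\<^sup>2 * K * B)" by (rule add_right_mono[OF elim(1)])
    also have "\<dots> \<le> ennreal \<epsilon>"
    proof -
      have "\<gamma>\<^sup>2 + \<gamma>\<^sup>2 * K * B = \<gamma>\<^sup>2 * (K * B + 1)" by (simp add: algebra_simps)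
      also have "\<dots> \<le> \<gamma>\<^sup>2 * (K * B + K + 1)" using K0 by (intro mult_left_mono) auto
      also have "\<dots> = \<epsilon>" using \<gamma>(2) kb by simp
      finally show ?thesis using K0 B_nonneg by (simp add: ennreal_plus[symmetric] ennreal_leI del: ennreal_plus)
    qed
    finally show ?case .
  qed
  then show "\<exists>\<gamma>>0. \<forall>\<^sub>F n in sequentially. (\<integral>\<^sup>+x. ennreal (if bounded_W \<gamma> n x then ((\<Sum>i<n. jump (\<lambda>t x. Svar n x t (th n)) i x - L.drift n (\<lambda>t x. Svar n x t (th n)) i x) / n)\<^sup>2 else 0) \<partial>N n) \<le> ennreal \<epsilon>"
    using \<gamma>(1) by blast
qed

text \<open>The drift is the time integral of Svar S0 times the hazard of row n. Replacing Svar S0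
  by \<open>vs\<close> costs a multiple of \<open>D\<close>, replacing the hazard by its limit costs
  the uniform distance of the hazards times the bound \<open>V\<close> of \<open>vs\<close>.\<close>

lemma information_drift_small:
  "small (\<lambda>n x. (\<Sum>i<n. L.drift n (\<lambda>t x. Svar n x t (th n)) i x) / n - J)"
proof (rule small_L1)
  show "(\<lambda>x. (\<Sum>i<n. L.drift n (\<lambda>t x. Svar n x t (th n)) i x) / n - J) \<in> borel_measurable (iid n obs_space)" for n
    using L.drift_measurable[OF Svar_th_measurable]
    by (intro borel_measurable_divide borel_measurable_sum borel_measurable_diff) auto
  fix \<epsilon> :: real assume \<epsilon>: "0 < \<epsilon>"
  obtain C where C: "0 \<le> C"
    "\<And>n x t. t \<in> {0..1} \<Longrightarrow> (Sbar n x t (th n) - e t)\<^sup>2 * S_fun n 0 x t (th n) \<le> C * D n x t"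
    "\<And>n x t. t \<in> {0..1} \<Longrightarrow> \<bar>Svar n x t (th n) * S_fun n 0 x t (th n) - (s 2 t - (s 1 t)\<^sup>2 / s 0 t)\<bar> \<le> C * D n x t"
    by (rule ratio_constant) (rule that)
  have K0: "0 \<le> K" by (rule L.K_nonneg)
  have CK: "0 \<le> C * K" using C K0 by simp
  define V where "V = B + B\<^sup>2 / c"
  have V: "0 \<le> V" using B_nonneg c_pos by (simp add: V_def)
  define \<eta> where "\<eta> = \<epsilon> / (2 * (V + 1))"
  have \<eta>: "0 < \<eta>" "V * \<eta> \<le> \<epsilon> / 2" using V \<epsilon> by (auto simp: \<eta>_def field_simps)
  have e2: "0 < \<epsilon> / 2" using \<epsilon> by simp
  show "\<forall>\<^sub>F n in sequentially. (\<integral>\<^sup>+x. ennreal \<bar>(\<Sum>i<n. L.drift n (\<lambda>t x. Svar n x t (th n)) i x) / n - J\<bar> \<partial>N n) \<le> ennreal \<epsilon>"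
    using nn_integral_D_scale[OF CK e2] hz_conv[OF \<eta>(1)] eventually_gt_at_top[of 0]
  proof eventually_elim
    case (elim n)
    interpret N: prob_space "N n" by (rule prob_space_N)
    have "(\<integral>\<^sup>+x. ennreal \<bar>(\<Sum>i<n. L.drift n (\<lambda>t x. Svar n x t (th n)) i x) / n - J\<bar> \<partial>N n) \<le>
       (\<integral>\<^sup>+x. (\<integral>\<^sup>+t. ennreal (C * K * (indicator {0..1} t * D n x t)) + ennreal (V * \<eta>) * indicator {0..1} t \<partial>lborel) \<partial>N n)"
    proof (rule nn_integral_mono)
      fix x assume "x \<in> space (N n)"
      then have x: "x \<in> space (iid n obs_space)" by (simp add: L.space_iid)
      let ?g = "\<lambda>t. Svar n x t (th n) * S_fun n 0 x t (th n) * hz n t - vs t * h0 t"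
      have gi: "integrable lborel ?g" using Svar_drift(2)[OF elim(3) x] vs_h_integrable by simp
      have "(\<Sum>i<n. L.drift n (\<lambda>t x. Svar n x t (th n)) i x) / n - J = (LBINT t. ?g t)"
        using Svar_drift[OF elim(3) x] vs_h_integrable by (simp add: J_def)
      then have "ennreal \<bar>(\<Sum>i<n. L.drift n (\<lambda>t x. Svar n x t (th n)) i x) / n - J\<bar> = ennreal (norm (LBINT t. ?g t))" by simp
      also have "\<dots> \<le> (\<integral>\<^sup>+t. ennreal (norm (?g t)) \<partial>lborel)" by (rule integral_norm_bound_ennreal[OF gi])
      also have "\<dots> \<le> (\<integral>\<^sup>+t. ennreal (C * K * (indicator {0..1} t * D n x t)) + ennreal (V * \<eta>) * indicator {0..1} t \<partial>lborel)"
      proof (rule nn_integral_mono)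
        fix t :: real
        show "ennreal (norm (?g t)) \<le> ennreal (C * K * (indicator {0..1} t * D n x t)) + ennreal (V * \<eta>) * indicator {0..1} t"
        proof (cases "t \<in> {0..1}")
          case True
          have "?g t = (Svar n x t (th n) * S_fun n 0 x t (th n) - vs t) * hz n t + vs t * (hz n t - h0 t)"
            by (simp add: algebra_simps)
          also have "\<bar>\<dots>\<bar> \<le> \<bar>(Svar n x t (th n) * S_fun n 0 x t (th n) - vs t) * hz n t\<bar> + \<bar>vs t * (hz n t - h0 t)\<bar>"
            by (rule abs_triangle_ineq)
          finally have 1: "\<bar>?g t\<bar> \<le> \<bar>(Svar n x t (th n) * S_fun n 0 x t (th n) - vs t) * hz n t\<bar> + \<bar>vs t * (hz n t - h0 t)\<bar>" .
          have 2: "\<bar>(Svar n x t (th n) * S_fun n 0 x t (th n) - vs t) * hz n t\<bar> \<le> (C * D n x t) * K"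
            unfolding abs_mult vs_def using C(3)[OF True, of n x] hz_le[of n t] L.h_nonneg[of n t] True mult_nonneg_nonneg[OF C(1) D_nonneg[of n x t]]
            by (intro mult_mono) auto
          have 3: "\<bar>vs t * (hz n t - h0 t)\<bar> \<le> V * \<eta>"
            unfolding abs_mult using vs_le[OF True] elim(2) V by (intro mult_mono) (auto simp: V_def)
          have 4: "\<bar>?g t\<bar> \<le> C * K * D n x t + V * \<eta>" using 1 2 3 by (simp add: mult_ac)
          have "0 \<le> C * K * D n x t" "0 \<le> V * \<eta>" using CK D_nonneg[of n x t] V \<eta> by simp_all
          then have "ennreal (C * K * D n x t + V * \<eta>) = ennreal (C * K * D n x t) + ennreal (V * \<eta>)"
            by (rule ennreal_plus)
          then show ?thesis using True ennreal_leI[OF 4] by simp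
        next
          case False
          then show ?thesis using L.h_outside[of t n] h0_outside[of t] by simp
        qed
      qed
      finally show "ennreal \<bar>(\<Sum>i<n. L.drift n (\<lambda>t x. Svar n x t (th n)) i x) / n - J\<bar> \<le>
        (\<integral>\<^sup>+t. ennreal (C * K * (indicator {0..1} t * D n x t)) + ennreal (V * \<eta>) * indicator {0..1} t \<partial>lborel)" .
    qed
    also have "\<dots> = (\<integral>\<^sup>+x. (\<integral>\<^sup>+t. ennreal (C * K * (indicator {0..1} t * D n x t)) \<partial>lborel) \<partial>N n) + ennreal (V * \<eta>)"
    proof -
      have m: "(\<lambda>x. \<integral>\<^sup>+t. ennreal (C * K * (indicator {0..1} t * D n x t)) \<partial>lborel) \<in> borel_measurable (N n)"
        by (rule measurable_NI, rule lborel.borel_measurable_nn_integral) measurable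
      have m2: "(\<lambda>t. ennreal (C * K * (indicator {0..1} t * D n x t))) \<in> borel_measurable lborel" for x
        unfolding D_def by measurable
      show ?thesis
        using m m2 by (simp add: nn_integral_add nn_integral_cmult N.emeasure_space_1)
    qed
    also have "\<dots> \<le> ennreal (\<epsilon> / 2) + ennreal (\<epsilon> / 2)"
      using elim(1) \<eta> by (intro add_mono ennreal_leI)
    also have "\<dots> = ennreal \<epsilon>" using \<epsilon> by (simp add: ennreal_plus[symmetric] del: ennreal_plus)
    finally show ?case .
  qed
qed

lemma information_small: "small (\<lambda>n x. cox_information n x (th n) / n - J)"
proof -
  have "small (\<lambda>n x. (\<Sum>i<n. jump (\<lambda>t x. Svar n x t (th n)) i x - L.drift n (\<lambda>t x. Svar n x t (th n)) i x) / n
    + ((\<Sum>i<n. L.drift n (\<lambda>t x. Svar n x t (th n)) i x) / n - J))"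
    by (rule small_add[OF information_martingale_small information_drift_small])
  moreover have "cox_information n x (th n) = (\<Sum>i<n. jump (\<lambda>t x. Svar n x t (th n)) i x)" for n x
    by (simp add: cox_information_def jump_def)
  ultimately show ?thesis by (simp add: sum_subtractf diff_divide_distrib)
qed

end

section \<open>Second moments of integrals affine in the covariate\<close>

context counting_law
begin

context
  fixes \<theta>0 d :: real
  assumes env: "integrable R (\<lambda>x. envelope \<theta>0 d (obs_W x))" and near: "\<bar>\<theta> - \<theta>0\<bar> \<le> d"
begin

lemma s_fun_integrable:
  assumes k: "k \<le> 2"
  shows "integrable R (\<lambda>x. obs_Y x t * obs_W x ^ k * exp (\<theta> * obs_W x))"
proof (rule Bochner_Integration.integrable_bound[OF env])
  show "(\<lambda>x. obs_Y x t * obs_W x ^ k * exp (\<theta> * obs_W x)) \<in> borel_measurable R"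
    unfolding obs_Y_def by (rule measurable_RI) measurable
  show "AE x in R. norm (obs_Y x t * obs_W x ^ k * exp (\<theta> * obs_W x)) \<le> norm (envelope \<theta>0 d (obs_W x))"
  proof (rule AE_I2)
    fix x :: obs
    show "norm (obs_Y x t * obs_W x ^ k * exp (\<theta> * obs_W x)) \<le> norm (envelope \<theta>0 d (obs_W x))"
      using power_exp_le_envelope[OF k near, of "obs_W x"] envelope_nonneg[of \<theta>0 d "obs_W x"]
      by (auto simp: obs_Y_def abs_mult)
  qed
qed

lemma s_fun_bound: 
  assumes k: "k \<le> 2"
  shows "\<bar>s_fun R k \<theta> t\<bar> \<le> (LINT x|R. envelope \<theta>0 d (obs_W x))"
  unfolding s_fun_def
proof (rule order_trans[OF integral_abs_bound], rule integral_mono[OF integrable_abs[OF s_fun_integrable[OF k]] env])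
  fix x :: obs
  show "\<bar>obs_Y x t * obs_W x ^ k * exp (\<theta> * obs_W x)\<bar> \<le> envelope \<theta>0 d (obs_W x)"
    using power_exp_le_envelope[OF k near, of "obs_W x"] envelope_nonneg[of \<theta>0 d "obs_W x"]
    by (auto simp: obs_Y_def abs_mult)
qed

lemma s_fun_measurable: "(\<lambda>t. s_fun R k \<theta>' t) \<in> borel_measurable borel"
proof -
  have "(\<lambda>z. obs_Y (snd z) (fst z) * obs_W (snd z) ^ k * exp (\<theta>' * obs_W (snd z))) \<in> borel_measurable (borel \<Otimes>\<^sub>M obs_space)"
    unfolding obs_Y_def by measurable
  then have "(\<lambda>z. obs_Y (snd z) (fst z) * obs_W (snd z) ^ k * exp (\<theta>' * obs_W (snd z))) \<in> borel_measurable (borel \<Otimes>\<^sub>M R)"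
    using measurable_cong_sets[OF sets_pair_measure_cong[OF refl sets_R] refl, of borel] by blast
  then show ?thesis
    unfolding s_fun_def by (intro borel_measurable_lebesgue_integral) (simp add: case_prod_beta')
qed

text \<open>Taking the expectation inside the time integral of the isometry turns W^2, W and 1,
  weighted by the intensity, into \<open>s_fun\<close> of order 2, 1 and 0. The coefficient \<alpha>
  is 0 for nuisance scores and 1 for the score for \<theta> and the efficient score.\<close>

lemma
  fixes g :: "real \<Rightarrow> real" and \<alpha> :: real
  assumes gm [measurable]: "g \<in> borel_measurable borel" and gb: "\<And>t. \<bar>g t\<bar> \<le> G"
  defines "q \<equiv> \<lambda>t. (\<alpha>\<^sup>2 * s_fun R 2 \<theta> t + 2 * \<alpha> * g t * s_fun R 1 \<theta> t + (g t)\<^sup>2 * s_fun R 0 \<theta> t) * h t"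
  shows nn_integral_mart_square_affine:
      "(\<integral>\<^sup>+x. ennreal ((mart (\<lambda>t w. \<alpha> * w + g t) x)\<^sup>2) \<partial>R) = ennreal (LBINT t. q t)"
    and integrable_mart_variance: "integrable lborel q"
    and integral_mart_variance_nonneg: "0 \<le> (LBINT t. q t)"
    and integrable_mart_square: "integrable R (\<lambda>x. (mart (\<lambda>t w. \<alpha> * w + g t) x)\<^sup>2)"
    and integral_mart_square_affine: "(LINT x|R. (mart (\<lambda>t w. \<alpha> * w + g t) x)\<^sup>2) = (LBINT t. q t)"
proof -
  interpret RL: pair_sigma_finite R lborel by standard
  let ?f = "\<lambda>t w. \<alpha> * w + g t"
  have fm: "(\<lambda>z. ?f (fst z) (snd z)) \<in> borel_measurable (borel \<Otimes>\<^sub>M borel)" by measurable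
  have sm: "s_fun R k \<theta> \<in> borel_measurable borel" for k using s_fun_measurable[of k \<theta>] by simp
  have G0: "0 \<le> G" using gb[of 0] by linarith
  define V where "V = (LINT x|R. envelope \<theta>0 d (obs_W x))"
  have V0: "0 \<le> V" unfolding V_def by (intro Bochner_Integration.integral_nonneg envelope_nonneg)
  have inner: "(\<integral>\<^sup>+x. ennreal ((?f t (obs_W x))\<^sup>2 * rate \<theta> h x t) \<partial>R) = ennreal (q t)" and q0: "0 \<le> q t" for t
  proof -
    let ?w = "\<lambda>k x. obs_Y x t * obs_W x ^ k * exp (\<theta> * obs_W x)"
    have eq: "(?f t (obs_W x))\<^sup>2 * rate \<theta> h x t = (\<alpha>\<^sup>2 * ?w 2 x + 2 * \<alpha> * g t * ?w 1 x + (g t)\<^sup>2 * ?w 0 x) * h t" for x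
      by (simp add: rate_def power2_eq_square algebra_simps)
    have i: "integrable R (?w 2)" "integrable R (?w 1)" "integrable R (?w 0)" by (rule s_fun_integrable; simp)+
    have int: "integrable R (\<lambda>x. (?f t (obs_W x))\<^sup>2 * rate \<theta> h x t)" unfolding eq using i by simp
    have val: "(LINT x|R. (?f t (obs_W x))\<^sup>2 * rate \<theta> h x t) = q t"
      unfolding eq q_def s_fun_def using i by simp
    have nn: "0 \<le> (?f t (obs_W x))\<^sup>2 * rate \<theta> h x t" for x by (intro mult_nonneg_nonneg rate_nonneg) simp
    show "(\<integral>\<^sup>+x. ennreal ((?f t (obs_W x))\<^sup>2 * rate \<theta> h x t) \<partial>R) = ennreal (q t)"
      using nn_integral_eq_integral[OF int] nn val by simp
    show "0 \<le> q t" unfolding val[symmetric] by (rule Bochner_Integration.integral_nonneg) (rule nn)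
  qed
  have qm: "q \<in> borel_measurable borel" unfolding q_def using sm by measurable
  let ?b = "(\<alpha>\<^sup>2 * V + 2 * \<bar>\<alpha>\<bar> * G * V + G\<^sup>2 * V) * K"
  have qb: "\<bar>q t\<bar> \<le> indicator {0..1} t * ?b" for t
  proof (cases "t \<in> {0..1}")
    case True
    have s: "\<bar>s_fun R 2 \<theta> t\<bar> \<le> V" "\<bar>s_fun R 1 \<theta> t\<bar> \<le> V" "\<bar>s_fun R 0 \<theta> t\<bar> \<le> V"
      using s_fun_bound[of 2 t] s_fun_bound[of 1 t] s_fun_bound[of 0 t] by (auto simp: V_def)
    have "\<bar>\<alpha>\<^sup>2 * s_fun R 2 \<theta> t + 2 * \<alpha> * g t * s_fun R 1 \<theta> t + (g t)\<^sup>2 * s_fun R 0 \<theta> t\<bar> \<le>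
       \<bar>\<alpha>\<^sup>2 * s_fun R 2 \<theta> t\<bar> + \<bar>2 * \<alpha> * g t * s_fun R 1 \<theta> t\<bar> + \<bar>(g t)\<^sup>2 * s_fun R 0 \<theta> t\<bar>" by linarith
    also have "\<dots> \<le> \<alpha>\<^sup>2 * V + 2 * \<bar>\<alpha>\<bar> * G * V + G\<^sup>2 * V"
    proof (intro add_mono)
      show "\<bar>\<alpha>\<^sup>2 * s_fun R 2 \<theta> t\<bar> \<le> \<alpha>\<^sup>2 * V" using s(1) by (simp add: abs_mult mult_left_mono)
      show "\<bar>2 * \<alpha> * g t * s_fun R 1 \<theta> t\<bar> \<le> 2 * \<bar>\<alpha>\<bar> * G * V"
        using s(2) gb[of t] G0 by (auto simp: abs_mult intro!: mult_mono)
      show "\<bar>(g t)\<^sup>2 * s_fun R 0 \<theta> t\<bar> \<le> G\<^sup>2 * V"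
        using s(3) power_mono[OF gb abs_ge_zero, of t 2] by (auto simp: abs_mult intro!: mult_mono)
    qed
    finally have 1: "\<bar>\<alpha>\<^sup>2 * s_fun R 2 \<theta> t + 2 * \<alpha> * g t * s_fun R 1 \<theta> t + (g t)\<^sup>2 * s_fun R 0 \<theta> t\<bar> \<le> \<alpha>\<^sup>2 * V + 2 * \<bar>\<alpha>\<bar> * G * V + G\<^sup>2 * V" .
    show ?thesis
      using True mult_mono[OF 1 h_le[of t]] h_nonneg[of t] V0 G0 unfolding q_def abs_mult by simp
  qed (simp add: q_def h_outside)
  show qi: "integrable lborel q"
  proof (rule Bochner_Integration.integrable_bound[where f="\<lambda>t. indicator {0..1} t * ?b"])
    show "integrable lborel (\<lambda>t::real. indicator {0..1} t * ?b)"
      by (intro integrable_mult_left integrable_indicator_01)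
    show "AE t in lborel. norm (q t) \<le> norm (indicator {0..1} t * ?b)"
      using qb by (intro AE_I2) (auto intro: order_trans[OF _ abs_ge_self])
  qed (use qm in simp)
  show q_nn: "0 \<le> (LBINT t. q t)" by (rule Bochner_Integration.integral_nonneg) (rule q0)
  have "(\<integral>\<^sup>+x. ennreal ((mart ?f x)\<^sup>2) \<partial>R) = (\<integral>\<^sup>+x. (\<integral>\<^sup>+t. ennreal ((?f t (obs_W x))\<^sup>2 * rate \<theta> h x t) \<partial>lborel) \<partial>R)"
  proof (rule nn_integral_mart_square[OF fm])
    show "\<bar>?f t w\<bar> \<le> \<bar>\<alpha>\<bar> * \<bar>w\<bar> + G" for t w
      using gb[of t] abs_triangle_ineq[of "\<alpha> * w" "g t"] by (simp add: abs_mult)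
  qed measurable
  also have "\<dots> = (\<integral>\<^sup>+t. (\<integral>\<^sup>+x. ennreal ((?f t (obs_W x))\<^sup>2 * rate \<theta> h x t) \<partial>R) \<partial>lborel)"
  proof (rule RL.Fubini'[symmetric])
    have "(\<lambda>z. ennreal ((?f (snd z) (obs_W (fst z)))\<^sup>2 * rate \<theta> h (fst z) (snd z))) \<in> borel_measurable (obs_space \<Otimes>\<^sub>M lborel)"
      by measurable
    then have "(\<lambda>z. ennreal ((?f (snd z) (obs_W (fst z)))\<^sup>2 * rate \<theta> h (fst z) (snd z))) \<in> borel_measurable (R \<Otimes>\<^sub>M lborel)"
      using measurable_cong_sets[OF sets_pair_measure_cong[OF sets_R refl] refl, of lborel] by blast
    then show "(\<lambda>(x, t). ennreal ((?f t (obs_W x))\<^sup>2 * rate \<theta> h x t)) \<in> borel_measurable (R \<Otimes>\<^sub>M lborel)"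
      by (simp add: case_prod_beta')
  qed
  also have "\<dots> = (\<integral>\<^sup>+t. ennreal (q t) \<partial>lborel)" by (simp only: inner)
  also have "\<dots> = ennreal (LBINT t. q t)" using qi q0 by (intro nn_integral_eq_integral) auto
  finally show nn: "(\<integral>\<^sup>+x. ennreal ((mart ?f x)\<^sup>2) \<partial>R) = ennreal (LBINT t. q t)" .
  have mm: "mart ?f \<in> borel_measurable R" using mart_measurable[OF fm] by (rule measurable_RI)
  show i: "integrable R (\<lambda>x. (mart ?f x)\<^sup>2)"
    by (rule integrableI_nonneg) (use mm nn in auto)
  have "ennreal (LINT x|R. (mart ?f x)\<^sup>2) = ennreal (LBINT t. q t)"
    using nn_integral_eq_integral[OF i] nn by simp
  then show "(LINT x|R. (mart ?f x)\<^sup>2) = (LBINT t. q t)"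
    using q_nn by simp
qed

end

end

section \<open>The influence function and its variance\<close>

context cox_sequence
begin

text \<open>Centred with the limit \<open>e\<close> in every row, not with the ratio of the row
  itself; the mean is 0 for any centring that depends on time only. The spelling
  \<open>1 * w + - e t\<close> matches the affine form of the preceding lemmas.\<close>

abbreviation "influence n \<equiv> L.mart n (\<lambda>t w. 1 * w + - e t)"

lemma env_n: "integrable (R n) (\<lambda>x. envelope \<theta>0 d (obs_W x))"
  by (rule integrable_W[OF envelope_integrable])

lemma neg_e: "(\<lambda>t. - e t) \<in> borel_measurable borel" "\<bar>- e t\<bar> \<le> E"
  using e_le by auto

lemma influence_measurable: "influence n \<in> borel_measurable obs_space"
  by (rule L.mart_measurable) measurable

lemma affine_W: "integrable (R n) (\<lambda>x. \<bar>obs_W x\<bar> + E)"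
proof -
  interpret Q: prob_space Q by (rule prob_space_Q)
  have "integrable Q (\<lambda>w. \<bar>w\<bar>)"
  proof (rule Bochner_Integration.integrable_bound[where f="\<lambda>w. 1 + w\<^sup>2"])
    have "\<bar>w\<bar> \<le> 1 + w\<^sup>2" for w :: real using sum_squares_bound[of 1 "\<bar>w\<bar>"] zero_le_power2[of w] by simp
    then show "AE w in Q. norm \<bar>w\<bar> \<le> norm (1 + w\<^sup>2)" by (intro AE_I2) simp
    have "(\<lambda>w::real. \<bar>w\<bar>) \<in> borel_measurable borel"
      by (intro borel_measurable_continuous_onI continuous_intros)
    then show "(\<lambda>w. \<bar>w\<bar>) \<in> borel_measurable Q"
      using measurable_cong_sets[OF sets_Q refl] by blast
  qed (use square_integrable in simp)
  then have "integrable Q (\<lambda>w. \<bar>w\<bar> + E)" by simp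
  then show ?thesis by (rule integrable_W)
qed

lemma
  shows integrable_influence: "integrable (R n) (influence n)"
    and integral_influence: "(LINT x|R n. influence n x) = 0"
proof -
  have fm: "(\<lambda>z. 1 * snd z + - e (fst z)) \<in> borel_measurable (borel \<Otimes>\<^sub>M borel)" by measurable
  have b: "\<bar>1 * w + - e t\<bar> \<le> \<bar>w\<bar> + E" for t w using e_le[of t] by linarith
  show "integrable (R n) (influence n)" by (rule L.integrable_mart[OF fm b affine_W])
  show "(LINT x|R n. influence n x) = 0" by (rule L.integral_mart[OF fm b affine_W])
qed

definition \<sigma>2 :: "nat \<Rightarrow> real" where
  "\<sigma>2 n = (LBINT t. (1\<^sup>2 * s_fun (R n) 2 (th n) t + 2 * 1 * - e t * s_fun (R n) 1 (th n) t + (- e t)\<^sup>2 * s_fun (R n) 0 (th n) t) * hz n t)"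

lemma integrable_influence_square: "integrable (R n) (\<lambda>x. (influence n x)\<^sup>2)"
  by (rule L.integrable_mart_square[OF env_n th_near neg_e])

lemma integral_influence_square: "(LINT x|R n. (influence n x)\<^sup>2) = \<sigma>2 n"
  unfolding \<sigma>2_def by (rule L.integral_mart_square_affine[OF env_n th_near neg_e])

lemma \<sigma>2_nonneg: "0 \<le> \<sigma>2 n"
  unfolding integral_influence_square[symmetric] by simp

text \<open>With the row functions replaced by their limits the integrand is s2 - 2 e s1 + e^2 s0,
  and e = s1 / s0 makes this equal to \<open>vs\<close>. The replacement error is linear in the
  deviations of \<open>s_fun\<close> and of the hazard.\<close>

lemma \<sigma>2_tendsto: "\<sigma>2 \<longlonglongrightarrow> J"
proof (rule tendstoI)
  fix \<epsilon> :: real assume \<epsilon>: "0 < \<epsilon>"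
  have K0: "0 \<le> K" by (rule L.K_nonneg)
  define V where "V = B + B\<^sup>2 / c"
  have V: "0 \<le> V" using B_nonneg c_pos by (simp add: V_def)
  define C where "C = (1 + 2 * E + E\<^sup>2) * K + V"
  have C: "0 \<le> C" using V K0 E_nonneg by (simp add: C_def)
  define \<eta> where "\<eta> = \<epsilon> / (2 * (C + 1))"
  have \<eta>: "0 < \<eta>" "C * \<eta> < \<epsilon>" using C \<epsilon> by (auto simp: \<eta>_def field_simps intro: add_nonneg_pos)
  have le: "(0::nat) \<le> 2" "(1::nat) \<le> 2" "(2::nat) \<le> 2" by auto
  show "\<forall>\<^sub>F n in sequentially. dist (\<sigma>2 n) J < \<epsilon>"
    using s_conv[OF le(1) \<eta>(1)] s_conv[OF le(2) \<eta>(1)] s_conv[OF le(3) \<eta>(1)] hz_conv[OF \<eta>(1)]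
  proof eventually_elim
    case (elim n)
    let ?q = "\<lambda>t. (1\<^sup>2 * s_fun (R n) 2 (th n) t + 2 * 1 * - e t * s_fun (R n) 1 (th n) t + (- e t)\<^sup>2 * s_fun (R n) 0 (th n) t) * hz n t"
    have qi: "integrable lborel ?q" by (rule L.integrable_mart_variance[OF env_n th_near neg_e])
    have ptw: "\<bar>?q t - vs t * h0 t\<bar> \<le> indicator {0..1} t * (C * \<eta>)" for t
    proof (cases "t \<in> {0..1}")
      case True
      have s0: "0 < s 0 t" using s0_ge[OF True] c_pos by linarith
      have vs: "vs t = s 2 t + 2 * - e t * s 1 t + (- e t)\<^sup>2 * s 0 t"
        using True s0 by (simp add: vs_def e_def field_simps power2_eq_square)
      have d0: "\<bar>s_fun (R n) 0 (th n) t - s 0 t\<bar> \<le> \<eta>" and d1: "\<bar>s_fun (R n) 1 (th n) t - s 1 t\<bar> \<le> \<eta>"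
        and d2: "\<bar>s_fun (R n) 2 (th n) t - s 2 t\<bar> \<le> \<eta>" and dh: "\<bar>hz n t - h0 t\<bar> \<le> \<eta>"
        using elim True by blast+
      define u where "u = (s_fun (R n) 2 (th n) t - s 2 t) + 2 * - e t * (s_fun (R n) 1 (th n) t - s 1 t) + (- e t)\<^sup>2 * (s_fun (R n) 0 (th n) t - s 0 t)"
      have "\<bar>2 * - e t * (s_fun (R n) 1 (th n) t - s 1 t)\<bar> \<le> 2 * E * \<eta>"
        unfolding abs_mult using e_le[of t] d1 E_nonneg by (intro mult_mono) auto
      moreover have "\<bar>(- e t)\<^sup>2 * (s_fun (R n) 0 (th n) t - s 0 t)\<bar> \<le> E\<^sup>2 * \<eta>"
        unfolding abs_mult using power_mono[OF e_le[of t] abs_ge_zero, of 2] d0 by (intro mult_mono) auto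
      ultimately have "\<bar>u\<bar> \<le> \<eta> + 2 * E * \<eta> + E\<^sup>2 * \<eta>" using d2 unfolding u_def by linarith
      also have "\<dots> = (1 + 2 * E + E\<^sup>2) * \<eta>" by (simp add: algebra_simps)
      finally have u: "\<bar>u\<bar> \<le> (1 + 2 * E + E\<^sup>2) * \<eta>" .
      have "\<bar>u * hz n t\<bar> \<le> ((1 + 2 * E + E\<^sup>2) * \<eta>) * K"
        unfolding abs_mult using u L.h_nonneg[of n t] L.h_le[of n t] \<eta> E_nonneg by (intro mult_mono) auto
      moreover have "\<bar>vs t * (hz n t - h0 t)\<bar> \<le> V * \<eta>"
        unfolding abs_mult using vs_le[OF True] dh V by (intro mult_mono) (auto simp: V_def)
      moreover have "?q t - vs t * h0 t = u * hz n t + vs t * (hz n t - h0 t)"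
        unfolding vs u_def by (simp add: algebra_simps)
      ultimately have "\<bar>?q t - vs t * h0 t\<bar> \<le> ((1 + 2 * E + E\<^sup>2) * \<eta>) * K + V * \<eta>" by linarith
      also have "\<dots> = C * \<eta>" by (simp add: C_def algebra_simps)
      finally show ?thesis using True by simp
    next
      case False
      then show ?thesis using L.h_outside[of t n] h0_outside[of t] by simp
    qed
    have "\<bar>\<sigma>2 n - J\<bar> = \<bar>LBINT t. ?q t - vs t * h0 t\<bar>"
      unfolding \<sigma>2_def J_def using qi vs_h_integrable by simp
    also have "\<dots> \<le> (LBINT t. \<bar>?q t - vs t * h0 t\<bar>)" by (rule integral_abs_bound)
    also have "\<dots> \<le> (LBINT t. indicator {0..1::real} t * (C * \<eta>))"
      using qi vs_h_integrable ptw by (intro integral_mono integrable_mult_left integrable_indicator_01 integrable_abs) auto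
    also have "\<dots> = C * \<eta>" by simp
    finally show ?case using \<eta> by (simp add: dist_real_def)
  qed
qed

definition lin :: "nat \<Rightarrow> (nat \<Rightarrow> obs) \<Rightarrow> real" where
  "lin n x = (\<Sum>i<n. influence n (x i)) / sqrt n"

lemma lin_measurable: "lin n \<in> borel_measurable (iid n obs_space)"
proof -
  have "(\<lambda>x. influence n (x i)) \<in> borel_measurable (iid n obs_space)" if "i < n" for i
  proof -
    have "(\<lambda>x. x i) \<in> iid n obs_space \<rightarrow>\<^sub>M obs_space" using that by measurable
    then show ?thesis by (rule measurable_compose[OF _ influence_measurable])
  qed
  then show ?thesis unfolding lin_def[abs_def] by (intro borel_measurable_divide borel_measurable_sum) auto
qed

text \<open>In the score dN may be replaced by dM because the deviations W - Sbar, weighted by the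
  intensities, sum to 0 at every time. Equivalently, the total drifts of the integrands W - e and
  Sbar - e coincide.\<close>

lemma cox_score_decomposition:
  assumes n: "0 < n" and x: "x \<in> space (iid n obs_space)"
  shows "cox_score n x (th n) / sqrt n = lin n x - remainder n x"
proof -
  let ?M = "\<Sum>j<n. \<bar>obs_W (x j)\<bar>"
  have M: "\<bar>obs_W (x j)\<bar> \<le> ?M" if "j < n" for j using that by (intro member_le_sum) auto
  have Sm: "(\<lambda>t. Sbar n x t (th n) - e t) \<in> borel_measurable borel" using x by measurable
  have Sb: "\<bar>Sbar n x t (th n) - e t\<bar> \<le> ?M + E" for t
  proof -
    have "\<bar>Sbar n x t (th n)\<bar> \<le> ?M" by (rule Sbar_le[OF M]) (auto intro: sum_nonneg)
    then show ?thesis using e_le[of t] by linarith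
  qed
  have i1: "integrable lborel (\<lambda>t. (Sbar n x t (th n) - e t) * rate (th n) (hz n) (x i) t)" for i
    by (rule L.rate_integrable[OF Sm Sb])
  have i2: "integrable lborel (\<lambda>t. (1 * obs_W (x i) + - e t) * rate (th n) (hz n) (x i) t)" for i
  proof (rule L.rate_integrable[where B="\<bar>obs_W (x i)\<bar> + E"])
    show "\<bar>1 * obs_W (x i) + - e t\<bar> \<le> \<bar>obs_W (x i)\<bar> + E" for t using e_le[of t] by linarith
  qed measurable
  have zero: "(\<Sum>i<n. (1 * obs_W (x i) + - e t) * rate (th n) (hz n) (x i) t) = (\<Sum>i<n. (Sbar n x t (th n) - e t) * rate (th n) (hz n) (x i) t)" for t
  proof -
    have "(\<Sum>i<n. (1 * obs_W (x i) + - e t) * rate (th n) (hz n) (x i) t) =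
      (\<Sum>i<n. obs_W (x i) * rate (th n) (hz n) (x i) t) - e t * (\<Sum>i<n. rate (th n) (hz n) (x i) t)"
      by (simp add: left_diff_distrib sum_subtractf sum_distrib_left)
    also have "\<dots> = (Sbar n x t (th n) - e t) * (\<Sum>i<n. rate (th n) (hz n) (x i) t)"
      using S_fun_eq_0[of n x t "th n" 1 "th n"]
      by (cases "S_fun n 0 x t (th n) = 0") (auto simp: sum_rate sum_W_rate Sbar_def algebra_simps)
    finally show ?thesis by (simp only: sum_distrib_left)
  qed
  have drift: "(\<Sum>i<n. L.drift n (\<lambda>t x. Sbar n x t (th n) - e t) i x) = (\<Sum>i<n. LBINT t. (1 * obs_W (x i) + - e t) * rate (th n) (hz n) (x i) t)"
  proof -
    have "(\<Sum>i<n. L.drift n (\<lambda>t x. Sbar n x t (th n) - e t) i x) = (LBINT t. (\<Sum>i<n. (Sbar n x t (th n) - e t) * rate (th n) (hz n) (x i) t))"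
      unfolding L.drift_def by (rule Bochner_Integration.integral_sum[symmetric]) (rule i1)
    also have "\<dots> = (\<Sum>i<n. LBINT t. (1 * obs_W (x i) + - e t) * rate (th n) (hz n) (x i) t)"
      unfolding zero[symmetric] by (rule Bochner_Integration.integral_sum) (rule i2)
    finally show ?thesis .
  qed
  have jmp: "cox_score n x (th n) = (\<Sum>i<n. (if ev (x i) then 1 * obs_W (x i) + - e (obs_T (x i)) else 0)) - (\<Sum>i<n. jump (\<lambda>t x. Sbar n x t (th n) - e t) i x)"
    unfolding cox_score_def jump_def sum_subtractf[symmetric] by (intro sum.cong) auto
  have "cox_score n x (th n) = (\<Sum>i<n. influence n (x i)) - (\<Sum>i<n. jump (\<lambda>t x. Sbar n x t (th n) - e t) i x - L.drift n (\<lambda>t x. Sbar n x t (th n) - e t) i x)"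
    unfolding L.mart_def sum_subtractf drift jmp by simp
  then show ?thesis by (simp add: lin_def remainder_def diff_divide_distrib)
qed

subsection \<open>Central limit theorem for the linear term\<close>

text \<open>Isometry and compensator formula are used in opposite directions: the second moment
  becomes a time integral against the intensity and then the mean of (W - e)^2 at an observed event.
  The exponential weight disappears, and what remains is a tail of W^2 under
  \<open>Q\<close>.\<close>

lemma influence_tail_integral:
  "(\<integral>\<^sup>+x. ennreal (if \<bar>obs_W x\<bar> \<le> b then 0 else (influence n x)\<^sup>2) \<partial>R n) \<le>
    ennreal (LINT w|Q. (if \<bar>w\<bar> \<le> b then 0 else 2 * w\<^sup>2 + 2 * E\<^sup>2))"
proof -
  interpret Q: prob_space Q by (rule prob_space_Q)
  let ?f = "\<lambda>t w. indicator (- {-b..b}) w * (1 * w + - e t)"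
  have fm: "(\<lambda>z. ?f (fst z) (snd z)) \<in> borel_measurable (borel \<Otimes>\<^sub>M borel)" by measurable
  have ind: "indicator (- {-b..b}) w = (if \<bar>w\<bar> \<le> b then 0 else 1 :: real)" for w :: real
    by (auto simp: abs_le_iff split: split_indicator)
  have mart: "L.mart n ?f x = indicator (- {-b..b}) (obs_W x) * influence n x" for x
    by (cases "obs_W x \<in> {-b..b}") (simp_all add: L.mart_def)
  have "(\<integral>\<^sup>+x. ennreal (if \<bar>obs_W x\<bar> \<le> b then 0 else (influence n x)\<^sup>2) \<partial>R n) = (\<integral>\<^sup>+x. ennreal ((L.mart n ?f x)\<^sup>2) \<partial>R n)"
    by (intro nn_integral_cong) (subst mart, auto simp: ind)
  also have "\<dots> = (\<integral>\<^sup>+x. (\<integral>\<^sup>+t. ennreal ((?f t (obs_W x))\<^sup>2 * rate (th n) (hz n) x t) \<partial>lborel) \<partial>R n)"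
  proof (rule L.nn_integral_mart_square[OF fm])
    show "\<bar>?f t w\<bar> \<le> \<bar>w\<bar> + E" for t w
      using e_le[of t] abs_triangle_ineq4[of w "e t"] E_nonneg by (auto split: split_indicator)
  qed measurable
  also have "\<dots> = (\<integral>\<^sup>+x. (\<integral>\<^sup>+t. ennreal (rate (th n) (hz n) x t) * ennreal ((?f t (obs_W x))\<^sup>2) \<partial>lborel) \<partial>R n)"
    by (intro nn_integral_cong) (simp add: ennreal_mult' L.rate_nonneg mult.commute)
  also have "\<dots> = (\<integral>\<^sup>+x. (if ev x then ennreal ((?f (obs_T x) (obs_W x))\<^sup>2) else 0) \<partial>R n)"
    by (rule L.compensator[symmetric]) (use measurable_compose[OF fm, of "\<lambda>x. ennreal (x\<^sup>2)" borel] in \<open>simp add: case_prod_beta'\<close>)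
  also have "\<dots> \<le> (\<integral>\<^sup>+x. ennreal (if \<bar>obs_W x\<bar> \<le> b then 0 else 2 * (obs_W x)\<^sup>2 + 2 * E\<^sup>2) \<partial>R n)"
  proof (rule nn_integral_mono)
    fix x :: obs
    have "(1 * obs_W x + - e (obs_T x))\<^sup>2 \<le> 2 * (obs_W x)\<^sup>2 + 2 * E\<^sup>2"
    proof -
      have "(e (obs_T x))\<^sup>2 \<le> E\<^sup>2" using power_mono[OF e_le[of "obs_T x"] abs_ge_zero, of 2] by simp
      moreover have "0 \<le> (obs_W x + e (obs_T x))\<^sup>2" by simp
      moreover have "(1 * obs_W x + - e (obs_T x))\<^sup>2 + (obs_W x + e (obs_T x))\<^sup>2 = 2 * (obs_W x)\<^sup>2 + 2 * (e (obs_T x))\<^sup>2"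
        by (simp add: power2_eq_square algebra_simps)
      ultimately show ?thesis by linarith
    qed
    then show "(if ev x then ennreal ((?f (obs_T x) (obs_W x))\<^sup>2) else 0) \<le> ennreal (if \<bar>obs_W x\<bar> \<le> b then 0 else 2 * (obs_W x)\<^sup>2 + 2 * E\<^sup>2)"
      by (auto simp: ind intro!: ennreal_leI)
  qed
  also have "\<dots> = ennreal (LINT x|R n. (if \<bar>obs_W x\<bar> \<le> b then 0 else 2 * (obs_W x)\<^sup>2 + 2 * E\<^sup>2))"
  proof (rule nn_integral_eq_integral)
    have qi: "integrable Q (\<lambda>w. indicator (- {-b..b}) w * (2 * w\<^sup>2 + 2 * E\<^sup>2))"
    proof (rule Bochner_Integration.integrable_bound[where f="\<lambda>w. 2 * w\<^sup>2 + 2 * E\<^sup>2"])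
      show "integrable Q (\<lambda>w. 2 * w\<^sup>2 + 2 * E\<^sup>2)" using square_integrable by simp
      have "(\<lambda>w::real. indicator (- {-b..b}) w * (2 * w\<^sup>2 + 2 * E\<^sup>2)) \<in> borel_measurable borel" by measurable
      then show "(\<lambda>w. indicator (- {-b..b}) w * (2 * w\<^sup>2 + 2 * E\<^sup>2)) \<in> borel_measurable Q"
        using measurable_cong_sets[OF sets_Q refl] by blast
    qed (auto intro!: AE_I2 split: split_indicator)
    show "integrable (R n) (\<lambda>x. if \<bar>obs_W x\<bar> \<le> b then 0 else 2 * (obs_W x)\<^sup>2 + 2 * E\<^sup>2)"
      using integrable_W[OF qi, of n] by (simp add: ind if_distrib[of "\<lambda>u. u * _"] cong: if_cong)
  qed (auto intro!: AE_I2)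
  also have "(LINT x|R n. (if \<bar>obs_W x\<bar> \<le> b then 0 else 2 * (obs_W x)\<^sup>2 + 2 * E\<^sup>2)) = (LINT w|Q. (if \<bar>w\<bar> \<le> b then 0 else 2 * w\<^sup>2 + 2 * E\<^sup>2))"
  proof -
    have "(\<lambda>w::real. indicator (- {-b..b}) w * (2 * w\<^sup>2 + 2 * E\<^sup>2)) \<in> borel_measurable borel" by measurable
    from integral_W[OF this, of n] show ?thesis by (simp add: ind if_distrib[of "\<lambda>u. u * _"] cong: if_cong)
  qed
  finally show ?thesis .
qed

lemma square_tail_small:
  assumes "0 < \<epsilon>"
  obtains b where "0 \<le> b" "(LINT w|Q. (if \<bar>w\<bar> \<le> b then 0 else 2 * w\<^sup>2 + 2 * E\<^sup>2)) \<le> \<epsilon>"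
proof -
  interpret Q: prob_space Q by (rule prob_space_Q)
  let ?q = "\<lambda>m w. if \<bar>w\<bar> \<le> real m then 0 else 2 * w\<^sup>2 + 2 * E\<^sup>2"
  have "(\<lambda>m. LINT w|Q. ?q m w) \<longlonglongrightarrow> (LINT w|Q. 0)"
  proof (rule integral_dominated_convergence[where w="\<lambda>w. 2 * w\<^sup>2 + 2 * E\<^sup>2"])
    show "AE w in Q. (\<lambda>m. ?q m w) \<longlonglongrightarrow> 0"
    proof (rule AE_I2)
      fix w :: real
      obtain m0 :: nat where "\<bar>w\<bar> \<le> real m0" using real_arch_simple by blast
      then have "\<forall>\<^sub>F m in sequentially. ?q m w = 0"
        by (auto simp: eventually_sequentially intro!: exI[of _ m0])
      then show "(\<lambda>m. ?q m w) \<longlonglongrightarrow> 0" by (rule tendsto_eventually)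
    qed
    show "?q m \<in> borel_measurable Q" for m
    proof -
      have "?q m = (\<lambda>w. indicator (- {- real m..real m}) w * (2 * w\<^sup>2 + 2 * E\<^sup>2))"
        by (auto simp: fun_eq_iff abs_le_iff split: split_indicator)
      moreover have "(\<lambda>w::real. indicator (- {- real m..real m}) w * (2 * w\<^sup>2 + 2 * E\<^sup>2)) \<in> borel_measurable borel" by measurable
      then have "(\<lambda>w::real. indicator (- {- real m..real m}) w * (2 * w\<^sup>2 + 2 * E\<^sup>2)) \<in> borel_measurable Q"
        using measurable_cong_sets[OF sets_Q refl] by blast
      ultimately show ?thesis by (simp only:)
    qed
    show "AE w in Q. norm (?q m w) \<le> 2 * w\<^sup>2 + 2 * E\<^sup>2" for m by (auto intro!: AE_I2)
  qed (use square_integrable in auto)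
  then have "\<forall>\<^sub>F m in sequentially. (LINT w|Q. ?q m w) < \<epsilon>"
    using assms by (intro order_tendstoD(2)) auto
  then obtain m where "(LINT w|Q. ?q m w) < \<epsilon>" using eventually_happens'[OF sequentially_bot] by blast
  then show thesis by (intro that[of "real m"]) auto
qed

lemma influence_bounded:
  assumes W: "\<bar>obs_W x\<bar> \<le> b"
  shows "\<bar>influence n x\<bar> \<le> (b + E) * (1 + K * exp ((\<bar>\<theta>0\<bar> + d) * b))"
proof -
  have b0: "0 \<le> b" using W by linarith
  have f: "\<bar>1 * obs_W x + - e t\<bar> \<le> b + E" for t using e_le[of t] W by linarith
  have th: "\<bar>th n\<bar> \<le> \<bar>\<theta>0\<bar> + d" using th_near[of n] by linarith
  have "th n * obs_W x \<le> (\<bar>\<theta>0\<bar> + d) * b"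
  proof -
    have "th n * obs_W x \<le> \<bar>th n\<bar> * \<bar>obs_W x\<bar>" by (simp add: abs_mult[symmetric])
    also have "\<dots> \<le> (\<bar>\<theta>0\<bar> + d) * b" using th W by (intro mult_mono) auto
    finally show ?thesis .
  qed
  then have ex: "exp (th n * obs_W x) \<le> exp ((\<bar>\<theta>0\<bar> + d) * b)" by simp
  have r: "\<bar>(1 * obs_W x + - e t) * rate (th n) (hz n) x t\<bar> \<le> indicator {0..1} t * ((b + E) * (K * exp ((\<bar>\<theta>0\<bar> + d) * b)))" for t
  proof -
    have "rate (th n) (hz n) x t \<le> indicator {0..1} t * (K * exp ((\<bar>\<theta>0\<bar> + d) * b))"
      using L.rate_le[where n=n and \<theta>'="th n" and x=x and t=t] ex L.K_nonneg
      by (auto intro: order_trans mult_left_mono split: split_indicator)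
    then have "\<bar>1 * obs_W x + - e t\<bar> * rate (th n) (hz n) x t \<le> (b + E) * (indicator {0..1} t * (K * exp ((\<bar>\<theta>0\<bar> + d) * b)))"
      using f[of t] L.rate_nonneg b0 E_nonneg by (intro mult_mono) auto
    then show ?thesis by (simp add: abs_mult L.rate_nonneg mult_ac)
  qed
  have "\<bar>LBINT t. (1 * obs_W x + - e t) * rate (th n) (hz n) x t\<bar> \<le> (LBINT t. \<bar>(1 * obs_W x + - e t) * rate (th n) (hz n) x t\<bar>)"
    by (rule integral_abs_bound)
  also have "\<dots> \<le> (LBINT t. indicator {0..1::real} t * ((b + E) * (K * exp ((\<bar>\<theta>0\<bar> + d) * b))))"
    using r b0 E_nonneg L.K_nonneg
    by (intro integral_mono' integrable_mult_left integrable_indicator_01 mult_nonneg_nonneg) auto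
  also have "\<dots> = (b + E) * (K * exp ((\<bar>\<theta>0\<bar> + d) * b))" by simp
  finally have "\<bar>LBINT t. (1 * obs_W x + - e t) * rate (th n) (hz n) x t\<bar> \<le> (b + E) * (K * exp ((\<bar>\<theta>0\<bar> + d) * b))" .
  moreover have "\<bar>if ev x then 1 * obs_W x + - e (obs_T x) else 0\<bar> \<le> b + E" using f[of "obs_T x"] b0 E_nonneg by auto
  ultimately have "\<bar>influence n x\<bar> \<le> (b + E) + (b + E) * (K * exp ((\<bar>\<theta>0\<bar> + d) * b))"
    unfolding L.mart_def by linarith
  then show ?thesis by (simp add: algebra_simps)
qed

text \<open>The minimum is the error term in the second-order expansion of a characteristic
  function. Where |W| <= b the influence function is bounded uniformly in n and the cubic
  alternative is of order 1 / sqrt n; elsewhere the quadratic alternative is controlled by the tail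
  integral.\<close>

lemma lindeberg:
  "(\<lambda>n. LINT x|R n. min (6 * (influence n x)\<^sup>2) (\<bar>u / sqrt n\<bar> * \<bar>influence n x\<bar> ^ 3)) \<longlonglongrightarrow> 0"
proof (rule tendstoI)
  fix \<epsilon> :: real assume \<epsilon>: "0 < \<epsilon>"
  \<comment> \<open>The coefficient 6 of the quadratic alternative turns this into \<epsilon> /
    4.\<close>
  then have "0 < \<epsilon> / 24" by simp
  then obtain b where b: "0 \<le> b" "(LINT w|Q. (if \<bar>w\<bar> \<le> b then 0 else 2 * w\<^sup>2 + 2 * E\<^sup>2)) \<le> \<epsilon> / 24"
    by (rule square_tail_small)
  define C where "C = (b + E) * (1 + K * exp ((\<bar>\<theta>0\<bar> + d) * b))"
  have C: "\<bar>influence n x\<bar> \<le> C" if "\<bar>obs_W x\<bar> \<le> b" for n x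
    unfolding C_def by (rule influence_bounded[OF that])
  have "(\<lambda>n. \<bar>u\<bar> * C ^ 3 / sqrt (real n)) \<longlonglongrightarrow> 0"
    by (rule real_tendsto_divide_at_top[OF tendsto_const filterlim_compose[OF sqrt_at_top filterlim_real_sequentially]])
  then have "\<forall>\<^sub>F n in sequentially. \<bar>u\<bar> * C ^ 3 / sqrt (real n) < \<epsilon> / 4"
    using \<epsilon> by (intro order_tendstoD) auto
  then show "\<forall>\<^sub>F n in sequentially. dist (LINT x|R n. min (6 * (influence n x)\<^sup>2) (\<bar>u / sqrt n\<bar> * \<bar>influence n x\<bar> ^ 3)) 0 < \<epsilon>"
  proof eventually_elim
    case (elim n)
    let ?m = "\<lambda>x. min (6 * (influence n x)\<^sup>2) (\<bar>u / sqrt n\<bar> * \<bar>influence n x\<bar> ^ 3)"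
    have im: "influence n \<in> borel_measurable (R n)" by (rule L.measurable_RI) (rule influence_measurable)
    have tm: "(\<lambda>x. ennreal (if \<bar>obs_W x\<bar> \<le> b then 0 else (influence n x)\<^sup>2)) \<in> borel_measurable (R n)"
    proof -
      have "(\<lambda>x. indicator (- {-b..b}) (obs_W x) * (influence n x)\<^sup>2) \<in> borel_measurable (R n)"
        using im obs_W_measurable by measurable
      moreover have "indicator (- {-b..b}) (obs_W x) * (influence n x)\<^sup>2 = (if \<bar>obs_W x\<bar> \<le> b then 0 else (influence n x)\<^sup>2)" for x
        by (auto simp: abs_le_iff split: split_indicator)
      ultimately show ?thesis by simp
    qed
    have m0: "0 \<le> ?m x" for x by simp
    have "(\<integral>\<^sup>+x. ennreal (?m x) \<partial>R n) \<le> (\<integral>\<^sup>+x. ennreal (\<epsilon> / 4) + ennreal 6 * ennreal (if \<bar>obs_W x\<bar> \<le> b then 0 else (influence n x)\<^sup>2) \<partial>R n)"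
    proof (rule nn_integral_mono)
      fix x
      show "ennreal (?m x) \<le> ennreal (\<epsilon> / 4) + ennreal 6 * ennreal (if \<bar>obs_W x\<bar> \<le> b then 0 else (influence n x)\<^sup>2)"
      proof (cases "\<bar>obs_W x\<bar> \<le> b")
        case True
        have "?m x \<le> \<bar>u / sqrt n\<bar> * \<bar>influence n x\<bar> ^ 3" by simp
        also have "\<dots> \<le> \<bar>u / sqrt n\<bar> * C ^ 3" using C[OF True, of n] by (intro mult_left_mono power_mono) auto
        also have "\<dots> \<le> \<epsilon> / 4" using elim by simp
        finally show ?thesis using True ennreal_leI by simp
      next
        case False
        have "?m x \<le> 6 * (influence n x)\<^sup>2" by simp
        then have "ennreal (?m x) \<le> ennreal 6 * ennreal ((influence n x)\<^sup>2)"
          by (subst ennreal_mult'[symmetric]) (auto intro: ennreal_leI)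
        then show ?thesis using False by (simp add: add_increasing)
      qed
    qed
    also have "\<dots> = ennreal (\<epsilon> / 4) + ennreal 6 * (\<integral>\<^sup>+x. ennreal (if \<bar>obs_W x\<bar> \<le> b then 0 else (influence n x)\<^sup>2) \<partial>R n)"
      using tm by (simp add: nn_integral_add nn_integral_cmult L.emeasure_space_1)
    also have "\<dots> \<le> ennreal (\<epsilon> / 4) + ennreal 6 * ennreal (\<epsilon> / 24)"
      using b(2) by (intro add_left_mono mult_left_mono order_trans[OF influence_tail_integral ennreal_leI]) auto
    also have "\<dots> = ennreal (\<epsilon> / 2)"
    proof -
      have "ennreal 6 * ennreal (\<epsilon> / 24) = ennreal (6 * (\<epsilon> / 24))" by (rule ennreal_mult'[symmetric]) simp
      also have "6 * (\<epsilon> / 24) = \<epsilon> / 4" by simp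
      finally show ?thesis using \<epsilon> by (simp only: ennreal_plus[symmetric]) simp
    qed
    finally have "(\<integral>\<^sup>+x. ennreal (?m x) \<partial>R n) \<le> ennreal (\<epsilon> / 2)" .
    then have "(LINT x|R n. ?m x) \<le> \<epsilon> / 2"
      using \<epsilon> m0 im by (intro integral_real_bounded) auto
    moreover have "0 \<le> (LINT x|R n. ?m x)" by (intro Bochner_Integration.integral_nonneg m0)
    ultimately show ?case using \<epsilon> by (simp add: dist_real_def)
  qed
qed

lemma char_lin: "char (distr (N n) borel (lin n)) u = char (distr (R n) borel (influence n)) (u / sqrt n) ^ n"
proof -
  have lm: "lin n \<in> N n \<rightarrow>\<^sub>M borel" by (rule measurable_NI) (rule lin_measurable)
  have im: "influence n \<in> borel_measurable (R n)" by (rule L.measurable_RI) (rule influence_measurable)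
  have int: "integrable (R n) (\<lambda>y. iexp (u / sqrt n * influence n y))"
    using im by (intro L.integrable_const_bound[where B=1]) auto
  have "char (distr (N n) borel (lin n)) u = (CLINT x|N n. iexp (u * lin n x))"
    unfolding char_def using lm by (subst integral_distr) auto
  also have "\<dots> = (CLINT x|N n. (\<Prod>i<n. iexp (u / sqrt n * influence n (x i))))"
  proof (intro Bochner_Integration.integral_cong refl)
    fix x
    have "\<i> * complex_of_real (u * lin n x) = (\<Sum>i<n. \<i> * complex_of_real (u / sqrt n * influence n (x i)))"
      by (simp add: lin_def sum_distrib_left sum_divide_distrib)
    then show "iexp (u * lin n x) = (\<Prod>i<n. iexp (u / sqrt n * influence n (x i)))"
      by (simp only: exp_sum[OF finite_lessThan])
  qed
  also have "\<dots> = (\<Prod>i<n. CLINT y|R n. iexp (u / sqrt n * influence n y))"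
    unfolding iid_def by (rule L.PP.product_integral_prod[OF finite_lessThan]) (rule int)
  also have "\<dots> = (CLINT y|R n. iexp (u / sqrt n * influence n y)) ^ n" by simp
  also have "(CLINT y|R n. iexp (u / sqrt n * influence n y)) = char (distr (R n) borel (influence n)) (u / sqrt n)"
    unfolding char_def using im by (subst integral_distr) auto
  finally show ?thesis .
qed

text \<open>The n-th power is compared with that of 1 - u^2 J / (2 n). For bases in the unit disc,
  n-th powers differ by at most n times the difference of the bases, which leaves the Lindeberg term
  and |\<sigma>2 n - J|.\<close>

lemma char_lin_tendsto: "(\<lambda>n. char (distr (N n) borel (lin n)) u) \<longlonglongrightarrow> complex_of_real (exp (- (u\<^sup>2 * J / 2)))"
proof -
  let ?\<phi> = "\<lambda>n. char (distr (R n) borel (influence n)) (u / sqrt n)"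
  let ?w = "\<lambda>n. complex_of_real (1 + (- (u\<^sup>2 * J / 2)) / n)"
  let ?lam = "\<lambda>n. LINT x|R n. min (6 * (influence n x)\<^sup>2) (\<bar>u / sqrt n\<bar> * \<bar>influence n x\<bar> ^ 3)"
  have J0: "0 \<le> J" using \<sigma>2_tendsto \<sigma>2_nonneg by (intro LIMSEQ_le_const) auto
  have lim0: "(\<lambda>n. u\<^sup>2 / 6 * ?lam n + u\<^sup>2 / 2 * \<bar>\<sigma>2 n - J\<bar>) \<longlonglongrightarrow> 0"
  proof -
    have "(\<lambda>n. \<bar>\<sigma>2 n - J\<bar>) \<longlonglongrightarrow> 0"
      using tendsto_rabs[OF tendsto_diff[OF \<sigma>2_tendsto tendsto_const[of J]]] by simp
    then show ?thesis
      using tendsto_add[OF tendsto_mult_left[OF lindeberg, of "u\<^sup>2 / 6" u] tendsto_mult_left[of _ 0 _ "u\<^sup>2 / 2"]] by simp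
  qed
  have bd: "\<forall>\<^sub>F n in sequentially. norm (char (distr (N n) borel (lin n)) u - ?w n ^ n) \<le> u\<^sup>2 / 6 * ?lam n + u\<^sup>2 / 2 * \<bar>\<sigma>2 n - J\<bar>"
  proof -
    \<comment> \<open>From this n on, u^2 J / (2 n) is at most 2, so that the comparison base has
      absolute value at most 1.\<close>
    obtain n0 :: nat where n0: "u\<^sup>2 * J / 4 \<le> real n0" using real_arch_simple by blast
    have "\<forall>\<^sub>F n in sequentially. n0 \<le> n \<and> 0 < n" by (intro eventually_conj eventually_ge_at_top eventually_gt_at_top)
    then show ?thesis
    proof eventually_elim
      case (elim n)
      then have n: "u\<^sup>2 * J / 4 \<le> real n" "0 < n" using n0 by auto
      have im: "influence n \<in> borel_measurable (R n)" by (rule L.measurable_RI) (rule influence_measurable)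
      interpret D: real_distribution "distr (R n) borel (influence n)"
        by (rule L.real_distribution_distr) (rule im)
      have n1: "norm (?\<phi> n) \<le> 1" by (rule D.cmod_char_le_1)
      have n2: "norm (?w n) \<le> 1"
      proof -
        have "\<bar>1 + (- (u\<^sup>2 * J / 2)) / n\<bar> \<le> 1" using n J0 by (auto simp: abs_le_iff field_simps)
        then show ?thesis by (simp only: norm_of_real)
      qed
      have var: "(LINT x|R n. (influence n x - (LINT y|R n. influence n y))\<^sup>2) = \<sigma>2 n"
        unfolding integral_influence by (simp only: diff_zero integral_influence_square)
      have "norm (?\<phi> n - (1 - (u / sqrt n)\<^sup>2 * \<sigma>2 n / 2)) \<le> (u / sqrt n)\<^sup>2 / 6 * ?lam n"
        by (rule L.char_approx3'[OF im integrable_influence integrable_influence_square integral_influence var refl])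
      moreover have "norm ((1 - (u / sqrt n)\<^sup>2 * \<sigma>2 n / 2) - ?w n) \<le> u\<^sup>2 / n / 2 * \<bar>\<sigma>2 n - J\<bar>"
      proof -
        have "(1 - (u / sqrt n)\<^sup>2 * \<sigma>2 n / 2) - ?w n = complex_of_real (u\<^sup>2 / n / 2 * (J - \<sigma>2 n))"
        proof -
          have "(1 - (u / sqrt n)\<^sup>2 * \<sigma>2 n / 2) - (1 + (- (u\<^sup>2 * J / 2)) / n) = u\<^sup>2 / n / 2 * (J - \<sigma>2 n)"
            using n by (simp add: power_divide field_simps)
          from arg_cong[OF this, of complex_of_real] show ?thesis by simp
        qed
        also have "norm \<dots> = u\<^sup>2 / n / 2 * \<bar>\<sigma>2 n - J\<bar>"
          by (simp only: norm_of_real abs_mult) (simp add: abs_minus_commute)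
        finally show ?thesis by simp
      qed
      ultimately have d: "norm (?\<phi> n - ?w n) \<le> (u / sqrt n)\<^sup>2 / 6 * ?lam n + u\<^sup>2 / n / 2 * \<bar>\<sigma>2 n - J\<bar>"
        by (rule norm_diff_triangle_le)
      have "norm (?\<phi> n ^ n - ?w n ^ n) \<le> n * norm (?\<phi> n - ?w n)" by (rule norm_power_diff[OF n1 n2])
      also have "\<dots> \<le> n * ((u / sqrt n)\<^sup>2 / 6 * ?lam n + u\<^sup>2 / n / 2 * \<bar>\<sigma>2 n - J\<bar>)" by (rule mult_left_mono[OF d]) simp
      also have "\<dots> = u\<^sup>2 / 6 * ?lam n + u\<^sup>2 / 2 * \<bar>\<sigma>2 n - J\<bar>" using n by (simp add: power_divide field_simps)
      finally show ?case by (simp only: char_lin)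
    qed
  qed
  have "(\<lambda>n. (1 + (- (u\<^sup>2 * J / 2)) / real n) ^ n) \<longlonglongrightarrow> exp (- (u\<^sup>2 * J / 2))"
    by (rule tendsto_exp_limit_sequentially)
  then have "(\<lambda>n. complex_of_real ((1 + (- (u\<^sup>2 * J / 2)) / real n) ^ n)) \<longlonglongrightarrow> complex_of_real (exp (- (u\<^sup>2 * J / 2)))"
    by (rule tendsto_of_real)
  then have w: "(\<lambda>n. ?w n ^ n) \<longlonglongrightarrow> complex_of_real (exp (- (u\<^sup>2 * J / 2)))" by (simp only: of_real_power)
  show ?thesis by (rule Lim_transform[OF w]) (rule Lim_null_comparison[OF bd lim0])
qed

end

section \<open>Asymptotic linearity and weak convergence of the estimator\<close>

lemma norm_iexp_diff_le: "norm (iexp a - iexp b) \<le> \<bar>a - b\<bar>"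
proof -
  have "iexp a - iexp b = iexp b * (iexp (a - b) - 1)"
    by (simp add: right_diff_distrib exp_add[symmetric])
  then have "norm (iexp a - iexp b) = norm (iexp (a - b) - 1)" by (simp add: norm_mult)
  also have "\<dots> \<le> \<bar>a - b\<bar>" using iexp_approx1[of "a - b" 0] by simp
  finally show ?thesis .
qed

lemma
  assumes \<sigma>: "0 < \<sigma>"
  shows real_distribution_normal: "real_distribution (density lborel (normal_density 0 \<sigma>))"
    and char_normal: "char (density lborel (normal_density 0 \<sigma>)) u = complex_of_real (exp (- ((\<sigma> * u)\<^sup>2 / 2)))"
proof -
  interpret S: prob_space std_normal_distribution using real_dist_normal_dist by (simp add: real_distribution_def)
  have "distributed std_normal_distribution lborel (\<lambda>x. x) (normal_density 0 1)"
    by (auto simp: distributed_def distr_id2)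
  from S.normal_density_affine[OF this, of \<sigma> 0] \<sigma>
  have "distributed std_normal_distribution lborel (\<lambda>x. \<sigma> * x) (normal_density 0 \<sigma>)" by simp
  then have eq: "density lborel (normal_density 0 \<sigma>) = distr std_normal_distribution borel (\<lambda>x. \<sigma> * x)"
    by (simp add: distributed_def cong: distr_cong)
  show "real_distribution (density lborel (normal_density 0 \<sigma>))"
    unfolding eq by (rule S.real_distribution_distr) simp
  have "char (distr std_normal_distribution borel (\<lambda>x. \<sigma> * x)) u = char std_normal_distribution (\<sigma> * u)"
    unfolding char_def by (subst integral_distr) (auto simp: mult_ac)
  then show "char (density lborel (normal_density 0 \<sigma>)) u = complex_of_real (exp (- ((\<sigma> * u)\<^sup>2 / 2)))"
    unfolding eq by (simp add: char_std_normal_distribution)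
qed

context cox_sequence
begin

lemma lin_tight:
  assumes \<delta>: "0 < \<delta>"
  obtains M where "0 < M" "\<forall>\<^sub>F n in sequentially. measure (N n) {x \<in> space (N n). M < \<bar>lin n x\<bar>} \<le> \<delta>"
proof -
  have J0: "0 \<le> J" using \<sigma>2_tendsto \<sigma>2_nonneg by (intro LIMSEQ_le_const) auto
  \<comment> \<open>Chebyshev: the second moment is eventually below J + 1, and (J + 1) / M^2 =
    \<delta>.\<close>
  define M where "M = sqrt ((J + 1) / \<delta>)"
  have M: "0 < M" "M\<^sup>2 = (J + 1) / \<delta>" using J0 \<delta> by (auto simp: M_def)
  have "\<forall>\<^sub>F n in sequentially. \<sigma>2 n < J + 1" using \<sigma>2_tendsto by (intro order_tendstoD) auto
  then have "\<forall>\<^sub>F n in sequentially. measure (N n) {x \<in> space (N n). M < \<bar>lin n x\<bar>} \<le> \<delta>"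
    using eventually_gt_at_top[of 0]
  proof eventually_elim
    case (elim n)
    interpret N: prob_space "N n" by (rule prob_space_N)
    note su = L.iid_sum_square[OF integrable_influence integrable_influence_square integral_influence, of n n]
    have li: "integrable (N n) (\<lambda>x. (lin n x)\<^sup>2)"
      using su(1) by (simp add: lin_def power_divide)
    have lv: "(LINT x|N n. (lin n x)\<^sup>2) = \<sigma>2 n"
      using su(2) elim(2) by (simp add: lin_def power_divide integral_influence_square[symmetric])
    have lm: "(\<lambda>x. (lin n x)\<^sup>2) \<in> borel_measurable (iid n obs_space)" using lin_measurable[of n] by measurable
    have "measure (N n) {x \<in> space (N n). M\<^sup>2 < \<bar>(lin n x)\<^sup>2\<bar>} \<le> (J + 1) / M\<^sup>2"
    proof (rule markov_N[OF lm])
      have "(\<integral>\<^sup>+x. ennreal \<bar>(lin n x)\<^sup>2\<bar> \<partial>N n) = ennreal (LINT x|N n. (lin n x)\<^sup>2)"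
        using nn_integral_eq_integral[OF li] by simp
      also have "\<dots> \<le> ennreal (J + 1)" using elim(1) lv by (intro ennreal_leI) simp
      finally show "(\<integral>\<^sup>+x. ennreal \<bar>(lin n x)\<^sup>2\<bar> \<partial>N n) \<le> ennreal (J + 1)" .
    qed (use M(1) J0 in auto)
    also have "(J + 1) / M\<^sup>2 = \<delta>" using M(2) J0 \<delta> by simp
    also have "{x \<in> space (N n). M\<^sup>2 < \<bar>(lin n x)\<^sup>2\<bar>} = {x \<in> space (N n). M < \<bar>lin n x\<bar>}"
    proof -
      have "M\<^sup>2 < \<bar>y\<^sup>2\<bar> \<longleftrightarrow> M < \<bar>y\<bar>" for y
        using M(1) power_strict_mono[of M "\<bar>y\<bar>" 2] power_mono[of "\<bar>y\<bar>" M 2] by (auto simp: not_le[symmetric])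
      then show ?thesis by simp
    qed
    finally show ?case .
  qed
  with M(1) show thesis by (rule that)
qed

text \<open>Combines the Newton step with the good events. Within distance A / sqrt n of
  \<open>th n\<close> the exponents move by at most A \<gamma>, so the information varies by a
  factor at most exp (2 A \<gamma>). The three summands of the bound account for this variation, for
  the replacement of the normalised information by J, and for the remainder of the score.\<close>

lemma estimator_near_linear:
  assumes n: "0 < n" and x: "x \<in> space (iid n obs_space)" and J: "0 < J"
    and lin: "\<bar>lin n x\<bar> \<le> M" and rem: "\<bar>remainder n x\<bar> \<le> \<rho>" "\<rho> \<le> 1"
    and inf: "\<bar>cox_information n x (th n) / n - J\<bar> \<le> \<rho>'" "\<rho>' \<le> J / 2"
    and W: "bounded_W \<gamma> n x" and \<gamma>: "0 < \<gamma>" and A: "4 * (M + 1) < A * J" and \<kappa>: "exp (2 * (A * \<gamma>)) \<le> 2"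
    and S: "{th n - A / sqrt n..th n + A / sqrt n} \<subseteq> \<Theta>"
    and arg: "(\<exists>\<theta>. is_arg_max (log_cox_likelihood n x) (\<lambda>\<theta>. \<theta> \<in> \<Theta>) \<theta>) \<Longrightarrow> is_arg_max (log_cox_likelihood n x) (\<lambda>\<theta>. \<theta> \<in> \<Theta>) \<theta>h"
  shows "\<bar>sqrt n * (\<theta>h - th n) - lin n x / J\<bar> \<le> (exp (2 * (A * \<gamma>)) - 1) * (2 * (M + 1) / J) + (M + 1) * (2 * \<rho>' / J\<^sup>2) + \<rho> / J"
proof -
  let ?V = "cox_information n x (th n)" and ?U = "cox_score n x (th n)" and ?\<kappa> = "exp (2 * (A * \<gamma>))"
  define g where "g = ?U / sqrt n"
  define I where "I = ?V / n"
  have M0: "0 \<le> M" using lin by linarith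
  have A0: "0 < A" using A J M0 by (metis add_nonneg_pos mult_pos_pos not_less order.strict_trans zero_less_mult_pos2 zero_less_numeral zero_less_one)
  have sn: "0 < sqrt n" "sqrt n * sqrt n = n" using n by auto
  have U: "?U = sqrt n * g" and V: "?V = n * I" using n by (auto simp: g_def I_def)
  have gl: "g = lin n x - remainder n x" unfolding g_def by (rule cox_score_decomposition[OF n x])
  have g: "\<bar>g\<bar> \<le> M + 1" using lin rem gl by linarith
  have I: "J / 2 \<le> I" "\<bar>I - J\<bar> \<le> \<rho>'" using inf unfolding I_def by linarith+
  have I0: "0 < I" using I J by linarith
  have \<kappa>1: "1 \<le> ?\<kappa>" using A0 \<gamma> by simp
  have key: "\<bar>(\<theta>h - th n) - ?U / ?V\<bar> \<le> (?\<kappa> - 1) * \<bar>?U\<bar> / ?V"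
  proof (rule concave_maximiser_near[where f="log_cox_likelihood n x" and f'="cox_score n x" and V="cox_information n x" and r="A / sqrt n" and S=\<Theta>])
    show "(log_cox_likelihood n x has_real_derivative cox_score n x \<theta>) (at \<theta>)" for \<theta>
      using log_cox_likelihood_deriv[of n x \<theta>] by simp
    show "(cox_score n x has_real_derivative - cox_information n x \<theta>) (at \<theta>)" for \<theta>
      using cox_score_deriv[of n x \<theta>] by simp
    show "0 \<le> cox_information n x \<theta>" for \<theta> by (rule cox_information_nonneg)
    show "0 < ?V" using V I0 n by simp
    show "0 < A / sqrt n" using A0 sn by simp
    show "1 \<le> ?\<kappa>" by (rule \<kappa>1)
    show "cox_information n x \<theta> \<le> ?\<kappa> * ?V \<and> ?V \<le> ?\<kappa> * cox_information n x \<theta>" if t: "\<bar>\<theta> - th n\<bar> \<le> A / sqrt n" for \<theta>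
    proof -
      have "\<bar>(\<theta> - th n) * obs_W (x j)\<bar> \<le> A * \<gamma>" if "j < n" for j
      proof -
        have "\<bar>(\<theta> - th n) * obs_W (x j)\<bar> \<le> (A / sqrt n) * (\<gamma> * sqrt n)"
          unfolding abs_mult using t W that A0 sn \<gamma> by (intro mult_mono) (auto simp: bounded_W_def)
        then show ?thesis using sn(1) by simp
      qed
      moreover have "\<bar>(th n - \<theta>) * obs_W (x j)\<bar> = \<bar>(\<theta> - th n) * obs_W (x j)\<bar>" for j
        by (simp add: abs_mult abs_minus_commute)
      ultimately show ?thesis by (auto intro!: cox_information_tilt)
    qed
    show "?\<kappa> * \<bar>?U\<bar> < A / sqrt n * ?V"
    proof -
      \<comment> \<open>The Newton step, enlarged by the factor \<kappa>, stays inside the window: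
        \<kappa> |g| <= 2 (M + 1) < A J / 2 <= A I. This is the purpose of the condition on
        A.\<close>
      have "?\<kappa> * \<bar>g\<bar> \<le> 2 * (M + 1)" using \<kappa> g M0 by (intro mult_mono) auto
      also have "\<dots> < A * (J / 2)" using A by simp
      also have "\<dots> \<le> A * I" using I A0 by (intro mult_left_mono) auto
      finally have "sqrt n * (?\<kappa> * \<bar>g\<bar>) < sqrt n * (A * I)" using sn by simp
      also have "sqrt n * (A * I) = A / sqrt n * (n * I)"
        using sn(1) by (simp add: real_div_sqrt field_simps)
      finally show ?thesis unfolding U V using sn(1) by (simp add: abs_mult mult_ac)
    qed
    show "{th n - A / sqrt n..th n + A / sqrt n} \<subseteq> \<Theta>" by (rule S)
    show "(\<exists>\<theta>. is_arg_max (log_cox_likelihood n x) (\<lambda>\<theta>. \<theta> \<in> \<Theta>) \<theta>) \<Longrightarrow> is_arg_max (log_cox_likelihood n x) (\<lambda>\<theta>. \<theta> \<in> \<Theta>) \<theta>h"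
      by (rule arg)
  qed
  have UV: "sqrt n * (?U / ?V) = g / I" and UV': "sqrt n * (\<bar>?U\<bar> / ?V) = \<bar>g\<bar> / I"
    unfolding U V using sn I0 n by (simp_all add: abs_mult mult.assoc[symmetric])
  have "\<bar>sqrt n * (\<theta>h - th n) - g / I\<bar> = sqrt n * \<bar>(\<theta>h - th n) - ?U / ?V\<bar>"
  proof -
    have "sqrt n * (\<theta>h - th n) - g / I = sqrt n * ((\<theta>h - th n) - ?U / ?V)"
      unfolding right_diff_distrib UV ..
    then show ?thesis using sn by (simp add: abs_mult)
  qed
  also have "\<dots> \<le> sqrt n * ((?\<kappa> - 1) * \<bar>?U\<bar> / ?V)" using key sn by (intro mult_left_mono) auto
  also have "\<dots> = (?\<kappa> - 1) * (\<bar>g\<bar> / I)" unfolding UV'[symmetric] by simp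
  also have "\<dots> \<le> (?\<kappa> - 1) * (2 * (M + 1) / J)"
  proof -
    have "\<bar>g\<bar> / I \<le> (M + 1) / (J / 2)" using g I J M0 by (intro frac_le) auto
    then show ?thesis using \<kappa>1 by (intro mult_left_mono) (auto simp: mult.commute)
  qed
  finally have 1: "\<bar>sqrt n * (\<theta>h - th n) - g / I\<bar> \<le> (?\<kappa> - 1) * (2 * (M + 1) / J)" .
  have 2: "\<bar>g / I - g / J\<bar> \<le> (M + 1) * (2 * \<rho>' / J\<^sup>2)"
  proof -
    have "g / I - g / J = g * ((J - I) / (I * J))" using I0 J by (simp add: field_simps)
    then have "\<bar>g / I - g / J\<bar> = \<bar>g\<bar> * (\<bar>I - J\<bar> / (I * J))"
      using I0 J by (simp add: abs_mult abs_divide abs_minus_commute)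
    also have "\<dots> \<le> (M + 1) * (\<rho>' / (J / 2 * J))"
      using g I I0 J M0 by (intro mult_mono frac_le) auto
    also have "\<dots> = (M + 1) * (2 * \<rho>' / J\<^sup>2)" by (simp add: power2_eq_square)
    finally show ?thesis .
  qed
  have 3: "\<bar>g / J - lin n x / J\<bar> \<le> \<rho> / J"
    unfolding gl diff_divide_distrib[symmetric] using rem J by (simp add: abs_divide divide_right_mono)
  show ?thesis using 1 2 3 by linarith
qed

text \<open>The order of the choices matters: tightness of the linear term gives M, then A is large
  compared with M / J, and only then is \<gamma> small compared with 1 / A. Outside four events of
  probability at most \<delta> / 4 each, the bound of \<open>estimator_near_linear\<close> is at
  most \<epsilon>.\<close>

lemma estimator_linear:
  assumes J: "0 < J" and th: "th \<longlonglongrightarrow> \<theta>0" and \<Theta>: "\<theta>0 \<in> interior \<Theta>" and est: "cox_estimator \<Theta> \<theta>hat"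
  shows "small (\<lambda>n x. sqrt n * (\<theta>hat n x - th n) - lin n x / J)"
  unfolding small_def
proof (intro conjI allI impI)
  have hm: "\<theta>hat n \<in> borel_measurable (iid n obs_space)" for n
    using est by (simp add: cox_estimator_def)
  then show m: "(\<lambda>x. sqrt n * (\<theta>hat n x - th n) - lin n x / J) \<in> borel_measurable (iid n obs_space)" for n
    using lin_measurable by measurable
  fix \<epsilon> \<delta> :: real assume \<epsilon>: "0 < \<epsilon>" and \<delta>: "0 < \<delta>"
  then have d4: "0 < \<delta> / 4" by simp
  then obtain M where M: "0 < M" "\<forall>\<^sub>F n in sequentially. measure (N n) {x \<in> space (N n). M < \<bar>lin n x\<bar>} \<le> \<delta> / 4"
    by (rule lin_tight)
  define A where "A = 4 * (M + 1) / J + 1"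
  have A: "4 * (M + 1) < A * J" using J by (simp add: A_def field_simps)
  have A0: "0 < A" using J M by (simp add: A_def add_pos_pos)
  \<comment> \<open>The first entry of each of the three minima meets a side condition of
    \<open>estimator_near_linear\<close>, the second makes one of its three summands at most
    \<epsilon> / 3.\<close>
  define \<rho> where "\<rho> = min 1 (\<epsilon> * J / 3)"
  define \<rho>' where "\<rho>' = min (J / 2) (\<epsilon> * J\<^sup>2 / (6 * (M + 1)))"
  define \<kappa> where "\<kappa> = min 2 (1 + \<epsilon> * J / (6 * (M + 1)))"
  have \<rho>: "0 < \<rho>" "\<rho> \<le> 1" "\<rho> / J \<le> \<epsilon> / 3" using \<epsilon> J by (auto simp: \<rho>_def field_simps min_def)
  have \<rho>': "0 < \<rho>'" using \<epsilon> J M by (simp add: \<rho>'_def)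
  have \<rho>'2: "\<rho>' \<le> J / 2" unfolding \<rho>'_def by (rule min.cobounded1)
  have \<rho>'3: "(M + 1) * (2 * \<rho>' / J\<^sup>2) \<le> \<epsilon> / 3"
  proof -
    have "\<rho>' \<le> \<epsilon> * J\<^sup>2 / (6 * (M + 1))" by (simp add: \<rho>'_def)
    then show ?thesis using J M by (simp add: field_simps)
  qed
  have \<kappa>: "1 < \<kappa>" "\<kappa> \<le> 2" using \<epsilon> J M by (auto simp: \<kappa>_def)
  have \<kappa>3: "(\<kappa> - 1) * (2 * (M + 1) / J) \<le> \<epsilon> / 3"
  proof -
    have "\<kappa> - 1 \<le> \<epsilon> * J / (6 * (M + 1))" by (simp add: \<kappa>_def)
    then show ?thesis using J M by (simp add: field_simps)
  qed
  define \<gamma> where "\<gamma> = ln \<kappa> / (2 * A)"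
  have \<gamma>: "0 < \<gamma>" "exp (2 * (A * \<gamma>)) = \<kappa>" using \<kappa> A0 by (auto simp: \<gamma>_def)
  obtain r where r: "0 < r" "ball \<theta>0 r \<subseteq> \<Theta>" using \<Theta> by (auto simp: mem_interior)
  have th_r: "\<forall>\<^sub>F n in sequentially. \<bar>th n - \<theta>0\<bar> < r / 2"
    using tendstoD[OF th, of "r / 2"] r by (simp add: dist_real_def)
  have "(\<lambda>n. A / sqrt (real n)) \<longlonglongrightarrow> 0"
    by (rule real_tendsto_divide_at_top[OF tendsto_const filterlim_compose[OF sqrt_at_top filterlim_real_sequentially]])
  then have A_r: "\<forall>\<^sub>F n in sequentially. A / sqrt (real n) < r / 2" using r by (intro order_tendstoD) auto
  show "\<forall>\<^sub>F n in sequentially. measure (N n) {x \<in> space (N n). \<epsilon> < \<bar>sqrt n * (\<theta>hat n x - th n) - lin n x / J\<bar>} \<le> \<delta>"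
    using M(2) smallD(1)[OF remainder_small \<rho>(1) d4] smallD(1)[OF information_small \<rho>' d4]
      bounded_W_likely[OF \<gamma>(1) d4] th_r A_r eventually_gt_at_top[of 0]
  proof eventually_elim
    case (elim n)
    interpret N: prob_space "N n" by (rule prob_space_N)
    let ?B1 = "{x \<in> space (N n). M < \<bar>lin n x\<bar>}" and ?B2 = "{x \<in> space (N n). \<rho> < \<bar>remainder n x\<bar>}"
      and ?B3 = "{x \<in> space (N n). \<rho>' < \<bar>cox_information n x (th n) / n - J\<bar>}" and ?B4 = "{x \<in> space (N n). \<not> bounded_W \<gamma> n x}"
    have [measurable]: "lin n \<in> borel_measurable (N n)" "remainder n \<in> borel_measurable (N n)"
      "(\<lambda>x. cox_information n x (th n) / n - J) \<in> borel_measurable (N n)"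
      using lin_measurable[of n] smallD(2)[OF remainder_small, of n] smallD(2)[OF information_small, of n]
      by (auto intro!: measurable_NI)
    have S: "{th n - A / sqrt n..th n + A / sqrt n} \<subseteq> \<Theta>"
    proof
      fix y assume "y \<in> {th n - A / sqrt n..th n + A / sqrt n}"
      then have "\<bar>\<theta>0 - y\<bar> < r" using elim(5,6) unfolding atLeastAtMost_iff by linarith
      then show "y \<in> \<Theta>" using r(2) by (auto simp: dist_real_def)
    qed
    have Bs: "?B1 \<in> sets (N n)" "?B2 \<in> sets (N n)" "?B3 \<in> sets (N n)" "?B4 \<in> sets (N n)" by measurable
    have "{x \<in> space (N n). \<epsilon> < \<bar>sqrt n * (\<theta>hat n x - th n) - lin n x / J\<bar>} \<subseteq> ?B1 \<union> ?B2 \<union> ?B3 \<union> ?B4"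
    proof (rule subsetI, rule ccontr)
      fix x assume x1: "x \<in> {x \<in> space (N n). \<epsilon> < \<bar>sqrt n * (\<theta>hat n x - th n) - lin n x / J\<bar>}"
        and x2: "x \<notin> ?B1 \<union> ?B2 \<union> ?B3 \<union> ?B4"
      from x1 have xs: "x \<in> space (iid n obs_space)" by (simp add: L.space_iid)
      have "\<bar>sqrt n * (\<theta>hat n x - th n) - lin n x / J\<bar> \<le> (exp (2 * (A * \<gamma>)) - 1) * (2 * (M + 1) / J) + (M + 1) * (2 * \<rho>' / J\<^sup>2) + \<rho> / J"
      proof (rule estimator_near_linear[OF elim(7) xs J])
        show "(\<exists>\<theta>. is_arg_max (log_cox_likelihood n x) (\<lambda>\<theta>. \<theta> \<in> \<Theta>) \<theta>) \<Longrightarrow> is_arg_max (log_cox_likelihood n x) (\<lambda>\<theta>. \<theta> \<in> \<Theta>) (\<theta>hat n x)"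
          using est xs by (auto simp: cox_estimator_def)
      qed (use x1 x2 S \<rho> \<rho>' \<rho>'2 A \<gamma> \<kappa> in auto)
      also have "\<dots> \<le> \<epsilon>" using \<kappa>3 \<rho>'3 \<rho>(3) unfolding \<gamma>(2) by linarith
      finally show False using x1 by simp
    qed
    then have "measure (N n) {x \<in> space (N n). \<epsilon> < \<bar>sqrt n * (\<theta>hat n x - th n) - lin n x / J\<bar>} \<le> measure (N n) (?B1 \<union> ?B2 \<union> ?B3 \<union> ?B4)"
      using Bs by (intro N.finite_measure_mono) auto
    also have "\<dots> \<le> measure (N n) ?B1 + measure (N n) ?B2 + measure (N n) ?B3 + measure (N n) ?B4"
      using Bs by (intro order_trans[OF measure_Un_le] add_mono) auto
    finally show ?case using elim(1-4) by linarith
  qed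
qed

text \<open>Slutsky's argument on characteristic functions: two of them differ by at most |u|
  \<kappa> where the variables are within \<kappa> of each other, and by at most 2 on the remaining
  event, whose probability is small.\<close>

lemma weak_conv_of_linear:
  assumes J: "0 < J" and Z: "small (\<lambda>n x. T n x - lin n x / J)"
    and Tm: "\<And>n. T n \<in> borel_measurable (iid n obs_space)"
  shows "weak_conv_m (\<lambda>n. distr (N n) borel (T n)) (density lborel (normal_density 0 (sqrt (1 / J))))"
proof (rule levy_continuity)
  have \<sigma>: "0 < sqrt (1 / J)" using J by simp
  show "real_distribution (density lborel (normal_density 0 (sqrt (1 / J))))"
    by (rule real_distribution_normal[OF \<sigma>])
  have Tn: "T n \<in> borel_measurable (N n)" for n by (rule measurable_NI) (rule Tm)
  have ln: "lin n \<in> borel_measurable (N n)" for n by (rule measurable_NI) (rule lin_measurable)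
  show "real_distribution (distr (N n) borel (T n))" for n
    by (rule prob_space.real_distribution_distr[OF prob_space_N Tn])
  fix u :: real
  have lim: "(\<lambda>n. char (distr (N n) borel (lin n)) (u / J)) \<longlonglongrightarrow> char (density lborel (normal_density 0 (sqrt (1 / J)))) u"
  proof -
    have "(u / J)\<^sup>2 * J / 2 = (sqrt (1 / J) * u)\<^sup>2 / 2"
    proof -
      have "(sqrt (1 / J) * u)\<^sup>2 = u\<^sup>2 / J" using J by (simp add: power_mult_distrib)
      moreover have "(u / J)\<^sup>2 * J = u\<^sup>2 / J" using J by (simp add: power2_eq_square)
      ultimately show ?thesis by simp
    qed
    then show ?thesis using char_lin_tendsto[of "u / J"] by (simp only: char_normal[OF \<sigma>])
  qed
  have diff: "(\<lambda>n. char (distr (N n) borel (T n)) u - char (distr (N n) borel (lin n)) (u / J)) \<longlonglongrightarrow> 0"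
  proof (rule tendstoI)
    fix \<epsilon> :: real assume \<epsilon>: "0 < \<epsilon>"
    define \<kappa> where "\<kappa> = \<epsilon> / (4 * (\<bar>u\<bar> + 1))"
    have \<kappa>: "0 < \<kappa>" "\<bar>u\<bar> * \<kappa> \<le> \<epsilon> / 4" using \<epsilon> by (auto simp: \<kappa>_def field_simps)
    have e8: "0 < \<epsilon> / 8" using \<epsilon> by simp
    show "\<forall>\<^sub>F n in sequentially. dist (char (distr (N n) borel (T n)) u - char (distr (N n) borel (lin n)) (u / J)) 0 < \<epsilon>"
      using smallD(1)[OF Z \<kappa>(1) e8]
    proof eventually_elim
      case (elim n)
      interpret N: prob_space "N n" by (rule prob_space_N)
      note [measurable] = Tn[of n] ln[of n]
      let ?S = "{x \<in> space (N n). \<kappa> < \<bar>T n x - lin n x / J\<bar>}"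
      have S: "?S \<in> sets (N n)" by measurable
      have iS1: "integrable (N n) (\<lambda>x. 2 * indicator ?S x :: real)"
        using S by (intro integrable_mult_right integrable_real_indicator) (simp_all add: N.emeasure_eq_measure)
      have iS: "integrable (N n) (\<lambda>x. \<epsilon> / 4 + 2 * indicator ?S x)"
        using iS1 by (intro Bochner_Integration.integrable_add) simp_all
      have i1: "integrable (N n) (\<lambda>x. iexp (u * T n x))" and i2: "integrable (N n) (\<lambda>x. iexp (u / J * lin n x))"
        by (intro N.integrable_const_bound[where B=1]; simp)+
      have "char (distr (N n) borel (T n)) u - char (distr (N n) borel (lin n)) (u / J) =
        (CLINT x|N n. iexp (u * T n x)) - (CLINT x|N n. iexp (u / J * lin n x))"
        unfolding char_def by (subst (1 2) integral_distr) auto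
      also have "\<dots> = (CLINT x|N n. iexp (u * T n x) - iexp (u / J * lin n x))"
        by (rule Bochner_Integration.integral_diff[OF i1 i2, symmetric])
      finally have "norm (char (distr (N n) borel (T n)) u - char (distr (N n) borel (lin n)) (u / J)) \<le>
         (LINT x|N n. norm (iexp (u * T n x) - iexp (u / J * lin n x)))"
        by (simp only: integral_norm_bound)
      also have "\<dots> \<le> (LINT x|N n. \<epsilon> / 4 + 2 * indicator ?S x)"
      proof (rule integral_mono)
        show "integrable (N n) (\<lambda>x. norm (iexp (u * T n x) - iexp (u / J * lin n x)))"
          by (rule integrable_norm[OF Bochner_Integration.integrable_diff[OF i1 i2]])
        show "integrable (N n) (\<lambda>x. \<epsilon> / 4 + 2 * indicator ?S x)" by (rule iS)
        fix x assume x: "x \<in> space (N n)"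
        show "norm (iexp (u * T n x) - iexp (u / J * lin n x)) \<le> \<epsilon> / 4 + 2 * indicator ?S x"
        proof (cases "x \<in> ?S")
          case True
          have "norm (iexp (u * T n x) - iexp (u / J * lin n x)) \<le> norm (iexp (u * T n x)) + norm (iexp (u / J * lin n x))"
            by (rule norm_triangle_ineq4)
          then show ?thesis using True \<epsilon> by simp
        next
          case False
          then have k: "\<bar>T n x - lin n x / J\<bar> \<le> \<kappa>" using x by simp
          have "norm (iexp (u * T n x) - iexp (u / J * lin n x)) \<le> \<bar>u * T n x - u / J * lin n x\<bar>"
            by (rule norm_iexp_diff_le)
          also have "u * T n x - u / J * lin n x = u * (T n x - lin n x / J)" by (simp add: right_diff_distrib)
          also have "\<bar>u * (T n x - lin n x / J)\<bar> \<le> \<bar>u\<bar> * \<kappa>" unfolding abs_mult using k by (rule mult_left_mono) simp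
          finally show ?thesis using False \<kappa>(2) by simp
        qed
      qed
      also have "\<dots> = \<epsilon> / 4 + 2 * measure (N n) ?S"
        using S N.prob_space by (subst Bochner_Integration.integral_add[OF _ iS1]) simp_all
      also have "\<dots> < \<epsilon>" using elim \<epsilon> by linarith
      finally show ?case by simp
    qed
  qed
  from tendsto_add[OF diff lim] show "(\<lambda>n. char (distr (N n) borel (T n)) u) \<longlonglongrightarrow> char (density lborel (normal_density 0 (sqrt (1 / J)))) u"
    by simp
qed

end

section \<open>The efficient score\<close>

text \<open>A measurable function is almost everywhere a limit of continuous functions. Dominated
  convergence makes one of them close in mean square, and a polynomial that is uniformly close to it
  on [0,1] is continuously differentiable.\<close>

lemma C1_dense_L2:
  fixes \<phi> :: "real \<Rightarrow> real"
  assumes m: "\<phi> \<in> borel_measurable borel" and b: "\<And>t. \<bar>\<phi> t\<bar> \<le> M" and \<delta>: "0 < \<delta>"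
  obtains p where "C1_01 p" "continuous_on UNIV p" "integrable lborel (\<lambda>t. indicator {0..1} t * (\<phi> t - p t)\<^sup>2)"
    "(LBINT t. indicator {0..1} t * (\<phi> t - p t)\<^sup>2) < \<delta>"
proof -
  have M0: "0 \<le> M" using b[of 0] by linarith
  have "\<phi> \<in> borel_measurable lebesgue" using m by (simp add: measurable_completion)
  then have "\<phi> measurable_on UNIV" by (intro lebesgue_measurable_imp_measurable_on_real) auto
  then obtain N g where N: "negligible N" and g: "\<And>n. continuous_on UNIV (g n)"
    and lim: "\<And>t. t \<notin> N \<Longrightarrow> (\<lambda>n. g n t) \<longlonglongrightarrow> \<phi> t"
    unfolding measurable_on_def by auto
  \<comment> \<open>Clipping to [-M, M] leaves the limit unchanged, since |\<phi>| <= M, and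
    provides the dominating function.\<close>
  define k where "k n t = max (- M) (min M (g n t))" for n :: nat and t :: real
  have kc: "continuous_on UNIV (k n)" for n unfolding k_def by (intro continuous_intros g)
  have km[measurable]: "k n \<in> borel_measurable borel" for n by (rule borel_measurable_continuous_onI[OF kc])
  have kM: "\<bar>k n t\<bar> \<le> M" for n t using M0 by (auto simp: k_def abs_le_iff)
  have klim: "(\<lambda>n. k n t) \<longlonglongrightarrow> \<phi> t" if "t \<notin> N" for t
  proof -
    have "(\<lambda>n. max (- M) (min M (g n t))) \<longlonglongrightarrow> max (- M) (min M (\<phi> t))"
      by (intro tendsto_intros lim[OF that])
    moreover have "max (- M) (min M (\<phi> t)) = \<phi> t" using b[of t] by (auto simp: abs_le_iff)
    ultimately show ?thesis by (simp add: k_def)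
  qed
  have "AE t in lebesgue. t \<notin> N"
    using N by (intro AE_not_in) (simp add: negligible_iff_null_sets)
  then have N0: "AE t in lborel. t \<notin> N" by (simp only: AE_completion_iff)
  have "(\<lambda>n. LBINT t. indicator {0..1} t * (\<phi> t - k n t)\<^sup>2) \<longlonglongrightarrow> (LBINT t::real. 0)"
  proof (rule integral_dominated_convergence[where w="\<lambda>t. indicator {0..1} t * (2 * M)\<^sup>2"])
    show "AE t in lborel. (\<lambda>n. indicator {0..1} t * (\<phi> t - k n t)\<^sup>2) \<longlonglongrightarrow> 0"
      using N0
    proof eventually_elim
      case (elim t)
      have "(\<lambda>n. indicator {0..1} t * (\<phi> t - k n t)\<^sup>2) \<longlonglongrightarrow> indicator {0..1} t * (\<phi> t - \<phi> t)\<^sup>2"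
        by (intro tendsto_intros klim[OF elim])
      then show ?case by simp
    qed
    show "AE t in lborel. norm (indicator {0..1} t * (\<phi> t - k n t)\<^sup>2) \<le> indicator {0..1} t * (2 * M)\<^sup>2" for n
    proof (rule AE_I2)
      fix t :: real
      have "\<bar>\<phi> t - k n t\<bar> \<le> 2 * M" using b[of t] kM[of n t] by linarith
      from power_mono[OF this abs_ge_zero, of 2]
      show "norm (indicator {0..1} t * (\<phi> t - k n t)\<^sup>2) \<le> indicator {0..1} t * (2 * M)\<^sup>2"
        by (auto split: split_indicator)
    qed
    show "integrable lborel (\<lambda>t::real. indicator {0..1} t * (2 * M)\<^sup>2)"
      by (intro integrable_mult_left integrable_indicator_01)
  qed (use m in measurable)
  then have "\<forall>\<^sub>F n in sequentially. (LBINT t. indicator {0..1} t * (\<phi> t - k n t)\<^sup>2) < \<delta> / 4"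
    using \<delta> by (intro order_tendstoD) auto
  then obtain n where n: "(LBINT t. indicator {0..1} t * (\<phi> t - k n t)\<^sup>2) < \<delta> / 4"
    using eventually_happens'[OF sequentially_bot] by blast
  \<comment> \<open>Each of the two squared errors enters with the factor 2, so the total is below 2
    \<delta> / 4 + 2 \<delta> / 8 < \<delta>.\<close>
  define \<eta> where "\<eta> = sqrt (\<delta> / 8)"
  have \<eta>: "0 < \<eta>" "\<eta>\<^sup>2 = \<delta> / 8" using \<delta> by (auto simp: \<eta>_def)
  obtain p where p: "real_polynomial_function p" and pk: "\<And>t. t \<in> {0..1} \<Longrightarrow> \<bar>k n t - p t\<bar> < \<eta>"
    using Stone_Weierstrass_real_polynomial_function[OF compact_Icc continuous_on_subset[OF kc subset_UNIV] \<eta>(1)]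
    by metis
  obtain p' where p': "real_polynomial_function p'" "\<And>x. (p has_real_derivative p' x) (at x)"
    using has_real_derivative_polynomial_function[OF p] by blast
  have pc: "continuous_on S p" "continuous_on S p'" for S
    using continuous_real_polymonial_function[OF p] continuous_real_polymonial_function[OF p'(1)]
    by (auto intro: continuous_at_imp_continuous_on)
  have C1: "C1_01 p"
    unfolding C1_01_def using p'(2) pc(2) by (intro exI[of _ p']) (auto intro: has_field_derivative_at_within)
  have pm[measurable]: "p \<in> borel_measurable borel" by (rule borel_measurable_continuous_onI[OF pc(1)])
  have bd: "indicator {0..1} t * (\<phi> t - p t)\<^sup>2 \<le> 2 * (indicator {0..1} t * (\<phi> t - k n t)\<^sup>2) + indicator {0..1} t * (\<delta> / 4)" for t
  proof (cases "t \<in> {0..1}")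
    case True
    have 1: "(k n t - p t)\<^sup>2 \<le> \<delta> / 8"
      using power_mono[OF less_imp_le[OF pk[OF True]] abs_ge_zero, of 2] \<eta> by simp
    have "0 \<le> ((\<phi> t - k n t) - (k n t - p t))\<^sup>2" by simp
    then have "(\<phi> t - p t)\<^sup>2 \<le> 2 * (\<phi> t - k n t)\<^sup>2 + 2 * (k n t - p t)\<^sup>2"
      unfolding power2_eq_square by (simp add: algebra_simps)
    then have "(\<phi> t - p t)\<^sup>2 \<le> 2 * (\<phi> t - k n t)\<^sup>2 + \<delta> / 4" using 1 by linarith
    then show ?thesis using True by simp
  qed simp
  have i1: "integrable lborel (\<lambda>t. indicator {0..1} t * (\<phi> t - k n t)\<^sup>2)"
  proof (rule Bochner_Integration.integrable_bound[where f="\<lambda>t. indicator {0..1} t * (2 * M)\<^sup>2"])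
    show "integrable lborel (\<lambda>t::real. indicator {0..1} t * (2 * M)\<^sup>2)"
      by (intro integrable_mult_left integrable_indicator_01)
    show "AE t in lborel. norm (indicator {0..1} t * (\<phi> t - k n t)\<^sup>2) \<le> norm (indicator {0..1} t * (2 * M)\<^sup>2)"
    proof (rule AE_I2)
      fix t :: real
      have "\<bar>\<phi> t - k n t\<bar> \<le> 2 * M" using b[of t] kM[of n t] by linarith
      from power_mono[OF this abs_ge_zero, of 2]
      show "norm (indicator {0..1} t * (\<phi> t - k n t)\<^sup>2) \<le> norm (indicator {0..1} t * (2 * M)\<^sup>2)"
        by (auto split: split_indicator)
    qed
  qed (use m in measurable)
  have i2: "integrable lborel (\<lambda>t::real. indicator {0..1} t * (\<delta> / 4))"
    by (intro integrable_mult_left integrable_indicator_01)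
  have i3: "integrable lborel (\<lambda>t. 2 * (indicator {0..1} t * (\<phi> t - k n t)\<^sup>2) + indicator {0..1} t * (\<delta> / 4))"
    by (intro Bochner_Integration.integrable_add i2 integrable_mult_right i1)
  have i: "integrable lborel (\<lambda>t. indicator {0..1} t * (\<phi> t - p t)\<^sup>2)"
  proof (rule Bochner_Integration.integrable_bound[OF i3])
    show "AE t in lborel. norm (indicator {0..1} t * (\<phi> t - p t)\<^sup>2) \<le>
      norm (2 * (indicator {0..1} t * (\<phi> t - k n t)\<^sup>2) + indicator {0..1} t * (\<delta> / 4))"
    proof (rule AE_I2)
      fix t :: real
      have "norm (indicator {0..1} t * (\<phi> t - p t)\<^sup>2) = indicator {0..1} t * (\<phi> t - p t)\<^sup>2" by simp
      then show "norm (indicator {0..1} t * (\<phi> t - p t)\<^sup>2) \<le>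
        norm (2 * (indicator {0..1} t * (\<phi> t - k n t)\<^sup>2) + indicator {0..1} t * (\<delta> / 4))"
        using bd[of t] unfolding real_norm_def by linarith
    qed
  qed (use m in measurable)
  have "(LBINT t. indicator {0..1} t * (\<phi> t - p t)\<^sup>2) \<le> (LBINT t. 2 * (indicator {0..1} t * (\<phi> t - k n t)\<^sup>2) + indicator {0..1} t * (\<delta> / 4))"
    by (rule integral_mono[OF i i3 bd])
  also have "\<dots> = 2 * (LBINT t. indicator {0..1} t * (\<phi> t - k n t)\<^sup>2) + \<delta> / 4"
    by (subst Bochner_Integration.integral_add[OF integrable_mult_right[OF i1] i2]) simp
  also have "\<dots> < \<delta>" using n \<delta> by linarith
  finally have "(LBINT t. indicator {0..1} t * (\<phi> t - p t)\<^sup>2) < \<delta>" .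
  with C1 pc(1) i show thesis by (rule that)
qed

section \<open>Products and orthogonality of square-integrable functions\<close>

lemma integrable_mult_L2:
  fixes f g :: "'a \<Rightarrow> real"
  assumes "f \<in> borel_measurable M" "g \<in> borel_measurable M" "integrable M (\<lambda>x. (f x)\<^sup>2)" "integrable M (\<lambda>x. (g x)\<^sup>2)"
  shows "integrable M (\<lambda>x. f x * g x)"
proof (rule Bochner_Integration.integrable_bound[where f="\<lambda>x. (f x)\<^sup>2 + (g x)\<^sup>2"])
  have *: "\<bar>a * b\<bar> \<le> a\<^sup>2 + b\<^sup>2" for a b :: real
  proof -
    have "2 * (\<bar>a\<bar> * \<bar>b\<bar>) \<le> \<bar>a\<bar>\<^sup>2 + \<bar>b\<bar>\<^sup>2" using sum_squares_bound[of "\<bar>a\<bar>" "\<bar>b\<bar>"] by simp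
    moreover have "0 \<le> \<bar>a\<bar> * \<bar>b\<bar>" by simp
    ultimately show ?thesis unfolding abs_mult power2_abs by linarith
  qed
  show "AE x in M. norm (f x * g x) \<le> norm ((f x)\<^sup>2 + (g x)\<^sup>2)"
    unfolding real_norm_def by (intro AE_I2 order_trans[OF * abs_ge_self])
qed (use assms in auto)

text \<open>Orthogonality survives mean-square limits. The weighted inequality |l u| <= (c l^2 + u^2
  / c) / 2 takes the place of Cauchy-Schwarz.\<close>

lemma orthogonal_L2_closure:
  fixes l :: "'a \<Rightarrow> real"
  assumes lm: "l \<in> borel_measurable P" and l2: "integrable P (\<lambda>x. (l x)\<^sup>2)"
    and orth: "\<And>a. a \<in> A \<Longrightarrow> L2 P a \<Longrightarrow> (LINT x|P. l x * a x) = 0" and k: "k \<in> L2_closure P A"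
  shows "(LINT x|P. l x * k x) = 0"
proof -
  have kL: "L2 P k" using k by (simp add: L2_closure_def)
  have *: "\<bar>LINT x|P. l x * k x\<bar> \<le> \<epsilon>" if \<epsilon>: "0 < \<epsilon>" for \<epsilon>
  proof -
    define v where "v = (LINT x|P. (l x)\<^sup>2)"
    have v: "0 \<le> v" by (simp add: v_def)
    \<comment> \<open>With this weight, and an element of \<open>A\<close> within c \<epsilon> of
      \<open>k\<close> in mean square, each of the two terms is at most \<epsilon>.\<close>
    define c where "c = \<epsilon> / (v + 1)"
    have c: "0 < c" "c * v \<le> \<epsilon>" using \<epsilon> v by (auto simp: c_def field_simps)
    obtain a where a: "a \<in> A" "L2 P a" "(LINT x|P. (k x - a x)\<^sup>2) < c * \<epsilon>"
    proof -
      have "\<forall>\<epsilon>>0. \<exists>a\<in>A. L2 P a \<and> (LINT x|P. (k x - a x)\<^sup>2) < \<epsilon>" using k by (simp add: L2_closure_def)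
      moreover have "0 < c * \<epsilon>" using c \<epsilon> by simp
      ultimately show ?thesis using that by blast
    qed
    have am: "a \<in> borel_measurable P" "integrable P (\<lambda>x. (a x)\<^sup>2)" and km: "k \<in> borel_measurable P" "integrable P (\<lambda>x. (k x)\<^sup>2)"
      using a(2) kL by (auto simp: L2_def)
    have i1: "integrable P (\<lambda>x. l x * k x)" by (rule integrable_mult_L2[OF lm km(1) l2 km(2)])
    have i2: "integrable P (\<lambda>x. l x * a x)" by (rule integrable_mult_L2[OF lm am(1) l2 am(2)])
    have i3: "integrable P (\<lambda>x. k x * a x)" by (rule integrable_mult_L2[OF km(1) am(1) km(2) am(2)])
    have i4: "integrable P (\<lambda>x. (k x - a x)\<^sup>2)" unfolding power2_diff using i3 km am by (simp add: mult.assoc)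
    have ptw: "\<bar>l x * (k x - a x)\<bar> \<le> (c * (l x)\<^sup>2 + (k x - a x)\<^sup>2 / c) / 2" for x
    proof -
      have "0 \<le> (c * \<bar>l x\<bar> - \<bar>k x - a x\<bar>)\<^sup>2" by simp
      then have 1: "2 * c * (\<bar>l x\<bar> * \<bar>k x - a x\<bar>) \<le> c * c * (l x)\<^sup>2 + (k x - a x)\<^sup>2"
        by (simp only: power2_diff power_mult_distrib power2_abs) (simp add: power2_eq_square mult_ac)
      have "c * ((c * (l x)\<^sup>2 + (k x - a x)\<^sup>2 / c) / 2) = (c * c * (l x)\<^sup>2 + (k x - a x)\<^sup>2) / 2"
        using c(1) by (simp add: distrib_left)
      then have "c * (\<bar>l x\<bar> * \<bar>k x - a x\<bar>) \<le> c * ((c * (l x)\<^sup>2 + (k x - a x)\<^sup>2 / c) / 2)"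
        using 1 by simp
      then show ?thesis unfolding abs_mult by (rule mult_left_le_imp_le) (rule c(1))
    qed
    have i5: "integrable P (\<lambda>x. (c * (l x)\<^sup>2 + (k x - a x)\<^sup>2 / c) / 2)" using l2 i4 by simp
    have i6: "integrable P (\<lambda>x. l x * (k x - a x))" using i1 i2 by (simp add: right_diff_distrib)
    have "(LINT x|P. l x * k x) = (LINT x|P. l x * (k x - a x))"
      using i1 i2 orth[OF a(1,2)] by (simp add: right_diff_distrib)
    also have "\<bar>\<dots>\<bar> \<le> (LINT x|P. \<bar>l x * (k x - a x)\<bar>)" by (rule integral_abs_bound)
    also have "\<dots> \<le> (LINT x|P. (c * (l x)\<^sup>2 + (k x - a x)\<^sup>2 / c) / 2)"
      by (rule integral_mono[OF integrable_abs[OF i6] i5 ptw])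
    also have "\<dots> = (c * v + (LINT x|P. (k x - a x)\<^sup>2) / c) / 2"
      using l2 i4 by (simp add: v_def)
    also have "\<dots> \<le> (\<epsilon> + \<epsilon>) / 2"
    proof -
      have "(LINT x|P. (k x - a x)\<^sup>2) / c \<le> \<epsilon>" using a(3) c(1) by (simp add: field_simps)
      then show ?thesis using c(2) by simp
    qed
    finally show ?thesis by simp
  qed
  have "\<bar>LINT x|P. l x * k x\<bar> \<le> 0"
    by (rule field_le_epsilon, unfold add_0) (rule *)
  then show ?thesis by simp
qed

context counting_law
begin

lemma mart_integrand_integrable:
  assumes gm [measurable]: "g \<in> borel_measurable borel" and g: "\<And>t. \<bar>g t\<bar> \<le> G"
  shows "integrable lborel (\<lambda>t. (\<alpha> * w + g t) * rate \<theta> h x t)"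
proof (rule rate_integrable[where B="\<bar>\<alpha> * w\<bar> + G"])
  show "\<bar>\<alpha> * w + g t\<bar> \<le> \<bar>\<alpha> * w\<bar> + G" for t using g[of t] by linarith
qed measurable

lemma mart_diff:
  assumes g: "g \<in> borel_measurable borel" "\<And>t. \<bar>g t\<bar> \<le> G" and k: "k \<in> borel_measurable borel" "\<And>t. \<bar>k t\<bar> \<le> G'"
  shows "mart (\<lambda>t w. \<alpha> * w + g t) x - mart (\<lambda>t w. \<beta> * w + k t) x = mart (\<lambda>t w. (\<alpha> - \<beta>) * w + (g t - k t)) x"
proof -
  have "(LBINT t. ((\<alpha> - \<beta>) * obs_W x + (g t - k t)) * rate \<theta> h x t) =
    (LBINT t. (\<alpha> * obs_W x + g t) * rate \<theta> h x t - (\<beta> * obs_W x + k t) * rate \<theta> h x t)"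
    by (intro Bochner_Integration.integral_cong) (auto simp: algebra_simps)
  also have "\<dots> = (LBINT t. (\<alpha> * obs_W x + g t) * rate \<theta> h x t) - (LBINT t. (\<beta> * obs_W x + k t) * rate \<theta> h x t)"
    by (intro Bochner_Integration.integral_diff mart_integrand_integrable[OF g] mart_integrand_integrable[OF k])
  finally show ?thesis unfolding mart_def by (simp add: algebra_simps)
qed

lemma mart_scale_neg:
  "mart (\<lambda>t w. 0 * w + - g t) x = - mart (\<lambda>t w. 0 * w + g t) x"
  by (simp add: mart_def)

end

section \<open>Continuous functions on the window\<close>

lemma C1_01_continuous: "C1_01 f \<Longrightarrow> continuous_on {0..1} f"
  unfolding C1_01_def by (meson DERIV_continuous_on)

lemma continuous_01_measurable:
  fixes f :: "real \<Rightarrow> real"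
  shows "continuous_on {0..1} f \<Longrightarrow> (\<lambda>t. indicator {0..1} t * f t) \<in> borel_measurable borel"
  using borel_measurable_continuous_on_indicator[of "{0..1}" f] by simp

lemma continuous_01_bounded:
  fixes f :: "real \<Rightarrow> real"
  assumes "continuous_on {0..1} f"
  obtains M where "0 < M" "\<And>t. t \<in> {0..1} \<Longrightarrow> \<bar>f t\<bar> \<le> M"
proof -
  have "bounded (f ` {0..1})"
    using compact_continuous_image[OF assms] compact_imp_bounded by auto
  then obtain M where "\<forall>y\<in>f ` {0..1}. norm y \<le> M" unfolding bounded_iff by blast
  then have "\<bar>f t\<bar> \<le> \<bar>M\<bar> + 1" if "t \<in> {0..1}" for t using that by force
  then show thesis by (intro that[of "\<bar>M\<bar> + 1"]) auto
qed

lemma continuous_01_pos: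
  fixes f :: "real \<Rightarrow> real"
  assumes "continuous_on {0..1} f" "\<And>t. t \<in> {0..1} \<Longrightarrow> 0 < f t"
  obtains m where "0 < m" "\<And>t. t \<in> {0..1} \<Longrightarrow> m \<le> f t"
proof -
  obtain t0 where "t0 \<in> {0..1}" "\<forall>t\<in>{0..1}. f t0 \<le> f t"
    using continuous_attains_inf[OF compact_Icc _ assms(1)] by auto
  then show thesis using assms(2) by (intro that[of "f t0"]) auto
qed

lemma int_dM_eq:
  assumes "(\<lambda>t. indicator {0..1} t * f t) \<in> borel_measurable borel"
  shows "int_dM \<theta> \<eta> f x = (if ev x then f (obs_T x) else 0) - (LBINT t. f t * rate \<theta> (haz01 \<eta>) x t)"
proof -
  have "(LBINT s:{0..1}. f s * (obs_Y x s * \<eta> s * exp (\<theta> * obs_W x))) = (LBINT t. f t * rate \<theta> (haz01 \<eta>) x t)"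
    unfolding set_lebesgue_integral_def
    by (intro Bochner_Integration.integral_cong) (auto simp: rate_def haz01_def)
  then show ?thesis by (simp only: int_dM_def int_dN_eq[OF assms])
qed

section \<open>Scores and projection at the true law\<close>

locale cox_law_efficient = counting_law R \<theta> "haz01 \<eta>" K
  for R :: "obs measure" and \<theta> :: real and \<eta> :: "real \<Rightarrow> real" and K :: real +
  fixes d c :: real
  assumes env: "integrable R (\<lambda>x. envelope \<theta> d (obs_W x))" and d: "0 \<le> d"
    and nonneg: "AE x in R. obs_D x \<longrightarrow> 0 \<le> obs_T x"
    and W2: "integrable R (\<lambda>x. (obs_W x)\<^sup>2)"
    and \<eta>: "smooth_hazard \<eta>" and c: "0 < c" and s0: "\<And>t. t \<in> {0..1} \<Longrightarrow> c \<le> s_fun R 0 \<theta> t"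
begin

lemma near: "\<bar>\<theta> - \<theta>\<bar> \<le> d" using d by simp

definition e :: "real \<Rightarrow> real" where "e t = indicator {0..1} t * (s_fun R 1 \<theta> t / s_fun R 0 \<theta> t)"

definition E :: real where "E = (LINT x|R. envelope \<theta> d (obs_W x)) / c"

lemma sm [measurable]: "s_fun R k \<theta> \<in> borel_measurable borel"
  using s_fun_measurable[OF env near, of k \<theta>] by simp

lemma e_measurable [measurable]: "e \<in> borel_measurable borel" unfolding e_def[abs_def] by measurable

lemma V_nonneg: "0 \<le> (LINT x|R. envelope \<theta> d (obs_W x))"
  by (intro Bochner_Integration.integral_nonneg envelope_nonneg)

lemma E_nonneg: "0 \<le> E" using V_nonneg c by (simp add: E_def)

lemma e_le: "\<bar>e t\<bar> \<le> E"
proof (cases "t \<in> {0..1}")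
  case True
  have "\<bar>s_fun R 1 \<theta> t / s_fun R 0 \<theta> t\<bar> \<le> (LINT x|R. envelope \<theta> d (obs_W x)) / c"
    unfolding abs_divide using s_fun_bound[OF env near, of 1 t] s0[OF True] c V_nonneg by (intro frac_le) auto
  then show ?thesis using True by (simp add: e_def E_def)
qed (simp add: e_def E_nonneg)

lemma rate_01: "t \<notin> {0..1} \<Longrightarrow> rate \<theta> (haz01 \<eta>) x t = 0"
  by (simp add: rate_def haz01_def)

lemma efficient_score_eq: "cox_efficient_score R \<theta> \<eta> x = mart (\<lambda>t w. 1 * w + - e t) x"
proof -
  have "(\<lambda>t. indicator {0..1} t * (obs_W x - s_fun R 1 \<theta> t / s_fun R 0 \<theta> t)) \<in> borel_measurable borel" by measurable
  note eq = int_dM_eq[OF this]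
  have "(LBINT t. (obs_W x - s_fun R 1 \<theta> t / s_fun R 0 \<theta> t) * rate \<theta> (haz01 \<eta>) x t) = (LBINT t. (1 * obs_W x + - e t) * rate \<theta> (haz01 \<eta>) x t)"
  proof (intro Bochner_Integration.integral_cong refl)
    fix t show "(obs_W x - s_fun R 1 \<theta> t / s_fun R 0 \<theta> t) * rate \<theta> (haz01 \<eta>) x t = (1 * obs_W x + - e t) * rate \<theta> (haz01 \<eta>) x t"
      by (cases "t \<in> {0..1}") (simp_all add: e_def rate_01)
  qed
  moreover have "(if ev x then obs_W x - s_fun R 1 \<theta> (obs_T x) / s_fun R 0 \<theta> (obs_T x) else 0) = (if ev x then 1 * obs_W x + - e (obs_T x) else 0)"
    by (simp add: e_def ev_def)
  ultimately show ?thesis unfolding cox_efficient_score_def eq mart_def by (simp only:)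
qed

lemma smooth: "continuous_on {0..1} \<eta>" "\<And>t. t \<in> {0..1} \<Longrightarrow> 0 < \<eta> t"
  using \<eta> C1_01_continuous by (auto simp: smooth_hazard_def)

text \<open>The integrand of a nuisance score, cut off to the window so that it is bounded on the
  whole line.\<close>

definition dir :: "(real \<Rightarrow> real) \<Rightarrow> real \<Rightarrow> real" where "dir b t = indicator {0..1} t * (b t / \<eta> t)"

lemma
  assumes "C1_01 b"
  shows dir_measurable: "dir b \<in> borel_measurable borel" and dir_bounded: "\<exists>M. \<forall>t. \<bar>dir b t\<bar> \<le> M"
    and score_\<eta>_eq: "score_\<eta> \<theta> \<eta> b x = mart (\<lambda>t w. 0 * w + dir b t) x"
proof -
  have "continuous_on {0..1} (\<lambda>t. b t / \<eta> t)"
    using smooth C1_01_continuous[OF assms] by (intro continuous_intros) force+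
  note co = this
  show m: "dir b \<in> borel_measurable borel"
    unfolding dir_def[abs_def] by (rule continuous_01_measurable[OF co])
  obtain M where "0 < M" "\<And>t. t \<in> {0..1} \<Longrightarrow> \<bar>b t / \<eta> t\<bar> \<le> M" by (rule continuous_01_bounded[OF co]) (rule that)
  then have "\<bar>dir b t\<bar> \<le> M" for t by (simp add: dir_def split: split_indicator)
  then show "\<exists>M. \<forall>t. \<bar>dir b t\<bar> \<le> M" by blast
  have "(LBINT t. b t / \<eta> t * rate \<theta> (haz01 \<eta>) x t) = (LBINT t. (0 * obs_W x + dir b t) * rate \<theta> (haz01 \<eta>) x t)"
  proof (intro Bochner_Integration.integral_cong refl)
    fix t show "b t / \<eta> t * rate \<theta> (haz01 \<eta>) x t = (0 * obs_W x + dir b t) * rate \<theta> (haz01 \<eta>) x t"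
      by (cases "t \<in> {0..1}") (simp_all add: dir_def rate_01)
  qed
  moreover have "(if ev x then b (obs_T x) / \<eta> (obs_T x) else 0) = (if ev x then 0 * obs_W x + dir b (obs_T x) else 0)"
    by (simp add: dir_def ev_def)
  ultimately show "score_\<eta> \<theta> \<eta> b x = mart (\<lambda>t w. 0 * w + dir b t) x"
    unfolding score_\<eta>_def int_dM_eq[OF continuous_01_measurable[OF co]] mart_def by (simp only:)
qed

lemma score_\<theta>_eq: "score_\<theta> \<theta> \<eta> x = obs_W x * ((if obs_D x \<and> obs_T x \<le> 1 then 1 else 0) - (LBINT t. rate \<theta> (haz01 \<eta>) x t))"
proof -
  have "(LBINT s:{0..1}. obs_Y x s * \<eta> s * exp (\<theta> * obs_W x)) = (LBINT t. rate \<theta> (haz01 \<eta>) x t)"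
    unfolding set_lebesgue_integral_def
    by (intro Bochner_Integration.integral_cong) (auto simp: rate_def haz01_def)
  then show ?thesis unfolding score_\<theta>_def cox_M_def obs_N_def by (simp only:)
qed

text \<open>\<open>obs_N\<close> also counts an uncensored failure before time 0, which
  \<open>ev\<close> excludes; such failures form a null set.\<close>

lemma score_\<theta>_mart: "AE x in R. score_\<theta> \<theta> \<eta> x = mart (\<lambda>t w. 1 * w + 0) x"
  using nonneg
proof eventually_elim
  case (elim x)
  have "(LBINT t. (1 * obs_W x + 0) * rate \<theta> (haz01 \<eta>) x t) = obs_W x * (LBINT t. rate \<theta> (haz01 \<eta>) x t)" by simp
  then show ?case using elim unfolding score_\<theta>_eq mart_def ev_def by (auto simp: algebra_simps)
qed

lemma score_\<theta>_measurable: "score_\<theta> \<theta> \<eta> \<in> borel_measurable R"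
  unfolding score_\<theta>_eq[abs_def] by (rule measurable_RI) measurable

lemma zero_g: "(\<lambda>t. 0) \<in> borel_measurable borel" "\<bar>0::real\<bar> \<le> 0" by auto

lemma mart_affine_measurable:
  assumes [measurable]: "g \<in> borel_measurable borel"
  shows "mart (\<lambda>t w. \<alpha> * w + g t) \<in> borel_measurable R"
  by (rule measurable_RI, rule mart_measurable) measurable

lemma L2_mart:
  assumes "g \<in> borel_measurable borel" "\<And>t. \<bar>g t\<bar> \<le> G"
  shows "L2 R (mart (\<lambda>t w. \<alpha> * w + g t))"
  unfolding L2_def using mart_affine_measurable[OF assms(1)] integrable_mart_square[OF env near assms] by blast

lemma L2_score_\<theta>: "L2 R (score_\<theta> \<theta> \<eta>)"
  unfolding L2_def
proof
  show "integrable R (\<lambda>x. (score_\<theta> \<theta> \<eta> x)\<^sup>2)"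
  proof (rule integrable_cong_AE_imp[OF integrable_mart_square[OF env near zero_g]])
    show "AE x in R. (mart (\<lambda>t w. 1 * w + 0) x)\<^sup>2 = (score_\<theta> \<theta> \<eta> x)\<^sup>2"
      using score_\<theta>_mart by eventually_elim simp
  qed (use score_\<theta>_measurable in measurable)
qed (rule score_\<theta>_measurable)

lemma neg_e: "(\<lambda>t. - e t) \<in> borel_measurable borel" "\<bar>- e t\<bar> \<le> E"
  using e_le by auto

abbreviation "eff \<equiv> mart (\<lambda>t w. 1 * w + - e t)"

text \<open>Polarisation reduces the inner product to the variances of sum and difference. These
  differ by 4 times the integral of \<open>dir b\<close> (s1 - e s0) against the hazard, and e = s1
  / s0 makes the integrand vanish.\<close>

lemma eff_orthogonal:
  assumes b: "C1_01 b"
  shows "(LINT x|R. eff x * mart (\<lambda>t w. 0 * w + dir b t) x) = 0"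
proof -
  note g = dir_measurable[OF b]
  obtain M where M: "\<And>t. \<bar>dir b t\<bar> \<le> M" using dir_bounded[OF b] by blast
  let ?a = "mart (\<lambda>t w. 0 * w + dir b t)" and ?a' = "mart (\<lambda>t w. 0 * w + - dir b t)"
  have ng: "(\<lambda>t. - dir b t) \<in> borel_measurable borel" using g by measurable
  have nM: "\<bar>- dir b t\<bar> \<le> M" for t using M by simp
  have minus: "eff x - ?a x = mart (\<lambda>t w. 1 * w + (- e t - dir b t)) x" for x
    using mart_diff[OF neg_e g M, of 1 x 0] by simp
  \<comment> \<open>A sum is the difference with the negated direction, which brings it under
    \<open>mart_diff\<close>.\<close>
  have plus: "eff x + ?a x = mart (\<lambda>t w. 1 * w + (- e t - - dir b t)) x" for x
    using mart_diff[OF neg_e ng nM, of 1 x 0] by (simp add: mart_scale_neg[of "dir b", simplified])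
  have m1: "(\<lambda>t. - e t - dir b t) \<in> borel_measurable borel" and m2: "(\<lambda>t. - e t - - dir b t) \<in> borel_measurable borel"
    using g by measurable
  have b1: "\<bar>- e t - dir b t\<bar> \<le> E + M" and b2: "\<bar>- e t - - dir b t\<bar> \<le> E + M" for t
    using e_le[of t] M[of t] by linarith+
  let ?q = "\<lambda>k t. (1\<^sup>2 * s_fun R 2 \<theta> t + 2 * 1 * k t * s_fun R 1 \<theta> t + (k t)\<^sup>2 * s_fun R 0 \<theta> t) * haz01 \<eta> t"
  have "(LINT x|R. eff x * ?a x) = ((LINT x|R. (eff x + ?a x)\<^sup>2) - (LINT x|R. (eff x - ?a x)\<^sup>2)) / 4"
  proof -
    have i: "integrable R (\<lambda>x. (eff x + ?a x)\<^sup>2)" "integrable R (\<lambda>x. (eff x - ?a x)\<^sup>2)"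
      unfolding plus minus
      by (rule integrable_mart_square[OF env near m2 b2], rule integrable_mart_square[OF env near m1 b1])
    have "eff x * ?a x = ((eff x + ?a x)\<^sup>2 - (eff x - ?a x)\<^sup>2) / 4" for x
      by (simp add: power2_eq_square algebra_simps)
    then have "(LINT x|R. eff x * ?a x) = (LINT x|R. ((eff x + ?a x)\<^sup>2 - (eff x - ?a x)\<^sup>2) / 4)" by (simp only:)
    also have "\<dots> = ((LINT x|R. (eff x + ?a x)\<^sup>2) - (LINT x|R. (eff x - ?a x)\<^sup>2)) / 4"
      using i by (simp del: mult_zero_left)
    finally show ?thesis .
  qed
  also have "(LINT x|R. (eff x + ?a x)\<^sup>2) = (LBINT t. ?q (\<lambda>t. - e t - - dir b t) t)"
    unfolding plus by (rule integral_mart_square_affine[OF env near m2 b2])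
  also have "(LINT x|R. (eff x - ?a x)\<^sup>2) = (LBINT t. ?q (\<lambda>t. - e t - dir b t) t)"
    unfolding minus by (rule integral_mart_square_affine[OF env near m1 b1])
  also have "(LBINT t. ?q (\<lambda>t. - e t - - dir b t) t) = (LBINT t. ?q (\<lambda>t. - e t - dir b t) t)"
  proof (intro Bochner_Integration.integral_cong refl)
    fix t
    show "?q (\<lambda>t. - e t - - dir b t) t = ?q (\<lambda>t. - e t - dir b t) t"
    proof (cases "t \<in> {0..1}")
      case True
      then have "s_fun R 1 \<theta> t = e t * s_fun R 0 \<theta> t" using s0[OF True] c by (simp add: e_def)
      then show ?thesis by (simp add: power2_eq_square algebra_simps)
    qed (simp add: haz01_def)
  qed
  finally show ?thesis by simp
qed

text \<open>The nuisance score of b has integrand b / \<eta>, so the ideal direction is e \<eta>,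
  which is bounded and measurable but need not be differentiable. A continuously differentiable b
  close to it in mean square on [0,1] suffices, because the isometry turns the distance of the
  scores into a weighted distance in time.\<close>

lemma e_in_closure: "mart (\<lambda>t w. 0 * w + e t) \<in> L2_closure R {score_\<eta> \<theta> \<eta> b |b. C1_01 b}"
  unfolding L2_closure_def
proof (intro CollectI conjI allI impI)
  show "L2 R (mart (\<lambda>t w. 0 * w + e t))" by (rule L2_mart[OF e_measurable e_le])
  fix \<epsilon> :: real assume \<epsilon>: "0 < \<epsilon>"
  define V where "V = (LINT x|R. envelope \<theta> d (obs_W x))"
  have V: "0 \<le> V" unfolding V_def by (rule V_nonneg)
  obtain m where m: "0 < m" "\<And>t. t \<in> {0..1} \<Longrightarrow> m \<le> \<eta> t" using continuous_01_pos[OF smooth] by metis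
  \<comment> \<open>Bounds the weight: \<open>s_fun\<close> of order 0 is at most V, the hazard at
    most K, and division of the direction by \<eta> costs 1 / m^2.\<close>
  define C where "C = V * K / m\<^sup>2"
  have C: "0 \<le> C" using V K_nonneg m by (simp add: C_def)
  let ?\<phi> = "\<lambda>t. e t * haz01 \<eta> t"
  have pm: "?\<phi> \<in> borel_measurable borel" by measurable
  have pb: "\<bar>?\<phi> t\<bar> \<le> E * K" for t
    unfolding abs_mult using e_le[of t] h_le[of t] h_nonneg[of t] E_nonneg by (intro mult_mono) auto
  have "0 < \<epsilon> / (C + 1)" using \<epsilon> C by simp
  then obtain b where b: "C1_01 b" "integrable lborel (\<lambda>t. indicator {0..1} t * (?\<phi> t - b t)\<^sup>2)"
    "(LBINT t. indicator {0..1} t * (?\<phi> t - b t)\<^sup>2) < \<epsilon> / (C + 1)"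
    by (rule C1_dense_L2[OF pm pb])
  note g = dir_measurable[OF b(1)]
  obtain M where M: "\<And>t. \<bar>dir b t\<bar> \<le> M" using dir_bounded[OF b(1)] by blast
  have km: "(\<lambda>t. e t - dir b t) \<in> borel_measurable borel" using g by measurable
  have kb: "\<bar>e t - dir b t\<bar> \<le> E + M" for t using e_le[of t] M[of t] by linarith
  let ?q = "\<lambda>t. (0\<^sup>2 * s_fun R 2 \<theta> t + 2 * 0 * (e t - dir b t) * s_fun R 1 \<theta> t + (e t - dir b t)\<^sup>2 * s_fun R 0 \<theta> t) * haz01 \<eta> t"
  have "(LINT x|R. (mart (\<lambda>t w. 0 * w + e t) x - score_\<eta> \<theta> \<eta> b x)\<^sup>2) = (LINT x|R. (mart (\<lambda>t w. 0 * w + (e t - dir b t)) x)\<^sup>2)"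
    using mart_diff[OF e_measurable e_le g M, of 0 _ 0] by (simp add: score_\<eta>_eq[OF b(1)])
  also have "\<dots> = (LBINT t. ?q t)" by (rule integral_mart_square_affine[OF env near km kb])
  also have "\<dots> \<le> (LBINT t. C * (indicator {0..1} t * (?\<phi> t - b t)\<^sup>2))"
  proof (rule integral_mono)
    show "integrable lborel ?q" by (rule integrable_mart_variance[OF env near km kb])
    show "integrable lborel (\<lambda>t. C * (indicator {0..1} t * (?\<phi> t - b t)\<^sup>2))" using b(2) by (intro integrable_mult_right)
    fix t
    show "?q t \<le> C * (indicator {0..1} t * (?\<phi> t - b t)\<^sup>2)"
    proof (cases "t \<in> {0..1}")
      case True
      have h: "haz01 \<eta> t = \<eta> t" "0 < \<eta> t" "m \<le> \<eta> t" using True smooth(2) m by (auto simp: haz01_def)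
      have eq: "e t - dir b t = (?\<phi> t - b t) / \<eta> t" using True h by (simp add: dir_def field_simps)
      have "(e t - dir b t)\<^sup>2 \<le> (?\<phi> t - b t)\<^sup>2 / m\<^sup>2"
        unfolding eq power_divide by (rule frac_le) (use h m(1) power_mono[of m "\<eta> t" 2] in auto)
      moreover have "s_fun R 0 \<theta> t \<le> V" using s_fun_bound[OF env near, of 0 t] unfolding V_def by simp
      ultimately have "(e t - dir b t)\<^sup>2 * s_fun R 0 \<theta> t * haz01 \<eta> t \<le> (?\<phi> t - b t)\<^sup>2 / m\<^sup>2 * V * K"
        using s0[OF True] c h_le[of t] h_nonneg[of t] V m(1) by (intro mult_mono) auto
      also have "\<dots> = C * (?\<phi> t - b t)\<^sup>2" by (simp add: C_def)
      finally show ?thesis using True by simp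
    qed (simp add: haz01_def)
  qed
  also have "\<dots> = C * (LBINT t. indicator {0..1} t * (?\<phi> t - b t)\<^sup>2)" by (rule integral_mult_right_zero)
  also have "\<dots> \<le> C * (\<epsilon> / (C + 1))" using b(3) C by (intro mult_left_mono) auto
  also have "\<dots> < \<epsilon>" using C \<epsilon> by (simp add: field_simps)
  finally have "(LINT x|R. (mart (\<lambda>t w. 0 * w + e t) x - score_\<eta> \<theta> \<eta> b x)\<^sup>2) < \<epsilon>" .
  moreover have "L2 R (score_\<eta> \<theta> \<eta> b)"
    using L2_mart[OF g M, of 0] unfolding score_\<eta>_eq[OF b(1), abs_def] .
  ultimately show "\<exists>a\<in>{score_\<eta> \<theta> \<eta> b |b. C1_01 b}. L2 R a \<and> (LINT x|R. (mart (\<lambda>t w. 0 * w + e t) x - a x)\<^sup>2) < \<epsilon>"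
    using b(1) by blast
qed

lemma score_minus_projection: "AE x in R. score_\<theta> \<theta> \<eta> x - mart (\<lambda>t w. 0 * w + e t) x = eff x"
  using score_\<theta>_mart
proof eventually_elim
  case (elim x)
  then show ?case using mart_diff[OF zero_g e_measurable e_le, of 1 x 0] by simp
qed

lemma is_efficient_score:
  assumes P: "P \<theta> \<eta> = R"
  shows "is_efficient_score P \<theta> \<eta> (cox_efficient_score R \<theta> \<eta>)"
  unfolding is_efficient_score_def P
proof (intro conjI exI)
  show "cox_efficient_score R \<theta> \<eta> \<in> borel_measurable R"
    unfolding efficient_score_eq[abs_def] by (rule mart_affine_measurable) measurable
  show "AE x in R. cox_efficient_score R \<theta> \<eta> x = score_\<theta> \<theta> \<eta> x - mart (\<lambda>t w. 0 * w + e t) x"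
    using score_minus_projection unfolding efficient_score_eq by eventually_elim (rule sym)
  show "L2_projection R {score_\<eta> \<theta> \<eta> b |b. C1_01 b} (score_\<theta> \<theta> \<eta>) (mart (\<lambda>t w. 0 * w + e t))"
    unfolding L2_projection_def
  proof (intro conjI ballI L2_score_\<theta> e_in_closure)
    fix k assume k: "k \<in> L2_closure R {score_\<eta> \<theta> \<eta> b |b. C1_01 b}"
    have km: "k \<in> borel_measurable R" using k by (simp add: L2_closure_def L2_def)
    have em: "eff \<in> borel_measurable R" by (rule mart_affine_measurable[OF neg_e(1)])
    have "(LINT x|R. (score_\<theta> \<theta> \<eta> x - mart (\<lambda>t w. 0 * w + e t) x) * k x) = (LINT x|R. eff x * k x)"
    proof (rule integral_cong_AE)
      show "(\<lambda>x. (score_\<theta> \<theta> \<eta> x - mart (\<lambda>t w. 0 * w + e t) x) * k x) \<in> borel_measurable R"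
        using score_\<theta>_measurable mart_affine_measurable[OF e_measurable, of 0] km
        by (intro borel_measurable_times borel_measurable_diff)
      show "AE x in R. (score_\<theta> \<theta> \<eta> x - mart (\<lambda>t w. 0 * w + e t) x) * k x = eff x * k x"
        using score_minus_projection by eventually_elim (simp only:)
    qed (use em km in \<open>rule borel_measurable_times\<close>)
    also have "\<dots> = 0"
    proof (rule orthogonal_L2_closure[OF em integrable_mart_square[OF env near neg_e] _ k])
      fix a assume "a \<in> {score_\<eta> \<theta> \<eta> b |b. C1_01 b}"
      then obtain b where b: "C1_01 b" "a = score_\<eta> \<theta> \<eta> b" by blast
      show "(LINT x|R. eff x * a x) = 0"
        using eff_orthogonal[OF b(1)] by (simp only: b(2) score_\<eta>_eq[OF b(1)])
    qed
    finally show "(LINT x|R. (score_\<theta> \<theta> \<eta> x - mart (\<lambda>t w. 0 * w + e t) x) * k x) = 0" .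
  qed
qed

lemma J_info_eq: "J_info R \<theta> \<eta> = (LBINT t. (s_fun R 2 \<theta> t - (s_fun R 1 \<theta> t)\<^sup>2 / s_fun R 0 \<theta> t) * haz01 \<eta> t)"
  unfolding J_info_def set_lebesgue_integral_def
proof (intro Bochner_Integration.integral_cong refl)
  fix t :: real
  show "indicator {0..1} t *\<^sub>R (v_fun R \<theta> t * s_fun R 0 \<theta> t * \<eta> t) = (s_fun R 2 \<theta> t - (s_fun R 1 \<theta> t)\<^sup>2 / s_fun R 0 \<theta> t) * haz01 \<eta> t"
  proof (cases "t \<in> {0..1}")
    case True
    then have "s_fun R 0 \<theta> t \<noteq> 0" using s0[OF True] c by linarith
    then show ?thesis using True by (simp add: v_fun_def haz01_def field_simps power2_eq_square)
  qed (simp add: haz01_def)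
qed

lemma variance_efficient_score: "(LINT x|R. (cox_efficient_score R \<theta> \<eta> x - (LINT y|R. cox_efficient_score R \<theta> \<eta> y))\<^sup>2) = J_info R \<theta> \<eta>"
proof -
  have z: "(LINT x|R. eff x) = 0"
  proof (rule integral_mart)
    show "(\<lambda>z. 1 * snd z + - e (fst z)) \<in> borel_measurable (borel \<Otimes>\<^sub>M borel)" by measurable
    show "\<bar>1 * w + - e t\<bar> \<le> (1 + w\<^sup>2) + E" for t w
    proof -
      have "\<bar>w\<bar> \<le> 1 + w\<^sup>2" using sum_squares_bound[of 1 "\<bar>w\<bar>"] zero_le_power2[of w] by simp
      then show ?thesis using e_le[of t] by linarith
    qed
    show "integrable R (\<lambda>x. (1 + (obs_W x)\<^sup>2) + E)" using W2 by simp
  qed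
  have "(LINT x|R. (eff x)\<^sup>2) = (LBINT t. (1\<^sup>2 * s_fun R 2 \<theta> t + 2 * 1 * - e t * s_fun R 1 \<theta> t + (- e t)\<^sup>2 * s_fun R 0 \<theta> t) * haz01 \<eta> t)"
    by (rule integral_mart_square_affine[OF env near neg_e])
  also have "\<dots> = J_info R \<theta> \<eta>"
    unfolding J_info_eq
  proof (intro Bochner_Integration.integral_cong refl)
    fix t
    show "(1\<^sup>2 * s_fun R 2 \<theta> t + 2 * 1 * - e t * s_fun R 1 \<theta> t + (- e t)\<^sup>2 * s_fun R 0 \<theta> t) * haz01 \<eta> t =
      (s_fun R 2 \<theta> t - (s_fun R 1 \<theta> t)\<^sup>2 / s_fun R 0 \<theta> t) * haz01 \<eta> t"
    proof (cases "t \<in> {0..1}")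
      case True
      then have "s_fun R 0 \<theta> t \<noteq> 0" using s0[OF True] c by linarith
      then show ?thesis using True by (simp add: e_def field_simps power2_eq_square)
    qed (simp add: haz01_def)
  qed
  finally show ?thesis unfolding efficient_score_eq z by (simp only: diff_zero)
qed

end

section \<open>The Cox model\<close>

locale cox_model =
  fixes \<Theta> U\<theta> :: "real set" and U\<eta> :: "(real \<Rightarrow> real) set"
    and Q :: "real measure"
    and F :: "real \<Rightarrow> (real \<Rightarrow> real) \<Rightarrow> real \<Rightarrow> real measure"
    and G :: "real \<Rightarrow> real measure"
    and P :: "real \<Rightarrow> (real \<Rightarrow> real) \<Rightarrow> obs measure"
    and \<theta>\<^sub>0 :: real and \<eta>\<^sub>0 :: "real \<Rightarrow> real"
    and P\<^sub>0 :: "obs measure" and J :: real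
    and \<theta>hat :: "nat \<Rightarrow> (nat \<Rightarrow> obs) \<Rightarrow> real"
  assumes model: "cox_ingredients \<Theta> Q F G"
    and P: "P = cox_law Q F G"
    and P\<^sub>0: "P\<^sub>0 = P \<theta>\<^sub>0 \<eta>\<^sub>0"
    and J: "J = J_info P\<^sub>0 \<theta>\<^sub>0 \<eta>\<^sub>0"
    and \<theta>\<^sub>0: "\<theta>\<^sub>0 \<in> interior \<Theta>"
    and U\<theta>: "\<theta>\<^sub>0 \<in> interior U\<theta>" "U\<theta> \<subseteq> \<Theta>"
    and U\<eta>: "hazard_neighbourhood \<eta>\<^sub>0 U\<eta>"
    and cond1: "\<forall>\<^sub>F \<theta> in nhds \<theta>\<^sub>0. \<forall>k\<le>3. integrable Q (\<lambda>w. w ^ k * exp (\<theta> * w))"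
      "\<exists>\<delta>>0. integrable Q (\<lambda>w. \<bar>w\<bar> powr (2 + \<delta>))"
    and cond2: "smooth_hazard \<eta>\<^sub>0"
    and cond4: "\<forall>k\<le>3. continuous_uniformly_in_t U\<theta> U\<eta> (\<lambda>\<theta> \<eta> t. s_fun (P \<theta> \<eta>) k \<theta> t)"
      "\<forall>k\<le>3. \<exists>K. \<forall>\<theta>\<in>U\<theta>. \<forall>\<eta>\<in>U\<eta>. \<forall>t\<in>{0..1}. \<bar>s_fun (P \<theta> \<eta>) k \<theta> t\<bar> \<le> K"
      "\<exists>c>0. \<forall>\<theta>\<in>U\<theta>. \<forall>\<eta>\<in>U\<eta>. \<forall>t\<in>{0..1}. c \<le> s_fun (P \<theta> \<eta>) 0 \<theta> t"
      "0 < J"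
    and est: "cox_estimator \<Theta> \<theta>hat"
begin

lemma \<theta>\<^sub>0_mem: "\<theta>\<^sub>0 \<in> U\<theta>" "\<theta>\<^sub>0 \<in> \<Theta>"
  using U\<theta> interior_subset by blast+

lemma \<eta>\<^sub>0_continuous: "continuous_on {0..1} \<eta>\<^sub>0" and \<eta>\<^sub>0_pos: "t \<in> {0..1} \<Longrightarrow> 0 < \<eta>\<^sub>0 t"
  using cond2 C1_01_continuous by (auto simp: smooth_hazard_def)

lemma continuous_hazard:
  assumes "continuous_on {0..1} \<eta>" "\<And>t. t \<in> {0..1} \<Longrightarrow> 0 < \<eta> t"
  shows "bounded_hazard \<eta>"
proof -
  have "\<eta> \<in> borel_measurable (restrict_space borel {0..1})"
    using assms(1) by (rule borel_measurable_continuous_on_restrict)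
  moreover obtain M where "0 < M" "\<And>t. t \<in> {0..1} \<Longrightarrow> \<bar>\<eta> t\<bar> \<le> M"
    using continuous_01_bounded[OF assms(1)] by metis
  then have "\<forall>t\<in>{0..1}. \<eta> t \<le> M" using abs_le_D1 by blast
  ultimately show ?thesis using assms(2) unfolding bounded_hazard_def by blast
qed

lemma \<eta>\<^sub>0_bounded_hazard: "bounded_hazard \<eta>\<^sub>0"
  by (rule continuous_hazard[OF \<eta>\<^sub>0_continuous \<eta>\<^sub>0_pos])

lemma \<eta>\<^sub>0_mem: "\<eta>\<^sub>0 \<in> U\<eta>"
  using U\<eta> \<eta>\<^sub>0_bounded_hazard unfolding hazard_neighbourhood_def by auto

lemma U\<eta>_bounded: "\<eta> \<in> U\<eta> \<Longrightarrow> bounded_hazard \<eta>"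
  using U\<eta> unfolding hazard_neighbourhood_def by blast

lemma Q_space: "prob_space Q" "sets Q = sets borel"
  using model by (auto simp: cox_ingredients_def)

lemma W_square_integrable: "integrable Q (\<lambda>w. w\<^sup>2)"
proof -
  interpret Q: prob_space Q by (rule Q_space)
  obtain \<delta> where \<delta>: "0 < \<delta>" "integrable Q (\<lambda>w. \<bar>w\<bar> powr (2 + \<delta>))" using cond1(2) by blast
  have "w\<^sup>2 \<le> 1 + \<bar>w\<bar> powr (2 + \<delta>)" for w :: real
  proof (cases "1 \<le> \<bar>w\<bar>")
    case True
    have "w\<^sup>2 = \<bar>w\<bar> powr 2" using True by simp
    also have "\<dots> \<le> \<bar>w\<bar> powr (2 + \<delta>)" using True \<delta>(1) by (intro powr_mono) auto
    finally show ?thesis by simp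
  next
    case False
    then have "w\<^sup>2 \<le> 1" using power_mono[of "\<bar>w\<bar>" 1 2] by simp
    moreover have "0 \<le> \<bar>w\<bar> powr (2 + \<delta>)" by simp
    ultimately show ?thesis by linarith
  qed
  note * = this
  show ?thesis
  proof (rule Bochner_Integration.integrable_bound[where f="\<lambda>w. 1 + \<bar>w\<bar> powr (2 + \<delta>)"])
    show "integrable Q (\<lambda>w. 1 + \<bar>w\<bar> powr (2 + \<delta>))" using \<delta>(2) by simp
    have "(\<lambda>w::real. w\<^sup>2) \<in> borel_measurable borel" by measurable
    then show "(\<lambda>w. w\<^sup>2) \<in> borel_measurable Q" using measurable_cong_sets[OF Q_space(2) refl] by blast
    show "AE w in Q. norm (w\<^sup>2) \<le> norm (1 + \<bar>w\<bar> powr (2 + \<delta>))"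
    proof (rule AE_I2)
      fix w :: real
      have "norm (w\<^sup>2) = w\<^sup>2" by simp
      then show "norm (w\<^sup>2) \<le> norm (1 + \<bar>w\<bar> powr (2 + \<delta>))"
        using *[of w] abs_ge_self[of "1 + \<bar>w\<bar> powr (2 + \<delta>)"] unfolding real_norm_def by linarith
    qed
  qed
qed

lemma envelope_radius:
  obtains d where "0 < d" "integrable Q (envelope \<theta>\<^sub>0 d)"
proof -
  obtain r where r: "0 < r" "\<And>\<theta>. dist \<theta> \<theta>\<^sub>0 < r \<Longrightarrow> \<forall>k\<le>3. integrable Q (\<lambda>w. w ^ k * exp (\<theta> * w))"
    using cond1(1) unfolding eventually_nhds_metric by blast
  have i: "integrable Q (\<lambda>w. w ^ k * exp (\<theta> * w))" if "\<bar>\<theta> - \<theta>\<^sub>0\<bar> < r" "k \<le> 3" for k \<theta>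
    using r(2)[of \<theta>] that by (simp add: dist_real_def)
  \<comment> \<open>Half the radius keeps both end points of the interval inside the neighbourhood
    where the exponential moments exist.\<close>
  have h: "0 < r / 2" "\<bar>\<theta>\<^sub>0 + r / 2 - \<theta>\<^sub>0\<bar> < r" "\<bar>\<theta>\<^sub>0 - r / 2 - \<theta>\<^sub>0\<bar> < r" using r(1) by auto
  have "envelope \<theta>\<^sub>0 (r / 2) = (\<lambda>w. w ^ 0 * exp ((\<theta>\<^sub>0 + r / 2) * w) + w ^ 0 * exp ((\<theta>\<^sub>0 - r / 2) * w)
    + w ^ 2 * exp ((\<theta>\<^sub>0 + r / 2) * w) + w ^ 2 * exp ((\<theta>\<^sub>0 - r / 2) * w))"
    by (simp add: fun_eq_iff envelope_def algebra_simps)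
  moreover have "integrable Q (\<lambda>w. w ^ 0 * exp ((\<theta>\<^sub>0 + r / 2) * w) + w ^ 0 * exp ((\<theta>\<^sub>0 - r / 2) * w)
    + w ^ 2 * exp ((\<theta>\<^sub>0 + r / 2) * w) + w ^ 2 * exp ((\<theta>\<^sub>0 - r / 2) * w))"
    by (intro Bochner_Integration.integrable_add i h) auto
  ultimately show thesis using that[OF h(1)] by simp
qed

text \<open>Continuity of the \<open>s_fun\<close> uniformly in time, at the point
  \<open>(\<theta>\<^sub>0, \<eta>\<^sub>0)\<close>, turns convergence of the parameters into
  \<open>s_conv\<close>. The constants \<open>B\<close> and \<open>c\<close> are the bounds at this
  limit point, which lies in both neighbourhoods.\<close>

lemma cox_sequence_local:
  assumes th_mem: "\<And>n. th n \<in> U\<theta>" and et_mem: "\<And>n. et n \<in> U\<eta>"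
    and th_near: "\<And>n. \<bar>th n - \<theta>\<^sub>0\<bar> \<le> d" and env: "integrable Q (envelope \<theta>\<^sub>0 d)"
    and K: "\<And>n t. t \<in> {0..1} \<Longrightarrow> et n t \<le> K" "\<And>t. t \<in> {0..1} \<Longrightarrow> \<eta>\<^sub>0 t \<le> K"
    and th_lim: "th \<longlonglongrightarrow> \<theta>\<^sub>0" and et_lim: "\<And>\<epsilon>. 0 < \<epsilon> \<Longrightarrow> \<forall>\<^sub>F n in sequentially. \<forall>t\<in>{0..1}. \<bar>et n t - \<eta>\<^sub>0 t\<bar> < \<epsilon>"
  obtains c B where "cox_sequence Q (\<lambda>n. P (th n) (et n)) th (\<lambda>n. haz01 (et n)) K \<theta>\<^sub>0 d (haz01 \<eta>\<^sub>0) (\<lambda>k. s_fun P\<^sub>0 k \<theta>\<^sub>0) c B"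
proof -
  obtain c where c: "0 < c" "\<forall>\<theta>\<in>U\<theta>. \<forall>\<eta>\<in>U\<eta>. \<forall>t\<in>{0..1}. c \<le> s_fun (P \<theta> \<eta>) 0 \<theta> t" using cond4(3) by blast
  have "\<exists>M. \<forall>t\<in>{0..1}. \<bar>s_fun P\<^sub>0 k \<theta>\<^sub>0 t\<bar> \<le> M" if "k \<le> 3" for k
    using cond4(2)[rule_format, OF that] \<theta>\<^sub>0_mem \<eta>\<^sub>0_mem unfolding P\<^sub>0 by blast
  then obtain M where M: "\<And>k t. k \<le> 3 \<Longrightarrow> t \<in> {0..1} \<Longrightarrow> \<bar>s_fun P\<^sub>0 k \<theta>\<^sub>0 t\<bar> \<le> M k" by metis
  define B where "B = max (M 0) (max (M 1) (M 2))"
  have law: "counting_law (P \<theta> \<eta>) \<theta> (haz01 \<eta>) K" if "\<theta> \<in> U\<theta>" "\<eta> \<in> U\<eta>" "\<And>t. t \<in> {0..1} \<Longrightarrow> \<eta> t \<le> K" for \<theta> \<eta>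
    unfolding P using that U\<theta>(2) U\<eta>_bounded by (intro counting_law_cox_law[OF model]) auto
  interpret L0: counting_law P\<^sub>0 \<theta>\<^sub>0 "haz01 \<eta>\<^sub>0" K
    unfolding P\<^sub>0 by (rule law[OF \<theta>\<^sub>0_mem(1) \<eta>\<^sub>0_mem K(2)])
  have W: "distr (P \<theta> \<eta>) borel obs_W = Q" if "\<theta> \<in> U\<theta>" "\<eta> \<in> U\<eta>" for \<theta> \<eta>
    unfolding P using that U\<theta>(2) U\<eta>_bounded by (intro distr_cox_law_W[OF model]) auto
  have env0: "integrable P\<^sub>0 (\<lambda>x. envelope \<theta>\<^sub>0 d (obs_W x))"
  proof -
    have "obs_W \<in> P\<^sub>0 \<rightarrow>\<^sub>M borel" by (rule L0.measurable_RI) measurable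
    from integrable_distr[OF this] show ?thesis using env W[OF \<theta>\<^sub>0_mem(1) \<eta>\<^sub>0_mem] unfolding P\<^sub>0 by simp
  qed
  have d0: "\<bar>\<theta>\<^sub>0 - \<theta>\<^sub>0\<bar> \<le> d" using order_trans[OF abs_ge_zero th_near] by simp
  have "cox_sequence Q (\<lambda>n. P (th n) (et n)) th (\<lambda>n. haz01 (et n)) K \<theta>\<^sub>0 d (haz01 \<eta>\<^sub>0) (\<lambda>k. s_fun P\<^sub>0 k \<theta>\<^sub>0) c B"
  proof (rule cox_sequence.intro)
    show "counting_law (P (th n) (et n)) (th n) (haz01 (et n)) K" for n
      by (rule law[OF th_mem et_mem K(1)])
    show "distr (P (th n) (et n)) borel obs_W = Q" for n by (rule W[OF th_mem et_mem])
    show "\<bar>th n - \<theta>\<^sub>0\<bar> \<le> d" for n by (rule th_near)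
    show "integrable Q (envelope \<theta>\<^sub>0 d)" by (rule env)
    show "integrable Q power2" by (rule W_square_integrable)
    show "haz01 \<eta>\<^sub>0 \<in> borel_measurable borel" by (rule L0.h_measurable)
    show "0 \<le> haz01 \<eta>\<^sub>0 t" "haz01 \<eta>\<^sub>0 t \<le> K" for t by (rule L0.h_nonneg, rule L0.h_le)
    show "haz01 \<eta>\<^sub>0 t = 0" if "t \<notin> {0..1}" for t using that by (rule L0.h_outside)
    show "\<forall>\<^sub>F n in sequentially. \<forall>t. \<bar>haz01 (et n) t - haz01 \<eta>\<^sub>0 t\<bar> \<le> \<epsilon>" if "0 < \<epsilon>" for \<epsilon>
      using et_lim[OF that]
    proof eventually_elim
      case (elim n)
      show ?case
      proof
        fix t
        show "\<bar>haz01 (et n) t - haz01 \<eta>\<^sub>0 t\<bar> \<le> \<epsilon>"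
          using elim that by (cases "t \<in> {0..1}") (auto simp: haz01_def intro: less_imp_le)
      qed
    qed
    show "s_fun P\<^sub>0 k \<theta>\<^sub>0 \<in> borel_measurable borel" for k
      using L0.s_fun_measurable[OF env0 d0] by simp
    show "\<forall>\<^sub>F n in sequentially. \<forall>t\<in>{0..1}. \<bar>s_fun (P (th n) (et n)) k (th n) t - s_fun P\<^sub>0 k \<theta>\<^sub>0 t\<bar> \<le> \<epsilon>"
      if k: "k \<le> 2" and \<epsilon>: "0 < \<epsilon>" for k \<epsilon>
    proof -
      have "k \<le> 3" using k by simp
      then have cu: "continuous_uniformly_in_t U\<theta> U\<eta> (\<lambda>\<theta> \<eta> t. s_fun (P \<theta> \<eta>) k \<theta> t)" using cond4(1) by blast
      obtain \<rho> where \<rho>: "0 < \<rho>" and \<rho>': "\<And>\<theta>' \<eta>' t. \<theta>' \<in> U\<theta> \<Longrightarrow> \<eta>' \<in> U\<eta> \<Longrightarrow> \<bar>\<theta>' - \<theta>\<^sub>0\<bar> < \<rho> \<Longrightarrow> \<forall>t\<in>{0..1}. \<bar>\<eta>' t - \<eta>\<^sub>0 t\<bar> < \<rho> \<Longrightarrow>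
          t \<in> {0..1} \<Longrightarrow> \<bar>s_fun (P \<theta>' \<eta>') k \<theta>' t - s_fun P\<^sub>0 k \<theta>\<^sub>0 t\<bar> < \<epsilon>"
        using cu[unfolded continuous_uniformly_in_t_def, rule_format, OF \<theta>\<^sub>0_mem(1) \<eta>\<^sub>0_mem \<epsilon>] unfolding P\<^sub>0 by metis
      have "\<forall>\<^sub>F n in sequentially. \<bar>th n - \<theta>\<^sub>0\<bar> < \<rho>" using tendstoD[OF th_lim \<rho>] by (simp add: dist_real_def)
      then show ?thesis using et_lim[OF \<rho>]
      proof eventually_elim
        case (elim n)
        show ?case using \<rho>'[OF th_mem et_mem elim] by (auto intro: less_imp_le)
      qed
    qed
    show "\<bar>s_fun P\<^sub>0 k \<theta>\<^sub>0 t\<bar> \<le> B" if "k \<le> 2" "t \<in> {0..1}" for k t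
    proof -
      have "k = 0 \<or> k = 1 \<or> k = 2" using that by auto
      then have "M k \<le> B" by (auto simp: B_def)
      moreover have "\<bar>s_fun P\<^sub>0 k \<theta>\<^sub>0 t\<bar> \<le> M k" using that by (intro M) auto
      ultimately show ?thesis by linarith
    qed
    show "0 < c" by (rule c)
    show "c \<le> s_fun P\<^sub>0 0 \<theta>\<^sub>0 t" if "t \<in> {0..1}" for t
      using c(2) \<theta>\<^sub>0_mem(1) \<eta>\<^sub>0_mem that unfolding P\<^sub>0 by blast
  qed
  then show thesis by (rule that)
qed

lemma efficient: 
  obtains K d c where "cox_law_efficient P\<^sub>0 \<theta>\<^sub>0 \<eta>\<^sub>0 K d c"
proof -
  obtain M where M: "0 < M" "\<And>t. t \<in> {0..1} \<Longrightarrow> \<bar>\<eta>\<^sub>0 t\<bar> \<le> M" using continuous_01_bounded[OF \<eta>\<^sub>0_continuous] by metis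
  obtain d where d: "0 < d" "integrable Q (envelope \<theta>\<^sub>0 d)" by (rule envelope_radius)
  obtain c where c: "0 < c" "\<forall>\<theta>\<in>U\<theta>. \<forall>\<eta>\<in>U\<eta>. \<forall>t\<in>{0..1}. c \<le> s_fun (P \<theta> \<eta>) 0 \<theta> t" using cond4(3) by blast
  interpret L0: counting_law P\<^sub>0 \<theta>\<^sub>0 "haz01 \<eta>\<^sub>0" M
    unfolding P\<^sub>0 P using M(2) by (intro counting_law_cox_law[OF model \<theta>\<^sub>0_mem(2) \<eta>\<^sub>0_bounded_hazard]) (auto dest: abs_le_D1)
  have Wm: "obs_W \<in> P\<^sub>0 \<rightarrow>\<^sub>M borel" by (rule L0.measurable_RI) measurable
  have W: "distr P\<^sub>0 borel obs_W = Q"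
    unfolding P\<^sub>0 P by (rule distr_cox_law_W[OF model \<theta>\<^sub>0_mem(2) \<eta>\<^sub>0_bounded_hazard])
  have "cox_law_efficient P\<^sub>0 \<theta>\<^sub>0 \<eta>\<^sub>0 M d c"
  proof
    show "integrable P\<^sub>0 (\<lambda>x. envelope \<theta>\<^sub>0 d (obs_W x))" using integrable_distr[OF Wm] d(2) W by simp
    show "0 \<le> d" using d(1) by simp
    show "AE x in P\<^sub>0. obs_D x \<longrightarrow> 0 \<le> obs_T x"
      unfolding P\<^sub>0 P by (rule AE_cox_law_nonneg[OF model \<theta>\<^sub>0_mem(2) \<eta>\<^sub>0_bounded_hazard])
    show "integrable P\<^sub>0 (\<lambda>x. (obs_W x)\<^sup>2)"
    proof -
      have "integrable (distr P\<^sub>0 borel obs_W) (\<lambda>w. w\<^sup>2)" unfolding W by (rule W_square_integrable)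
      from integrable_distr[OF Wm this] show ?thesis .
    qed
    show "smooth_hazard \<eta>\<^sub>0" by (rule cond2)
    show "0 < c" by (rule c)
    show "c \<le> s_fun P\<^sub>0 0 \<theta>\<^sub>0 t" if "t \<in> {0..1}" for t
      using c(2) \<theta>\<^sub>0_mem(1) \<eta>\<^sub>0_mem that unfolding P\<^sub>0 by blast
  qed
  then show thesis by (rule that)
qed

text \<open>The limiting information depends on the limit functions only, so every sequence of
  parameters that tends to the truth yields the same J.\<close>

lemma J_sequence:
  assumes "cox_sequence Q R th hz K \<theta>\<^sub>0 d (haz01 \<eta>\<^sub>0) (\<lambda>k. s_fun P\<^sub>0 k \<theta>\<^sub>0) c B"
  shows "cox_sequence.J (haz01 \<eta>\<^sub>0) (\<lambda>k. s_fun P\<^sub>0 k \<theta>\<^sub>0) = J"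
proof -
  interpret S: cox_sequence Q R th hz K \<theta>\<^sub>0 d "haz01 \<eta>\<^sub>0" "\<lambda>k. s_fun P\<^sub>0 k \<theta>\<^sub>0" c B by fact
  obtain K' d' c' where "cox_law_efficient P\<^sub>0 \<theta>\<^sub>0 \<eta>\<^sub>0 K' d' c'" by (rule efficient)
  then interpret E: cox_law_efficient P\<^sub>0 \<theta>\<^sub>0 \<eta>\<^sub>0 K' d' c' .
  show ?thesis unfolding J E.J_info_eq S.J_def S.vs_def ..
qed

text \<open>The constant sequence of parameters: the centring \<open>e\<close> is then the ratio at
  the true law itself, and the influence function is the efficient score.\<close>

lemma estimator_asymptotically_linear:
  "vanishes_in_prob (\<lambda>n. iid n P\<^sub>0)
     (\<lambda>n x. ereal \<bar>sqrt n * (\<theta>hat n x - \<theta>\<^sub>0) - 1 / sqrt n * (\<Sum>i<n. 1 / J * cox_efficient_score P\<^sub>0 \<theta>\<^sub>0 \<eta>\<^sub>0 (x i))\<bar>)"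
proof -
  obtain M where M: "0 < M" "\<And>t. t \<in> {0..1} \<Longrightarrow> \<bar>\<eta>\<^sub>0 t\<bar> \<le> M" using continuous_01_bounded[OF \<eta>\<^sub>0_continuous] by metis
  then have M': "\<eta>\<^sub>0 t \<le> M" if "t \<in> {0..1}" for t using abs_le_D1 that by blast
  obtain d where d: "0 < d" "integrable Q (envelope \<theta>\<^sub>0 d)" by (rule envelope_radius)
  obtain c B where seq: "cox_sequence Q (\<lambda>n. P \<theta>\<^sub>0 \<eta>\<^sub>0) (\<lambda>n. \<theta>\<^sub>0) (\<lambda>n. haz01 \<eta>\<^sub>0) M \<theta>\<^sub>0 d (haz01 \<eta>\<^sub>0) (\<lambda>k. s_fun P\<^sub>0 k \<theta>\<^sub>0) c B"
    by (rule cox_sequence_local[of "\<lambda>n. \<theta>\<^sub>0" "\<lambda>n. \<eta>\<^sub>0" d M]) (use \<theta>\<^sub>0_mem \<eta>\<^sub>0_mem d M' in auto)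
  interpret S: cox_sequence Q "\<lambda>n. P \<theta>\<^sub>0 \<eta>\<^sub>0" "\<lambda>n. \<theta>\<^sub>0" "\<lambda>n. haz01 \<eta>\<^sub>0" M \<theta>\<^sub>0 d "haz01 \<eta>\<^sub>0" "\<lambda>k. s_fun P\<^sub>0 k \<theta>\<^sub>0" c B
    by (rule seq)
  obtain K' d' c' where "cox_law_efficient P\<^sub>0 \<theta>\<^sub>0 \<eta>\<^sub>0 K' d' c'" by (rule efficient)
  then interpret E: cox_law_efficient P\<^sub>0 \<theta>\<^sub>0 \<eta>\<^sub>0 K' d' c' .
  have e: "S.e = E.e" by (simp add: fun_eq_iff S.e_def E.e_def)
  have SJ: "S.J = J" by (rule J_sequence[OF seq])
  have lin: "S.lin n x / S.J = 1 / sqrt n * (\<Sum>i<n. 1 / J * cox_efficient_score P\<^sub>0 \<theta>\<^sub>0 \<eta>\<^sub>0 (x i))" for n x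
    unfolding S.lin_def SJ E.efficient_score_eq e sum_distrib_left[symmetric] by simp
  have small: "S.small (\<lambda>n x. sqrt n * (\<theta>hat n x - \<theta>\<^sub>0) - S.lin n x / S.J)"
    by (rule S.estimator_linear[OF _ tendsto_const \<theta>\<^sub>0 est]) (use SJ cond4(4) in simp)
  show ?thesis
    unfolding vanishes_in_prob_def
  proof (intro allI impI)
    fix \<epsilon> :: real assume \<epsilon>: "0 < \<epsilon>"
    let ?Z = "\<lambda>n x. sqrt n * (\<theta>hat n x - \<theta>\<^sub>0) - S.lin n x / S.J"
    \<comment> \<open>The event is measurable, so its outer measure is its measure.\<close>
    have eq: "outer_measure_of (iid n P\<^sub>0) {x \<in> space (iid n P\<^sub>0). ereal \<epsilon> < ereal \<bar>sqrt n * (\<theta>hat n x - \<theta>\<^sub>0) - 1 / sqrt n * (\<Sum>i<n. 1 / J * cox_efficient_score P\<^sub>0 \<theta>\<^sub>0 \<eta>\<^sub>0 (x i))\<bar>}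
      = ennreal (measure (iid n P\<^sub>0) {x \<in> space (iid n P\<^sub>0). \<epsilon> < \<bar>?Z n x\<bar>})" for n
    proof -
      interpret N: prob_space "iid n P\<^sub>0" using S.prob_space_N[of n] by (simp only: P\<^sub>0)
      have Zm: "?Z n \<in> borel_measurable (iid n P\<^sub>0)"
        using S.measurable_NI[OF S.smallD(2)[OF small], of n] by (simp only: P\<^sub>0)
      have "{x \<in> space (iid n P\<^sub>0). \<epsilon> < \<bar>?Z n x\<bar>} \<in> sets (iid n P\<^sub>0)"
        using Zm by measurable
      then show ?thesis unfolding lin[symmetric] ereal_less_eq less_ereal.simps
        by (simp only: outer_measure_of_eq N.emeasure_eq_measure)
    qed
    have "(\<lambda>n. measure (iid n P\<^sub>0) {x \<in> space (iid n P\<^sub>0). \<epsilon> < \<bar>?Z n x\<bar>}) \<longlonglongrightarrow> 0"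
    proof (rule tendstoI)
      fix \<delta> :: real assume "0 < \<delta>"
      then have "0 < \<delta> / 2" by simp
      from S.smallD(1)[OF small \<epsilon> this]
      show "\<forall>\<^sub>F n in sequentially. dist (measure (iid n P\<^sub>0) {x \<in> space (iid n P\<^sub>0). \<epsilon> < \<bar>?Z n x\<bar>}) 0 < \<delta>"
        unfolding P\<^sub>0[symmetric]
      proof eventually_elim
        case (elim n)
        then show ?case using \<open>0 < \<delta>\<close> measure_nonneg[of "iid n P\<^sub>0" "{x \<in> space (iid n P\<^sub>0). \<epsilon> < \<bar>?Z n x\<bar>}"]
          unfolding dist_real_def by linarith
      qed
    qed
    then show "(\<lambda>n. outer_measure_of (iid n P\<^sub>0) {x \<in> space (iid n P\<^sub>0). ereal \<epsilon> < ereal \<bar>sqrt n * (\<theta>hat n x - \<theta>\<^sub>0) - 1 / sqrt n * (\<Sum>i<n. 1 / J * cox_efficient_score P\<^sub>0 \<theta>\<^sub>0 \<eta>\<^sub>0 (x i))\<bar>}) \<longlonglongrightarrow> 0"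
      unfolding eq using tendsto_ennrealI by fastforce
  qed
qed

text \<open>The local path is taken as the sequence of parameters, and its law at n is the law of
  row n. Since b is bounded on [0,1], the hazards converge uniformly, and centring at the moving
  parameter gives the limit law at once.\<close>

lemma estimator_weak_conv:
  assumes b: "C1_01 b"
  shows "weak_conv_m (\<lambda>n. distr (iid n (P (\<theta>\<^sub>0 + \<tau> / sqrt n) (\<lambda>t. \<eta>\<^sub>0 t + b t / sqrt n))) borel
           (\<lambda>x. sqrt n * (\<theta>hat n x - \<theta>\<^sub>0 - \<tau> / sqrt n)))
         (density lborel (normal_density 0 (sqrt (1 / J))))"
proof -
  let ?th = "\<lambda>n :: nat. \<theta>\<^sub>0 + \<tau> / sqrt n" and ?et = "\<lambda>(n :: nat) t. \<eta>\<^sub>0 t + b t / sqrt n"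
  have bc: "continuous_on {0..1} b" by (rule C1_01_continuous[OF b])
  obtain M where M: "0 < M" "\<And>t. t \<in> {0..1} \<Longrightarrow> \<bar>\<eta>\<^sub>0 t\<bar> \<le> M" using continuous_01_bounded[OF \<eta>\<^sub>0_continuous] by metis
  obtain Mb where Mb: "0 < Mb" "\<And>t. t \<in> {0..1} \<Longrightarrow> \<bar>b t\<bar> \<le> Mb" using continuous_01_bounded[OF bc] by metis
  obtain m where m: "0 < m" "\<And>t. t \<in> {0..1} \<Longrightarrow> m \<le> \<eta>\<^sub>0 t" using continuous_01_pos[OF \<eta>\<^sub>0_continuous \<eta>\<^sub>0_pos] by metis
  obtain d where d: "0 < d" "integrable Q (envelope \<theta>\<^sub>0 d)" by (rule envelope_radius)
  obtain r where r: "0 < r" "\<And>\<eta>. bounded_hazard \<eta> \<Longrightarrow> \<forall>t\<in>{0..1}. \<bar>\<eta> t - \<eta>\<^sub>0 t\<bar> < r \<Longrightarrow> \<eta> \<in> U\<eta>"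
    using U\<eta> unfolding hazard_neighbourhood_def by blast
  have inv: "(\<lambda>n. a / sqrt (real n)) \<longlonglongrightarrow> 0" for a
    by (rule real_tendsto_divide_at_top[OF tendsto_const filterlim_compose[OF sqrt_at_top filterlim_real_sequentially]])
  have th_lim: "?th \<longlonglongrightarrow> \<theta>\<^sub>0" using tendsto_add[OF tendsto_const[of \<theta>\<^sub>0] inv[of \<tau>]] by simp
  have et_lim: "\<forall>\<^sub>F n in sequentially. \<forall>t\<in>{0..1}. \<bar>?et n t - \<eta>\<^sub>0 t\<bar> < \<epsilon>" if "0 < \<epsilon>" for \<epsilon>
  proof -
    have "\<forall>\<^sub>F n in sequentially. Mb / sqrt (real n) < \<epsilon>" using inv[of Mb] that by (intro order_tendstoD) auto
    then show ?thesis
    proof eventually_elim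
      case (elim n)
      show ?case
      proof
        fix t :: real assume "t \<in> {0..1}"
        then have "\<bar>b t\<bar> / sqrt n \<le> Mb / sqrt n" using Mb by (intro divide_right_mono) auto
        then show "\<bar>?et n t - \<eta>\<^sub>0 t\<bar> < \<epsilon>" using elim by (simp add: abs_divide)
      qed
    qed
  qed
  \<comment> \<open>For small n the path may leave the neighbourhoods. Eventually the hazards are
    within \<open>m\<close> of \<open>\<eta>\<^sub>0\<close>, hence positive, and within 1 of it,
    hence at most \<open>M + 1\<close>.\<close>
  define good where "good n \<longleftrightarrow> ?th n \<in> U\<theta> \<and> ?et n \<in> U\<eta> \<and> \<bar>?th n - \<theta>\<^sub>0\<bar> \<le> d \<and> (\<forall>t\<in>{0..1}. ?et n t \<le> M + 1)" for n
  have ev_good: "\<forall>\<^sub>F n in sequentially. good n"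
  proof -
    have "\<forall>\<^sub>F n in sequentially. ?th n \<in> interior U\<theta>"
      by (rule topological_tendstoD[OF th_lim open_interior U\<theta>(1)])
    moreover have "\<forall>\<^sub>F n in sequentially. \<bar>?th n - \<theta>\<^sub>0\<bar> < d" using tendstoD[OF th_lim d(1)] by (simp add: dist_real_def)
    ultimately show ?thesis using et_lim[OF r(1)] et_lim[OF m(1)] et_lim[OF zero_less_one]
    proof eventually_elim
      case (elim n)
      have "bounded_hazard (?et n)"
      proof (rule continuous_hazard)
        show "continuous_on {0..1} (?et n)" 
          unfolding divide_inverse using \<eta>\<^sub>0_continuous bc by (intro continuous_intros)
        show "0 < ?et n t" if "t \<in> {0..1}" for t
        proof -
          have "\<bar>?et n t - \<eta>\<^sub>0 t\<bar> < m" using elim(4) that by blast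
          then show ?thesis using m(2)[OF that] by linarith
        qed
      qed
      then have 1: "?et n \<in> U\<eta>" by (rule r(2)) (rule elim(3))
      have 2: "\<forall>t\<in>{0..1}. ?et n t \<le> M + 1"
      proof
        fix t :: real assume t: "t \<in> {0..1}"
        have "\<bar>?et n t - \<eta>\<^sub>0 t\<bar> < 1" using elim(5) t by blast
        then show "?et n t \<le> M + 1" using M(2)[OF t] by linarith
      qed
      show ?case unfolding good_def using 1 2 elim(1,2) interior_subset[of U\<theta>] by auto
    qed
  qed
  \<comment> \<open>The locale demands its bounds in every row. The finitely many bad indices get
    the true parameters instead, which leaves the limits unaffected.\<close>
  define th where "th n = (if good n then ?th n else \<theta>\<^sub>0)" for n
  define et where "et n = (if good n then ?et n else \<eta>\<^sub>0)" for n
  have th_eq: "\<forall>\<^sub>F n in sequentially. th n = ?th n" and et_eq: "\<forall>\<^sub>F n in sequentially. et n = ?et n"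
    using ev_good by (eventually_elim, simp add: th_def et_def)+
  have th_lim': "th \<longlonglongrightarrow> \<theta>\<^sub>0"
    using th_lim th_eq by (subst tendsto_cong[OF th_eq])
  have et_lim': "\<forall>\<^sub>F n in sequentially. \<forall>t\<in>{0..1}. \<bar>et n t - \<eta>\<^sub>0 t\<bar> < \<epsilon>" if "0 < \<epsilon>" for \<epsilon>
    using et_lim[OF that] et_eq by eventually_elim simp
  have \<eta>M: "\<eta>\<^sub>0 t \<le> M + 1" if "t \<in> {0..1}" for t using M(2)[OF that] by linarith
  obtain c B where seq: "cox_sequence Q (\<lambda>n. P (th n) (et n)) th (\<lambda>n. haz01 (et n)) (M + 1) \<theta>\<^sub>0 d (haz01 \<eta>\<^sub>0) (\<lambda>k. s_fun P\<^sub>0 k \<theta>\<^sub>0) c B"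
  proof (rule cox_sequence_local[of th et d "M + 1", OF _ _ _ d(2) _ \<eta>M th_lim' et_lim'])
    show "th n \<in> U\<theta>" "et n \<in> U\<eta>" "\<bar>th n - \<theta>\<^sub>0\<bar> \<le> d" for n
      using \<theta>\<^sub>0_mem \<eta>\<^sub>0_mem d(1) by (auto simp: th_def et_def good_def)
    show "et n t \<le> M + 1" if "t \<in> {0..1}" for n t
      using \<eta>M[OF that] that by (auto simp: et_def good_def)
  qed
  interpret S: cox_sequence Q "\<lambda>n. P (th n) (et n)" th "\<lambda>n. haz01 (et n)" "M + 1" \<theta>\<^sub>0 d "haz01 \<eta>\<^sub>0" "\<lambda>k. s_fun P\<^sub>0 k \<theta>\<^sub>0" c B
    by (rule seq)
  have SJ: "S.J = J" by (rule J_sequence[OF seq])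
  then have SJ0: "0 < S.J" using cond4(4) by simp
  have hm: "\<theta>hat n \<in> borel_measurable (iid n obs_space)" for n
    using est by (simp add: cox_estimator_def)
  have "weak_conv_m (\<lambda>n. distr (S.N n) borel (\<lambda>x. sqrt n * (\<theta>hat n x - th n))) (density lborel (normal_density 0 (sqrt (1 / S.J))))"
  proof (rule S.weak_conv_of_linear[OF SJ0 S.estimator_linear[OF SJ0 th_lim' \<theta>\<^sub>0 est]])
    show "(\<lambda>x. sqrt n * (\<theta>hat n x - th n)) \<in> borel_measurable (iid n obs_space)" for n
      using hm[of n] by measurable
  qed
  moreover have eq: "\<forall>\<^sub>F n in sequentially. distr (S.N n) borel (\<lambda>x. sqrt n * (\<theta>hat n x - th n)) =
     distr (iid n (P (?th n) (?et n))) borel (\<lambda>x. sqrt n * (\<theta>hat n x - \<theta>\<^sub>0 - \<tau> / sqrt n))"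
    using th_eq et_eq by eventually_elim (simp add: diff_diff_eq)
  moreover have "(\<lambda>n. cdf (distr (iid n (P (?th n) (?et n))) borel (\<lambda>x. sqrt n * (\<theta>hat n x - \<theta>\<^sub>0 - \<tau> / sqrt n))) y) \<longlonglongrightarrow> z"
    if "(\<lambda>n. cdf (distr (S.N n) borel (\<lambda>x. sqrt n * (\<theta>hat n x - th n))) y) \<longlonglongrightarrow> z" for y z
  proof -
    have "\<forall>\<^sub>F n in sequentially. cdf (distr (S.N n) borel (\<lambda>x. sqrt n * (\<theta>hat n x - th n))) y =
      cdf (distr (iid n (P (?th n) (?et n))) borel (\<lambda>x. sqrt n * (\<theta>hat n x - \<theta>\<^sub>0 - \<tau> / sqrt n))) y"
      using eq by eventually_elim (simp only:)
    from tendsto_cong[OF this] that show ?thesis by (simp only:)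
  qed
  ultimately show ?thesis
    unfolding weak_conv_m_def weak_conv_def SJ by blast
qed

end

theorem mainTheorem3:
  fixes \<Theta> U\<theta> :: "real set" and U\<eta> :: "(real \<Rightarrow> real) set"
    and Q :: "real measure"
    and F :: "real \<Rightarrow> (real \<Rightarrow> real) \<Rightarrow> real \<Rightarrow> real measure"
    and G :: "real \<Rightarrow> real measure"
    and P :: "real \<Rightarrow> (real \<Rightarrow> real) \<Rightarrow> obs measure"
    and \<theta>\<^sub>0 :: real and \<eta>\<^sub>0 :: "real \<Rightarrow> real"
    and P\<^sub>0 :: "obs measure" and J :: real
    and \<theta>hat :: "nat \<Rightarrow> (nat \<Rightarrow> obs) \<Rightarrow> real"
  assumes model: "cox_ingredients \<Theta> Q F G"
    and P: "P = cox_law Q F G"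
    and P\<^sub>0: "P\<^sub>0 = P \<theta>\<^sub>0 \<eta>\<^sub>0"
    and J: "J = J_info P\<^sub>0 \<theta>\<^sub>0 \<eta>\<^sub>0"
    and \<theta>\<^sub>0: "\<theta>\<^sub>0 \<in> interior \<Theta>"
    and U\<theta>: "\<theta>\<^sub>0 \<in> interior U\<theta>" "U\<theta> \<subseteq> \<Theta>"
    and U\<eta>: "hazard_neighbourhood \<eta>\<^sub>0 U\<eta>"
    and cond1: "\<forall>\<^sub>F \<theta> in nhds \<theta>\<^sub>0. \<forall>k\<le>3. integrable Q (\<lambda>w. w ^ k * exp (\<theta> * w))"
      "\<exists>\<delta>>0. integrable Q (\<lambda>w. \<bar>w\<bar> powr (2 + \<delta>))"
    and cond2: "smooth_hazard \<eta>\<^sub>0"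
    and cond3: "S_uniformly_consistent P\<^sub>0 U\<theta> (\<lambda>k \<theta> t. s_fun (P \<theta> \<eta>\<^sub>0) k \<theta> t) \<or>
                S_uniformly_consistent P\<^sub>0 U\<theta> (\<lambda>k \<theta> t. s_fun P\<^sub>0 k \<theta> t)"
    and cond4: "\<forall>k\<le>3. continuous_uniformly_in_t U\<theta> U\<eta> (\<lambda>\<theta> \<eta> t. s_fun (P \<theta> \<eta>) k \<theta> t)"
      "\<forall>k\<le>3. \<exists>K. \<forall>\<theta>\<in>U\<theta>. \<forall>\<eta>\<in>U\<eta>. \<forall>t\<in>{0..1}. \<bar>s_fun (P \<theta> \<eta>) k \<theta> t\<bar> \<le> K"
      "\<exists>c>0. \<forall>\<theta>\<in>U\<theta>. \<forall>\<eta>\<in>U\<eta>. \<forall>t\<in>{0..1}. c \<le> s_fun (P \<theta> \<eta>) 0 \<theta> t"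
      "0 < J"
    and est: "cox_estimator \<Theta> \<theta>hat"
  shows "is_efficient_score P \<theta>\<^sub>0 \<eta>\<^sub>0 (cox_efficient_score P\<^sub>0 \<theta>\<^sub>0 \<eta>\<^sub>0)
    \<and> prob_space.variance P\<^sub>0 (cox_efficient_score P\<^sub>0 \<theta>\<^sub>0 \<eta>\<^sub>0) = J
    \<and> vanishes_in_prob (\<lambda>n. iid n P\<^sub>0)
        (\<lambda>n x. ereal \<bar>sqrt n * (\<theta>hat n x - \<theta>\<^sub>0)
                 - 1 / sqrt n * (\<Sum>i<n. 1 / J * cox_efficient_score P\<^sub>0 \<theta>\<^sub>0 \<eta>\<^sub>0 (x i))\<bar>)
    \<and> best_regular P \<theta>\<^sub>0 \<eta>\<^sub>0 \<theta>hat"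
proof -
  interpret M: cox_model \<Theta> U\<theta> U\<eta> Q F G P \<theta>\<^sub>0 \<eta>\<^sub>0 P\<^sub>0 J \<theta>hat
    by (rule cox_model.intro) fact+
  obtain K d c where "cox_law_efficient P\<^sub>0 \<theta>\<^sub>0 \<eta>\<^sub>0 K d c" by (rule M.efficient)
  then interpret E: cox_law_efficient P\<^sub>0 \<theta>\<^sub>0 \<eta>\<^sub>0 K d c .
  have "real_distribution (density lborel (normal_density 0 (sqrt (1 / J))))"
    using cond4(4) by (intro real_distribution_normal) simp
  then have "best_regular P \<theta>\<^sub>0 \<eta>\<^sub>0 \<theta>hat"
    unfolding best_regular_def regular_with_limit_def J[unfolded P\<^sub>0, symmetric]
    using M.estimator_weak_conv by blast
  then show ?thesis
    using E.is_efficient_score[of P, OF P\<^sub>0[symmetric]] E.variance_efficient_score M.estimator_asymptotically_linear J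
    by simp
qed

end
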